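(* Let $\theta=2$ (so $\alpha=\frac12$). There exists a unique solution $(u,m)$ to the planning problem (P), in the sense that $m$ is unique and $u_x$ is unique on the set $\{m>0\}$, such that all of the following hold: (i) $\frac{u}{1+|x|}\in L^\infty_{\mathrm{loc}}((0,T];\mathbb{R})$, i.e. for every $\delta\in(0,T)$ the function $\frac{u}{1+|x|}$ is bounded for $t\in[\delta,T)$, $x\in\mathbb{R}$; and $\int_{\mathbb{R}}m\,u_x^2\,dx\in L^1_{\mathrm{loc}}((0,T))$; (ii) for every $\delta\in(0,T)$ there is $C_\delta>0$ with $\|u_x(t,\cdot)\|_{L^\infty(\mathbb{R})}\le C_\delta t^{\alpha-1}$ for $t\in(0,T-\delta]$; (iii) for some $C>0$, $\|m(t)\|_{L^{\theta+1}(\mathbb{R})}^{\theta+1}\le Ct^{-\alpha\theta}$ and $\int_{\mathbb{R}}|x|^2m(t)\,dx\le C$ for $t\in(0,T]$; (iv) as $t\to0^+$, the probability densities $x\mapsto t^\alpha m(t,t^\alpha x)$ converge to $\phi$ in the Wasserstein distance $\mathbf{d}_1$.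
   Context: Let $T>0$, $\theta>0$, $\alpha=\frac{2}{2+\theta}\in(0,1)$, and $\phi(r)=\left(\frac12\alpha(1-\alpha)(R_\alpha^2-r^2)\right)_+^{1/\theta}$, where $R_\alpha>0$ is chosen such that $\int_{\mathbb{R}}\phi=1$. The terminal density $m_T:\mathbb{R}\to[0,\infty)$ is a probability density supported in an interval $[a,b]$, smooth in $(a,b)$, with $m_T^\theta\in C^{1,\sigma}(a,b)$ for some $\sigma>0$, and for some $C_0>1$ $$C_0^{-1}\,\mathrm{dist}(x,\{a,b\})^{1/\theta}\le m_T(x)\le C_0\,\mathrm{dist}(x,\{a,b\})^{1/\theta},\qquad x\in[a,b].$$ The planning problem (P) is $$-u_t+\tfrac12|u_x|^2=m^\theta,\qquad m_t-(mu_x)_x=0\quad\text{in }(0,T)\times\mathbb{R},\qquad m(0)=\delta_0,\quad m(T)=m_T.$$ A solution of (P) is a pair $(u,m)\in C^1((0,T)\times\mathbb{R})\times\big(C([0,T];\mathcal{P}(\mathbb{R}))\cap C((0,T)\times\mathbb{R})\big)$ ($\mathcal{P}(\mathbb{R})$: Borel probability measures with the weak topology) such that the first equation holds classically, the second in the distributional sense, and $m(0,\cdot)=\delta_0$, $m(T,\cdot)=m_T$. $\mathbf{d}_1$ is the 1-Wasserstein distance between probability measures on $\mathbb{R}$. *)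

theory Defs
  imports "HOL-Probability.Probability"
begin

text \<open>Classes of differentiable functions on an open set \<open>S\<close>.\<close>

primrec Ck_on :: "nat \<Rightarrow> ('a::real_normed_vector) set \<Rightarrow> ('a \<Rightarrow> real) \<Rightarrow> bool" where
  "Ck_on 0 S f \<longleftrightarrow> continuous_on S f"
| "Ck_on (Suc k) S f \<longleftrightarrow>
     (\<forall>x\<in>S. f differentiable (at x)) \<and>
     (\<forall>v. Ck_on k S (\<lambda>x. frechet_derivative f (at x) v))"

definition smooth_on :: "('a::real_normed_vector) set \<Rightarrow> ('a \<Rightarrow> real) \<Rightarrow> bool" where
  "smooth_on S f \<longleftrightarrow> (\<forall>k. Ck_on k S f)"

text \<open>Finiteness of the \<open>C\<^sup>1\<^sup>,\<^sup>\<sigma>\<close> norm; the Hoelder estimate is uniform on \<open>S\<close>,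
  not merely on compact subsets of \<open>S\<close>.\<close>

definition C1_holder_on :: "real \<Rightarrow> real set \<Rightarrow> (real \<Rightarrow> real) \<Rightarrow> bool" where
  "C1_holder_on \<sigma> S f \<longleftrightarrow>
     Ck_on 1 S f \<and> bounded (f ` S) \<and> bounded (deriv f ` S) \<and>
     (\<exists>L. \<forall>x\<in>S. \<forall>y\<in>S. \<bar>deriv f x - deriv f y\<bar> \<le> L * \<bar>x - y\<bar> powr \<sigma>)"

definition dt :: "(real \<Rightarrow> real \<Rightarrow> real) \<Rightarrow> real \<Rightarrow> real \<Rightarrow> real" where
  "dt f t x = deriv (\<lambda>s. f s x) t"

definition dx :: "(real \<Rightarrow> real \<Rightarrow> real) \<Rightarrow> real \<Rightarrow> real \<Rightarrow> real" where
  "dx f t x = deriv (f t) x"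

text \<open>Continuity of a curve of measures for the weak topology, i.e. the coarsest topology making
  integration against each bounded continuous function continuous.\<close>

definition weakly_continuous_on :: "real set \<Rightarrow> (real \<Rightarrow> real measure) \<Rightarrow> bool" where
  "weakly_continuous_on I \<mu> \<longleftrightarrow>
     (\<forall>f. continuous_on UNIV f \<and> bounded (range f) \<longrightarrow>
        continuous_on I (\<lambda>t. integral\<^sup>L (\<mu> t) (f :: real \<Rightarrow> real)))"

definition couplings :: "real measure \<Rightarrow> real measure \<Rightarrow> (real \<times> real) measure set" where
  "couplings \<mu> \<nu> =
     {\<gamma>. sets \<gamma> = sets borel \<and> distr \<gamma> borel fst = \<mu> \<and> distr \<gamma> borel snd = \<nu>}"

definition wasserstein1 :: "real measure \<Rightarrow> real measure \<Rightarrow> ennreal" where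
  "wasserstein1 \<mu> \<nu> = (INF \<gamma>\<in>couplings \<mu> \<nu>. \<integral>\<^sup>+ p. ennreal \<bar>fst p - snd p\<bar> \<partial>\<gamma>)"

definition alpha :: "real \<Rightarrow> real" where
  "alpha \<theta> = 2 / (2 + \<theta>)"

definition phi :: "real \<Rightarrow> real \<Rightarrow> real \<Rightarrow> real" where
  "phi \<theta> R r = (max 0 (1/2 * alpha \<theta> * (1 - alpha \<theta>) * (R\<^sup>2 - r\<^sup>2))) powr (1 / \<theta>)"

text \<open>The equation \<open>m\<^sub>t - (m u\<^sub>x)\<^sub>x = 0\<close> in the sense of distributions on \<open>(0,T) \<times> \<real>\<close>.\<close>

definition continuity_eq :: "real \<Rightarrow> (real \<Rightarrow> real \<Rightarrow> real) \<Rightarrow> (real \<Rightarrow> real \<Rightarrow> real) \<Rightarrow> bool" where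
  "continuity_eq T u m \<longleftrightarrow>
     (\<forall>\<psi> :: real \<Rightarrow> real \<Rightarrow> real.
        smooth_on UNIV (\<lambda>(t, x). \<psi> t x) \<and>
        (\<exists>K. compact K \<and> K \<subseteq> {0<..<T} \<times> UNIV \<and> (\<forall>t x. (t, x) \<notin> K \<longrightarrow> \<psi> t x = 0)) \<longrightarrow>
        (LINT (t, x) : {0<..<T} \<times> UNIV | lborel.
           - m t x * dt \<psi> t x + m t x * dx u t x * dx \<psi> t x) = 0)"

text \<open>The unknown density is represented twice: \<open>\<mu>\<close> is the curve of probability measures on
  \<open>[0,T]\<close>, and \<open>m t\<close> is the density of \<open>\<mu> t\<close> for \<open>0 < t \<le> T\<close> (at \<open>t = 0\<close> there is none).
  Values of \<open>\<mu>\<close>, \<open>m\<close> and \<open>u\<close> at other times are irrelevant.\<close>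

definition planning_solution ::
  "real \<Rightarrow> real \<Rightarrow> (real \<Rightarrow> real) \<Rightarrow>
   (real \<Rightarrow> real \<Rightarrow> real) \<Rightarrow> (real \<Rightarrow> real measure) \<Rightarrow> (real \<Rightarrow> real \<Rightarrow> real) \<Rightarrow> bool" where
  "planning_solution \<theta> T mT u \<mu> m \<longleftrightarrow>
     Ck_on 1 ({0<..<T} \<times> UNIV) (\<lambda>(t, x). u t x) \<and>
     (\<forall>t\<in>{0..T}. real_distribution (\<mu> t)) \<and>
     weakly_continuous_on {0..T} \<mu> \<and>
     (\<forall>t\<in>{0<..T}. m t \<in> borel_measurable borel \<and> (\<forall>x. 0 \<le> m t x) \<and>
        \<mu> t = density lborel (\<lambda>x. ennreal (m t x))) \<and>
     continuous_on ({0<..<T} \<times> UNIV) (\<lambda>(t, x). m t x) \<and>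
     (\<forall>t\<in>{0<..<T}. \<forall>x. - dt u t x + 1/2 * (dx u t x)\<^sup>2 = m t x powr \<theta>) \<and>
     continuity_eq T u m \<and>
     \<mu> 0 = return borel 0 \<and>
     \<mu> T = density lborel (\<lambda>x. ennreal (mT x))"

definition u_growth :: "real \<Rightarrow> (real \<Rightarrow> real \<Rightarrow> real) \<Rightarrow> bool" where
  "u_growth T u \<longleftrightarrow>
     (\<forall>\<delta>\<in>{0<..<T}. \<exists>K. \<forall>t\<in>{\<delta>..<T}. \<forall>x. \<bar>u t x / (1 + \<bar>x\<bar>)\<bar> \<le> K)"

definition energy_L1_loc :: "real \<Rightarrow> (real \<Rightarrow> real \<Rightarrow> real) \<Rightarrow> (real \<Rightarrow> real \<Rightarrow> real) \<Rightarrow> bool" where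
  "energy_L1_loc T u m \<longleftrightarrow>
     (\<forall>s r. 0 < s \<and> s \<le> r \<and> r < T \<longrightarrow>
        (\<integral>\<^sup>+ t\<in>{s..r}. (\<integral>\<^sup>+ x. ennreal (m t x * (dx u t x)\<^sup>2) \<partial>lborel) \<partial>lborel) < \<infinity>)"

definition ux_bound :: "real \<Rightarrow> real \<Rightarrow> (real \<Rightarrow> real \<Rightarrow> real) \<Rightarrow> bool" where
  "ux_bound \<theta> T u \<longleftrightarrow>
     (\<forall>\<delta>\<in>{0<..<T}. \<exists>C>0. \<forall>t\<in>{0<..T - \<delta>}.
        esssup lborel (\<lambda>x. ereal \<bar>dx u t x\<bar>) \<le> ereal (C * t powr (alpha \<theta> - 1)))"

definition m_bounds :: "real \<Rightarrow> real \<Rightarrow> (real \<Rightarrow> real \<Rightarrow> real) \<Rightarrow> bool" where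
  "m_bounds \<theta> T m \<longleftrightarrow>
     (\<exists>C>0. \<forall>t\<in>{0<..T}.
        (\<integral>\<^sup>+ x. ennreal (\<bar>m t x\<bar> powr (\<theta> + 1)) \<partial>lborel) \<le> ennreal (C * t powr (- alpha \<theta> * \<theta>)) \<and>
        (\<integral>\<^sup>+ x. ennreal (\<bar>x\<bar>\<^sup>2 * m t x) \<partial>lborel) \<le> ennreal C)"

definition self_similar_limit :: "real \<Rightarrow> real \<Rightarrow> (real \<Rightarrow> real \<Rightarrow> real) \<Rightarrow> bool" where
  "self_similar_limit \<theta> R m \<longleftrightarrow>
     ((\<lambda>t. wasserstein1
             (density lborel (\<lambda>x. ennreal (t powr alpha \<theta> * m t (t powr alpha \<theta> * x))))
             (density lborel (\<lambda>x. ennreal (phi \<theta> R x)))) \<longlongrightarrow> 0) (at_right 0)"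

definition admissible_solution ::
  "real \<Rightarrow> real \<Rightarrow> real \<Rightarrow> (real \<Rightarrow> real) \<Rightarrow>
   (real \<Rightarrow> real \<Rightarrow> real) \<Rightarrow> (real \<Rightarrow> real measure) \<Rightarrow> (real \<Rightarrow> real \<Rightarrow> real) \<Rightarrow> bool" where
  "admissible_solution \<theta> T R mT u \<mu> m \<longleftrightarrow>
     planning_solution \<theta> T mT u \<mu> m \<and>
     u_growth T u \<and> energy_L1_loc T u m \<and>
     ux_bound \<theta> T u \<and>
     m_bounds \<theta> T m \<and>
     self_similar_limit \<theta> R m"

end

theory Submission
  imports Defs "HOL-Complex_Analysis.Complex_Analysis"
begin

text \<open>For \<open>\<theta> = 2\<close> put \<open>w = - u\<^sub>x + i sqrt 2 m\<close>: the two equations say that \<open>w\<close> solves the complex Burgers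
  equation \<open>w\<^sub>t + w w\<^sub>x = 0\<close>. Hence \<open>w\<close> is constant along the characteristics
  \<open>x = z - (T - t) W z\<close>, where \<open>W z = z / T - kap G z\<close> with the Cauchy transform \<open>G\<close> of the terminal
  density: then \<open>Im W = sqrt 2 m\<^sub>T\<close> on the real line, and at time \<open>0\<close> all characteristics issue from
  \<open>z = \<infinity>\<close> and meet at \<open>x = 0\<close>. Where \<open>m > 0\<close> the foot \<open>z\<close> lies in the upper half plane; elsewhere it
  is real, and it is frozen at an end point of the support as soon as the characteristics from the
  exterior are exhausted. Real and imaginary part of the potential of \<open>w\<close> give \<open>u\<close> and the
  distribution function of \<open>m\<close>.

  Uniqueness is the Lasry--Lions argument: the integral of \<open>(u - u') (m - m')\<close> is decreasing in time, and
  it vanishes in the limit at both ends. At \<open>0\<close> this follows from the self-similar profile. At \<open>T\<close> the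
  function \<open>u'\<close> is not known to have a trace, and one compares it along paths through the
  Hamilton--Jacobi inequality.\<close>

text \<open>The system is elliptic where \<open>m > 0\<close>, so there are no real characteristics
  to follow. The complexified foot map is the subordination map of free probability:
  \<open>X t z = (t/T) (z + k G z)\<close> with \<open>k = 1 / thr t\<close>. For
  \<open>0 < t < T\<close> the density is that of \<open>(t/T) Y + S\<close>, where \<open>Y\<close>
  has the terminal law and \<open>S\<close> is a free semicircular variable of variance
  \<open>kap t (T - t) / T\<close>. This is a free Brownian bridge, and its small-time profile is a
  semicircle, the shape of \<open>phi\<close> for exponent 2.

  The obstacle is regularity at the free boundary. At the edge of \<open>{m > 0}\<close> the map
  \<open>X t\<close> has a critical point, and at a frozen foot \<open>G\<close> is merely
  continuous. The potential is C1 there not because the foot is differentiable, but because the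
  potential is stationary in the foot: a vanishing change of the foot times an error of the order of
  the displacement is negligible.

  Square-root behaviour of the terminal density keeps \<open>G\<close> bounded up to the support,
  hence \<open>u_x\<close> and \<open>m\<close> bounded near \<open>T\<close>. An arbitrary solution
  is compared with this explicit one, whose regularity compensates for the missing trace of the
  other.\<close>

abbreviation (input) LIMSEQ_ascii (infixr "---->" 60) where "X ----> L \<equiv> X \<longlonglongrightarrow> L"
notation (input) tendsto (infixr "--->" 55)
abbreviation ldens :: "(real \<Rightarrow> real) \<Rightarrow> real measure" where "ldens f \<equiv> density lborel (\<lambda>x. ennreal (f x))"

lemmas hk_add = Henstock_Kurzweil_Integration.integral_add
lemmas hk_combine = Henstock_Kurzweil_Integration.integral_combine
lemmas hk_diff = Henstock_Kurzweil_Integration.integral_diff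
lemmas hk_nonneg = Henstock_Kurzweil_Integration.integral_nonneg
lemmas hk_reflect_real = Henstock_Kurzweil_Integration.integral_reflect_real

section \<open>A duality identity for pairs of functions on a strip\<close>

text \<open>The partial derivatives are arguments and not \<open>deriv\<close> terms, so that a
  potential with prescribed derivatives, such as \<open>n_t = m u_x\<close> and
  \<open>n_x = m\<close>, is a single hypothesis.\<close>

definition C1_strip ::
 "real set => (real => real => real) => (real => real => real) => (real => real => real) => bool" where
 "C1_strip I f ft fx \<longleftrightarrow>
   (\<forall>t\<in>I. \<forall>x. ((%s. f s x) has_real_derivative ft t x) (at t) \<and>
        (f t has_real_derivative fx t x) (at x)) \<and>
   continuous_on (I \<times> UNIV) (%(t, x). f t x) \<and>
   continuous_on (I \<times> UNIV) (%(t, x). ft t x) \<and>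
   continuous_on (I \<times> UNIV) (%(t, x). fx t x)"

lemma C1_stripD:
 assumes "C1_strip I f ft fx"
 shows "!!t x. t \<in> I ==> ((%s. f s x) has_real_derivative ft t x) (at t)"
  and "!!t x. t \<in> I ==> (f t has_real_derivative fx t x) (at x)"
  and "continuous_on (I \<times> UNIV) (%(t, x). f t x)"
  and "continuous_on (I \<times> UNIV) (%(t, x). ft t x)"
  and "continuous_on (I \<times> UNIV) (%(t, x). fx t x)"
 using assms by (auto simp: C1_strip_def)

lemma C1_strip_diff:
 assumes "C1_strip I f ft fx" "C1_strip I g gt gx"
 shows "C1_strip I (%t x. f t x - g t x) (%t x. ft t x - gt t x) (%t x. fx t x - gx t x)"
proof -
 note A = C1_stripD[OF assms(1)] and B = C1_stripD[OF assms(2)]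
 show ?thesis
  unfolding C1_strip_def using A(1,2) B(1,2)
   continuous_on_diff[OF A(3) B(3)] continuous_on_diff[OF A(4) B(4)] continuous_on_diff[OF A(5) B(5)]
  by (auto intro!: derivative_intros simp: split_beta)
qed

lemma continuous_on_fixed_time:
 assumes "continuous_on (I \<times> UNIV) (%(t, x). f t x)" "t \<in> I"
 shows "continuous_on A (f t)"
proof -
 have "continuous_on A (%x. (%(t, x). f t x) (t, x))"
  using assms(2) by (intro continuous_on_compose2[OF assms(1)] continuous_intros) auto
 then show ?thesis by simp
qed

lemma continuous_on_fixed_space:
 assumes "continuous_on (I \<times> UNIV) (%(t, x). f t x)" "J \<subseteq> I"
 shows "continuous_on J (%t. f t x)"
proof -
 have "continuous_on J (%t. (%(t, x). f t x) (t, x))"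
  using assms(2) by (intro continuous_on_compose2[OF assms(1)] continuous_intros) auto
 then show ?thesis by simp
qed

lemma uniform_limit_strip:
 fixes f :: "real => real => real"
 assumes "continuous_on (I \<times> UNIV) (%(t, x). f t x)" "{s..t} \<subseteq> I" "ta \<in> {s..t}"
 shows "uniform_limit {p..q} f (f ta) (at ta within {s..t})"
proof (rule uniform_limitI)
 fix e :: real assume "e > 0"
 have "uniformly_continuous_on ({s..t} \<times> {p..q}) (%(t, x). f t x)"
  using assms(2) by (intro compact_uniformly_continuous continuous_on_subset[OF assms(1)] compact_Times) auto
 then obtain d where d: "d > 0"
  "!!u v. u \<in> {s..t} \<times> {p..q} ==> v \<in> {s..t} \<times> {p..q} ==> dist v u < d ==>
    dist ((%(t, x). f t x) v) ((%(t, x). f t x) u) < e"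
  using \<open>e > 0\<close> unfolding uniformly_continuous_on_def by metis
 have "\<forall>\<^sub>F y in at ta within {s..t}. y \<in> {s..t} \<and> dist y ta < d"
  using d(1) unfolding eventually_at by auto
 then show "\<forall>\<^sub>F y in at ta within {s..t}. \<forall>x\<in>{p..q}. dist (f y x) (f ta x) < e"
 proof eventually_elim
  case (elim y)
  show ?case
  proof
   fix x assume "x \<in> {p..q}"
   then show "dist (f y x) (f ta x) < e"
    using d(2)[of "(ta, x)" "(y, x)"] assms(3) elim by (auto simp: dist_Pair_Pair)
  qed
 qed
qed

text \<open>By the mean value theorem each quotient is a value of \<open>ft\<close> at an
  intermediate time; uniform continuity of \<open>ft\<close> on the compact rectangle brings it
  close to \<open>ft ta\<close> for all \<open>x\<close> at once.\<close>

lemma uniform_limit_difference_quotient: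
 fixes f :: "real => real => real"
 assumes C: "C1_strip I f ft fx" and "{s..t} \<subseteq> I" "ta \<in> {s..t}"
 shows "uniform_limit {p..q} (%y x. (f y x - f ta x) / (y - ta)) (ft ta) (at ta within {s..t})"
proof (rule uniform_limitI)
 fix e :: real assume "e > 0"
 have "uniformly_continuous_on ({s..t} \<times> {p..q}) (%(t, x). ft t x)"
  using assms(2) by (intro compact_uniformly_continuous continuous_on_subset[OF C1_stripD(4)[OF C]] compact_Times) auto
 then obtain d where d: "d > 0"
  "!!u v. u \<in> {s..t} \<times> {p..q} ==> v \<in> {s..t} \<times> {p..q} ==> dist v u < d ==>
    dist ((%(t, x). ft t x) v) ((%(t, x). ft t x) u) < e"
  using \<open>e > 0\<close> unfolding uniformly_continuous_on_def by metis
 have "\<forall>\<^sub>F y in at ta within {s..t}. y \<in> {s..t} \<and> dist y ta < d \<and> y \<noteq> ta"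
  using d(1) unfolding eventually_at by auto
 then show "\<forall>\<^sub>F y in at ta within {s..t}. \<forall>x\<in>{p..q}. dist ((f y x - f ta x) / (y - ta)) (ft ta x) < e"
 proof eventually_elim
  case (elim y)
  show ?case
  proof
   fix x assume x: "x \<in> {p..q}"
   define l where "l = min y ta"
   define r where "r = max y ta"
   have lr: "l < r" "{l..r} \<subseteq> {s..t}" using elim assms(3) by (auto simp: l_def r_def)
   have "!!u. l <= u ==> u <= r ==> ((%s. f s x) has_real_derivative ft u x) (at u)"
    using lr(2) assms(2) by (intro C1_stripD(1)[OF C]) auto
   from MVT2[OF lr(1) this] obtain z where z: "l < z" "z < r" "f r x - f l x = (r - l) * ft z x" by auto
   have "(f y x - f ta x) / (y - ta) = (f r x - f l x) / (r - l)"
    by (auto simp: l_def r_def min_def max_def) (metis minus_diff_eq minus_divide_divide)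
   also have "... = ft z x" using z lr(1) by simp
   finally have eq: "(f y x - f ta x) / (y - ta) = ft z x" .
   have "z \<in> {s..t}" using z lr(2) by auto
   moreover have "dist z ta < d" using z elim by (auto simp: l_def r_def dist_real_def)
   ultimately show "dist ((f y x - f ta x) / (y - ta)) (ft ta x) < e"
    using d(2)[of "(ta, x)" "(z, x)"] assms(3) x eq by (auto simp: dist_Pair_Pair)
  qed
 qed
qed

lemma tendsto_integral_uniform_limit:
 fixes f :: "'a => real => 'c::banach"
 assumes u: "uniform_limit {a..b} f g F" and c: "\<forall>\<^sub>F n in F. continuous_on {a..b} (f n)" and F: "F \<noteq> bot"
 shows "((%n. integral {a..b} (f n)) ---> integral {a..b} g) F"
proof -
 have g: "continuous_on {a..b} g"
  by (rule uniform_limit_theorem[OF c u F])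
 \<comment> \<open>Members that fail to be continuous are replaced by the limit. Eventually nothing
   changes, and now every member is integrable.\<close>
 define f' where "f' n = (if continuous_on {a..b} (f n) then f n else g)" for n
 have ev: "\<forall>\<^sub>F n in F. f' n = f n" using c by eventually_elim (simp add: f'_def)
 have u': "uniform_limit {a..b} f' g F"
  by (rule uniform_limit_cong[THEN iffD2, OF _ _ u]) (use ev in eventually_elim, auto)
 obtain I J where "!!n. (f' n has_integral I n) {a..b}" "(g has_integral J) {a..b}" "(I ---> J) F"
  by (rule uniform_limit_integral[OF u' _ F]) (auto simp: f'_def g)
 then have "((%n. integral {a..b} (f' n)) ---> integral {a..b} g) F"
  by (metis (mono_tags, lifting) integral_unique tendsto_cong eventuallyI)
 then show ?thesis
  by (rule Lim_transform_eventually) (use ev in eventually_elim, auto)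
qed

lemma integral_by_parts_real:
 fixes f g :: "real => real"
 assumes "p <= q" "!!x. x \<in> {p..q} ==> (f has_real_derivative f' x) (at x)"
  "!!x. x \<in> {p..q} ==> (g has_real_derivative g' x) (at x)"
  "continuous_on {p..q} f'" "continuous_on {p..q} g'"
 shows "integral {p..q} (%x. f x * g' x) = f q * g q - f p * g p - integral {p..q} (%x. f' x * g x)"
proof -
 have cf: "continuous_on {p..q} f" "continuous_on {p..q} g"
  using assms(2,3) by (meson DERIV_isCont continuous_at_imp_continuous_on)+
 have "((%x. f x * g' x + f' x * g x) has_integral (f q * g q - f p * g p)) {p..q}"
 proof (intro fundamental_theorem_of_calculus assms(1))
  fix x assume x: "x \<in> {p..q}"
  have "((%x. f x * g x) has_real_derivative f x * g' x + f' x * g x) (at x)"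
   by (rule DERIV_cong[OF DERIV_mult[OF assms(2)[OF x] assms(3)[OF x]]]) simp
  then show "((%x. f x * g x) has_vector_derivative f x * g' x + f' x * g x) (at x within {p..q})"
   by (simp add: has_real_derivative_iff_has_vector_derivative has_vector_derivative_at_within)
 qed
 from integral_unique[OF this] show ?thesis
  using cf assms by (subst (asm) integral_add) (auto intro!: integrable_continuous_interval continuous_intros)
qed

text \<open>Only the time difference of \<open>w\<close> and of \<open>n\<close> is ever taken: the one of \<open>nx\<close>, which need not be
 differentiable in time, is integrated by parts in space.\<close>

lemma has_derivative_pairing:
 assumes W: "C1_strip I w wt wx" and N: "C1_strip I n nt nx"
  and st: "{s..t} \<subseteq> I" "ta \<in> {s..t}" "s < t" and pq: "p <= q"
 shows "((%t. integral {p..q} (%x. w t x * nx t x)) has_real_derivative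
   integral {p..q} (%x. wt ta x * nx ta x - wx ta x * nt ta x) + w ta q * nt ta q - w ta p * nt ta p)
   (at ta within {s..t})"
proof -
 let ?F = "at ta within {s..t}"
 note Wd = C1_stripD[OF W] and Nd = C1_stripD[OF N]
 have tI: "ta \<in> I" using st by auto
 have cW: "!!r A. r \<in> I ==> continuous_on A (w r)" "!!r A. r \<in> I ==> continuous_on A (wt r)"
  "!!r A. r \<in> I ==> continuous_on A (wx r)"
  using continuous_on_fixed_time[OF Wd(3)] continuous_on_fixed_time[OF Wd(4)] continuous_on_fixed_time[OF Wd(5)] by auto
 have cN: "!!r A. r \<in> I ==> continuous_on A (n r)" "!!r A. r \<in> I ==> continuous_on A (nt r)"
  "!!r A. r \<in> I ==> continuous_on A (nx r)"
  using continuous_on_fixed_time[OF Nd(3)] continuous_on_fixed_time[OF Nd(4)] continuous_on_fixed_time[OF Nd(5)] by auto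
 have F: "?F \<noteq> bot" using st by (simp add: trivial_limit_within islimpt_Icc)
 have evI: "\<forall>\<^sub>F y in ?F. y \<in> {s..t} \<and> y \<noteq> ta"
  by (auto simp: eventually_at intro!: exI[of _ 1])
 have bd: "continuous_on {p..q} h ==> bounded (h ` {p..q})" for h :: "real => real"
  by (intro compact_imp_bounded compact_continuous_image) auto
 have 1: "((%y. integral {p..q} (%x. (w y x - w ta x) / (y - ta) * nx y x)) --->
   integral {p..q} (%x. wt ta x * nx ta x)) ?F"
 proof (rule tendsto_integral_uniform_limit[OF _ _ F])
  show "uniform_limit {p..q} (%y x. (w y x - w ta x) / (y - ta) * nx y x) (%x. wt ta x * nx ta x) ?F"
   by (intro uniform_lim_mult uniform_limit_difference_quotient[OF W] uniform_limit_strip[OF Nd(5)] st bd cW cN tI)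
  show "\<forall>\<^sub>F y in ?F. continuous_on {p..q} (%x. (w y x - w ta x) / (y - ta) * nx y x)"
   using evI
  proof eventually_elim
   case (elim y) then have "y \<in> I" using st by auto
   then show ?case using elim tI by (intro continuous_intros cW cN) auto
  qed
 qed
 have 2: "((%y. integral {p..q} (%x. wx ta x * ((n y x - n ta x) / (y - ta)))) --->
   integral {p..q} (%x. wx ta x * nt ta x)) ?F"
 proof (rule tendsto_integral_uniform_limit[OF _ _ F])
  show "uniform_limit {p..q} (%y x. wx ta x * ((n y x - n ta x) / (y - ta))) (%x. wx ta x * nt ta x) ?F"
   by (intro uniform_lim_mult uniform_limit_difference_quotient[OF N] uniform_limit_const st bd cW cN tI)
  show "\<forall>\<^sub>F y in ?F. continuous_on {p..q} (%x. wx ta x * ((n y x - n ta x) / (y - ta)))"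
   using evI
  proof eventually_elim
   case (elim y) then have "y \<in> I" using st by auto
   then show ?case using elim tI by (intro continuous_intros cW cN) auto
  qed
 qed
 have 3: "((%y. (n y x - n ta x) / (y - ta)) ---> nt ta x) ?F" for x
  using has_field_derivative_at_within[OF Nd(1)[OF tI, of x]] by (simp add: has_field_derivative_iff)
 have lim: "((%y. integral {p..q} (%x. (w y x - w ta x) / (y - ta) * nx y x)
    + w ta q * ((n y q - n ta q) / (y - ta)) - w ta p * ((n y p - n ta p) / (y - ta))
    - integral {p..q} (%x. wx ta x * ((n y x - n ta x) / (y - ta)))) --->
   integral {p..q} (%x. wt ta x * nx ta x) + w ta q * nt ta q - w ta p * nt ta p
    - integral {p..q} (%x. wx ta x * nt ta x)) ?F"
  by (intro tendsto_intros 1 2 3)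
 have eqD: "integral {p..q} (%x. wt ta x * nx ta x) + w ta q * nt ta q - w ta p * nt ta p
    - integral {p..q} (%x. wx ta x * nt ta x) =
   integral {p..q} (%x. wt ta x * nx ta x - wx ta x * nt ta x) + w ta q * nt ta q - w ta p * nt ta p"
  by (subst integral_diff) (auto intro!: integrable_continuous_interval continuous_intros cW cN tI)
 have ev: "\<forall>\<^sub>F y in ?F. integral {p..q} (%x. (w y x - w ta x) / (y - ta) * nx y x)
    + w ta q * ((n y q - n ta q) / (y - ta)) - w ta p * ((n y p - n ta p) / (y - ta))
    - integral {p..q} (%x. wx ta x * ((n y x - n ta x) / (y - ta)))
   = (integral {p..q} (%x. w y x * nx y x) - integral {p..q} (%x. w ta x * nx ta x)) / (y - ta)"
  using evI
 proof eventually_elim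
  case (elim y)
  then have yI: "y \<in> I" using st by auto
  define h where "h = y - ta"
  have h: "h \<noteq> 0" using elim by (simp add: h_def)
  have ib: "integral {p..q} (%x. w ta x * ((nx y x - nx ta x) / h)) =
    w ta q * ((n y q - n ta q) / h) - w ta p * ((n y p - n ta p) / h)
    - integral {p..q} (%x. wx ta x * ((n y x - n ta x) / h))"
   using pq by (intro integral_by_parts_real)
    (auto intro!: derivative_eq_intros Wd(2) Nd(2) tI yI continuous_intros cW cN simp: h)
  have "integral {p..q} (%x. (w y x - w ta x) / h * nx y x)
    + integral {p..q} (%x. w ta x * ((nx y x - nx ta x) / h))
   = integral {p..q} (%x. (w y x - w ta x) / h * nx y x + w ta x * ((nx y x - nx ta x) / h))"
   by (subst integral_add) (auto intro!: integrable_continuous_interval continuous_intros cW cN tI yI simp: h)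
  also have "... = integral {p..q} (%x. (w y x * nx y x - w ta x * nx ta x) / h)"
   by (intro integral_cong) (auto simp: h field_simps)
  also have "... = (integral {p..q} (%x. w y x * nx y x) - integral {p..q} (%x. w ta x * nx ta x)) / h"
   by (subst integral_diff[symmetric])
    (auto intro!: integrable_continuous_interval continuous_intros cW cN tI yI simp: h)
  finally show ?case using ib by (simp add: h_def)
 qed
 show ?thesis
  unfolding has_field_derivative_iff
  using Lim_transform_eventually[OF lim ev] unfolding eqD .
qed

text \<open>Serves in several roles: with \<open>w\<close> a difference of value functions and
  \<open>nx\<close> a difference of densities it gives the monotonicity behind uniqueness; with
  \<open>w\<close> a test function and \<open>n\<close> a stream function it gives the weak
  continuity equation.\<close>

lemma pairing_identity:
 assumes W: "C1_strip I w wt wx" and N: "C1_strip I n nt nx"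
  and st: "{s..t} \<subseteq> I" "s <= t" and pq: "p <= q"
 shows "integral {s..t} (%ta. integral {p..q} (%x. wt ta x * nx ta x - wx ta x * nt ta x)
      + w ta q * nt ta q - w ta p * nt ta p)
   = integral {p..q} (%x. w t x * nx t x) - integral {p..q} (%x. w s x * nx s x)"
proof (cases "s = t")
 case False
 with st have "s < t" by auto
 then show ?thesis
  using has_derivative_pairing[OF W N st(1) _ _ pq]
  by (intro integral_unique fundamental_theorem_of_calculus)
   (auto simp: has_real_derivative_iff_has_vector_derivative[symmetric])
qed auto

section \<open>Test functions and the distributional continuity equation\<close>

text \<open>Smoothness in one real variable by chains of derivatives. Only products of two such
  functions serve as test functions, so the Frechet derivatives in \<open>Ck_on\<close> are met
  once, in \<open>Ck_on_tensor\<close>.\<close>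

primrec times_differentiable :: "nat => (real => real) => bool" where
 "times_differentiable 0 f \<longleftrightarrow> True"
| "times_differentiable (Suc k) f \<longleftrightarrow>
   (\<exists>f'. (\<forall>x. (f has_real_derivative f' x) (at x)) \<and> times_differentiable k f')"

definition smooth_real :: "(real => real) => bool" where
 "smooth_real f \<longleftrightarrow> (\<forall>k. times_differentiable k f)"

lemma times_differentiable_Suc_imp: "times_differentiable (Suc k) f ==> times_differentiable k f"
 by (induction k arbitrary: f) auto

lemma times_differentiable_add:
 "times_differentiable k f ==> times_differentiable k g ==> times_differentiable k (%x. f x + g x)"
proof (induction k arbitrary: f g)
 case (Suc k)
 then obtain f' g' where "!!x. (f has_real_derivative f' x) (at x)" "times_differentiable k f'"
  "!!x. (g has_real_derivative g' x) (at x)" "times_differentiable k g'" by auto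
 then show ?case using Suc.IH[of f' g'] by (auto intro!: exI[of _ "%x. f' x + g' x"] derivative_intros)
qed auto

lemma times_differentiable_mult:
 "times_differentiable k f ==> times_differentiable k g ==> times_differentiable k (%x. f x * g x)"
proof (induction k arbitrary: f g)
 case (Suc k)
 then obtain f' g' where fg: "!!x. (f has_real_derivative f' x) (at x)" "times_differentiable k f'"
  "!!x. (g has_real_derivative g' x) (at x)" "times_differentiable k g'" by auto
 have "times_differentiable k f" "times_differentiable k g"
  using Suc.prems by (blast intro: times_differentiable_Suc_imp)+
 then have "times_differentiable k (%x. f' x * g x + g' x * f x)"
  using fg by (intro times_differentiable_add Suc.IH)
 then show ?case using fg
  by (auto intro!: exI[of _ "%x. f' x * g x + g' x * f x"] DERIV_mult)
qed auto

lemma times_differentiable_compose_affine: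
 "times_differentiable k f ==> times_differentiable k (%x. c * f (a * x + b))"
proof (induction k arbitrary: f c)
 case (Suc k)
 then obtain f' where f': "!!x. (f has_real_derivative f' x) (at x)" "times_differentiable k f'" by auto
 have "((%x. c * f (a * x + b)) has_real_derivative (c * a) * f' (a * x + b)) (at x)" for x
  by (rule DERIV_cong[OF DERIV_cmult[OF DERIV_chain2[OF f'(1)]]])
   (auto intro!: derivative_eq_intros)
 then show ?case
  using Suc.IH[OF f'(2), of "c * a"] by (auto intro!: exI[of _ "%x. c * a * f' (a * x + b)"])
qed auto

lemma smooth_real_derivative:
 assumes "smooth_real f" "!!x. (f has_real_derivative f' x) (at x)"
 shows "smooth_real f'"
 unfolding smooth_real_def
proof
 fix k
 have "times_differentiable (Suc k) f" using assms(1) by (auto simp: smooth_real_def)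
 then obtain f'' where "!!x. (f has_real_derivative f'' x) (at x)" "times_differentiable k f''" by auto
 moreover from this(1) assms(2) have "f'' = f'" by (intro ext DERIV_unique)
 ultimately show "times_differentiable k f'" by simp
qed

lemma smooth_real_antiderivative:
 assumes "smooth_real f'" "!!x. (f has_real_derivative f' x) (at x)"
 shows "smooth_real f"
 unfolding smooth_real_def
proof
 fix k show "times_differentiable k f"
  using assms by (cases k) (auto simp: smooth_real_def)
qed

lemma smooth_real_has_derivative:
 assumes "smooth_real f" shows "(f has_real_derivative deriv f x) (at x)"
proof -
 have "times_differentiable (Suc 0) f" using assms unfolding smooth_real_def by blast
 then obtain f' where "!!x. (f has_real_derivative f' x) (at x)" by auto
 then show ?thesis by (metis DERIV_imp_deriv)
qed

lemma smooth_real_continuous: "smooth_real f ==> continuous_on A f"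
 using smooth_real_has_derivative by (meson DERIV_isCont continuous_at_imp_continuous_on)

section \<open>Products of smooth functions of one variable as test functions\<close>

lemma Ck_on_add: "Ck_on k UNIV f ==> Ck_on k UNIV g ==> Ck_on k UNIV (%x. f x + g x)"
proof (induction k arbitrary: f g)
 case (Suc k)
 have "frechet_derivative (%x. f x + g x) (at x) v =
   frechet_derivative f (at x) v + frechet_derivative g (at x) v" for x v
 proof -
  have "(f has_derivative frechet_derivative f (at x)) (at x)" "(g has_derivative frechet_derivative g (at x)) (at x)"
   using Suc.prems by (auto simp: frechet_derivative_works[symmetric])
  from has_derivative_add[OF this] show ?thesis by (subst frechet_derivative_at[symmetric]) auto
 qed
 then show ?case using Suc by (auto intro!: derivative_intros)
qed (auto intro!: continuous_intros)

lemma Ck_on_cmult: "Ck_on k UNIV f ==> Ck_on k UNIV (%x. c * f x)"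
proof (induction k arbitrary: f)
 case (Suc k)
 have "frechet_derivative (%x. c * f x) (at x) v = c * frechet_derivative f (at x) v" for x v
 proof -
  have "f differentiable (at x)" using Suc.prems by simp
  then have "(f has_derivative frechet_derivative f (at x)) (at x)" by (simp add: frechet_derivative_works)
  then have "((%x. c * f x) has_derivative (%v. c * frechet_derivative f (at x) v)) (at x)"
   by (rule has_derivative_mult_right)
  then show ?thesis by (subst frechet_derivative_at[symmetric]) auto
 qed
 then show ?case using Suc by (auto intro!: derivative_intros)
qed (auto intro!: continuous_intros)

text \<open>Continuity of the derivatives of order \<open>k\<close> is inferred from one further
  derivative, hence \<open>Suc k\<close>. The derivative in direction \<open>v\<close> is a
  combination of two tensor products, which closes the induction.\<close>

lemma Ck_on_tensor:
 "times_differentiable (Suc k) f ==> times_differentiable (Suc k) g ==>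
   Ck_on k UNIV (%p. f (fst p) * g (snd p))"
proof (induction k arbitrary: f g)
 case 0
 then have "continuous_on UNIV f" "continuous_on UNIV g"
  unfolding times_differentiable.simps by (meson DERIV_isCont continuous_at_imp_continuous_on)+
 then show ?case
  by (auto intro!: continuous_on_mult continuous_on_compose2[of UNIV f UNIV fst] continuous_on_compose2[of UNIV g UNIV snd]
    continuous_on_fst continuous_on_snd continuous_on_id)
next
 case (Suc k)
 then obtain f' g' where fg: "!!x. (f has_real_derivative f' x) (at x)" "times_differentiable (Suc k) f'"
  "!!x. (g has_real_derivative g' x) (at x)" "times_differentiable (Suc k) g'" by auto
 have D: "((%p. f (fst p) * g (snd p)) has_derivative
   (%v. fst v * (f' (fst p) * g (snd p)) + snd v * (f (fst p) * g' (snd p)))) (at p)" for p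
 proof -
  have 1: "((%p. f (fst p)) has_derivative (%v. f' (fst p) * fst v)) (at p)"
   using has_derivative_compose[OF has_derivative_fst[OF has_derivative_ident] fg(1)[of "fst p", unfolded has_field_derivative_def]]
   by simp
  have 2: "((%p. g (snd p)) has_derivative (%v. g' (snd p) * snd v)) (at p)"
   using has_derivative_compose[OF has_derivative_snd[OF has_derivative_ident] fg(3)[of "snd p", unfolded has_field_derivative_def]]
   by simp
  show ?thesis by (rule has_derivative_eq_rhs[OF has_derivative_mult[OF 1 2]]) (auto simp: algebra_simps)
 qed
 have "frechet_derivative (%p. f (fst p) * g (snd p)) (at p) v =
   fst v * (f' (fst p) * g (snd p)) + snd v * (f (fst p) * g' (snd p))" for p v
  by (subst frechet_derivative_at[OF D, symmetric]) (rule refl)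
 moreover have "times_differentiable (Suc k) f" "times_differentiable (Suc k) g"
  using Suc.prems by (blast intro: times_differentiable_Suc_imp)+
 then have "Ck_on k UNIV (%p. fst v * (f' (fst p) * g (snd p)) + snd v * (f (fst p) * g' (snd p)))" for v
  using fg by (intro Ck_on_add Ck_on_cmult Suc.IH)
 moreover have "(%p. f (fst p) * g (snd p)) differentiable (at p)" for p
  using D unfolding differentiable_def by blast
 ultimately show ?case by simp
qed

lemma smooth_on_tensor:
 assumes "smooth_real f" "smooth_real g"
 shows "smooth_on UNIV (%(t, x). f t * g x)"
 using Ck_on_tensor[of _ f g] assms
 by (auto simp: smooth_on_def smooth_real_def case_prod_beta' simp del: times_differentiable.simps)

section \<open>A smooth bump and the lemma of du Bois-Reymond\<close>

lemma poly_times_exp_minus_tendsto_0: "((%y::real. poly P y * exp (- y)) ---> 0) at_top"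
proof -
 have "((%y. \<Sum>i\<le>degree P. coeff P i * (y ^ i / exp y)) ---> (\<Sum>i\<le>degree P. coeff P i * 0)) at_top"
  by (intro tendsto_intros tendsto_power_div_exp_0)
 moreover have "(\<Sum>i\<le>degree P. coeff P i * (y ^ i / exp y)) = poly P y * exp (- y)" for y :: real
  by (simp add: poly_altdef exp_minus sum_distrib_right divide_inverse mult.assoc)
 ultimately show ?thesis by simp
qed

text \<open>With \<open>y = 1/x\<close>, the derivative of \<open>P(y) exp(-y)\<close> in
  \<open>x\<close> is \<open>y^2 (P - P')(y) exp(-y)\<close>. The family over all polynomials is
  closed under differentiation, and smoothness is an induction on the order with \<open>P\<close>
  arbitrary.\<close>

definition flat_exp :: "real poly => real => real" where
 "flat_exp P x = (if x > 0 then poly P (inverse x) * exp (- inverse x) else 0)"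

lemma has_derivative_flat_exp:
 "(flat_exp P has_real_derivative flat_exp ([:0, 0, 1:] * (P - pderiv P)) x) (at x)"
proof -
 consider "x > 0" | "x < 0" | "x = 0" by linarith
 then show ?thesis
 proof cases
  case 1
  have "((%x. poly P (inverse x) * exp (- inverse x)) has_real_derivative
    flat_exp ([:0, 0, 1:] * (P - pderiv P)) x) (at x)"
   using 1 by (auto intro!: derivative_eq_intros DERIV_chain2[OF poly_DERIV]
     simp: flat_exp_def power2_eq_square algebra_simps)
  then show ?thesis
   by (rule has_field_derivative_transform_within_open[of _ _ _ "{0<..}"]) (use 1 in \<open>auto simp: flat_exp_def\<close>)
 next
  case 2
  have "((%x. 0) has_real_derivative 0) (at x)" by simp
  then have "(flat_exp P has_real_derivative 0) (at x)"
   by (rule has_field_derivative_transform_within_open[of _ _ _ "{..<0}"]) (use 2 in \<open>auto simp: flat_exp_def\<close>)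
  then show ?thesis using 2 by (simp add: flat_exp_def[of _ x])
 next
  case 3
  have r: "((%h. flat_exp P h / h) ---> 0) (at_right 0)"
  proof (rule Lim_transform_eventually)
   show "((%h. poly ([:0, 1:] * P) (inverse h) * exp (- inverse h)) ---> 0) (at_right (0::real))"
    by (rule filterlim_compose[OF poly_times_exp_minus_tendsto_0 filterlim_inverse_at_top_right])
   show "\<forall>\<^sub>F h in at_right (0::real). poly ([:0, 1:] * P) (inverse h) * exp (- inverse h) = flat_exp P h / h"
    by (auto simp: eventually_at_right_less flat_exp_def divide_inverse eventually_at intro!: exI[of _ 1])
  qed
  have l: "((%h. flat_exp P h / h) ---> 0) (at_left 0)"
   by (rule tendsto_eventually) (auto simp: flat_exp_def eventually_at intro!: exI[of _ 1])
  have "((%h. flat_exp P h / h) ---> 0) (at 0)" using l r by (simp add: filterlim_at_split)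
  then show ?thesis using 3 by (simp add: has_field_derivative_iff flat_exp_def)
 qed
qed

lemma smooth_real_flat_exp: "smooth_real (flat_exp P)"
 unfolding smooth_real_def
proof
 fix k show "times_differentiable k (flat_exp P)"
  by (induction k arbitrary: P) (simp, use has_derivative_flat_exp in \<open>unfold times_differentiable.simps, blast\<close>)
qed

lemma smooth_bump_exists:
 assumes "de > 0"
 shows "\<exists>ro. smooth_real ro \<and> (\<forall>x. 0 <= ro x) \<and> (\<forall>x. \<bar>x\<bar> < de \<longrightarrow> 0 < ro x) \<and> (\<forall>x. de <= \<bar>x\<bar> \<longrightarrow> ro x = 0)"
proof (intro exI conjI)
 let ?ro = "%x. (1 * flat_exp 1 (1 * x + de)) * (1 * flat_exp 1 ((- 1) * x + de))"
 show "smooth_real ?ro"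
  using smooth_real_flat_exp unfolding smooth_real_def
  by (intro allI times_differentiable_mult times_differentiable_compose_affine) auto
qed (auto simp: flat_exp_def)

lemma integral_eq_0_continuous_nonneg:
 fixes f :: "real => real"
 assumes "continuous_on {a..b} f" "!!x. x \<in> {a..b} ==> 0 <= f x" "integral {a..b} f = 0" "x \<in> {a..b}" "a < b"
 shows "f x = 0"
proof -
 have "(f has_integral 0) (cbox a b)"
  using assms by (auto simp: has_integral_integrable_integral intro!: integrable_continuous_interval)
 then show ?thesis
  using has_integral_0_cbox_imp_0[of a b f x] assms by (auto simp: box_real)
qed

text \<open>If \<open>A\<close> minus the antiderivative of \<open>B\<close> took different values
  at \<open>s\<close> and \<open>t\<close>, a test function whose derivative is a bump at
  \<open>s\<close> minus the same bump at \<open>t\<close> would detect the difference.\<close>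

lemma du_Bois_Reymond:
 fixes A B :: "real => real"
 assumes I: "open I" "is_interval I" and cA: "continuous_on I A" and cB: "continuous_on I B"
  and test: "!!f c d. [|smooth_real f; c < d; {c..d} \<subseteq> I; !!x. x \<notin> {c<..<d} ==> f x = 0|] ==>
    integral {c..d} (%x. deriv f x * A x + f x * B x) = 0"
  and st: "s \<in> I" "t \<in> I" "s <= t"
 shows "A t - A s = integral {s..t} B"
proof (cases "s = t")
 case False
 then have "s < t" using st by simp
 obtain e1 where e1: "e1 > 0" "cball s e1 \<subseteq> I" using I(1) st(1) open_contains_cball by blast
 obtain e2 where e2: "e2 > 0" "cball t e2 \<subseteq> I" using I(1) st(2) open_contains_cball by blast
 define c where "c = s - e1"
 define d where "d = t + e2"
 have cd: "c < s" "t < d" "c \<in> I" "d \<in> I" using e1 e2 by (auto simp: c_def d_def dist_real_def)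
 then have cdI: "{c..d} \<subseteq> I" using I(2) by (meson atLeastAtMost_iff mem_is_interval_1_I subsetI)
 define B1 where "B1 x = integral {c..x} B" for x
 have B1: "(B1 has_real_derivative B x) (at x within {c..d})" if "x \<in> {c..d}" for x
  unfolding B1_def has_real_derivative_iff_has_vector_derivative
  by (rule integral_has_vector_derivative[OF continuous_on_subset[OF cB cdI] that])
 have cB1: "continuous_on {c..d} B1" using B1 by (meson DERIV_continuous continuous_on_eq_continuous_within)
 define H where "H x = A x - B1 x" for x
 have cH: "continuous_on {c..d} H"
  unfolding H_def by (intro continuous_intros cB1 continuous_on_subset[OF cA cdI])
 have "H s = H t"
 proof (rule ccontr)
  assume neq: "H s \<noteq> H t"
  \<comment> \<open>The sign of \<open>D\<close> and the midpoint \<open>\<mu>\<close> normalise the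
    situation: \<open>(H - \<mu>) * D\<close> is positive near \<open>s\<close> and negative near
    \<open>t\<close>, which matches the signs of the two bumps.\<close>
  define D where "D = H s - H t"
  define \<mu> where "\<mu> = (H s + H t) / 2"
  have cont: "isCont H s" "isCont H t"
   using cd \<open>s < t\<close> by (intro continuous_on_interior[OF cH]; auto)+
  have "\<forall>\<^sub>F x in nhds s. (H x - \<mu>) * D > 0"
  proof (rule order_tendstoD(1)[of _ "(H s - \<mu>) * D"])
   show "((%x. (H x - \<mu>) * D) ---> (H s - \<mu>) * D) (nhds s)"
    using cont(1) by (intro tendsto_intros) (auto simp: isCont_def tendsto_at_iff_tendsto_nhds)
   have "(H s - \<mu>) * D = D^2 / 2" by (simp add: D_def \<mu>_def power2_eq_square field_simps)
   moreover have "D^2 > 0" using neq by (simp add: D_def)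
   ultimately show "0 < (H s - \<mu>) * D" by linarith
  qed
  then obtain d1 where d1: "d1 > 0" "!!x. dist x s < d1 ==> (H x - \<mu>) * D > 0"
   unfolding eventually_nhds_metric by blast
  have "\<forall>\<^sub>F x in nhds t. (H x - \<mu>) * D < 0"
  proof (rule order_tendstoD(2)[of _ "(H t - \<mu>) * D"])
   show "((%x. (H x - \<mu>) * D) ---> (H t - \<mu>) * D) (nhds t)"
    using cont(2) by (intro tendsto_intros) (auto simp: isCont_def tendsto_at_iff_tendsto_nhds)
   have "(H t - \<mu>) * D = - (D\<^sup>2 / 2)" by (simp add: D_def \<mu>_def power2_eq_square field_simps)
   moreover have "D^2 > 0" using neq by (simp add: D_def)
   ultimately show "(H t - \<mu>) * D < 0" by linarith
  qed
  then obtain d2 where d2: "d2 > 0" "!!x. dist x t < d2 ==> (H x - \<mu>) * D < 0"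
   unfolding eventually_nhds_metric by blast
  define h where "h = (t - s) / 2"
  have "h > 0" using \<open>s < t\<close> by (simp add: h_def)
  define de where "de = min d1 (min d2 (min e1 (min e2 h)))"
  have de: "de > 0" "de <= d1" "de <= d2" "de <= e1" "de <= e2" "de <= h"
   using d1(1) d2(1) e1(1) e2(1) \<open>h > 0\<close> by (simp_all add: de_def)
  obtain ro where ro: "smooth_real ro" "!!x. 0 <= ro x" "!!x. \<bar>x\<bar> < de ==> 0 < ro x" "!!x. de <= \<bar>x\<bar> ==> ro x = 0"
   using smooth_bump_exists[OF de(1)] by blast
  obtain \<Phi> where \<Phi>: "!!x. (\<Phi> has_real_derivative ro x) (at x)"
   using einterval_antiderivative[of "-\<infinity>" "\<infinity>" ro] smooth_real_continuous[OF ro(1), of UNIV]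
   by (auto simp: has_real_derivative_iff_has_vector_derivative continuous_on_eq_continuous_at)
  \<comment> \<open>Two translates of one antiderivative of the bump have the same constants on the
    far left and on the far right, so their difference has compact support.\<close>
  define f where "f x = \<Phi> (x - s) - \<Phi> (x - t)" for x
  define f' where "f' x = ro (x - s) - ro (x - t)" for x
  have sm\<Phi>: "smooth_real \<Phi>" by (rule smooth_real_antiderivative[OF ro(1) \<Phi>])
  have f': "(f has_real_derivative f' x) (at x)" for x
   unfolding f_def f'_def by (auto intro!: derivative_eq_intros DERIV_chain2[OF \<Phi>])
  have smf: "smooth_real f"
  proof -
   have "f = (%x. 1 * \<Phi> (1 * x + - s) + (- 1) * \<Phi> (1 * x + - t))" by (auto simp: f_def)
   moreover have "times_differentiable k (%x. 1 * \<Phi> (1 * x + - s) + (- 1) * \<Phi> (1 * x + - t))" for k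
    using sm\<Phi> unfolding smooth_real_def
    by (intro times_differentiable_add times_differentiable_compose_affine) blast+
   ultimately show ?thesis unfolding smooth_real_def by metis
  qed
  have \<Phi>0: "(\<Phi> has_real_derivative 0) (at x)" if "de <= \<bar>x\<bar>" for x
   using \<Phi>[of x] ro(4)[OF that] by simp
  have c\<Phi>: "continuous_on X \<Phi>" for X using smooth_real_continuous[OF sm\<Phi>] .
  have low: "\<Phi> x = \<Phi> (- de)" if "x <= - de" for x
  proof (cases "x = - de")
   case False
   with that have "x < - de" by simp
   then have "\<Phi> (- de) = \<Phi> x" by (rule DERIV_isconst_end[OF _ c\<Phi>]) (auto intro!: \<Phi>0)
   then show ?thesis by simp
  qed simp
  have high: "\<Phi> x = \<Phi> de" if "de <= x" for x
  proof (cases "x = de")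
   case False
   with that have "de < x" by simp
   then show ?thesis by (rule DERIV_isconst_end[OF _ c\<Phi>]) (auto intro!: \<Phi>0)
  qed simp
  have f0: "f x = 0" if "x \<notin> {c<..<d}" for x
  proof (cases "x <= c")
   case True
   then have "x - s <= - de" "x - t <= - de" using de \<open>s < t\<close> by (auto simp: c_def h_def)
   then show ?thesis using low[of "x - s"] low[of "x - t"] by (simp add: f_def)
  next
   case False
   then have "de <= x - s" "de <= x - t" using de \<open>s < t\<close> that by (auto simp: d_def h_def)
   then show ?thesis using high[of "x - s"] high[of "x - t"] by (simp add: f_def)
  qed
  have df: "deriv f = f'" using f' by (intro ext DERIV_imp_deriv)
  have cf': "continuous_on {c..d} f'"
   using smooth_real_continuous[OF smooth_real_derivative[OF smf f']] .
  have cf: "continuous_on {c..d} f" using smooth_real_continuous[OF smf] .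
  have 1: "integral {c..d} (%x. f' x * A x + f x * B x) = 0"
   using test[OF smf _ cdI f0] cd \<open>s < t\<close> df by simp
  have "((%x. f x * B x + f' x * B1 x) has_integral f d * B1 d - f c * B1 c) {c..d}"
  proof (intro fundamental_theorem_of_calculus)
   show "c <= d" using cd \<open>s < t\<close> by simp
   fix x assume x: "x \<in> {c..d}"
   show "((%x. f x * B1 x) has_vector_derivative f x * B x + f' x * B1 x) (at x within {c..d})"
    unfolding has_real_derivative_iff_has_vector_derivative[symmetric]
    by (rule DERIV_cong[OF DERIV_mult[OF has_field_derivative_at_within[OF f'] B1[OF x]]]) simp
  qed
  then have 2: "((%x. f x * B x + f' x * B1 x) has_integral 0) {c..d}" using f0[of c] f0[of d] by auto
  have "((%x. f' x * (1::real)) has_integral f d - f c) {c..d}"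
   by (intro fundamental_theorem_of_calculus)
    (use cd \<open>s < t\<close> f' in \<open>auto simp: has_real_derivative_iff_has_vector_derivative[symmetric] intro: has_field_derivative_at_within\<close>)
  then have 3: "((%x. f' x) has_integral 0) {c..d}" using f0[of c] f0[of d] by auto
  have cI: "continuous_on {c..d} (%x. f' x * A x + f x * B x)"
   by (intro continuous_intros cf cf' continuous_on_subset[OF cA cdI] continuous_on_subset[OF cB cdI])
  have "((%x. f' x * A x + f x * B x) has_integral 0) {c..d}"
   using 1 integrable_continuous_interval[OF cI] by (metis integrable_integral)
  \<comment> \<open>The constant \<open>\<mu>\<close> can be subtracted because \<open>f'\<close>
    has integral zero.\<close>
  from has_integral_diff[OF has_integral_diff[OF this 2] has_integral_mult_right[OF 3, of \<mu>]]
  have "((%x. f' x * (H x - \<mu>)) has_integral 0) {c..d}"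
   by (rule has_integral_eq_rhs[OF has_integral_cong[THEN iffD1, rotated]]) (auto simp: H_def algebra_simps)
  from has_integral_mult_left[OF this, of D]
  have 4: "integral {c..d} (%x. f' x * (H x - \<mu>) * D) = 0" by (auto dest: integral_unique)
  have "f' s * (H s - \<mu>) * D = 0"
  proof (rule integral_eq_0_continuous_nonneg[OF _ _ 4])
   show "continuous_on {c..d} (%x. f' x * (H x - \<mu>) * D)" by (intro continuous_intros cf' cH)
   fix x assume "x \<in> {c..d}"
   have "0 <= f' x * ((H x - \<mu>) * D)"
   proof -
    consider "dist x s < de" | "dist x t < de" | "dist x s \<ge> de" "dist x t \<ge> de" by linarith
    then show ?thesis
    proof cases
     case 1
     then have "ro (x - t) = 0" using de by (intro ro(4)) (auto simp: dist_real_def h_def)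
     then show ?thesis using d1(2)[of x] 1 de ro(2) by (auto simp: f'_def less_imp_le)
    next
     case 2
     then have "ro (x - s) = 0" using de by (intro ro(4)) (auto simp: dist_real_def h_def)
     then show ?thesis using mult_nonneg_nonpos[OF ro(2)[of "x - t"], of "(H x - \<mu>) * D"] d2(2)[of x] 2 de by (simp add: f'_def)
    next
     case 3
     then show ?thesis using ro(4) by (auto simp: f'_def dist_real_def)
    qed
   qed
   then show "0 <= f' x * (H x - \<mu>) * D" by (simp add: mult.assoc)
  qed (use cd \<open>s < t\<close> in auto)
  moreover have "f' s > 0" using ro(3)[of 0] ro(4)[of "s - t"] de \<open>s < t\<close> by (auto simp: f'_def h_def)
  ultimately show False using d1(2)[of s] d1(1) by (auto simp: mult.assoc)
 qed
 moreover have "B1 t - B1 s = integral {s..t} B"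
 proof -
  have "B integrable_on {c..t}"
   using cd \<open>s < t\<close> by (intro integrable_continuous_interval continuous_on_subset[OF cB] order_trans[OF _ cdI]) auto
  from hk_combine[OF _ _ this, of s] cd \<open>s < t\<close>
  show ?thesis by (auto simp: B1_def)
 qed
 ultimately show ?thesis by (simp add: H_def)
qed auto

section \<open>The weak continuity equation as a balance of mass on rectangles\<close>

lemma continuity_eq_tensor:
 assumes ce: "continuity_eq T u m"
  and cm: "continuous_on ({0<..<T} \<times> UNIV) (%(t, x). m t x)"
  and cu: "continuous_on ({0<..<T} \<times> UNIV) (%(t, x). dx u t x)"
  and f: "smooth_real f" "!!t. t \<notin> {c<..<d} ==> f t = 0" "{c..d} \<subseteq> {0<..<T}"
  and g: "smooth_real g" "!!x. x \<notin> {p<..<q} ==> g x = 0"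
 shows "integral {c..d} (%t. integral {p..q} (%x.
      - m t x * (deriv f t * g x) + m t x * dx u t x * (f t * deriv g x))) = 0"
proof -
 let ?h = "%(t, x). - m t x * (deriv f t * g x) + m t x * dx u t x * (f t * deriv g x)"
 let ?K = "cbox (c, p) (d, q)"
 have K: "?K = {c..d} \<times> {p..q}" by (simp add: cbox_Pair_eq)
 have zero: "deriv h x = 0" if "smooth_real h" "!!t. t \<notin> {c<..<d} ==> h t = 0" "x \<notin> {c..d}" for h x and c d :: real
 proof -
  have "((%x. 0) has_real_derivative 0) (at x)" by simp
  then have "(h has_real_derivative 0) (at x)"
   by (rule has_field_derivative_transform_within_open[of _ _ _ "- {c..d}"]) (use that in auto)
  then show ?thesis by (rule DERIV_imp_deriv)
 qed
 have dt: "dt (%t x. f t * g x) t x = deriv f t * g x" for t x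
  unfolding dt_def by (intro DERIV_imp_deriv DERIV_cmult_right smooth_real_has_derivative f)
 have dx: "dx (%t x. f t * g x) t x = f t * deriv g x" for t x
  unfolding dx_def by (intro DERIV_imp_deriv DERIV_cmult smooth_real_has_derivative g)
 have "\<exists>K. compact K \<and> K \<subseteq> {0<..<T} \<times> UNIV \<and> (\<forall>t x. (t, x) \<notin> K \<longrightarrow> f t * g x = 0)"
  using f(2,3) g(2) by (intro exI[of _ ?K]) (fastforce simp: K intro!: compact_Times)
 then have "(LINT (t, x) : {0<..<T} \<times> UNIV | lborel.
      - m t x * dt (%t x. f t * g x) t x + m t x * dx u t x * dx (%t x. f t * g x) t x) = 0"
  using ce smooth_on_tensor[OF f(1) g(1)] unfolding continuity_eq_def by blast
 then have "(LINT z : {0<..<T} \<times> UNIV | lborel. ?h z) = 0"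
  by (simp add: dt dx case_prod_beta')
 also have "(LINT z : {0<..<T} \<times> UNIV | lborel. ?h z) = (LINT z : ?K | lborel. ?h z)"
  unfolding set_lebesgue_integral_def
 proof (intro Bochner_Integration.integral_cong refl)
  fix z :: "real \<times> real"
  obtain t x where z: "z = (t, x)" by (cases z)
  show "indicator ({0<..<T} \<times> UNIV) z *\<^sub>R ?h z = indicator ?K z *\<^sub>R ?h z"
  proof (cases "t \<in> {c..d} \<and> x \<in> {p..q}")
   case True
   then show ?thesis using f(3) by (auto simp: z K indicator_def)
  next
   case False
   then have "(f t = 0 \<and> deriv f t = 0) \<or> (g x = 0 \<and> deriv g x = 0)"
   proof (cases "t \<in> {c..d}")
    case True
    with False have x: "x \<notin> {p..q}" by simp
    then have "x \<notin> {p<..<q}" by auto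
    with zero[OF g x] g(2) show ?thesis by blast
   next
    case t: False
    then have "t \<notin> {c<..<d}" by auto
    with zero[OF f(1,2) t] f(2) show ?thesis by blast
   qed
   then have "?h z = 0" by (auto simp: z)
   then show ?thesis by simp
  qed
 qed
 also have ch: "continuous_on ?K ?h"
 proof -
  have sub: "?K \<subseteq> {0<..<T} \<times> UNIV" using f(3) by (auto simp: K)
  have c: "continuous_on ?K (%z. m (fst z) (snd z))" "continuous_on ?K (%z. dx u (fst z) (snd z))"
   using continuous_on_subset[OF cm sub] continuous_on_subset[OF cu sub] by (auto simp: case_prod_beta')
  have s: "smooth_real (deriv f)" "smooth_real (deriv g)"
   using smooth_real_derivative[OF _ smooth_real_has_derivative] f(1) g(1) by auto
  have r: "continuous_on ?K (%z. h (fst z))" "continuous_on ?K (%z. h (snd z))" if "smooth_real h" for h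
   using smooth_real_continuous[OF that, of UNIV] by (auto intro!: continuous_on_compose2[of UNIV h] continuous_intros)
  show ?thesis unfolding case_prod_beta' by (intro continuous_intros c r s f g)
 qed
 then have "(LINT z : ?K | lborel. ?h z) = integral ?K ?h"
  unfolding set_integrable_def[symmetric]
  by (intro set_borel_integral_eq_integral) (unfold set_integrable_def, intro borel_integrable_compact, simp)
 also have "... = integral {c..d} (%t. integral {p..q} (%x. ?h (t, x)))"
  by (subst integral_prod_continuous[OF ch]) simp
 finally show ?thesis by simp
qed

text \<open>The lemma of du Bois-Reymond is applied once in time, with the space factor fixed, and
  once in space, to the time integral of the flux \<open>m u_x\<close>; both \<open>m\<close> and
  the flux need only be continuous.\<close>

lemma continuity_eq_integrated:
 assumes ce: "continuity_eq T u m"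
  and cm: "continuous_on ({0<..<T} \<times> UNIV) (%(t, x). m t x)"
  and cu: "continuous_on ({0<..<T} \<times> UNIV) (%(t, x). dx u t x)"
  and st: "0 < s" "s <= t" "t < T" and pq: "p <= q"
 shows "integral {p..q} (m t) - integral {p..q} (m s) =
   integral {s..t} (%ta. m ta q * dx u ta q) - integral {s..t} (%ta. m ta p * dx u ta p)"
proof -
 have cmu: "continuous_on ({0<..<T} \<times> UNIV) (%(t, x). m t x * dx u t x)"
  using continuous_on_mult[OF cm cu] by (simp add: case_prod_beta')
 note cm1 = continuous_on_fixed_time[OF cm] and cmu1 = continuous_on_fixed_time[OF cmu]
 have scont: "smooth_real f ==> continuous_on A f" "smooth_real f ==> continuous_on A (deriv f)" for f A
  using smooth_real_continuous smooth_real_derivative[OF _ smooth_real_has_derivative] by auto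
 have param: "continuous_on {0<..<T} (%ta. integral {c..d} (%x. h ta x * g x))"
  if "continuous_on ({0<..<T} \<times> UNIV) (%(t, x). h t x)" "continuous_on UNIV g" for h :: "real => real => real" and g and c d :: real
 proof -
  have "continuous_on ({0<..<T} \<times> cbox c d) (%(ta, x). h ta x * g x)"
   unfolding case_prod_beta'
  proof (intro continuous_on_mult)
   show "continuous_on ({0<..<T} \<times> cbox c d) (%z. h (fst z) (snd z))"
    using continuous_on_subset[OF that(1), of "{0<..<T} \<times> cbox c d"] by (auto simp: case_prod_beta')
   show "continuous_on ({0<..<T} \<times> cbox c d) (%z. g (snd z))"
    by (intro continuous_on_compose2[OF that(2)] continuous_intros) auto
  qed
  from integral_continuous_on_param[OF this] show ?thesis by simp
 qed
 have step1: "integral {c..d} (%x. m t x * g x) - integral {c..d} (%x. m s x * g x) =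
   - integral {s..t} (%ta. integral {c..d} (%x. m ta x * dx u ta x * deriv g x))"
  if g: "smooth_real g" "!!x. x \<notin> {c<..<d} ==> g x = 0" for g c d
 proof -
  have "integral {c..d} (%x. m t x * g x) - integral {c..d} (%x. m s x * g x) =
   integral {s..t} (%ta. - integral {c..d} (%x. m ta x * dx u ta x * deriv g x))"
  proof (rule du_Bois_Reymond[where I="{0<..<T}"])
   show "continuous_on {0<..<T} (%ta. integral {c..d} (%x. m ta x * g x))"
    by (rule param[OF cm scont(1)[OF g(1)]])
   show "continuous_on {0<..<T} (%ta. - integral {c..d} (%x. m ta x * dx u ta x * deriv g x))"
    by (intro continuous_intros param[OF cmu scont(2)[OF g(1)]])
   fix f l r assume f: "smooth_real f" "l < r" "{l..r} \<subseteq> {0<..<T}" "!!x. x \<notin> {l<..<r} ==> f x = 0"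
   have "integral {c..d} (%x. - m ta x * (deriv f ta * g x) + m ta x * dx u ta x * (f ta * deriv g x)) =
     - (deriv f ta * integral {c..d} (%x. m ta x * g x) + f ta * - integral {c..d} (%x. m ta x * dx u ta x * deriv g x))"
    if "ta \<in> {l..r}" for ta
   proof -
    have ta: "ta \<in> {0<..<T}" using that f(3) by auto
    have "integral {c..d} (%x. - m ta x * (deriv f ta * g x) + m ta x * dx u ta x * (f ta * deriv g x)) =
      integral {c..d} (%x. f ta * (m ta x * dx u ta x * deriv g x) - deriv f ta * (m ta x * g x))"
     by (intro integral_cong) (simp add: algebra_simps)
    also have "... = f ta * integral {c..d} (%x. m ta x * dx u ta x * deriv g x) - deriv f ta * integral {c..d} (%x. m ta x * g x)"
     by (subst integral_diff) (auto intro!: integrable_continuous_interval continuous_intros cm1 cmu1 scont(1)[OF g(1)] scont(2)[OF g(1)] ta[simplified])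
    finally show ?thesis by simp
   qed
   then have "integral {l..r} (%ta. deriv f ta * integral {c..d} (%x. m ta x * g x) + f ta * - integral {c..d} (%x. m ta x * dx u ta x * deriv g x))
     = - integral {l..r} (%ta. integral {c..d} (%x. - m ta x * (deriv f ta * g x) + m ta x * dx u ta x * (f ta * deriv g x)))"
    by (subst integral_neg[symmetric]) (intro integral_cong, simp)
   then show "integral {l..r} (%ta. deriv f ta * integral {c..d} (%x. m ta x * g x) + f ta * - integral {c..d} (%x. m ta x * dx u ta x * deriv g x)) = 0"
    using continuity_eq_tensor[OF ce cm cu f(1,4,3) g] by simp
  qed (use st in auto)
  then show ?thesis by simp
 qed
 define A where "A x = integral {s..t} (%ta. m ta x * dx u ta x)" for x
 have sI: "{s..t} \<subseteq> {0<..<T}" using st by auto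
 have cA: "continuous_on UNIV A"
 proof -
  have "continuous_on (UNIV \<times> cbox s t) (%(x, ta). m ta x * dx u ta x)"
  proof -
   have "continuous_on (UNIV \<times> cbox s t) (%z. (%(t, x). m t x * dx u t x) (snd z, fst z))"
    by (rule continuous_on_compose2[OF cmu])
     (use sI in \<open>auto intro!: continuous_on_Pair continuous_on_fst continuous_on_snd continuous_on_id\<close>)
   then show ?thesis by (simp add: case_prod_beta')
  qed
  from integral_continuous_on_param[OF this] show ?thesis by (simp add: A_def[abs_def])
 qed
 have "A q - A p = integral {p..q} (%x. m t x - m s x)"
 proof (rule du_Bois_Reymond[where I=UNIV])
  show "continuous_on UNIV (%x. m t x - m s x)" using st by (intro continuous_intros cm1) auto
  fix g c d assume g: "smooth_real g" "c < d" "!!x. x \<notin> {c<..<d} ==> g x = (0::real)"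
  have "integral {s..t} (%ta. integral {c..d} (%x. m ta x * dx u ta x * deriv g x)) =
    integral {c..d} (%x. integral {s..t} (%ta. m ta x * dx u ta x * deriv g x))"
  proof -
   have sub: "cbox (s, c) (t, d) \<subseteq> {0<..<T} \<times> UNIV" using sI by (auto simp: cbox_Pair_eq)
   have "continuous_on (cbox (s, c) (t, d)) (%(ta, x). m ta x * dx u ta x * deriv g x)"
    unfolding case_prod_beta'
   proof (rule continuous_on_mult)
    show "continuous_on (cbox (s, c) (t, d)) (%z. m (fst z) (snd z) * dx u (fst z) (snd z))"
     using continuous_on_subset[OF cmu sub] by (simp add: case_prod_beta')
    show "continuous_on (cbox (s, c) (t, d)) (%z. deriv g (snd z))"
     by (rule continuous_on_compose2[OF scont(2)[OF g(1), of UNIV]]) (auto intro!: continuous_on_snd continuous_on_id)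
   qed
   from integral_swap_continuous[OF this] show ?thesis by simp
  qed
  also have "... = integral {c..d} (%x. deriv g x * A x)"
   by (intro integral_cong) (simp add: A_def mult.commute)
  finally have 1: "integral {c..d} (%x. m t x * g x) - integral {c..d} (%x. m s x * g x) = - integral {c..d} (%x. deriv g x * A x)"
   using step1[OF g(1,3)] by simp
  have ib: "(%x. m t x * g x) integrable_on {c..d}" "(%x. m s x * g x) integrable_on {c..d}"
   "(%x. deriv g x * A x) integrable_on {c..d}"
   using st by (auto intro!: integrable_continuous_interval continuous_intros cm1 scont(1)[OF g(1)] scont(2)[OF g(1)] continuous_on_subset[OF cA])
  have "integral {c..d} (%x. deriv g x * A x + g x * (m t x - m s x)) =
    integral {c..d} (%x. deriv g x * A x + (m t x * g x - m s x * g x))"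
   by (intro integral_cong) (simp add: algebra_simps)
  also have "... = integral {c..d} (%x. deriv g x * A x) + (integral {c..d} (%x. m t x * g x) - integral {c..d} (%x. m s x * g x))"
   using ib by (simp add: integral_add integral_diff integrable_diff)
  finally show "integral {c..d} (%x. deriv g x * A x + g x * (m t x - m s x)) = 0" using 1 by simp
 qed (use pq cA in auto)
 moreover have "integral {p..q} (%x. m t x - m s x) = integral {p..q} (m t) - integral {p..q} (m s)"
  using st by (intro integral_diff integrable_continuous_interval cm1) auto
 ultimately show ?thesis by (simp add: A_def)
qed

section \<open>Functions of class C1 on a strip\<close>

lemma has_derivative_strip:
 fixes f :: "real => real => real"
 assumes ft: "((%s. f s x) has_real_derivative ft) (at t)"
  and fx: "!!s y. s \<in> I ==> (f s has_real_derivative fx s y) (at y)"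
  and cfx: "continuous_on (I \<times> UNIV) (%(t, x). fx t x)" and I: "open I" "t \<in> I"
 shows "((%(t, x). f t x) has_derivative (%(a, b). ft * a + fx t x * b)) (at (t, x))"
proof -
 obtain e where e: "e > 0" "ball t e \<subseteq> I" using I open_contains_ball by blast
 have "((%(t, x). f t x) has_derivative (%(a, b). ft * a + blinfun_scaleR_left (fx t x) b)) (at (t, x) within ball t e \<times> UNIV)"
 proof (rule has_derivative_partialsI)
  show "((%s. f s x) has_derivative (*) ft) (at t within ball t e)"
   using ft by (simp add: has_field_derivative_def has_derivative_at_withinI)
  show "(f s has_derivative blinfun_apply (blinfun_scaleR_left (fx s y))) (at y within UNIV)" if "s \<in> ball t e" for s y
   using fx[of s y] that e by (auto simp: has_field_derivative_def mult_commute_abs)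
  have "continuous_on (ball t e \<times> UNIV) (%z. blinfun_scaleR_left (fx (fst z) (snd z)))"
   using continuous_on_subset[OF cfx, of "ball t e \<times> UNIV"] e
   by (intro continuous_intros) (auto simp: case_prod_beta')
  then show "continuous (at (t, x) within ball t e \<times> UNIV) (%(t, x). blinfun_scaleR_left (fx t x))"
   using e by (auto simp: continuous_on_eq_continuous_within case_prod_beta')
 qed auto
 moreover have "at (t, x) within ball t e \<times> UNIV = at (t, x)"
  using e by (intro at_within_open open_Times) auto
 ultimately show ?thesis by (simp add: mult.commute)
qed

lemma C1_strip_has_derivative:
 assumes C: "C1_strip I f ft fx" and I: "open I" "t \<in> I"
 shows "((%(t, x). f t x) has_derivative (%(a, b). ft t x * a + fx t x * b)) (at (t, x))"
 by (rule has_derivative_strip[where f=f, OF C1_stripD(1)[OF C I(2)] C1_stripD(2)[OF C] C1_stripD(5)[OF C] I])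

lemma C1_stripI:
 assumes ft: "!!t x. t \<in> I ==> ((%s. f s x) has_real_derivative ft t x) (at t)"
  and fx: "!!t x. t \<in> I ==> (f t has_real_derivative fx t x) (at x)"
  and c: "continuous_on (I \<times> UNIV) (%(t, x). ft t x)" "continuous_on (I \<times> UNIV) (%(t, x). fx t x)" and I: "open I"
 shows "C1_strip I f ft fx"
proof -
 have "continuous_on (I \<times> UNIV) (%(t, x). f t x)"
  using has_derivative_continuous[OF has_derivative_strip[OF ft fx c(2) I]]
  by (intro continuous_at_imp_continuous_on) auto
 then show ?thesis using assms by (auto simp: C1_strip_def)
qed

lemma C1_strip_DERIV_along:
 assumes C: "C1_strip I f ft fx" and I: "open I" "s \<in> I"
  and X: "(X has_real_derivative X') (at s)"
 shows "((%s. f s (X s)) has_real_derivative ft s (X s) + fx s (X s) * X') (at s)"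
proof -
 have "((%s. (s, X s)) has_derivative (%h. (h, X' * h))) (at s)"
  using X by (intro has_derivative_Pair has_derivative_ident) (simp add: has_field_derivative_def)
 from has_derivative_compose[OF this C1_strip_has_derivative[OF C I]]
 have "((%s. f s (X s)) has_derivative (%h. ft s (X s) * h + fx s (X s) * (X' * h))) (at s)" by simp
 then show ?thesis
  unfolding has_field_derivative_def
  by (rule has_derivative_eq_rhs) (auto simp: fun_eq_iff algebra_simps)
qed

lemma tendsto_integral_symmetric_interval:
 fixes f :: "real => real"
 assumes "integrable lborel f"
 shows "((%q. integral {- q..q} f) ---> integral\<^sup>L lborel f) at_top"
proof -
 have "((%q. LINT x|lborel. indicator {- q..q} x * f x) ---> integral\<^sup>L lborel f) at_top"
 proof (rule integral_dominated_convergence_at_top[where w="%x. \<bar>f x\<bar>"])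
  show "AE x in lborel. ((%q. indicator {- q..q} x * f x) ---> f x) at_top"
  proof (intro AE_I2 tendsto_eventually)
   fix x
   show "\<forall>\<^sub>F q in at_top. indicator {- q..q} x * f x = f x"
    using eventually_ge_at_top[of "\<bar>x\<bar>"] by eventually_elim (auto simp: indicator_def)
  qed
 qed (use assms in \<open>auto intro!: always_eventually AE_I2 simp: indicator_def dest: borel_measurable_integrable\<close>)
 moreover have "(LINT x|lborel. indicator {- q..q} x * f x) = integral {- q..q} f" for q
 proof -
  have "set_integrable lborel {- q..q} f"
   unfolding set_integrable_def by (rule integrable_mult_indicator[OF _ assms]) auto
  from set_borel_integral_eq_integral(2)[OF this] show ?thesis by (simp add: set_lebesgue_integral_def)
 qed
 ultimately show ?thesis by simp
qed

lemma integral_real_ivl_mono_set: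
 fixes f :: "real => real"
 assumes "continuous_on UNIV f" "!!x. 0 <= f x" "{a..b} \<subseteq> {c..d}"
 shows "integral {a..b} f <= integral {c..d} f"
 using assms by (intro integral_subset_le integrable_continuous_interval) (auto intro: continuous_on_subset)

lemma continuous_on_integral_space:
 fixes f :: "real => real => real"
 assumes "continuous_on (I \<times> UNIV) (%(t, x). f t x)"
 shows "continuous_on I (%t. integral {p..q} (f t))"
proof -
 have "continuous_on (I \<times> cbox p q) (%(t, x). f t x)"
  by (rule continuous_on_subset[OF assms]) auto
 from integral_continuous_on_param[OF this] show ?thesis by simp
qed

lemma continuous_on_strip_compose:
 fixes f :: "real => real => 'a::topological_space"
 assumes "continuous_on (I \<times> UNIV) (%(t, x). f t x)"
  "continuous_on A g" "continuous_on A h" "!!z. z \<in> A ==> g z \<in> I"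
 shows "continuous_on A (%z. f (g z) (h z))"
proof -
 have "continuous_on A (%z. (%(t, x). f t x) (g z, h z))"
  using assms by (intro continuous_on_compose2[OF assms(1)] continuous_on_Pair) auto
 then show ?thesis by simp
qed

lemma integral_swap_strip:
 fixes f :: "real => real => real"
 assumes "continuous_on ({s..t} \<times> {p..q}) (%(ta, x). f ta x)"
 shows "integral {s..t} (%ta. integral {p..q} (f ta)) = integral {p..q} (%x. integral {s..t} (%ta. f ta x))"
proof -
 have "cbox (s, p) (t, q) = {s..t} \<times> {p..q}" by (simp add: cbox_Pair_eq)
 with assms have "continuous_on (cbox (s, p) (t, q)) (%(ta, x). f ta x)" by simp
 from integral_swap_continuous[OF this] show ?thesis by simp
qed

text \<open>The moment bound on \<open>ro\<close> makes the lateral boundary terms small along a sequence of intervals.\<close>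

lemma small_boundary_exists:
 fixes ro :: "real => real => real"
 assumes c: "continuous_on (I \<times> UNIV) (%(t, x). ro t x)" and pos: "!!ta x. ta \<in> {s..t} ==> 0 <= ro ta x"
  and st: "{s..t} \<subseteq> I" "s <= t"
  and mom: "!!ta Q. ta \<in> {s..t} ==> integral {- Q..Q} (%x. (1 + \<bar>x\<bar>) * ro ta x) <= B"
  and e: "e > 0"
 shows "\<exists>q\<ge>q0. integral {s..t} (%ta. (1 + q) * (ro ta q + ro ta (- q))) <= e"
proof (rule ccontr)
 assume neg: "\<not> (\<exists>q\<ge>q0. integral {s..t} (%ta. (1 + q) * (ro ta q + ro ta (- q))) <= e)"
 define q1 where "q1 = max q0 0"
 define h where "h q = integral {s..t} (%ta. (1 + q) * (ro ta q + ro ta (- q)))" for q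
 have big: "h q > e" if "q \<ge> q1" for q using neg that by (force simp: h_def q1_def)
 \<comment> \<open>Were \<open>h\<close> above \<open>e\<close> from \<open>q1\<close> on, its
   integral up to \<open>Q\<close> would be at least
   \<open>e * (Q - q1) = 2 * B * (t - s) + e\<close>. By Fubini and the moment bound on either half
   line it is at most \<open>2 * B * (t - s)\<close>.\<close>
 define Q where "Q = q1 + (2 * B * (t - s)) / e + 1"
 have B: "B \<ge> 0" using mom[of s 0] st by auto
 have Q: "q1 < Q" using B st e by (auto simp: Q_def add_nonneg_pos)
 have sub: "continuous_on A (%z. ro (g z) (k z))" if "continuous_on A g" "continuous_on A k" "!!z. z \<in> A ==> g z \<in> {s..t}"
  for A and g k :: "'x::topological_space => real"
  using that st by (intro continuous_on_strip_compose[OF c]) auto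
 have cH: "continuous_on ({s..t} \<times> {q1..Q}) (%(ta, q). (1 + q) * (ro ta q + ro ta (- q)))"
  unfolding case_prod_beta'
  by (intro continuous_intros continuous_on_strip_compose[OF c]) (use st in auto)
 have swap: "integral {q1..Q} h = integral {s..t} (%ta. integral {q1..Q} (%q. (1 + q) * (ro ta q + ro ta (- q))))"
  unfolding h_def by (rule integral_swap_strip[OF cH, symmetric])
 have ch: "continuous_on {q1..Q} h"
 proof -
  have "continuous_on ({q1..Q} \<times> cbox s t) (%(q, ta). (1 + q) * (ro ta q + ro ta (- q)))"
   unfolding case_prod_beta'
   by (intro continuous_intros continuous_on_strip_compose[OF c]) (use st in auto)
  from integral_continuous_on_param[OF this] show ?thesis by (simp add: h_def[abs_def])
 qed
 have "e * (Q - q1) = integral {q1..Q} (%_. e)" using Q by simp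
 also have "... <= integral {q1..Q} h"
  using big by (intro integral_le integrable_continuous_interval ch) (auto intro: less_imp_le)
 also have "... <= integral {s..t} (%_. 2 * B)"
  unfolding swap
 proof (intro integral_le integrable_continuous_interval)
  show "continuous_on {s..t} (%ta. integral {q1..Q} (%q. (1 + q) * (ro ta q + ro ta (- q))))"
   using integral_continuous_on_param[of "{s..t}" q1 Q "%ta q. (1 + q) * (ro ta q + ro ta (- q))"] cH by simp
  fix ta assume ta: "ta \<in> {s..t}"
  have cr: "continuous_on A (%x. (1 + \<bar>x\<bar>) * ro ta x)" for A
   using ta st by (intro continuous_intros continuous_on_fixed_time[OF c]) auto
  have i1: "integral {q1..Q} (%x. (1 + \<bar>x\<bar>) * ro ta x) <= B"
   by (rule order_trans[OF integral_real_ivl_mono_set[OF cr, of q1 Q "- Q" Q] mom[OF ta]])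
    (use pos[OF ta] in \<open>auto simp: q1_def\<close>)
  have i2: "integral {- Q..- q1} (%x. (1 + \<bar>x\<bar>) * ro ta x) <= B"
   by (rule order_trans[OF integral_real_ivl_mono_set[OF cr, of "-Q" "-q1" "- Q" Q] mom[OF ta]])
    (use pos[OF ta] Q in \<open>auto simp: q1_def\<close>)
  have "integral {q1..Q} (%q. (1 + q) * (ro ta q + ro ta (- q))) =
   integral {q1..Q} (%x. (1 + \<bar>x\<bar>) * ro ta x + (1 + \<bar>-x\<bar>) * ro ta (- x))"
   by (intro integral_cong) (auto simp: q1_def algebra_simps)
  also have "... = integral {q1..Q} (%x. (1 + \<bar>x\<bar>) * ro ta x) + integral {q1..Q} (%x. (1 + \<bar>-x\<bar>) * ro ta (- x))"
  proof (rule integral_add)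
   show "(%x. (1 + \<bar>x\<bar>) * ro ta x) integrable_on {q1..Q}" by (intro integrable_continuous_interval cr)
   show "(%x. (1 + \<bar>-x\<bar>) * ro ta (- x)) integrable_on {q1..Q}"
    by (intro integrable_continuous_interval continuous_on_compose2[OF cr[of UNIV], of _ uminus] continuous_intros) auto
  qed
  also have "integral {q1..Q} (%x. (1 + \<bar>-x\<bar>) * ro ta (- x)) = integral {- Q..- q1} (%x. (1 + \<bar>x\<bar>) * ro ta x)"
   using hk_reflect_real[of "- q1" "- Q" "%x. (1 + \<bar>x\<bar>) * ro ta x"] by simp
  finally show "integral {q1..Q} (%q. (1 + q) * (ro ta q + ro ta (- q))) <= 2 * B" using i1 i2 by simp
 qed simp
 also have "... = 2 * B * (t - s)" using st by simp
 finally have "e * (Q - q1) <= 2 * B * (t - s)" .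
 moreover have "e * (Q - q1) = 2 * B * (t - s) + e" using e by (simp add: Q_def field_simps)
 ultimately show False using e by simp
qed

text \<open>The lateral terms \<open>w * nt\<close> are at most \<open>K^2 (1 + |q|) ro\<close> and
  become small along some sequence of \<open>q\<close>; both pairings converge as \<open>q\<close>
  grows, so the sequence suffices. The dissipation is nonnegative, and cutting it down to
  \<open>{- q0..q0}\<close> keeps the inequality.\<close>

lemma pairing_inequality:
 fixes ro :: "real => real => real"
 assumes W: "C1_strip I w wt wx" and N: "C1_strip I n nt nx"
  and st: "{s..t} \<subseteq> I" "s <= t"
  and c: "continuous_on (I \<times> UNIV) (%(t, x). ro t x)" and pos: "!!ta x. ta \<in> {s..t} ==> 0 <= ro ta x"
  and mom: "!!ta Q. ta \<in> {s..t} ==> integral {- Q..Q} (%x. (1 + \<bar>x\<bar>) * ro ta x) <= B"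
  and wK: "!!ta x. ta \<in> {s..t} ==> \<bar>w ta x\<bar> <= K * (1 + \<bar>x\<bar>)"
  and ntK: "!!ta x. ta \<in> {s..t} ==> \<bar>nt ta x\<bar> <= K * ro ta x"
  and sgn: "!!ta x. ta \<in> {s..t} ==> 0 <= wx ta x * nt ta x - wt ta x * nx ta x"
  and Js: "((%q. integral {- q..q} (%x. w s x * nx s x)) ---> Js) at_top"
  and Jt: "((%q. integral {- q..q} (%x. w t x * nx t x)) ---> Jt) at_top"
  and q0: "0 <= q0"
 shows "Jt - Js <= - integral {s..t} (%ta. integral {- q0..q0} (%x. wx ta x * nt ta x - wt ta x * nx ta x))"
proof -
 define E where "E ta x = wx ta x * nt ta x - wt ta x * nx ta x" for ta x
 have K: "K \<ge> 0" using order_trans[OF abs_ge_zero wK[of s 0]] st by simp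
 note Wd = C1_stripD[OF W] and Nd = C1_stripD[OF N]
 have cE: "continuous_on (I \<times> UNIV) (%(t, x). E t x)"
  unfolding E_def case_prod_beta'
  using Wd(3-5) Nd(3-5) unfolding case_prod_beta' by (intro continuous_intros)
 have main: "\<exists>q\<ge>q'. integral {- q..q} (%x. w t x * nx t x) - integral {- q..q} (%x. w s x * nx s x)
   <= - integral {s..t} (%ta. integral {- q0..q0} (E ta)) + e" if e: "e > 0" and q': "q' \<ge> q0" for e q'
 proof -
  obtain q where q: "q \<ge> q'" "integral {s..t} (%ta. (1 + q) * (ro ta q + ro ta (- q))) <= e / (K * K + 1)"
   using small_boundary_exists[OF c pos st mom, of "e / (K * K + 1)" q'] e K by (auto simp: add_nonneg_pos)
  have q_pos: "q \<ge> 0" "q \<ge> q0" using q q' q0 by auto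
  have cEi: "continuous_on {s..t} (%ta. integral {- r..r} (E ta))" for r
   by (rule continuous_on_subset[OF continuous_on_integral_space[OF cE] st(1)])
  have sp: "continuous_on {s..t} (%ta. w ta x)" "continuous_on {s..t} (%ta. nt ta x)" "continuous_on {s..t} (%ta. ro ta x)" for x
   using continuous_on_fixed_space[OF _ st(1)] Wd(3) Nd(4) c by auto
  have "integral {- q..q} (%x. w t x * nx t x) - integral {- q..q} (%x. w s x * nx s x) =
    integral {s..t} (%ta. integral {- q..q} (%x. wt ta x * nx ta x - wx ta x * nt ta x)
      + w ta q * nt ta q - w ta (- q) * nt ta (- q))"
   using pairing_identity[OF W N st, of "- q" q] q_pos by simp
  also have "... = integral {s..t} (%ta. (w ta q * nt ta q - w ta (- q) * nt ta (- q)) - integral {- q..q} (E ta))"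
  proof (rule integral_cong)
   fix ta
   have "integral {- q..q} (%x. wt ta x * nx ta x - wx ta x * nt ta x) = - integral {- q..q} (E ta)"
    by (simp add: E_def integral_neg[symmetric])
   then show "integral {- q..q} (%x. wt ta x * nx ta x - wx ta x * nt ta x) + w ta q * nt ta q - w ta (- q) * nt ta (- q) =
     (w ta q * nt ta q - w ta (- q) * nt ta (- q)) - integral {- q..q} (E ta)" by simp
  qed
  also have "... <= integral {s..t} (%ta. K * K * ((1 + q) * (ro ta q + ro ta (- q))) - integral {- q0..q0} (E ta))"
  proof (intro integral_le integrable_continuous_interval continuous_intros sp cEi)
   fix ta assume ta: "ta \<in> {s..t}"
   have b: "\<bar>w ta x * nt ta x\<bar> <= K * (1 + \<bar>x\<bar>) * (K * ro ta x)" for x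
    unfolding abs_mult using wK[OF ta] ntK[OF ta] K by (intro mult_mono) auto
   have "integral {- q0..q0} (E ta) <= integral {- q..q} (E ta)"
    using q_pos sgn[OF ta] ta st by (intro integral_real_ivl_mono_set continuous_on_fixed_time[OF cE]) (auto simp: E_def)
   moreover have "w ta q * nt ta q - w ta (- q) * nt ta (- q) <= K * K * ((1 + q) * (ro ta q + ro ta (- q)))"
    using b[of q] b[of "- q"] q_pos by (auto simp: algebra_simps abs_le_iff)
   ultimately show "w ta q * nt ta q - w ta (- q) * nt ta (- q) - integral {- q..q} (E ta) <=
     K * K * ((1 + q) * (ro ta q + ro ta (- q))) - integral {- q0..q0} (E ta)" by simp
  qed
  also have "... = K * K * integral {s..t} (%ta. (1 + q) * (ro ta q + ro ta (- q))) - integral {s..t} (%ta. integral {- q0..q0} (E ta))"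
   by (subst integral_diff) (auto intro!: integrable_continuous_interval continuous_intros sp cEi)
  also have "K * K * integral {s..t} (%ta. (1 + q) * (ro ta q + ro ta (- q))) <= K * K * (e / (K * K + 1))"
   using K by (intro mult_left_mono q) auto
  also have "K * K * (e / (K * K + 1)) <= e"
  proof -
   have "0 < K * K + 1" using K by (simp add: add_nonneg_pos)
   then show ?thesis using e by (simp add: field_simps)
  qed
  finally show ?thesis using q(1) by (intro exI[of _ q]) simp
 qed
 define D where "D q = integral {- q..q} (%x. w t x * nx t x) - integral {- q..q} (%x. w s x * nx s x)" for q
 define Z where "Z = integral {s..t} (%ta. integral {- q0..q0} (E ta))"
 have D: "(D ---> Jt - Js) at_top" unfolding D_def by (intro tendsto_intros Js Jt)
 have "Jt - Js <= - Z"
 proof (rule ccontr)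
  assume "\<not> Jt - Js <= - Z"
  define e where "e = (Jt - Js + Z) / 2"
  have e: "e > 0" using \<open>\<not> _\<close> by (simp add: e_def)
  have "\<forall>\<^sub>F q in at_top. D q > - Z + e"
   using \<open>\<not> _\<close> by (intro order_tendstoD(1)[OF D]) (simp add: e_def field_simps)
  then obtain q' where q': "!!q. q \<ge> q' ==> D q > - Z + e" by (auto simp: eventually_at_top_linorder)
  obtain q where "q \<ge> max q' q0" "D q <= - Z + e"
   using main[OF e, of "max q' q0"] by (auto simp: D_def Z_def)
  then show False using q'[of q] by simp
 qed
 then show ?thesis unfolding Z_def E_def[abs_def] .
qed

section \<open>Transport along Hamilton--Jacobi paths\<close>

text \<open>Along the straight path of velocity \<open>c\<close> the equation gives
  \<open>u_t + c u_x = (u_x + c)^2 / 2 - c^2 / 2 - m^2\<close>, and the first square is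
  dropped.\<close>

lemma HJ_path_inequality:
 assumes C: "C1_strip {0<..<T} u ut ux"
  and HJ: "!!t x. t \<in> {0<..<T} ==> ut t x = 1/2 * (ux t x)^2 - (m t x)^2"
  and cm: "continuous_on ({0<..<T} \<times> UNIV) (%(t, x). m t x)"
  and tr: "0 < t" "t < r" "r < T"
 shows "u t x - u r y <= (x - y)^2 / (2 * (r - t)) +
   integral {t..r} (%s. (m s ((1 - (s - t) / (r - t)) * x + (s - t) / (r - t) * y))^2)"
proof -
 define c where "c = (y - x) / (r - t)"
 define X where "X s = (1 - (s - t) / (r - t)) * x + (s - t) / (r - t) * y" for s
 have X: "X s = x + (s - t) * c" for s
 proof -
  define k where "k = (s - t) / (r - t)"
  have "X s = x + k * (y - x)" by (simp add: X_def k_def[symmetric] algebra_simps)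
  then show ?thesis by (simp add: k_def c_def)
 qed
 have sub: "{t..r} \<subseteq> {0<..<T}" using tr by auto
 define g' where "g' s = ut s (X s) + ux s (X s) * c" for s
 have cX: "continuous_on {t..r} X" unfolding X by (intro continuous_intros)
 have cg: "continuous_on {t..r} g'"
  unfolding g'_def using sub
  by (intro continuous_intros continuous_on_strip_compose[OF C1_stripD(4)[OF C]]
    continuous_on_strip_compose[OF C1_stripD(5)[OF C]] cX) auto
 have cmX: "continuous_on {t..r} (%s. m s (X s))"
  using sub by (intro continuous_on_strip_compose[OF cm] cX continuous_intros) auto
 have "(g' has_integral u r (X r) - u t (X t)) {t..r}"
 proof (rule fundamental_theorem_of_calculus)
  fix s assume "s \<in> {t..r}"
  then have "s \<in> {0<..<T}" using sub by blast
  have "(X has_real_derivative c) (at s)"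
   unfolding X[abs_def] by (auto intro!: derivative_eq_intros)
  from C1_strip_DERIV_along[OF C _ \<open>s \<in> {0<..<T}\<close> this]
  show "((%s. u s (X s)) has_vector_derivative g' s) (at s within {t..r})"
   by (simp add: g'_def has_real_derivative_iff_has_vector_derivative has_vector_derivative_at_within)
 qed (use tr in simp)
 then have "u r (X r) - u t (X t) = integral {t..r} g'" by (simp add: integral_unique)
 also have "... \<ge> integral {t..r} (%s. - (c^2 / 2) - (m s (X s))^2)"
 proof (intro integral_le integrable_continuous_interval cg continuous_intros cmX)
  fix s assume "s \<in> {t..r}"
  then have "s \<in> {0<..<T}" using sub by auto
  from HJ[OF this, of "X s"] have "g' s + c^2 / 2 + (m s (X s))^2 = (ux s (X s) + c)^2 / 2"
   by (simp add: g'_def power2_eq_square field_simps)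
  then show "- (c\<^sup>2 / 2) - (m s (X s))\<^sup>2 <= g' s"
   using zero_le_power2[of "ux s (X s) + c"] by linarith
 qed
 also have "integral {t..r} (%s. - (c\<^sup>2 / 2) - (m s (X s))\<^sup>2) = - (c\<^sup>2 / 2) * (r - t) - integral {t..r} (%s. (m s (X s))\<^sup>2)"
  using tr by (subst integral_diff) (auto intro!: integrable_continuous_interval continuous_intros cmX)
 finally have "u t (X t) - u r (X r) <= c^2 / 2 * (r - t) + integral {t..r} (%s. (m s (X s))^2)" by simp
 moreover have "c^2 / 2 * (r - t) = (x - y)^2 / (2 * (r - t))"
 proof -
  have *: "c^2 / 2 * d = (c * d)^2 / (2 * d)" if "d \<noteq> 0" for d :: real
   using that by (simp add: power2_eq_square)
  have "(y - x) = c * (r - t)" using tr by (simp add: c_def)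
  then have "(x - y)^2 = (c * (r - t))^2" by (metis power2_commute)
  moreover have "r - t \<noteq> 0" using tr by simp
  ultimately show ?thesis using *[of "r - t"] by (metis (no_types))
 qed
 moreover have "X t = x" "X r = y" using tr by (auto simp: X_def)
 ultimately have "u t x - u r y <= (x - y)^2 / (2 * (r - t)) + integral {t..r} (%s. (m s (X s))^2)"
  by (simp only:)
 then show ?thesis unfolding X_def .
qed

text \<open>The affine change of variables costs the factor \<open>1 / (1 - l) <= 2\<close>, and the
  image interval stays in \<open>{p..q}\<close> because \<open>y\<close> lies there.\<close>

lemma integral_convex_combination_le:
 fixes h :: "real => real"
 assumes h: "continuous_on UNIV h" "!!x. 0 <= h x" and l: "0 <= l" "l <= 1/2" and y: "y \<in> {p..q}"
 shows "integral {p..q} (%x. h ((1 - l) * x + l * y)) <= 2 * integral {p..q} h"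
proof -
 define p' where "p' = (1 - l) * p + l * y"
 define q' where "q' = (1 - l) * q + l * y"
 have l1: "1 - l > 0" using l by simp
 have "l * p <= l * y" "l * y <= l * q" using l y by (auto intro: mult_left_mono)
 then have pq': "p <= p'" "q' <= q" by (auto simp: p'_def q'_def algebra_simps)
 have "(h has_integral integral {p'..q'} h) (cbox p' q')"
  using integrable_continuous_interval[OF continuous_on_subset[OF h(1)], of p' q'] by (simp add: has_integral_integral)
 note aff = has_integral_affinity'[OF this l1, of "l * y"]
 have "(p' - l * y) /\<^sub>R (1 - l) = p" "(q' - l * y) /\<^sub>R (1 - l) = q"
  using l1 by (simp_all add: p'_def q'_def field_simps)
 with aff have "((%x. h ((1 - l) * x + l * y)) has_integral integral {p'..q'} h / (1 - l)) {p..q}"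
  by (simp add: divide_inverse mult.commute)
 then have "integral {p..q} (%x. h ((1 - l) * x + l * y)) = integral {p'..q'} h / (1 - l)" by (rule integral_unique)
 also have "... <= integral {p'..q'} h * 2"
 proof -
  have "0 <= integral {p'..q'} h" using h(2) by (intro hk_nonneg integrable_continuous_interval continuous_on_subset[OF h(1)]) auto
  moreover have "1 / (1 - l) <= 2" using l by (simp add: field_simps)
  ultimately show ?thesis using mult_left_mono[of "1 / (1 - l)" 2 "integral {p'..q'} h"] by simp
 qed
 also have "integral {p'..q'} h <= integral {p..q} h"
  using pq' by (intro integral_real_ivl_mono_set h) auto
 finally show ?thesis by simp
qed

lemma mult_power2_le_cubes:
 fixes a b :: real
 assumes "0 <= a" "0 <= b"
 shows "a * b^2 <= a ^ 3 + b ^ 3"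
proof -
 have cubes: "0 <= a ^ 3" "0 <= b ^ 3" using assms by auto
 show ?thesis
 proof (cases "a <= b")
  case True
  then have "a * b^2 <= b * b^2" by (intro mult_right_mono) auto
  also have "... = b ^ 3" by (simp add: power3_eq_cube power2_eq_square)
  finally show ?thesis using cubes by linarith
 next
  case False
  then have "b^2 <= a^2" using assms by (intro power_mono) auto
  then have "a * b^2 <= a * a^2" using assms by (intro mult_left_mono) auto
  also have "... = a ^ 3" by (simp add: power3_eq_cube power2_eq_square)
  finally show ?thesis using cubes by linarith
 qed
qed

text \<open>The density travelling less than half of the way is spread by a factor at most \<open>2\<close>, which bounds the
 interaction with \<open>h\<close>; the other density only enters through its mass.\<close>

lemma interpolated_interaction_bound:
 fixes f g h :: "real => real"
 assumes f: "continuous_on UNIV f" "!!x. 0 <= f x" and g: "continuous_on UNIV g" "!!x. 0 <= g x"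
  and h: "continuous_on UNIV h" "!!x. 0 <= h x" and l: "0 <= l" "l <= 1/2"
 shows "integral {p..q} (%y. integral {p..q} (%x. f x * g y * (h ((1 - l) * x + l * y))^2))
   <= integral {p..q} g * (integral {p..q} (%x. f x ^ 3) + 2 * integral {p..q} (%x. h x ^ 3))"
proof -
 define C where "C = integral {p..q} (%x. f x ^ 3) + 2 * integral {p..q} (%x. h x ^ 3)"
 have ch: "continuous_on A (%z. h (k z))" if "continuous_on A k" for A and k :: "'z::topological_space => real"
  using that by (intro continuous_on_compose2[OF h(1)]) auto
 have cf: "continuous_on A (%z. f (k z))" if "continuous_on A k" for A and k :: "'z::topological_space => real"
  using that by (intro continuous_on_compose2[OF f(1)]) auto
 have cg: "continuous_on A (%z. g (k z))" if "continuous_on A k" for A and k :: "'z::topological_space => real"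
  using that by (intro continuous_on_compose2[OF g(1)]) auto
 have "integral {p..q} (%y. integral {p..q} (%x. f x * g y * (h ((1 - l) * x + l * y))^2)) <= integral {p..q} (%y. g y * C)"
 proof (intro integral_le integrable_continuous_interval)
  have "continuous_on ({p..q} \<times> cbox p q) (%(y, x). f x * g y * (h ((1 - l) * x + l * y))^2)"
   unfolding case_prod_beta' by (intro continuous_intros ch cf cg)
  from integral_continuous_on_param[OF this]
  show "continuous_on {p..q} (%y. integral {p..q} (%x. f x * g y * (h ((1 - l) * x + l * y))^2))" by simp
  show "continuous_on {p..q} (%y. g y * C)" by (intro continuous_intros cg)
  fix y assume y: "y \<in> {p..q}"
  have "integral {p..q} (%x. f x * g y * (h ((1 - l) * x + l * y))^2) <=
    integral {p..q} (%x. g y * (f x ^ 3 + h ((1 - l) * x + l * y) ^ 3))"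
  proof (intro integral_le integrable_continuous_interval continuous_intros ch cf)
   fix x
   have "g y * (f x * (h ((1 - l) * x + l * y))^2) <= g y * (f x ^ 3 + h ((1 - l) * x + l * y) ^ 3)"
    by (intro mult_left_mono mult_power2_le_cubes f h g)
   then show "f x * g y * (h ((1 - l) * x + l * y))^2 <= g y * (f x ^ 3 + h ((1 - l) * x + l * y) ^ 3)"
    by (simp add: mult_ac)
  qed
  also have "... = g y * (integral {p..q} (%x. f x ^ 3) + integral {p..q} (%x. h ((1 - l) * x + l * y) ^ 3))"
   by (subst integral_add[symmetric]) (auto intro!: integrable_continuous_interval continuous_intros ch cf)
  also have "... <= g y * C"
   unfolding C_def using h(2)
   by (intro mult_left_mono add_left_mono g integral_convex_combination_le[OF _ _ l y, of "%x. h x ^ 3"] continuous_intros h) auto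
  finally show "integral {p..q} (%x. f x * g y * (h ((1 - l) * x + l * y))^2) <= g y * C" .
 qed
 then show ?thesis by (simp add: C_def)
qed

text \<open>On one cell the product coupling of \<open>f\<close> and \<open>g\<close>, scaled to the
  smaller of the two masses, is moved along straight paths; the excess mass is charged at the sup
  bound \<open>K\<close>. The cubic integrals absorb the term \<open>m^2\<close> of the path
  inequality.\<close>

lemma cell_transport:
 assumes C: "C1_strip {0<..<T} u ut ux"
  and HJ: "!!t x. t \<in> {0<..<T} ==> ut t x = 1/2 * (ux t x)^2 - (m t x)^2"
  and cm: "continuous_on ({0<..<T} \<times> UNIV) (%(t, x). m t x)" and m0: "!!t x. t \<in> {0<..<T} ==> 0 <= m t x"
  and tr: "0 < t" "t < r" "r < T" and pq: "p <= q"
  and f: "continuous_on UNIV f" "!!x. 0 <= f x" and g: "continuous_on UNIV g" "!!x. 0 <= g x"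
  and bd: "!!x. x \<in> {p..q} ==> \<bar>u t x\<bar> <= K" "!!x. x \<in> {p..q} ==> \<bar>u r x\<bar> <= K"
 shows "integral {p..q} (%x. f x * u t x) - integral {p..q} (%x. g x * u r x) <=
   integral {p..q} f * ((q - p)^2 / (2 * (r - t)))
   + integral {t..r} (%s. integral {p..q} (%x. f x ^ 3) + integral {p..q} (%x. g x ^ 3) + 2 * integral {p..q} (%x. m s x ^ 3))
   + K * \<bar>integral {p..q} f - integral {p..q} g\<bar>"
proof -
 define a where "a = integral {p..q} f"
 define b where "b = integral {p..q} g"
 define FU where "FU = integral {p..q} (%x. f x * u t x)"
 define GU where "GU = integral {p..q} (%x. g x * u r x)"
 define S where "S = (q - p)^2 / (2 * (r - t))"
 define Cs where "Cs s = integral {p..q} (%x. f x ^ 3) + integral {p..q} (%x. g x ^ 3) + 2 * integral {p..q} (%x. m s x ^ 3)" for s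
 have sub: "{t..r} \<subseteq> {0<..<T}" using tr by auto
 have K: "K \<ge> 0" using bd(1)[of p] pq by auto
 have cont: "continuous_on A f" "continuous_on A g" for A using f g by (auto intro: continuous_on_subset)
 have cmt: "continuous_on A (m s)" if "s \<in> {t..r}" for s A using that sub by (intro continuous_on_fixed_time[OF cm]) auto
 have cu: "continuous_on A (u t)" "continuous_on A (u r)" for A
  using tr continuous_on_fixed_time[OF C1_stripD(3)[OF C]] by auto
 have ab: "a \<ge> 0" "b \<ge> 0" unfolding a_def b_def using f g
  by (auto intro!: hk_nonneg integrable_continuous_interval cont)
 have S: "S \<ge> 0" using tr by (simp add: S_def)
 have cube: "0 <= integral {p..q} (%x. k x ^ 3)" if "continuous_on {p..q} k" "!!x. x \<in> {p..q} ==> 0 <= k x" for k :: "real => real"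
  using that by (intro hk_nonneg integrable_continuous_interval continuous_intros) auto
 have cubes: "0 <= integral {p..q} (%x. f x ^ 3)" "0 <= integral {p..q} (%x. g x ^ 3)"
  "!!s. s \<in> {t..r} ==> 0 <= integral {p..q} (%x. m s x ^ 3)"
  using f g m0 sub by (auto intro!: cube cont cmt)
 have Cs0: "0 <= Cs s" if "s \<in> {t..r}" for s using cubes that by (simp add: Cs_def)
 have cCs: "continuous_on {t..r} Cs"
 proof -
  have "continuous_on ({0<..<T} \<times> UNIV) (%(t, x). m t x ^ 3)"
   using cm unfolding case_prod_beta' by (intro continuous_intros)
  from continuous_on_subset[OF continuous_on_integral_space[OF this] sub]
  show ?thesis unfolding Cs_def by (intro continuous_intros)
 qed
 have ICs: "0 <= integral {t..r} Cs"
  by (intro hk_nonneg integrable_continuous_interval cCs) (use Cs0 in auto)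
 have FUb: "\<bar>FU\<bar> <= K * a"
 proof -
  have "norm FU <= integral {p..q} (%x. K * f x)" unfolding FU_def
  proof (intro integral_norm_bound_integral integrable_continuous_interval continuous_intros cont cu)
   fix x assume "x \<in> {p..q}"
   then show "norm (f x * u t x) <= K * f x"
    using mult_left_mono[OF bd(1)[of x] f(2)[of x]] f(2)[of x] by (simp add: abs_mult mult.commute)
  qed
  then show ?thesis by (simp add: a_def)
 qed
 have GUb: "\<bar>GU\<bar> <= K * b"
 proof -
  have "norm GU <= integral {p..q} (%x. K * g x)" unfolding GU_def
  proof (intro integral_norm_bound_integral integrable_continuous_interval continuous_intros cont cu)
   fix x assume "x \<in> {p..q}"
   then show "norm (g x * u r x) <= K * g x"
    using mult_left_mono[OF bd(2)[of x] g(2)[of x]] g(2)[of x] by (simp add: abs_mult mult.commute)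
  qed
  then show ?thesis by (simp add: b_def)
 qed
 have "FU - GU <= a * S + integral {t..r} Cs + K * \<bar>a - b\<bar>"
 proof (cases "a = 0 \<or> b = 0")
  case True
  then have "\<bar>FU\<bar> + \<bar>GU\<bar> <= K * \<bar>a - b\<bar>" using FUb GUb ab by auto
  moreover have "0 <= a * S" using ab S by simp
  ultimately show ?thesis using ICs by linarith
 next
  case False
  then have pos: "a > 0" "b > 0" using ab by auto
  \<comment> \<open>The mass that can be matched; the weight \<open>\<theta> / (a * b)\<close> gives
    the product of \<open>f\<close> and \<open>g\<close> exactly this total mass.\<close>
  define \<theta> where "\<theta> = min a b"
  have \<theta>: "0 < \<theta>" "\<theta> <= a" "\<theta> <= b" using pos by (auto simp: \<theta>_def)
  define lam where "lam s = (s - t) / (r - t)" for s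
  define H where "H x y s = f x * g y * (m s ((1 - lam s) * x + lam s * y))^2" for x y s
  have clam: "continuous_on A lam" for A unfolding lam_def using tr by (intro continuous_intros) auto
  have cH: "continuous_on A (%z. H (k1 z) (k2 z) (k3 z))"
   if "continuous_on A k1" "continuous_on A k2" "continuous_on A k3" "!!z. z \<in> A ==> k3 z \<in> {t..r}"
   for A and k1 k2 k3 :: "'z::topological_space => real"
  proof -
   have "0 < k3 z" "k3 z < T" if "z \<in> A" for z using \<open>!!z. z \<in> A ==> k3 z \<in> {t..r}\<close>[OF that] tr by auto
   then show ?thesis
    unfolding H_def using that(1-3)
    by (intro continuous_intros continuous_on_compose2[OF f(1)] continuous_on_compose2[OF g(1)]
      continuous_on_strip_compose[OF cm] continuous_on_compose2[OF clam[of UNIV]]) auto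
  qed
  have iter: "integral {p..q} (%x. integral {p..q} (%y. integral {t..r} (H x y))) =
    integral {t..r} (%s. integral {p..q} (%x. integral {p..q} (%y. H x y s)))"
  proof -
   have "continuous_on (cbox (p, t) (q, r)) (%(x, s). integral {p..q} (%y. H x y s))"
   proof -
    have "continuous_on (cbox (p, t) (q, r) \<times> cbox p q) (%(z, y). H (fst z) y (snd z))"
     unfolding case_prod_beta' by (intro cH continuous_intros) (auto simp: cbox_Pair_eq)
    from integral_continuous_on_param[OF this] show ?thesis by (simp add: case_prod_beta')
   qed
   from integral_swap_continuous[OF this]
   have "integral {p..q} (%x. integral {t..r} (%s. integral {p..q} (%y. H x y s))) =
    integral {t..r} (%s. integral {p..q} (%x. integral {p..q} (%y. H x y s)))" by simp
   moreover have "integral {t..r} (%s. integral {p..q} (%y. H x y s)) = integral {p..q} (%y. integral {t..r} (H x y))" for x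
   proof (rule integral_swap_strip)
    show "continuous_on ({t..r} \<times> {p..q}) (%(s, y). H x y s)"
     unfolding case_prod_beta' by (intro cH continuous_intros) auto
   qed
   ultimately show ?thesis by simp
  qed
  \<comment> \<open>Up to half time the points are spread by their starting position, afterwards by
    their end position. Either way a factor of at most \<open>max a b\<close> appears, and the
    weight cancels it because \<open>max a b * min a b = a * b\<close>.\<close>
  have Hs: "integral {p..q} (%x. integral {p..q} (%y. H x y s)) * (\<theta> / (a * b)) <= Cs s" if s: "s \<in> {t..r}" for s
  proof -
   have lam01: "0 <= lam s" "lam s <= 1" using s tr by (auto simp: lam_def)
   define J where "J = integral {p..q} (%x. integral {p..q} (%y. H x y s))"
   have m0s: "0 <= m s x" for x using m0 s sub by auto
   have "J <= b * Cs s \<or> J <= a * Cs s"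
   proof (cases "lam s <= 1/2")
    case True
    have "J = integral {p..q} (%y. integral {p..q} (%x. H x y s))"
     unfolding J_def
    proof (rule integral_swap_strip)
     show "continuous_on ({p..q} \<times> {p..q}) (%(x, y). H x y s)"
      unfolding case_prod_beta' using s by (intro cH continuous_intros) auto
    qed
    also have "... <= b * (integral {p..q} (%x. f x ^ 3) + 2 * integral {p..q} (%x. m s x ^ 3))"
     unfolding H_def b_def using True lam01 by (intro interpolated_interaction_bound f g cmt s m0s) auto
    also have "... <= b * Cs s" using cubes(2) pos by (intro mult_left_mono) (auto simp: Cs_def)
    finally show ?thesis by simp
   next
    case False
    have "J = integral {p..q} (%x. integral {p..q} (%y. g y * f x * (m s ((1 - (1 - lam s)) * y + (1 - lam s) * x))^2))"
     unfolding J_def H_def by (simp add: mult.commute add.commute)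
    also have "... <= a * (integral {p..q} (%x. g x ^ 3) + 2 * integral {p..q} (%x. m s x ^ 3))"
     unfolding a_def using False lam01 by (intro interpolated_interaction_bound f g cmt s m0s) auto
    also have "... <= a * Cs s" using cubes(1) pos by (intro mult_left_mono) (auto simp: Cs_def)
    finally show ?thesis by simp
   qed
   then have "J <= max a b * Cs s"
    using mult_right_mono[OF max.cobounded1[of a b] Cs0[OF s]] mult_right_mono[OF max.cobounded2[of b a] Cs0[OF s]]
    by linarith
   then have "J * (\<theta> / (a * b)) <= max a b * Cs s * (\<theta> / (a * b))"
    using \<theta> pos by (intro mult_right_mono) auto
   also have "max a b * \<theta> = a * b" by (auto simp: \<theta>_def max_def min_def)
   then have "max a b * Cs s * (\<theta> / (a * b)) = Cs s" using pos by (simp add: field_simps)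
   finally show ?thesis by (simp add: J_def)
  qed
  have "b * FU - a * GU = integral {p..q} (%x. integral {p..q} (%y. f x * g y * (u t x - u r y)))"
  proof -
   have "integral {p..q} (%y. f x * g y * (u t x - u r y)) = b * (f x * u t x) - f x * GU" for x
   proof -
    have "integral {p..q} (%y. f x * g y * (u t x - u r y)) = integral {p..q} (%y. f x * u t x * g y - f x * (g y * u r y))"
     by (intro integral_cong) (simp add: algebra_simps)
    also have "... = b * (f x * u t x) - f x * GU"
     by (subst integral_diff) (auto intro!: integrable_continuous_interval continuous_intros cont cu simp: b_def GU_def)
    finally show ?thesis .
   qed
   then have "integral {p..q} (%x. integral {p..q} (%y. f x * g y * (u t x - u r y))) = integral {p..q} (%x. b * (f x * u t x) - f x * GU)"
    by simp
   also have "... = b * FU - a * GU"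
    by (subst integral_diff) (auto intro!: integrable_continuous_interval continuous_intros cont cu simp: FU_def a_def)
   finally show ?thesis by simp
  qed
  also have "... <= integral {p..q} (%x. integral {p..q} (%y. f x * g y * S + integral {t..r} (H x y)))"
  proof -
   have c1: "continuous_on A (%z. u t (k z))" "continuous_on A (%z. u r (k z))" "continuous_on A (%z. f (k z))" "continuous_on A (%z. g (k z))"
    if "continuous_on A k" for A and k :: "'z::topological_space => real"
    using that by (auto intro!: continuous_on_compose2[OF cu(1)[of UNIV]] continuous_on_compose2[OF cu(2)[of UNIV]] continuous_on_compose2[OF f(1)] continuous_on_compose2[OF g(1)])
   have c2: "continuous_on ({p..q} \<times> cbox p q) (%(x, y). f x * g y * (u t x - u r y))"
    unfolding case_prod_beta' by (intro continuous_intros c1)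
   have "continuous_on (cbox (p, p) (q, q) \<times> cbox t r) (%(z, s). H (fst z) (snd z) s)"
    unfolding case_prod_beta' by (intro cH continuous_intros) (auto simp: cbox_Pair_eq)
   from integral_continuous_on_param[OF this]
   have c3: "continuous_on ({p..q} \<times> {p..q}) (%z. integral {t..r} (H (fst z) (snd z)))" by (simp add: cbox_Pair_eq)
   then have c4: "continuous_on ({p..q} \<times> cbox p q) (%(x, y). f x * g y * S + integral {t..r} (H x y))"
    unfolding case_prod_beta' by (intro continuous_intros c1) auto
   have c3': "continuous_on {p..q} (%y. integral {t..r} (H x y))" if "x \<in> {p..q}" for x
   proof -
    have "continuous_on {p..q} (%y. (%z. integral {t..r} (H (fst z) (snd z))) (x, y))"
     by (rule continuous_on_compose2[OF c3])
      (use that in \<open>auto intro!: continuous_on_Pair continuous_on_const continuous_on_id\<close>)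
    then show ?thesis by simp
   qed
   show ?thesis
   proof (intro integral_le integrable_continuous_interval)
    show "continuous_on {p..q} (%x. integral {p..q} (%y. f x * g y * (u t x - u r y)))"
     using integral_continuous_on_param[OF c2] by simp
    show "continuous_on {p..q} (%x. integral {p..q} (%y. f x * g y * S + integral {t..r} (H x y)))"
     using integral_continuous_on_param[OF c4] by simp
    fix x assume x: "x \<in> {p..q}"
    show "continuous_on {p..q} (%y. f x * g y * (u t x - u r y))" by (intro continuous_intros c1)
    show "continuous_on {p..q} (%y. f x * g y * S + integral {t..r} (H x y))" by (intro continuous_intros c1 c3' x)
    fix y assume y: "y \<in> {p..q}"
    have "(x - y)^2 <= (q - p)^2" using x y by (intro abs_le_square_iff[THEN iffD1]) auto
    then have "(x - y)^2 / (2 * (r - t)) <= S" unfolding S_def using tr by (intro divide_right_mono) auto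
    with HJ_path_inequality[OF C HJ cm tr, of x y]
    have le: "u t x - u r y <= S + integral {t..r} (%s. (m s ((1 - lam s) * x + lam s * y))^2)" by (simp add: lam_def)
    have "f x * g y * (u t x - u r y) <= f x * g y * (S + integral {t..r} (%s. (m s ((1 - lam s) * x + lam s * y))^2))"
     using f g by (intro mult_left_mono[OF le]) auto
    also have "... = f x * g y * S + integral {t..r} (H x y)"
     by (simp add: H_def[abs_def] distrib_left)
    finally show "f x * g y * (u t x - u r y) <= f x * g y * S + integral {t..r} (H x y)" .
   qed
  qed
  also have "... = a * b * S + integral {t..r} (%s. integral {p..q} (%x. integral {p..q} (%y. H x y s)))"
  proof -
   have "continuous_on (cbox (p, p) (q, q) \<times> cbox t r) (%(z, s). H (fst z) (snd z) s)"
    unfolding case_prod_beta' by (intro cH continuous_intros) (auto simp: cbox_Pair_eq)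
   from integral_continuous_on_param[OF this]
   have c3: "continuous_on ({p..q} \<times> {p..q}) (%z. integral {t..r} (H (fst z) (snd z)))" by (simp add: cbox_Pair_eq)
   then have c3': "continuous_on {p..q} (%y. integral {t..r} (H x y))" if "x \<in> {p..q}" for x
   proof -
    have "continuous_on {p..q} (%y. (%z. integral {t..r} (H (fst z) (snd z))) (x, y))"
     by (rule continuous_on_compose2[OF c3])
      (use that in \<open>auto intro!: continuous_on_Pair continuous_on_const continuous_on_id\<close>)
    then show ?thesis by simp
   qed
   have c5: "continuous_on {p..q} (%x. integral {p..q} (%y. integral {t..r} (H x y)))"
    using integral_continuous_on_param[of "{p..q}" p q "%x y. integral {t..r} (H x y)"] c3 by (simp add: case_prod_beta')
   have "integral {p..q} (%x. integral {p..q} (%y. f x * g y * S + integral {t..r} (H x y))) =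
     integral {p..q} (%x. f x * (b * S) + integral {p..q} (%y. integral {t..r} (H x y)))"
   proof (rule integral_cong)
    fix x assume x: "x \<in> {p..q}"
    show "integral {p..q} (%y. f x * g y * S + integral {t..r} (H x y)) = f x * (b * S) + integral {p..q} (%y. integral {t..r} (H x y))"
     by (subst integral_add) (auto intro!: integrable_continuous_interval continuous_intros cont c3' simp: b_def x[simplified])
   qed
   also have "... = a * b * S + integral {p..q} (%x. integral {p..q} (%y. integral {t..r} (H x y)))"
    by (subst integral_add) (auto intro!: integrable_continuous_interval continuous_intros cont c5 simp: a_def)
   finally show ?thesis using iter by simp
  qed
  finally have main: "b * FU - a * GU <= a * b * S + integral {t..r} (%s. integral {p..q} (%x. integral {p..q} (%y. H x y s)))" .
  have "(b * FU - a * GU) * (\<theta> / (a * b)) <= (a * b * S + integral {t..r} (%s. integral {p..q} (%x. integral {p..q} (%y. H x y s)))) * (\<theta> / (a * b))"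
   using \<theta> pos by (intro mult_right_mono[OF main]) auto
  also have "... = \<theta> * S + integral {t..r} (%s. integral {p..q} (%x. integral {p..q} (%y. H x y s)) * (\<theta> / (a * b)))"
  proof -
   have "(a * b * S + Z) * (\<theta> / (a * b)) = \<theta> * S + Z * (\<theta> / (a * b))" for Z
    using pos by (simp add: field_simps)
   then show ?thesis by simp
  qed
  also have "... <= a * S + integral {t..r} Cs"
  proof (intro add_mono mult_right_mono \<theta> S integral_le integrable_continuous_interval cCs Hs)
   have "continuous_on ({t..r} \<times> cbox p q \<times> cbox p q) (%z. H (fst (snd z)) (snd (snd z)) (fst z))"
    by (intro cH continuous_intros) auto
   have "continuous_on (({t..r} \<times> cbox p q) \<times> cbox p q) (%(z, y). H (snd z) y (fst z))"
    unfolding case_prod_beta' by (intro cH continuous_intros) auto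
   from integral_continuous_on_param[OF this]
   have "continuous_on ({t..r} \<times> cbox p q) (%(s, x). integral {p..q} (%y. H x y s))" by (simp add: case_prod_beta')
   from integral_continuous_on_param[OF this]
   show "continuous_on {t..r} (%s. integral {p..q} (%x. integral {p..q} (%y. H x y s)) * (\<theta> / (a * b)))"
    by (intro continuous_intros) simp
  qed auto
  finally have "\<theta> / a * FU - \<theta> / b * GU <= a * S + integral {t..r} Cs"
   using pos by (simp add: field_simps)
  \<comment> \<open>The unmatched part of \<open>f\<close>, and next that of \<open>g\<close>; one
    of the two is zero.\<close>
  moreover have "(1 - \<theta> / a) * FU <= (a - \<theta>) * K"
  proof -
   have "(1 - \<theta> / a) * FU <= (1 - \<theta> / a) * (K * a)"
    using \<theta> pos FUb by (intro mult_left_mono) auto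
   also have "... = (a - \<theta>) * K" using pos by (simp add: field_simps)
   finally show ?thesis .
  qed
  moreover have "(1 - \<theta> / b) * (- GU) <= (b - \<theta>) * K"
  proof -
   have "(1 - \<theta> / b) * (- GU) <= (1 - \<theta> / b) * (K * b)"
    using \<theta> pos GUb by (intro mult_left_mono) auto
   also have "... = (b - \<theta>) * K" using pos by (simp add: field_simps)
   finally show ?thesis .
  qed
  moreover have "(a - \<theta>) * K + (b - \<theta>) * K = K * \<bar>a - b\<bar>"
   by (auto simp: \<theta>_def min_def abs_if algebra_simps)
  ultimately show ?thesis by (simp add: algebra_simps)
 qed
 then show ?thesis by (simp add: FU_def GU_def a_def b_def S_def Cs_def[abs_def])
qed

lemma sum_integral_cells:
 fixes h :: "real => real"
 assumes "continuous_on UNIV h" "l \<ge> 0"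
 shows "(\<Sum>j<n. integral {c + real j * l..c + real (Suc j) * l} h) = integral {c..c + real n * l} h"
proof (induction n)
 case (Suc n)
 have "integral {c..c + real n * l} h + integral {c + real n * l..c + real (Suc n) * l} h = integral {c..c + real (Suc n) * l} h"
  using assms by (intro hk_combine integrable_continuous_interval)
   (auto intro: continuous_on_subset simp: algebra_simps)
 then show ?case using Suc by simp
qed auto

text \<open>Three errors over \<open>n\<close> equal cells: a kinetic cost, since no path is longer
  than a cell; the interaction over the time \<open>r - t\<close>; and a mass mismatch of at most
  \<open>e\<close> per cell. The first decreases with \<open>n\<close> and the last increases, so
  that cell width and time step have to be balanced.\<close>

lemma transport_estimate:
 assumes C: "C1_strip {0<..<T} u ut ux"
  and HJ: "!!t x. t \<in> {0<..<T} ==> ut t x = 1/2 * (ux t x)^2 - (m t x)^2"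
  and cm: "continuous_on ({0<..<T} \<times> UNIV) (%(t, x). m t x)" and m0: "!!t x. t \<in> {0<..<T} ==> 0 <= m t x"
  and tr: "0 < t" "t < r" "r < T" and N: "N > 0" and n: "n > 0"
  and f: "continuous_on UNIV f" "!!x. 0 <= f x" and g: "continuous_on UNIV g" "!!x. 0 <= g x"
  and bd: "!!x. \<bar>u t x\<bar> <= K * (1 + \<bar>x\<bar>)" "!!x. \<bar>u r x\<bar> <= K * (1 + \<bar>x\<bar>)"
  and cub: "integral {- N..N} (%x. f x ^ 3) <= C3" "integral {- N..N} (%x. g x ^ 3) <= C3"
   "!!s. s \<in> {t..r} ==> integral {- N..N} (%x. m s x ^ 3) <= C3"
  and mass: "integral {- N..N} f <= 1"
  and e: "!!j. j < n ==> \<bar>integral {- N + real j * (2 * N / real n)..- N + real (Suc j) * (2 * N / real n)} f -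
        integral {- N + real j * (2 * N / real n)..- N + real (Suc j) * (2 * N / real n)} g\<bar> <= e"
 shows "integral {- N..N} (%x. f x * u t x) - integral {- N..N} (%x. g x * u r x) <=
   (2 * N / real n)^2 / (2 * (r - t)) + 4 * C3 * (r - t) + K * (1 + N) * real n * e"
proof -
 define l where "l = 2 * N / real n"
 define p where "p j = - N + real j * l" for j :: nat
 have l: "l > 0" using N n by (simp add: l_def)
 have end_: "- N + real n * l = N" using n by (simp add: l_def)
 have sub: "{t..r} \<subseteq> {0<..<T}" using tr by auto
 have K: "K \<ge> 0" using order_trans[OF abs_ge_zero bd(1)[of 0]] by simp
 have sumc: "(\<Sum>j<n. integral {p j..p (Suc j)} h) = integral {- N..N} h" if "continuous_on UNIV h" for h :: "real => real"
  using sum_integral_cells[OF that, of l "- N" n] l end_ by (simp add: p_def)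
 have cu: "continuous_on UNIV (u t)" "continuous_on UNIV (u r)"
  using tr continuous_on_fixed_time[OF C1_stripD(3)[OF C]] by auto
 have pin: "{p j..p (Suc j)} \<subseteq> {- N..N}" if "j < n" for j
 proof -
  have "real (Suc j) * l <= real n * l" using that l by (intro mult_right_mono) auto
  moreover have "0 <= real j * l" using l by simp
  ultimately show ?thesis using end_ by (auto simp: p_def)
 qed
 define Q where "Q j s = integral {p j..p (Suc j)} (%x. f x ^ 3) + integral {p j..p (Suc j)} (%x. g x ^ 3)
   + 2 * integral {p j..p (Suc j)} (%x. m s x ^ 3)" for j s
 have cm3: "continuous_on ({0<..<T} \<times> UNIV) (%(t, x). m t x ^ 3)"
  using cm unfolding case_prod_beta' by (intro continuous_intros)
 have cQ: "continuous_on {t..r} (Q j)" for j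
  unfolding Q_def[abs_def] by (intro continuous_intros continuous_on_subset[OF continuous_on_integral_space[OF cm3] sub])
 have "integral {- N..N} (%x. f x * u t x) - integral {- N..N} (%x. g x * u r x) =
   (\<Sum>j<n. integral {p j..p (Suc j)} (%x. f x * u t x) - integral {p j..p (Suc j)} (%x. g x * u r x))"
  by (simp add: sum_subtractf sumc continuous_on_mult f g cu)
 also have "... \<le> (\<Sum>j<n. integral {p j..p (Suc j)} f * (l^2 / (2 * (r - t))) + integral {t..r} (Q j) + K * (1 + N) * e)"
 proof (rule sum_mono)
  fix j assume "j \<in> {..<n}"
  then have j: "j < n" by simp
  have b: "\<bar>u t x\<bar> <= K * (1 + N)" "\<bar>u r x\<bar> <= K * (1 + N)" if "x \<in> {p j..p (Suc j)}" for x
  proof -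
   have "x \<in> {- N..N}" using that pin[OF j] by blast
   then have "K * (1 + \<bar>x\<bar>) <= K * (1 + N)" using K by (intro mult_left_mono) auto
   then show "\<bar>u t x\<bar> <= K * (1 + N)" "\<bar>u r x\<bar> <= K * (1 + N)" using bd[of x] by linarith+
  qed
  have pp: "p j <= p (Suc j)" "p (Suc j) - p j = l" using l by (auto simp: p_def algebra_simps)
  have "integral {p j..p (Suc j)} (%x. f x * u t x) - integral {p j..p (Suc j)} (%x. g x * u r x) <=
    integral {p j..p (Suc j)} f * ((p (Suc j) - p j)^2 / (2 * (r - t))) + integral {t..r} (Q j)
    + K * (1 + N) * \<bar>integral {p j..p (Suc j)} f - integral {p j..p (Suc j)} g\<bar>"
   using cell_transport[OF C HJ cm m0 tr pp(1) f g b] unfolding Q_def[abs_def] by simp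
  also have "K * (1 + N) * \<bar>integral {p j..p (Suc j)} f - integral {p j..p (Suc j)} g\<bar> <= K * (1 + N) * e"
   using e[OF j] K N by (intro mult_left_mono) (auto simp: p_def l_def)
  finally show "integral {p j..p (Suc j)} (%x. f x * u t x) - integral {p j..p (Suc j)} (%x. g x * u r x) <=
    integral {p j..p (Suc j)} f * (l^2 / (2 * (r - t))) + integral {t..r} (Q j) + K * (1 + N) * e" using pp by simp
 qed
 also have "... = integral {- N..N} f * (l\<^sup>2 / (2 * (r - t))) + (\<Sum>j<n. integral {t..r} (Q j)) + K * (1 + N) * real n * e"
 proof -
  have "(\<Sum>j<n. integral {p j..p (Suc j)} f * S) = integral {- N..N} f * S" for S
   by (subst sum_distrib_right[symmetric]) (simp add: sumc f)
  then show ?thesis by (simp only: sum.distrib) simp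
 qed
 also have "(\<Sum>j<n. integral {t..r} (Q j)) = integral {t..r} (%s. \<Sum>j<n. Q j s)"
  by (rule integral_sum[symmetric]) (auto intro!: integrable_continuous_interval cQ)
 also have "... <= integral {t..r} (%s. 4 * C3)"
 proof (intro integral_le integrable_continuous_interval continuous_intros cQ)
  fix s assume s: "s \<in> {t..r}"
  have "(\<Sum>j<n. Q j s) = integral {- N..N} (%x. f x ^ 3) + integral {- N..N} (%x. g x ^ 3) + 2 * integral {- N..N} (%x. m s x ^ 3)"
   using s sub unfolding Q_def
   by (simp add: sum.distrib sum_distrib_left[symmetric] sumc continuous_on_power f g continuous_on_fixed_time[OF cm] subset_iff)
  then show "(\<Sum>j<n. Q j s) \<le> 4 * C3" using cub(1,2) cub(3)[OF s] by simp
 qed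
 also have "integral {t..r} (%s. 4 * C3) = 4 * C3 * (r - t)" using tr by simp
 also have "integral {- N..N} f * (l\<^sup>2 / (2 * (r - t))) <= 1 * (l\<^sup>2 / (2 * (r - t)))"
  using tr by (intro mult_right_mono mass) auto
 finally show ?thesis by (simp add: l_def)
qed

section \<open>Admissible solutions\<close>

lemma Ck_on_1_imp_C1_strip:
 assumes C: "Ck_on 1 (I \<times> UNIV) (%(t, x). u t x)" and I: "open I"
 shows "C1_strip I u (dt u) (dx u)"
proof -
 let ?f = "%(t, x). u t x"
 have D: "(?f has_derivative frechet_derivative ?f (at (t, x))) (at (t, x))" if "t \<in> I" for t x
  using C that by (auto simp: frechet_derivative_works[symmetric])
 have cf: "continuous_on (I \<times> UNIV) (%z. frechet_derivative ?f (at z) v)" for v using C unfolding One_nat_def Ck_on.simps by blast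
 have t: "((%s. u s x) has_real_derivative frechet_derivative ?f (at (t, x)) (1, 0)) (at t)" if "t \<in> I" for t x
 proof -
  have "((%s. (s, x)) has_derivative (%h. (h, 0))) (at t)" by (intro has_derivative_Pair derivative_intros)
  from has_derivative_compose[OF this D[OF that]]
  have 1: "((%s. u s x) has_derivative (%h. frechet_derivative ?f (at (t, x)) (h, 0))) (at t)" by simp
  have "frechet_derivative ?f (at (t, x)) (h, 0) = frechet_derivative ?f (at (t, x)) (1, 0) * h" for h
   using linear_cmul[OF has_derivative_linear[OF D[OF that, of x]], of h "(1, 0)"] by simp
  then have eq: "(%h. frechet_derivative ?f (at (t, x)) (h, 0)) = (*) (frechet_derivative ?f (at (t, x)) (1, 0))" by (rule ext)
  show ?thesis unfolding has_field_derivative_def using 1 unfolding eq .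
 qed
 have x: "(u t has_real_derivative frechet_derivative ?f (at (t, x)) (0, 1)) (at x)" if "t \<in> I" for t x
 proof -
  have "((%y. (t, y)) has_derivative (%h. (0, h))) (at x)" by (intro has_derivative_Pair derivative_intros)
  from has_derivative_compose[OF this D[OF that]]
  have 1: "(u t has_derivative (%h. frechet_derivative ?f (at (t, x)) (0, h))) (at x)" by simp
  have "frechet_derivative ?f (at (t, x)) (0, h) = frechet_derivative ?f (at (t, x)) (0, 1) * h" for h
   using linear_cmul[OF has_derivative_linear[OF D[OF that, of x]], of h "(0, 1)"] by simp
  then have eq: "(%h. frechet_derivative ?f (at (t, x)) (0, h)) = (*) (frechet_derivative ?f (at (t, x)) (0, 1))" by (rule ext)
  show ?thesis unfolding has_field_derivative_def using 1 unfolding eq .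
 qed
 have eqt: "dt u t x = frechet_derivative ?f (at (t, x)) (1, 0)" if "t \<in> I" for t x
  unfolding dt_def by (rule DERIV_imp_deriv[OF t[OF that]])
 have eqx: "dx u t x = frechet_derivative ?f (at (t, x)) (0, 1)" if "t \<in> I" for t x
  unfolding dx_def by (rule DERIV_imp_deriv[OF x[OF that]])
 show ?thesis
 proof (rule C1_stripI)
  show "continuous_on (I \<times> UNIV) (%(t, x). dt u t x)"
   using cf[of "(1, 0)"] by (rule continuous_on_eq) (auto simp: eqt)
  show "continuous_on (I \<times> UNIV) (%(t, x). dx u t x)"
   using cf[of "(0, 1)"] by (rule continuous_on_eq) (auto simp: eqx)
 qed (use t x eqt eqx I in auto)
qed

text \<open>Oriented integral. Since \<open>integral {a..x}\<close> vanishes for \<open>x\<close>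
  below \<open>a\<close>, at least one of the two terms is zero in every position.\<close>

definition signed_integral :: "real => real => (real => real) => real" where
 "signed_integral a x f = integral {a..x} f - integral {x..a} f"

lemma integral_Icc_le_0:
 fixes f :: "real => real"
 assumes "d <= c" shows "integral {c..d} f = 0"
proof (cases "c = d")
 case False
 then have "{c..d} = {}" using assms by simp
 then show ?thesis by simp
qed simp

lemma signed_integral_diff:
 assumes f: "continuous_on I f" and I: "is_interval I" "a \<in> I" "x \<in> I" "y \<in> I" and "x <= y"
 shows "signed_integral a y f - signed_integral a x f = integral {x..y} f"
proof -
 have io: "f integrable_on {c..d}" if "c \<in> I" "d \<in> I" for c d
  using that I(1) by (intro integrable_continuous_interval continuous_on_subset[OF f])
   (meson atLeastAtMost_iff mem_is_interval_1_I subsetI)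
 note comb = hk_combine[where 'a=real and f=f]
 consider "a <= x" | "x < a" "a <= y" | "y < a" using \<open>x <= y\<close> by linarith
 then show ?thesis
 proof cases
  case 1
  have "integral {a..x} f + integral {x..y} f = integral {a..y} f"
   using 1 \<open>x <= y\<close> by (intro comb io I)
  then show ?thesis using integral_Icc_le_0[of a x] integral_Icc_le_0[of a y] 1 \<open>x <= y\<close> by (simp add: signed_integral_def)
 next
  case 2
  have "integral {x..a} f + integral {a..y} f = integral {x..y} f"
   using 2 by (intro comb io I) auto
  then show ?thesis using integral_Icc_le_0[of x a] integral_Icc_le_0[of a y] 2 by (simp add: signed_integral_def)
 next
  case 3
  have "integral {x..y} f + integral {y..a} f = integral {x..a} f"
   using 3 \<open>x <= y\<close> by (intro comb io I) auto
  then show ?thesis using integral_Icc_le_0[of x a] integral_Icc_le_0[of y a] 3 \<open>x <= y\<close> by (simp add: signed_integral_def)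
 qed
qed

lemma signed_integral_DERIV:
 assumes f: "continuous_on I f" and I: "is_interval I" "open I" "a \<in> I" "x \<in> I"
 shows "((%x. signed_integral a x f) has_real_derivative f x) (at x)"
proof -
 obtain e where e: "e > 0" "cball x e \<subseteq> I" using I(2,4) open_contains_cball by blast
 define c where "c = x - e"
 have sub: "{c..x + e} \<subseteq> I" using e by (auto simp: c_def cball_eq_atLeastAtMost)
 have cI: "c \<in> I" using sub e by (auto simp: c_def)
 have "((%u. integral {c..u} f) has_real_derivative f x) (at x within {c..x + e})"
  unfolding has_real_derivative_iff_has_vector_derivative
  by (rule integral_has_vector_derivative[OF continuous_on_subset[OF f sub]]) (use e in \<open>auto simp: c_def\<close>)
 moreover have "x \<in> interior {c..x + e}" using e by (auto simp: c_def)
 ultimately have "((%u. integral {c..u} f) has_real_derivative f x) (at x)" by (metis at_within_interior)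
 then have "((%u. signed_integral a c f + integral {c..u} f) has_real_derivative f x) (at x)"
  by (auto intro!: derivative_eq_intros)
 then show ?thesis
 proof (rule has_field_derivative_transform_within_open)
  show "open {c<..<x + e}" "x \<in> {c<..<x + e}" using e by (auto simp: c_def)
  fix y assume y: "y \<in> {c<..<x + e}"
  then have "y \<in> I" using sub by auto
  then show "signed_integral a c f + integral {c..y} f = signed_integral a y f"
   using signed_integral_diff[OF f I(1,3) cI, of y] y by auto
 qed
qed

text \<open>The stream function: mass measured from \<open>0\<close> at time \<open>t\<close>, plus
  the flux through \<open>0\<close> since \<open>T / 2\<close>. The balance of mass between
  \<open>0\<close> and \<open>x\<close> exchanges the flux through \<open>0\<close> for the flux
  through \<open>x\<close>, so the time derivative is \<open>m u_x\<close> at every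
  \<open>x\<close>, although \<open>m\<close> is only continuous.\<close>

lemma continuity_eq_potential:
 assumes ce: "continuity_eq T u m" and T: "T > 0"
  and cm: "continuous_on ({0<..<T} \<times> UNIV) (%(t, x). m t x)"
  and cu: "continuous_on ({0<..<T} \<times> UNIV) (%(t, x). dx u t x)"
 shows "\<exists>n. C1_strip {0<..<T} n (%t x. m t x * dx u t x) m"
proof -
 let ?I = "{0<..<T}"
 have cfl: "continuous_on (?I \<times> UNIV) (%(t, x). m t x * dx u t x)"
  using cm cu unfolding case_prod_beta' by (intro continuous_intros)
 define n where "n t x = signed_integral 0 x (m t) + signed_integral (T/2) t (%ta. m ta 0 * dx u ta 0)" for t x
 have T2: "T / 2 \<in> ?I" using T by simp
 have cfx: "continuous_on ?I (%ta. m ta x * dx u ta x)" for x using continuous_on_fixed_space[OF cfl] by simp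
 have nd: "n t x - n s x = integral {s..t} (%ta. m ta x * dx u ta x)" if "s \<in> ?I" "t \<in> ?I" "s <= t" for s t x
 proof -
  have 1: "signed_integral (T/2) t (%ta. m ta 0 * dx u ta 0) - signed_integral (T/2) s (%ta. m ta 0 * dx u ta 0) =
    integral {s..t} (%ta. m ta 0 * dx u ta 0)"
   using that T2 by (intro signed_integral_diff[OF cfx]) (auto simp: is_interval_oo)
  have ce': "p <= q ==> integral {p..q} (m t) - integral {p..q} (m s) =
   integral {s..t} (%ta. m ta q * dx u ta q) - integral {s..t} (%ta. m ta p * dx u ta p)" for p q
   using that by (intro continuity_eq_integrated[OF ce cm cu]) auto
  show ?thesis
  proof (cases "0 <= x")
   case True
   then have "integral {x..0} (m t) = 0" "integral {x..0} (m s) = 0"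
    using integral_Icc_le_0[of 0 x] by simp_all
   then show ?thesis using ce'[OF True] 1 by (simp add: n_def signed_integral_def)
  next
   case False
   then have "integral {0..x} (m t) = 0" "integral {0..x} (m s) = 0" by auto
   then show ?thesis using ce'[of x 0] False 1 by (simp add: n_def signed_integral_def)
  qed
 qed
 have n_eq: "n t x = n (T/2) x + signed_integral (T/2) t (%ta. m ta x * dx u ta x)" if "t \<in> ?I" for t x
 proof -
  have s0: "signed_integral (T/2) (T/2) f = 0" for f by (simp add: signed_integral_def)
  show ?thesis
  proof (cases "T/2 <= t")
   case True
   then have "integral {t..T/2} f = 0" for f :: "real => real"
    using integral_Icc_le_0[of "T/2" t] by simp
   then show ?thesis using nd[OF T2 that True, of x] by (simp add: signed_integral_def)
  next
   case False
   then show ?thesis using nd[OF that T2, of x] by (simp add: signed_integral_def)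
  qed
 qed
 show ?thesis
 proof (intro exI C1_stripI)
  fix t x assume t: "t \<in> ?I"
  show "(n t has_real_derivative m t x) (at x)"
  proof -
   have "((%x. signed_integral 0 x (m t)) has_real_derivative m t x) (at x)"
    by (rule signed_integral_DERIV[OF continuous_on_fixed_time[OF cm t, of UNIV]]) auto
   from DERIV_add[OF this DERIV_const] show ?thesis by (simp add: n_def[abs_def])
  qed
  have "((%s. n (T/2) x + signed_integral (T/2) s (%ta. m ta x * dx u ta x)) has_real_derivative m t x * dx u t x) (at t)"
  proof -
   have "((%s. signed_integral (T/2) s (%ta. m ta x * dx u ta x)) has_real_derivative m t x * dx u t x) (at t)"
    by (rule signed_integral_DERIV[OF cfx[of x] is_interval_oo open_greaterThanLessThan T2 t])
   from DERIV_add[OF DERIV_const this] show ?thesis by simp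
  qed
  then show "((%s. n s x) has_real_derivative m t x * dx u t x) (at t)"
   by (rule has_field_derivative_transform_within_open[OF _ open_greaterThanLessThan t n_eq[symmetric]])
 qed (use cm cfl in auto)
qed

section \<open>Consequences of admissibility for a single solution\<close>

lemma AE_lborel_continuous_le:
 fixes f :: "real => real"
 assumes "AE x in lborel. f x <= c" "continuous_on UNIV f"
 shows "f x <= c"
proof (rule ccontr)
 assume "\<not> f x <= c"
 then have "x \<in> {x. c < f x}" by simp
 moreover have "open {x. c < f x}" using assms(2) by (intro open_Collect_less continuous_intros)
 ultimately obtain e where e: "e > 0" "ball x e \<subseteq> {x. c < f x}" using open_contains_ball by blast
 obtain Z where Z: "{x \<in> space lborel. \<not> f x <= c} \<subseteq> Z" "emeasure lborel Z = 0" "Z \<in> sets lborel"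
  by (rule AE_E[OF assms(1)])
 have "{x - e<..<x + e} \<subseteq> Z" using e(2) Z(1) by (force simp: ball_eq_greaterThanLessThan)
 then have "emeasure lborel {x - e<..<x + e} <= emeasure lborel Z" using Z(3) by (intro emeasure_mono)
 then show False using e(1) Z(2) by simp
qed

locale admissible =
 fixes T R :: real and mT u \<mu> m
 assumes T: "T > 0" and adm: "admissible_solution 2 T R mT u \<mu> m"
begin

lemma sol: "planning_solution 2 T mT u \<mu> m" using adm by (simp add: admissible_solution_def)

lemma m_nonneg: "t \<in> {0<..T} ==> 0 <= m t x"
 and m_measurable: "t \<in> {0<..T} ==> m t \<in> borel_measurable borel"
 and mu_density: "t \<in> {0<..T} ==> \<mu> t = ldens (m t)"
 and mu_real_distribution: "t \<in> {0..T} ==> real_distribution (\<mu> t)"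
 and m_continuous: "continuous_on ({0<..<T} \<times> UNIV) (%(t, x). m t x)"
 and mu_weakly_continuous: "weakly_continuous_on {0..T} \<mu>"
 and mu_T: "\<mu> T = ldens mT" and mu_0: "\<mu> 0 = return borel 0"
 and ce: "continuity_eq T u m"
 using sol by (auto simp: planning_solution_def)

lemma u_C1: "C1_strip {0<..<T} u (dt u) (dx u)"
 using sol by (intro Ck_on_1_imp_C1_strip) (auto simp: planning_solution_def)

lemma HJ: "t \<in> {0<..<T} ==> dt u t x = 1/2 * (dx u t x)^2 - (m t x)^2"
proof -
 assume t: "t \<in> {0<..<T}"
 then have "- dt u t x + 1/2 * (dx u t x)\<^sup>2 = m t x powr 2"
  using sol by (auto simp: planning_solution_def)
 moreover have "m t x powr 2 = (m t x)^2"
  using m_nonneg[of t x] t by (cases "m t x = 0") (auto simp: powr_numeral)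
 ultimately show ?thesis by simp
qed

lemma potential: "\<exists>n. C1_strip {0<..<T} n (%t x. m t x * dx u t x) m"
 by (rule continuity_eq_potential[OF ce T m_continuous C1_stripD(5)[OF u_C1]])

lemma m_integrable:
 assumes t: "t \<in> {0<..T}"
 shows "integrable lborel (m t)" "integral\<^sup>L lborel (m t) = 1"
proof -
 interpret real_distribution "\<mu> t" using t by (intro mu_real_distribution) auto
 have "prob UNIV = 1" using prob_space by (simp only: space_eq_univ)
 then have "integrable (\<mu> t) (%x. 1 :: real)" "integral\<^sup>L (\<mu> t) (%x. 1 :: real) = 1" by auto
 moreover have "integrable (\<mu> t) (%x. 1 :: real) \<longleftrightarrow> integrable lborel (%x. m t x * 1)"
  "integral\<^sup>L (\<mu> t) (%x. 1 :: real) = (LINT x|lborel. m t x * 1)"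
  unfolding mu_density[OF t]
  by (rule integrable_real_density integral_real_density; use m_measurable[OF t] m_nonneg[OF t] in auto)+
 ultimately show "integrable lborel (m t)" "integral\<^sup>L lborel (m t) = 1"
  by (simp_all only: mult_1_right)
qed

lemma integral_mu:
 assumes t: "t \<in> {0<..T}" and f: "f \<in> borel_measurable borel"
 shows "integral\<^sup>L (\<mu> t) f = (LINT x|lborel. m t x * f x)"
 using m_measurable[OF t] m_nonneg[OF t] f by (simp add: mu_density[OF t] integral_real_density)

lemma moment: "\<exists>C>0. \<forall>t\<in>{0<..T}. integrable lborel (%x. x^2 * m t x) \<and> (LINT x|lborel. x^2 * m t x) <= C"
proof -
 obtain C where C: "C > 0" "!!t. t \<in> {0<..T} ==> (\<integral>\<^sup>+ x. ennreal (\<bar>x\<bar>^2 * m t x) \<partial>lborel) <= ennreal C"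
  using adm unfolding admissible_solution_def m_bounds_def by blast
 show ?thesis
 proof (intro exI[of _ C] conjI ballI C)
  fix t assume t: "t \<in> {0<..T}"
  have nn: "(\<integral>\<^sup>+ x. ennreal (x^2 * m t x) \<partial>lborel) <= ennreal C" using C(2)[OF t] by simp
  then show i: "integrable lborel (%x. x^2 * m t x)"
   using m_measurable[OF t] m_nonneg[OF t] by (intro integrableI_nonneg) (auto intro: le_less_trans)
  show "(LINT x|lborel. x^2 * m t x) <= C"
   using nn_integral_eq_integral[OF i] m_nonneg[OF t] nn C(1)
   by (simp add: ennreal_le_iff)
 qed
qed

lemma cube: "\<exists>C>0. \<forall>t\<in>{0<..<T}. \<forall>N. integral {- N..N} (%x. m t x ^ 3) <= C / t"
proof -
 obtain C where C: "C > 0" "!!t. t \<in> {0<..T} ==>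
   (\<integral>\<^sup>+ x. ennreal (\<bar>m t x\<bar> powr 3) \<partial>lborel) <= ennreal (C * t powr (- alpha 2 * 2))"
  using adm unfolding admissible_solution_def m_bounds_def by auto
 show ?thesis
 proof (intro exI[of _ C] conjI ballI allI C)
  fix t N assume t: "t \<in> {0<..<T}"
  have a: "t powr (- alpha 2 * 2) = 1 / t" using t by (simp add: alpha_def powr_minus_divide)
  have p3: "\<bar>m t x\<bar> powr 3 = m t x ^ 3" for x
   using m_nonneg[of t x] t by (cases "m t x = 0") (auto simp: powr_numeral)
  have nn: "(\<integral>\<^sup>+ x. ennreal (m t x ^ 3) \<partial>lborel) <= ennreal (C / t)" using C(2)[of t] t a p3 by simp
  have i: "integrable lborel (%x. m t x ^ 3)"
   using m_measurable[of t] m_nonneg[of t] t nn by (intro integrableI_nonneg) (auto intro: le_less_trans)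
  have "integral {- N..N} (%x. m t x ^ 3) = (LINT x:{- N..N}|lborel. m t x ^ 3)"
   by (rule set_borel_integral_eq_integral(2)[symmetric])
    (unfold set_integrable_def, rule integrable_mult_indicator[OF _ i], simp)
  also have "... <= (LINT x|lborel. m t x ^ 3)"
   unfolding set_lebesgue_integral_def using m_nonneg[of t] t
   by (intro integral_mono integrable_mult_indicator i) (auto simp: indicator_def)
  also have "... <= C / t"
   using nn_integral_eq_integral[OF i] m_nonneg[of t] t nn C(1) by (simp add: ennreal_le_iff)
  finally show "integral {- N..N} (%x. m t x ^ 3) <= C / t" .
 qed
qed

lemma ux_le:
 assumes "de \<in> {0<..<T}"
 shows "\<exists>C>0. \<forall>t\<in>{0<..T - de}. \<forall>x. \<bar>dx u t x\<bar> <= C * t powr (- 1/2)"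
proof -
 obtain C where C: "C > 0" "!!t. t \<in> {0<..T - de} ==>
   esssup lborel (%x. ereal \<bar>dx u t x\<bar>) <= ereal (C * t powr (alpha 2 - 1))"
  using adm assms unfolding admissible_solution_def ux_bound_def by blast
 show ?thesis
 proof (intro exI[of _ C] conjI ballI allI C)
  fix t x assume t: "t \<in> {0<..T - de}"
  have "AE x in lborel. ereal \<bar>dx u t x\<bar> <= ereal (C * t powr (alpha 2 - 1))"
   using esssup_AE by eventually_elim (rule order_trans[OF _ C(2)[OF t]])
  then have "AE x in lborel. \<bar>dx u t x\<bar> <= C * t powr (alpha 2 - 1)" by simp
  moreover have "continuous_on UNIV (%x. \<bar>dx u t x\<bar>)"
   using t assms by (intro continuous_intros continuous_on_fixed_time[OF C1_stripD(5)[OF u_C1]]) auto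
  ultimately have "\<bar>dx u t x\<bar> <= C * t powr (alpha 2 - 1)" by (rule AE_lborel_continuous_le)
  then show "\<bar>dx u t x\<bar> <= C * t powr (- 1/2)" by (simp add: alpha_def)
 qed
qed

lemma growth:
 assumes "de \<in> {0<..<T}"
 shows "\<exists>K\<ge>0. \<forall>t\<in>{de..<T}. \<forall>x. \<bar>u t x\<bar> <= K * (1 + \<bar>x\<bar>)"
proof -
 obtain K where K: "!!t x. t \<in> {de..<T} ==> \<bar>u t x / (1 + \<bar>x\<bar>)\<bar> <= K"
  using adm assms unfolding admissible_solution_def u_growth_def by blast
 show ?thesis
 proof (intro exI[of _ K] conjI ballI allI)
  show "K \<ge> 0" using order_trans[OF abs_ge_zero K[of de 0]] assms by auto
  fix t x assume "t \<in> {de..<T}"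
  from K[OF this, of x] show "\<bar>u t x\<bar> <= K * (1 + \<bar>x\<bar>)" by (simp add: abs_divide pos_divide_le_eq)
 qed
qed

lemma integrable_linear_growth:
 assumes t: "t \<in> {0<..T}" and f: "f \<in> borel_measurable borel" and K: "!!x. \<bar>f x\<bar> <= K * (1 + \<bar>x\<bar>)"
 shows "integrable lborel (%x. f x * m t x)"
proof -
 have K0: "K \<ge> 0" using order_trans[OF abs_ge_zero K[of 0]] by simp
 obtain C where C: "integrable lborel (%x. x^2 * m t x)" using moment t by blast
 have "integrable lborel (%x. K * (2 * m t x + x^2 * m t x))"
  using m_integrable(1)[OF t] C by (intro integrable_mult_right Bochner_Integration.integrable_add)
 then show ?thesis
 proof (rule Bochner_Integration.integrable_bound)
  show "(%x. f x * m t x) \<in> borel_measurable lborel" using f m_measurable[OF t] by simp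
  show "AE x in lborel. norm (f x * m t x) <= norm (K * (2 * m t x + x^2 * m t x))"
  proof (intro AE_I2)
   fix x :: real
   have "1 + \<bar>x\<bar> <= 2 + x\<^sup>2" using zero_le_power2[of "\<bar>x\<bar> - 1"] by (simp add: power2_eq_square algebra_simps)
   then have "\<bar>f x\<bar> <= K * (2 + x^2)" using K[of x] mult_left_mono[OF _ K0] by (meson order_trans)
   then have "\<bar>f x\<bar> * m t x <= K * (2 + x^2) * m t x" by (intro mult_right_mono m_nonneg[OF t])
   then show "norm (f x * m t x) <= norm (K * (2 * m t x + x^2 * m t x))"
    using m_nonneg[OF t, of x] K0 by (simp add: abs_mult algebra_simps)
  qed
 qed
qed

lemma weighted_mass_bound: "\<exists>B. \<forall>t\<in>{0<..<T}. \<forall>Q. integral {- Q..Q} (%x. (1 + \<bar>x\<bar>) * m t x) <= B"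
proof -
 obtain C where C: "!!t. t \<in> {0<..T} ==> integrable lborel (%x. x^2 * m t x) \<and> (LINT x|lborel. x^2 * m t x) <= C"
  using moment by blast
 show ?thesis
 proof (intro exI[of _ "2 + C"] ballI allI)
  fix t Q assume "t \<in> {0<..<T}"
  then have t: "t \<in> {0<..T}" by auto
  have i: "integrable lborel (%x. (1 + \<bar>x\<bar>) * m t x)"
   by (rule integrable_linear_growth[OF t, of _ 1]) auto
  have "integral {- Q..Q} (%x. (1 + \<bar>x\<bar>) * m t x) = (LINT x:{- Q..Q}|lborel. (1 + \<bar>x\<bar>) * m t x)"
   by (rule set_borel_integral_eq_integral(2)[symmetric])
    (unfold set_integrable_def, rule integrable_mult_indicator[OF _ i], simp)
  also have "... <= (LINT x|lborel. 2 * m t x + x^2 * m t x)"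
   unfolding set_lebesgue_integral_def
  proof (intro integral_mono integrable_mult_indicator i Bochner_Integration.integrable_add integrable_mult_right m_integrable(1)[OF t])
   show "integrable lborel (%x. x^2 * m t x)" using C[OF t] by blast
   fix x :: real
   have "1 + \<bar>x\<bar> <= 2 + x\<^sup>2" using zero_le_power2[of "\<bar>x\<bar> - 1"] by (simp add: power2_eq_square algebra_simps)
   then have "(1 + \<bar>x\<bar>) * m t x <= (2 + x^2) * m t x" by (intro mult_right_mono m_nonneg[OF t])
   then show "indicator {- Q..Q} x *\<^sub>R ((1 + \<bar>x\<bar>) * m t x) <= 2 * m t x + x\<^sup>2 * m t x"
    using m_nonneg[OF t, of x] by (auto simp: indicator_def algebra_simps)
  qed auto
  also have "... = 2 + (LINT x|lborel. x^2 * m t x)"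
   using m_integrable[OF t] C[OF t] by simp
  also have "... <= 2 + C" using C[OF t] by simp
  finally show "integral {- Q..Q} (%x. (1 + \<bar>x\<bar>) * m t x) <= 2 + C" .
 qed
qed

text \<open>Weak convergence gives convergence on sets with null boundary, and the limit has a
  density.\<close>

lemma interval_mass_tendsto:
 "((%t. measure (\<mu> t) {p..q}) ---> measure (\<mu> T) {p..q}) (at_left T)"
proof (rule tendsto_at_left_sequentially[OF T])
 fix S :: "nat => real" assume S: "!!n. S n < T" "!!n. 0 < S n" "S ----> T"
 have SI: "S n \<in> {0..T}" for n using S(1,2)[of n] by (auto intro: less_imp_le)
 have d: "real_distribution (\<mu> (S n))" for n using SI by (intro mu_real_distribution)
 have dT: "real_distribution (\<mu> T)" using T by (intro mu_real_distribution) auto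
 have wc: "weak_conv_m (%n. \<mu> (S n)) (\<mu> T)"
 proof (rule integral_bdd_continuous_conv_imp_weak_conv[OF d dT])
  fix f :: "real => real" assume f: "!!x. isCont f x" "!!x. \<bar>f x\<bar> <= 1"
  have "continuous_on UNIV f" "bounded (range f)"
   using f by (auto simp: continuous_on_eq_continuous_at bounded_iff)
  then have "continuous_on {0..T} (%t. integral\<^sup>L (\<mu> t) f)"
   using mu_weakly_continuous by (simp add: weakly_continuous_on_def)
  then show "(%n. integral\<^sup>L (\<mu> (S n)) f) ----> integral\<^sup>L (\<mu> T) f"
   using SI T by (intro continuous_on_tendsto_compose[OF _ S(3)]) auto
 qed
 have "emeasure (\<mu> T) (frontier {p..q}) = 0"
 proof -
  have "finite (frontier {p..q})" by (rule finite_subset[of _ "{p, q}"]) (auto simp: frontier_def)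
  then have null: "frontier {p..q} \<in> null_sets lborel" by (rule finite_imp_null_set_lborel)
  have TT: "T \<in> {0<..T}" using T by simp
  show ?thesis using null m_measurable[OF TT]
   by (auto simp: mu_density[OF TT] emeasure_density null_sets_def intro!: nn_integral_null_set)
 qed
 then show "(%n. measure (\<mu> (S n)) {p..q}) ----> measure (\<mu> T) {p..q}"
  by (intro weak_conv_imp_continuity_set_conv[OF d dT wc]) auto
qed

lemma measure_mu_interval:
 assumes t: "t \<in> {0<..<T}"
 shows "measure (\<mu> t) {p..q} = integral {p..q} (m t)"
proof -
 have t': "t \<in> {0<..T}" using t by auto
 interpret real_distribution "\<mu> t" using t by (intro mu_real_distribution) auto
 have si: "set_integrable lborel {p..q} (m t)"
  unfolding set_integrable_def by (rule integrable_mult_indicator[OF _ m_integrable(1)[OF t']]) simp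
 have "measure (\<mu> t) {p..q} = integral\<^sup>L (\<mu> t) (indicator {p..q})" by simp
 also have "... = (LINT x:{p..q}|lborel. m t x)"
  by (subst integral_mu[OF t']) (auto simp: set_lebesgue_integral_def mult.commute)
 also have "... = integral {p..q} (m t)" by (rule set_borel_integral_eq_integral(2)[OF si])
 finally show ?thesis .
qed

end

section \<open>Uniqueness\<close>

text \<open>The easy half of Kantorovich duality: any coupling of cost below \<open>e\<close> bounds
  the difference of the two integrals.\<close>

lemma wasserstein1_Lipschitz:
 fixes f :: "real => real"
 assumes W: "wasserstein1 M N < ennreal e" and L: "!!x y. \<bar>f x - f y\<bar> <= L * \<bar>x - y\<bar>" "L \<ge> 0"
  and f: "f \<in> borel_measurable borel" "integrable M f" "integrable N f"
 shows "\<bar>integral\<^sup>L M f - integral\<^sup>L N f\<bar> <= L * e"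
proof -
 obtain ga where ga: "ga \<in> couplings M N" "(\<integral>\<^sup>+ p. ennreal \<bar>fst p - snd p\<bar> \<partial>ga) < ennreal e"
  using W unfolding wasserstein1_def by (auto simp: INF_less_iff)
 have s: "sets ga = sets borel" and d: "distr ga borel fst = M" "distr ga borel snd = N"
  using ga(1) by (auto simp: couplings_def)
 have meas: "fst \<in> measurable ga (borel :: real measure)" "snd \<in> measurable ga (borel :: real measure)"
  using measurable_cong_sets[OF s refl] by (auto simp: borel_prod[symmetric])
 have i: "integrable ga (%p. f (fst p))" "integrable ga (%p. f (snd p))"
  using f(2,3) integrable_distr_eq[OF meas(1) f(1)] integrable_distr_eq[OF meas(2) f(1)] d by auto
 have md: "(%p. \<bar>fst p - snd p\<bar>) \<in> borel_measurable ga" using meas by measurable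
 have ia: "integrable ga (%p. \<bar>fst p - snd p\<bar>)"
  using ga(2) md by (intro integrableI_nonneg) (auto intro: less_trans)
 have le: "(LINT p|ga. \<bar>fst p - snd p\<bar>) <= e"
 proof -
  have "ennreal (LINT p|ga. \<bar>fst p - snd p\<bar>) < ennreal e"
   using ga(2) nn_integral_eq_integral[OF ia] by simp
  then show ?thesis by (simp add: ennreal_less_iff)
 qed
 have "integral\<^sup>L M f - integral\<^sup>L N f = (LINT p|ga. f (fst p) - f (snd p))"
  using i integral_distr[OF meas(1) f(1)] integral_distr[OF meas(2) f(1)] d by simp
 also have "\<bar>...\<bar> <= (LINT p|ga. \<bar>f (fst p) - f (snd p)\<bar>)" by (rule integral_abs_bound)
 also have "... <= (LINT p|ga. L * \<bar>fst p - snd p\<bar>)"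
  using i ia by (intro integral_mono) (auto intro: L)
 also have "... <= L * e" using le L(2) by (simp add: mult_left_mono)
 finally show ?thesis .
qed

lemma integrable_vanishing_outside:
 fixes f :: "real => real"
 assumes "continuous_on UNIV f" "!!x. x \<notin> {a..b} ==> f x = 0"
 shows "integrable lborel f"
proof -
 have "integrable lborel (%x. indicator {a..b} x *\<^sub>R f x)"
  using assms by (intro borel_integrable_compact) (auto intro: continuous_on_subset)
 moreover have "(%x. indicator {a..b} x *\<^sub>R f x) = f" using assms by (auto simp: indicator_def fun_eq_iff)
 ultimately show ?thesis by simp
qed

lemma integral_vanishing_outside:
 fixes f :: "real => real"
 assumes "integrable lborel f" "!!x. x \<notin> {a..b} ==> f x = 0"
 shows "integral\<^sup>L lborel f = integral {a..b} f"
proof -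
 have "integral\<^sup>L lborel f = (LINT x:{a..b}|lborel. f x)"
  unfolding set_lebesgue_integral_def using assms by (intro Bochner_Integration.integral_cong) (auto simp: indicator_def)
 also have "... = integral {a..b} f"
  by (rule set_borel_integral_eq_integral(2)) (unfold set_integrable_def, rule integrable_mult_indicator[OF _ assms(1)], simp)
 finally show ?thesis .
qed

lemma phi_2: "phi 2 R r = sqrt (max 0 (1/8 * (R^2 - r^2)))"
 by (simp add: phi_def alpha_def powr_half_sqrt)

lemma phi_2_continuous: "continuous_on A (phi 2 R)"
 unfolding phi_2[abs_def] by (intro continuous_intros)

lemma phi_2_outside: "\<bar>r\<bar> \<ge> \<bar>R\<bar> ==> phi 2 R r = 0"
 by (simp add: phi_2 max_def abs_le_square_iff)

context admissible
begin

text \<open>Stretching by \<open>s^(1/2)\<close> turns \<open>w\<close> into a function with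
  Lipschitz constant \<open>L s^(1/2)\<close>. The exceptional times are fixed before
  \<open>w\<close> and \<open>L\<close>, because in the application \<open>w\<close> is the
  difference of two value functions at the time \<open>s\<close> itself.\<close>

lemma self_similar_integral:
 assumes e: "e > 0"
 shows "\<forall>\<^sub>F s in at_right 0. \<forall>w L. L \<ge> 0 \<and> (\<forall>x y. \<bar>w x - w y\<bar> <= L * \<bar>x - y\<bar>) \<longrightarrow>
   \<bar>(LINT x|lborel. w x * m s x) - (LINT x|lborel. phi 2 R x * w (s powr (1/2) * x))\<bar> <= L * s powr (1/2) * e"
proof -
 have "((%s. wasserstein1
       (density lborel (%x. ennreal (s powr (1/2) * m s (s powr (1/2) * x))))
       (ldens (phi 2 R))) ---> 0) (at_right 0)"
  using adm by (simp add: admissible_solution_def self_similar_limit_def alpha_def)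
 then have 1: "\<forall>\<^sub>F s in at_right 0. wasserstein1
       (density lborel (%x. ennreal (s powr (1/2) * m s (s powr (1/2) * x))))
       (ldens (phi 2 R)) < ennreal e"
  using e by (intro order_tendstoD(2)) auto
 have 2: "\<forall>\<^sub>F s in at_right 0. s \<in> {0<..<T}"
  using T by (auto simp: eventually_at_right_field)
 from 1 2 show ?thesis
 proof eventually_elim
  case (elim s)
  show ?case
  proof (intro allI impI, elim conjE)
   fix w :: "real => real" and L assume L: "L \<ge> 0" "\<forall>x y. \<bar>w x - w y\<bar> <= L * \<bar>x - y\<bar>"
   define c where "c = s powr (1/2)"
   have c: "c > 0" using elim by (simp add: c_def)
   have s: "s \<in> {0<..T}" using elim by simp
   define f where "f x = w (c * x)" for x
   have "L-lipschitz_on UNIV w" using L by (auto simp: lipschitz_on_def dist_real_def)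
   then have cw: "continuous_on UNIV w" by (rule lipschitz_on_continuous_on)
   have cf: "continuous_on UNIV f" unfolding f_def by (intro continuous_on_compose2[OF cw] continuous_intros) auto
   have wm: "w \<in> borel_measurable borel" "f \<in> borel_measurable borel"
    using cw cf by (auto intro: borel_measurable_continuous_onI)
   have wK: "\<bar>w x\<bar> <= (\<bar>w 0\<bar> + L) * (1 + \<bar>x\<bar>)" for x
   proof -
    have "\<bar>w x\<bar> <= \<bar>w 0\<bar> + L * \<bar>x\<bar>" using L(2)[rule_format, of x 0] by simp
    also have "... <= (\<bar>w 0\<bar> + L) * (1 + \<bar>x\<bar>)" using L(1) by (simp add: algebra_simps)
    finally show ?thesis .
   qed
   have iw: "integrable lborel (%x. w x * m s x)" by (rule integrable_linear_growth[OF s wm(1) wK])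
   have mm: "(%x. c * m s (c * x)) \<in> borel_measurable borel"
    using m_measurable[OF s] by measurable
   have if1: "integrable lborel (%x. (c * m s (c * x)) * f x)"
   proof -
    have "integrable lborel (%x. w (c * x) * m s (c * x))"
     using lborel_integrable_real_affine[OF iw, of c 0] c by simp
    from integrable_mult_right[OF this, of c] show ?thesis by (simp add: f_def mult_ac)
   qed
   have eq1: "(LINT x|lborel. (c * m s (c * x)) * f x) = (LINT x|lborel. w x * m s x)"
    using lborel_integral_real_affine[of c "%x. w x * m s x" 0] c by (simp add: f_def mult_ac)
   have if2: "integrable lborel (%x. phi 2 R x * f x)"
    by (rule integrable_vanishing_outside[of _ "- \<bar>R\<bar>" "\<bar>R\<bar>"])
     (auto intro!: continuous_intros phi_2_continuous cf phi_2_outside)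
   have pm: "phi 2 R \<in> borel_measurable borel" by (intro borel_measurable_continuous_onI phi_2_continuous)
   have pn: "0 <= phi 2 R x" for x by (simp add: phi_2)
   have "\<bar>integral\<^sup>L (density lborel (%x. ennreal (c * m s (c * x)))) f - integral\<^sup>L (ldens (phi 2 R)) f\<bar> <= (L * c) * e"
   proof (rule wasserstein1_Lipschitz)
    show "wasserstein1 (density lborel (%x. ennreal (c * m s (c * x)))) (ldens (phi 2 R)) < ennreal e"
     using elim by (simp add: c_def)
    show "\<bar>f x - f y\<bar> <= (L * c) * \<bar>x - y\<bar>" for x y
     using L(2)[rule_format, of "c * x" "c * y"] c by (simp add: f_def right_diff_distrib[symmetric] abs_mult mult_ac)
    show "integrable (density lborel (%x. ennreal (c * m s (c * x)))) f"
     using if1 mm wm(2) m_nonneg[OF s] c by (subst integrable_real_density) auto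
    show "integrable (ldens (phi 2 R)) f"
     using if2 pm wm(2) pn by (subst integrable_real_density) auto
   qed (use L c wm in auto)
   also have "integral\<^sup>L (density lborel (%x. ennreal (c * m s (c * x)))) f = (LINT x|lborel. w x * m s x)"
    using mm wm(2) m_nonneg[OF s] c by (subst integral_real_density) (auto simp: eq1)
   also have "integral\<^sup>L (ldens (phi 2 R)) f = (LINT x|lborel. phi 2 R x * w (c * x))"
    using pm wm(2) pn by (subst integral_real_density) (auto simp: f_def)
   finally show "\<bar>(LINT x|lborel. w x * m s x) - (LINT x|lborel. phi 2 R x * w (s powr (1/2) * x))\<bar> <= L * s powr (1/2) * e"
    by (simp add: c_def)
  qed
 qed
qed

lemma u_measurable: "t \<in> {0<..<T} ==> u t \<in> borel_measurable borel"
 using continuous_on_fixed_time[OF C1_stripD(3)[OF u_C1]] by (intro borel_measurable_continuous_onI) auto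

end

text \<open>Deliberately asymmetric: the unprimed solution is controlled up to \<open>T\<close> and
  will be the explicit one, the primed one is merely admissible. Agreement of every solution with
  one fixed solution is already uniqueness.\<close>

locale two_solutions = A: admissible T R mT u \<mu> m + B: admissible T R mT u' \<mu>' m'
 for T R :: real and mT u \<mu> m u' \<mu>' m' +
 fixes t0 Cn N0 :: real
 assumes t0: "0 < t0" "t0 < T"
  and ux_near: "!!t x. t \<in> {t0..<T} ==> \<bar>dx u t x\<bar> <= Cn"
  and m_near: "!!t x. t \<in> {t0..<T} ==> m t x <= Cn"
  and m_support: "!!t x. t \<in> {t0..<T} ==> \<bar>x\<bar> > N0 ==> m t x = 0"
begin

section \<open>The Lasry--Lions pairing of two solutions\<close>

definition J :: "real => real" where
 "J t = (LINT x|lborel. (u t x - u' t x) * (m t x - m' t x))"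

text \<open>The dissipation rate. The first summand is \<open>(m - m') (m^2 - m'^2)\<close>,
  monotonicity of the coupling; the second is the convexity of the Hamiltonian, weighted with both
  densities.\<close>

definition E :: "real => real => real" where
 "E t x = (m t x - m' t x)^2 * (m t x + m' t x) + 1/2 * (m t x + m' t x) * (dx u t x - dx u' t x)^2"

lemma growth_at:
 assumes "t \<in> {0<..<T}"
 shows "\<exists>K. (\<forall>x. \<bar>u t x\<bar> <= K * (1 + \<bar>x\<bar>)) \<and> (\<forall>x. \<bar>u' t x\<bar> <= K * (1 + \<bar>x\<bar>))"
proof -
 obtain K1 where K1: "!!x. \<bar>u t x\<bar> <= K1 * (1 + \<bar>x\<bar>)" using A.growth[OF assms] assms by force
 obtain K2 where K2: "!!x. \<bar>u' t x\<bar> <= K2 * (1 + \<bar>x\<bar>)" using B.growth[OF assms] assms by force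
 have "K1 * (1 + \<bar>x\<bar>) <= max K1 K2 * (1 + \<bar>x\<bar>)" "K2 * (1 + \<bar>x\<bar>) <= max K1 K2 * (1 + \<bar>x\<bar>)" for x :: real
  by (intro mult_right_mono; simp)+
 with K1 K2 show ?thesis by (meson order_trans)
qed

lemma integrable_products:
 assumes t: "t \<in> {0<..<T}"
 shows "integrable lborel (%x. u t x * m t x)" "integrable lborel (%x. u t x * m' t x)"
  "integrable lborel (%x. u' t x * m t x)" "integrable lborel (%x. u' t x * m' t x)"
proof -
 obtain K where K: "!!x. \<bar>u t x\<bar> <= K * (1 + \<bar>x\<bar>)" "!!x. \<bar>u' t x\<bar> <= K * (1 + \<bar>x\<bar>)" using growth_at[OF t] by blast
 have t': "t \<in> {0<..T}" using t by auto
 show "integrable lborel (%x. u t x * m t x)" "integrable lborel (%x. u t x * m' t x)"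
  "integrable lborel (%x. u' t x * m t x)" "integrable lborel (%x. u' t x * m' t x)"
  using A.integrable_linear_growth[OF t' A.u_measurable[OF t] K(1)] B.integrable_linear_growth[OF t' A.u_measurable[OF t] K(1)]
   A.integrable_linear_growth[OF t' B.u_measurable[OF t] K(2)] B.integrable_linear_growth[OF t' B.u_measurable[OF t] K(2)]
  by auto
qed

lemma J_eq:
 assumes t: "t \<in> {0<..<T}"
 shows "integrable lborel (%x. (u t x - u' t x) * (m t x - m' t x))"
  "J t = (LINT x|lborel. u t x * m t x) - (LINT x|lborel. u t x * m' t x)
   - ((LINT x|lborel. u' t x * m t x) - (LINT x|lborel. u' t x * m' t x))"
proof -
 have eq: "(u t x - u' t x) * (m t x - m' t x) = u t x * m t x - u t x * m' t x - (u' t x * m t x - u' t x * m' t x)" for x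
  by (simp add: algebra_simps)
 show "integrable lborel (%x. (u t x - u' t x) * (m t x - m' t x))"
  unfolding eq using integrable_products[OF t] by (intro Bochner_Integration.integrable_diff)
 show "J t = (LINT x|lborel. u t x * m t x) - (LINT x|lborel. u t x * m' t x)
   - ((LINT x|lborel. u' t x * m t x) - (LINT x|lborel. u' t x * m' t x))"
  unfolding J_def eq using integrable_products[OF t] by simp
qed

lemma uniform_bounds:
 assumes st: "0 < s" "s <= t" "t < T"
 shows "\<exists>K\<ge>0. \<forall>ta\<in>{s..t}. \<forall>x. \<bar>u ta x\<bar> <= K * (1 + \<bar>x\<bar>) \<and> \<bar>u' ta x\<bar> <= K * (1 + \<bar>x\<bar>) \<and> \<bar>dx u ta x\<bar> <= K \<and> \<bar>dx u' ta x\<bar> <= K"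
proof -
 obtain K1 where K1: "K1 \<ge> 0" "!!ta x. ta \<in> {s..<T} ==> \<bar>u ta x\<bar> <= K1 * (1 + \<bar>x\<bar>)" using A.growth[of s] st by force
 obtain K2 where K2: "K2 \<ge> 0" "!!ta x. ta \<in> {s..<T} ==> \<bar>u' ta x\<bar> <= K2 * (1 + \<bar>x\<bar>)" using B.growth[of s] st by force
 obtain C1 where C1: "C1 > 0" "!!ta x. ta \<in> {0<..T - (T - t)} ==> \<bar>dx u ta x\<bar> <= C1 * ta powr (- 1/2)"
  using A.ux_le[of "T - t"] st by auto
 obtain C2 where C2: "C2 > 0" "!!ta x. ta \<in> {0<..T - (T - t)} ==> \<bar>dx u' ta x\<bar> <= C2 * ta powr (- 1/2)"
  using B.ux_le[of "T - t"] st by auto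
 define P where "P = s powr (- 1/2)"
 have P: "P \<ge> 0" by (simp add: P_def)
 define K where "K = K1 + K2 + C1 * P + C2 * P"
 have nn: "0 <= C1 * P" "0 <= C2 * P" using C1(1) C2(1) P by auto
 show ?thesis
 proof (intro exI[of _ K] conjI ballI allI)
  show "0 <= K" using K1 K2 nn by (simp add: K_def)
  fix ta x assume ta: "ta \<in> {s..t}"
  have r: "k <= K ==> k * (1 + \<bar>x\<bar>) <= K * (1 + \<bar>x\<bar>)" for k by (intro mult_right_mono) auto
  show "\<bar>u ta x\<bar> <= K * (1 + \<bar>x\<bar>)"
   using K1(2)[of ta x] ta st nn K2(1) by (intro order_trans[OF _ r[of K1]]) (auto simp: K_def)
  show "\<bar>u' ta x\<bar> <= K * (1 + \<bar>x\<bar>)"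
   using K2(2)[of ta x] ta st nn K1(1) by (intro order_trans[OF _ r[of K2]]) (auto simp: K_def)
  have p: "ta powr (- 1/2) <= P" unfolding P_def using ta st by (intro powr_mono2') auto
  have "\<bar>dx u ta x\<bar> <= C1 * P"
   using ta st C1(1) by (intro order_trans[OF C1(2) mult_left_mono[OF p]]) auto
  then show "\<bar>dx u ta x\<bar> <= K" using K1 K2 nn by (simp add: K_def)
  have "\<bar>dx u' ta x\<bar> <= C2 * P"
   using ta st C2(1) by (intro order_trans[OF C2(2) mult_left_mono[OF p]]) auto
  then show "\<bar>dx u' ta x\<bar> <= K" using K1 K2 nn by (simp add: K_def)
 qed
qed

lemma J_decreases:
 assumes st: "0 < s" "s <= t" "t < T" and q0: "q0 \<ge> 0"
 shows "J t - J s <= - integral {s..t} (%ta. integral {- q0..q0} (E ta))"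
proof -
 obtain K where K: "K \<ge> 0" "!!ta x. ta \<in> {s..t} ==> \<bar>u ta x\<bar> <= K * (1 + \<bar>x\<bar>)" "!!ta x. ta \<in> {s..t} ==> \<bar>u' ta x\<bar> <= K * (1 + \<bar>x\<bar>)"
  "!!ta x. ta \<in> {s..t} ==> \<bar>dx u ta x\<bar> <= K" "!!ta x. ta \<in> {s..t} ==> \<bar>dx u' ta x\<bar> <= K"
  using uniform_bounds[OF st] by blast
 obtain n where n: "C1_strip {0<..<T} n (%t x. m t x * dx u t x) m" using A.potential by blast
 obtain n' where n': "C1_strip {0<..<T} n' (%t x. m' t x * dx u' t x) m'" using B.potential by blast
 obtain B1 where B1: "!!t Q. t \<in> {0<..<T} ==> integral {- Q..Q} (%x. (1 + \<bar>x\<bar>) * m t x) <= B1" using A.weighted_mass_bound by blast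
 obtain B2 where B2: "!!t Q. t \<in> {0<..<T} ==> integral {- Q..Q} (%x. (1 + \<bar>x\<bar>) * m' t x) <= B2" using B.weighted_mass_bound by blast
 have sub: "{s..t} \<subseteq> {0<..<T}" using st by auto
 have eqE: "(dx u ta x - dx u' ta x) * (m ta x * dx u ta x - m' ta x * dx u' ta x) - (dt u ta x - dt u' ta x) * (m ta x - m' ta x) = E ta x"
  if "ta \<in> {s..t}" for ta x
 proof -
  have "ta \<in> {0<..<T}" using that sub by auto
  then show ?thesis
   unfolding A.HJ[OF \<open>ta \<in> {0<..<T}\<close>, of x] B.HJ[OF \<open>ta \<in> {0<..<T}\<close>, of x]
   by (simp add: E_def power2_eq_square field_simps)
 qed
 have mm: "0 <= m ta x" "0 <= m' ta x" if "ta \<in> {s..t}" for ta x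
  using that sub A.m_nonneg[of ta x] B.m_nonneg[of ta x] by auto
 have E0: "0 <= E ta x" if "ta \<in> {s..t}" for ta x using mm[OF that] by (simp add: E_def)
 have "J t - J s <= - integral {s..t} (%ta. integral {- q0..q0} (%x. (dx u ta x - dx u' ta x) * (m ta x * dx u ta x - m' ta x * dx u' ta x) - (dt u ta x - dt u' ta x) * (m ta x - m' ta x)))"
 proof (rule pairing_inequality[OF C1_strip_diff[OF A.u_C1 B.u_C1] C1_strip_diff[OF n n'] sub st(2)])
  show "continuous_on ({0<..<T} \<times> UNIV) (%(t, x). m t x + m' t x)"
   using A.m_continuous B.m_continuous unfolding case_prod_beta' by (intro continuous_intros)
  fix ta x assume ta: "ta \<in> {s..t}"
  show "0 <= m ta x + m' ta x" using mm[OF ta] by simp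
  show "\<bar>u ta x - u' ta x\<bar> <= (2 * K) * (1 + \<bar>x\<bar>)" using K(2,3)[OF ta, of x] by linarith
  have "\<bar>m ta x * dx u ta x - m' ta x * dx u' ta x\<bar> <= m ta x * \<bar>dx u ta x\<bar> + m' ta x * \<bar>dx u' ta x\<bar>"
   using mm[OF ta] by (intro order_trans[OF abs_triangle_ineq4]) (simp add: abs_mult)
  also have "... <= m ta x * K + m' ta x * K" using K(4,5)[OF ta] mm[OF ta] by (intro add_mono mult_left_mono)
  also have "... <= 2 * K * (m ta x + m' ta x)" using K(1) mm[OF ta] by (simp add: algebra_simps)
  finally show "\<bar>m ta x * dx u ta x - m' ta x * dx u' ta x\<bar> <= 2 * K * (m ta x + m' ta x)" .
  show "0 <= (dx u ta x - dx u' ta x) * (m ta x * dx u ta x - m' ta x * dx u' ta x) - (dt u ta x - dt u' ta x) * (m ta x - m' ta x)"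
   using E0[OF ta] eqE[OF ta] by simp
 next
  fix ta Q assume ta: "ta \<in> {s..t}"
  then have ta': "ta \<in> {0<..<T}" using sub by auto
  have "integral {- Q..Q} (%x. (1 + \<bar>x\<bar>) * (m ta x + m' ta x)) =
    integral {- Q..Q} (%x. (1 + \<bar>x\<bar>) * m ta x) + integral {- Q..Q} (%x. (1 + \<bar>x\<bar>) * m' ta x)"
   unfolding distrib_left
   by (intro hk_add integrable_continuous_interval continuous_intros
     continuous_on_fixed_time[OF A.m_continuous ta'] continuous_on_fixed_time[OF B.m_continuous ta'])
  then show "integral {- Q..Q} (%x. (1 + \<bar>x\<bar>) * (m ta x + m' ta x)) <= B1 + B2"
   using B1[OF ta'] B2[OF ta'] by (simp add: add_mono)
 next
  show "((%q. integral {- q..q} (%x. (u s x - u' s x) * (m s x - m' s x))) ---> J s) at_top"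
   unfolding J_def using st by (intro tendsto_integral_symmetric_interval J_eq(1)) auto
  show "((%q. integral {- q..q} (%x. (u t x - u' t x) * (m t x - m' t x))) ---> J t) at_top"
   unfolding J_def using st by (intro tendsto_integral_symmetric_interval J_eq(1)) auto
 qed (rule q0)
 also have "integral {s..t} (%ta. integral {- q0..q0} (%x. (dx u ta x - dx u' ta x) * (m ta x * dx u ta x - m' ta x * dx u' ta x) - (dt u ta x - dt u' ta x) * (m ta x - m' ta x)))
   = integral {s..t} (%ta. integral {- q0..q0} (E ta))"
  by (intro integral_cong eqE)
 finally show ?thesis .
qed

text \<open>The Lipschitz constant of \<open>u - u'\<close> grows like \<open>s^(-1/2)\<close>,
  while the densities live on the scale \<open>s^(1/2)\<close>. The product stays at
  \<open>C1 + C2\<close>, so both pairings of \<open>u - u'\<close> approach the same number, its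
  integral against the common profile.\<close>

lemma J_tendsto_0: "(J ---> 0) (at_right 0)"
proof (rule tendstoI)
 fix e :: real assume e: "e > 0"
 have T2: "T / 2 \<in> {0<..<T}" using A.T by auto
 obtain C1 where C1: "C1 > 0" "!!ta x. ta \<in> {0<..T - T/2} ==> \<bar>dx u ta x\<bar> <= C1 * ta powr (- 1/2)"
  using A.ux_le[OF T2] by blast
 obtain C2 where C2: "C2 > 0" "!!ta x. ta \<in> {0<..T - T/2} ==> \<bar>dx u' ta x\<bar> <= C2 * ta powr (- 1/2)"
  using B.ux_le[OF T2] by blast
 define d where "d = e / (4 * (C1 + C2))"
 have d: "d > 0" using e C1 C2 by (simp add: d_def)
 have ev: "\<forall>\<^sub>F s in at_right 0. s \<in> {0<..<T/2}" using A.T by (auto simp: eventually_at_right_field intro!: exI[of _ "T/2"])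
 from A.self_similar_integral[OF d] B.self_similar_integral[OF d] ev
 show "\<forall>\<^sub>F s in at_right 0. dist (J s) 0 < e"
 proof eventually_elim
  case (elim s)
  define w where "w x = u s x - u' s x" for x
  define L where "L = (C1 + C2) * s powr (- 1/2)"
  have s: "s \<in> {0<..<T}" "s \<in> {0<..T - T/2}" using elim(3) by auto
  have L0: "L \<ge> 0" using C1 C2 by (simp add: L_def)
  have lip: "\<bar>w x - w y\<bar> <= L * \<bar>x - y\<bar>" for x y
  proof -
   have "norm (w x - w y) <= L * norm (x - y)"
   proof (rule field_differentiable_bound[where S=UNIV and f'="%x. dx u s x - dx u' s x"])
    fix z
    show "(w has_real_derivative dx u s z - dx u' s z) (at z within UNIV)"
     unfolding w_def[abs_def] using C1_stripD(2)[OF A.u_C1 s(1)] C1_stripD(2)[OF B.u_C1 s(1)]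
     by (intro derivative_intros) auto
    show "norm (dx u s z - dx u' s z) <= L"
     using C1(2)[OF s(2), of z] C2(2)[OF s(2), of z] by (simp add: L_def algebra_simps)
   qed auto
   then show ?thesis by simp
  qed
  define P where "P = (LINT x|lborel. phi 2 R x * w (s powr (1/2) * x))"
  have a: "\<bar>(LINT x|lborel. w x * m s x) - P\<bar> <= L * s powr (1/2) * d"
   unfolding P_def using elim(1) L0 lip by blast
  have b: "\<bar>(LINT x|lborel. w x * m' s x) - P\<bar> <= L * s powr (1/2) * d"
   unfolding P_def using elim(2) L0 lip by blast
  have Ls: "L * s powr (1/2) = C1 + C2" using s by (simp add: L_def powr_minus field_simps)
  have "J s = (LINT x|lborel. w x * m s x) - (LINT x|lborel. w x * m' s x)"
   using integrable_products[OF s(1)] by (simp add: J_eq(2)[OF s(1)] w_def left_diff_distrib)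
  then have "\<bar>J s\<bar> <= 2 * ((C1 + C2) * d)" using a b unfolding Ls by linarith
  also have "(C1 + C2) * d = e / 4"
  proof -
   have "D * (e / (4 * D)) = e / 4" if "D \<noteq> 0" for D using that by simp
   from this[of "C1 + C2"] show ?thesis using C1(1) C2(1) unfolding d_def by linarith
  qed
  also have "2 * (e / 4) < e" using e by simp
  finally show ?case by simp
 qed
qed

text \<open>As \<open>u_x\<close> and \<open>m\<close> are bounded near \<open>T\<close>,
  \<open>u\<close> is Lipschitz in time there, and \<open>u t\<close> may be exchanged for
  \<open>u t1\<close> at one fixed earlier time. Truncated, this is a bounded continuous function,
  against which both curves converge weakly to the same terminal measure.\<close>

lemma u_pairing_tendsto_0:
 "((%t. (LINT x|lborel. u t x * m t x) - (LINT x|lborel. u t x * m' t x)) ---> 0) (at_left T)"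
proof (rule tendstoI)
 fix e :: real assume e: "e > 0"
 define C where "C = Cn^2 / 2 + Cn^2"
 have C0: "C \<ge> 0" by (simp add: C_def)
 \<comment> \<open>\<open>C\<close> bounds \<open>|u_t|\<close> by the Hamilton--Jacobi equation;
   \<open>t1\<close> is so late that twice the drift of \<open>u\<close> from then on costs at most
   \<open>e / 4\<close>.\<close>
 define t1 where "t1 = max t0 (T - e / (8 * (C + 1)))"
 have t1: "t1 \<in> {0<..<T}" "t0 <= t1" using t0 e C0 by (auto simp: t1_def)
 have small: "2 * (C * (T - t1)) <= e / 4"
 proof -
  have "T - t1 <= e / (8 * (C + 1))" by (simp add: t1_def)
  then have "C * (T - t1) <= C * (e / (8 * (C + 1)))" using C0 by (intro mult_left_mono)
  also have "... <= e / 8" using C0 e by (simp add: field_simps)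
  finally show ?thesis by simp
 qed
 obtain K where K: "!!x. \<bar>u t1 x\<bar> <= K * (1 + \<bar>x\<bar>)" using growth_at[OF t1(1)] by blast
 have K0: "K \<ge> 0" using order_trans[OF abs_ge_zero K[of 0]] by simp
 obtain M1 where M1: "M1 > 0" "!!t. t \<in> {0<..T} ==> integrable lborel (%x. x^2 * m t x) \<and> (LINT x|lborel. x^2 * m t x) <= M1"
  using A.moment by blast
 obtain M2 where M2: "M2 > 0" "!!t. t \<in> {0<..T} ==> integrable lborel (%x. x^2 * m' t x) \<and> (LINT x|lborel. x^2 * m' t x) <= M2"
  using B.moment by blast
 define Q where "Q = 2 * K^2 * (2 + M1 + M2)"
 have Q0: "Q \<ge> 0" using M1 M2 by (simp add: Q_def)
 define L where "L = 4 * Q / e + 1"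
 have L: "L > 0" using Q0 e by (simp add: L_def add_nonneg_pos)
 have QL: "Q / L <= e / 4"
 proof -
  have "Q = e / 4 * (4 * Q / e)" using e by simp
  also have "... <= e / 4 * L" using e by (intro mult_left_mono) (auto simp: L_def)
  finally show ?thesis using L by (simp add: field_simps)
 qed
 define b where "b x = max (- L) (min L (u t1 x))" for x
 have cb: "continuous_on UNIV b"
  unfolding b_def by (intro continuous_intros continuous_on_fixed_time[OF C1_stripD(3)[OF A.u_C1] t1(1)])
 have bb: "\<bar>b x\<bar> <= L" for x using L by (auto simp: b_def)
 have bm: "b \<in> borel_measurable borel" using cb by (rule borel_measurable_continuous_onI)
 \<comment> \<open>Where the truncation at \<open>L\<close> acts, \<open>|u| <= u^2 / L\<close>, and
   linear growth turns this into a second moment. The total error is \<open>Q / L\<close>, which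
   dictates the choice of \<open>L\<close>.\<close>
 have ub: "\<bar>u t1 x - b x\<bar> <= 2 * K^2 / L * (1 + x^2)" for x
 proof (cases "\<bar>u t1 x\<bar> <= L")
  case True
  then have "b x = u t1 x" by (auto simp: b_def)
  then show ?thesis using L by simp
 next
  case False
  then have "\<bar>u t1 x - b x\<bar> <= \<bar>u t1 x\<bar>" using L by (auto simp: b_def)
  also have "\<bar>u t1 x\<bar> * L <= \<bar>u t1 x\<bar> * \<bar>u t1 x\<bar>" using False by (intro mult_left_mono) auto
  then have "\<bar>u t1 x\<bar> <= \<bar>u t1 x\<bar> * \<bar>u t1 x\<bar> / L" using L by (simp add: field_simps)
  also have "\<bar>u t1 x\<bar> * \<bar>u t1 x\<bar> <= (K * (1 + \<bar>x\<bar>)) * (K * (1 + \<bar>x\<bar>))" using K[of x] K0 by (intro mult_mono) auto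
  also have "... = K^2 * (1 + \<bar>x\<bar>)^2" by (simp add: power2_eq_square mult_ac)
  also have "... <= K^2 * (2 * (1 + x^2))"
   using zero_le_power2[of "\<bar>x\<bar> - 1"] by (intro mult_left_mono) (auto simp: power2_eq_square algebra_simps)
  finally have "\<bar>u t1 x - b x\<bar> <= K^2 * (2 * (1 + x^2)) / L" using L by (simp add: divide_right_mono)
  also have "... = 2 * K^2 / L * (1 + x^2)" by simp
  finally show ?thesis .
 qed
 have tb: "((%t. integral\<^sup>L (\<mu> t) b) ---> integral\<^sup>L (\<mu> T) b) (at_left T)" "((%t. integral\<^sup>L (\<mu>' t) b) ---> integral\<^sup>L (\<mu>' T) b) (at_left T)"
 proof -
  have "bounded (range b)" using bb by (auto simp: bounded_iff)
  then have 1: "continuous_on {0..T} (%t. integral\<^sup>L (\<mu> t) b)" "continuous_on {0..T} (%t. integral\<^sup>L (\<mu>' t) b)"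
   using A.mu_weakly_continuous B.mu_weakly_continuous cb by (auto simp: weakly_continuous_on_def)
  have "at T within {0..T} = at_left T"
   using A.T by (rule at_within_Icc_at_left)
  moreover have "T \<in> {0..T}" using A.T by simp
  ultimately show "((%t. integral\<^sup>L (\<mu> t) b) ---> integral\<^sup>L (\<mu> T) b) (at_left T)" "((%t. integral\<^sup>L (\<mu>' t) b) ---> integral\<^sup>L (\<mu>' T) b) (at_left T)"
   using 1 unfolding continuous_on_def by metis+
 qed
 have "((%t. integral\<^sup>L (\<mu> t) b - integral\<^sup>L (\<mu>' t) b) ---> integral\<^sup>L (\<mu> T) b - integral\<^sup>L (\<mu>' T) b) (at_left T)"
  by (intro tendsto_intros tb)
 then have ev1: "\<forall>\<^sub>F t in at_left T. dist (integral\<^sup>L (\<mu> t) b - integral\<^sup>L (\<mu>' t) b) 0 < e / 4"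
  using e A.mu_T B.mu_T by (intro tendstoD) auto
 have ev2: "\<forall>\<^sub>F t in at_left T. t \<in> {t1<..<T}" using t1 by (auto simp: eventually_at_left_field)
 from ev1 ev2
 show "\<forall>\<^sub>F t in at_left T. dist ((LINT x|lborel. u t x * m t x) - (LINT x|lborel. u t x * m' t x)) 0 < e"
 proof eventually_elim
  case (elim t)
  have t: "t \<in> {0<..<T}" "t \<in> {0<..T}" using elim(2) t1 by auto
  have ut: "\<bar>u t x - u t1 x\<bar> <= C * (T - t1)" for x
  proof -
   have "norm (u t x - u t1 x) <= C * norm (t - t1)"
   proof (rule field_differentiable_bound[where S="{t1..t}" and f'="%s. dt u s x" and f="%s. u s x"])
    fix s assume s: "s \<in> {t1..t}"
    then have s': "s \<in> {0<..<T}" "s \<in> {t0..<T}" using t t1 by auto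
    show "((%s. u s x) has_real_derivative dt u s x) (at s within {t1..t})"
     using C1_stripD(1)[OF A.u_C1 s'(1)] by (rule has_field_derivative_at_within)
    have "(dx u s x)^2 <= Cn^2" using ux_near[OF s'(2), of x] by (intro abs_le_square_iff[THEN iffD1]) auto
    moreover have "(m s x)^2 <= Cn^2" using m_near[OF s'(2), of x] A.m_nonneg[of s x] s'(1) by (intro power_mono) auto
    ultimately show "norm (dt u s x) <= C" using A.HJ[OF s'(1), of x] zero_le_power2[of "m s x"] zero_le_power2[of "dx u s x"]
     unfolding C_def real_norm_def by linarith
   qed (use elim(2) in auto)
   also have "... <= C * (T - t1)" using elim(2) C0 by (intro mult_left_mono) auto
   finally show ?thesis by simp
  qed
  have ub2: "\<bar>u t x - b x\<bar> <= C * (T - t1) + 2 * K^2 / L * (1 + x^2)" for x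
   using ut[of x] ub[of x] by linarith
  have est: "\<bar>(LINT x|lborel. u t x * f x) - (LINT x|lborel. f x * b x)\<bar> <= C * (T - t1) + 2 * K^2 / L * (1 + M)"
   if f: "!!x. 0 <= f x" "integrable lborel f" "integral\<^sup>L lborel f = 1" "integrable lborel (%x. x^2 * f x)" "(LINT x|lborel. x^2 * f x) <= M"
    and iu: "integrable lborel (%x. u t x * f x)" for f :: "real => real" and M
  proof -
   have ib: "integrable lborel (%x. f x * b x)"
   proof (rule Bochner_Integration.integrable_bound[of _ "%x. L * f x"])
    show "integrable lborel (%x. L * f x)" using f by simp
    show "(%x. f x * b x) \<in> borel_measurable lborel" using bm f(2) by (auto dest: borel_measurable_integrable)
    show "AE x in lborel. norm (f x * b x) <= norm (L * f x)"
    proof (intro AE_I2)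
     fix x show "norm (f x * b x) <= norm (L * f x)"
      using mult_left_mono[OF bb[of x] f(1)[of x]] f(1)[of x] L by (simp add: abs_mult mult.commute)
    qed
   qed
   have "\<bar>(LINT x|lborel. u t x * f x) - (LINT x|lborel. f x * b x)\<bar> = \<bar>LINT x|lborel. u t x * f x - f x * b x\<bar>"
    using iu ib by simp
   also have "... <= (LINT x|lborel. \<bar>u t x * f x - f x * b x\<bar>)" by (rule integral_abs_bound)
   also have "... <= (LINT x|lborel. (C * (T - t1) + 2 * K^2 / L) * f x + 2 * K^2 / L * (x^2 * f x))"
   proof (rule integral_mono)
    fix x
    have "u t x * f x - f x * b x = (u t x - b x) * f x" by (simp add: algebra_simps)
    then have "\<bar>u t x * f x - f x * b x\<bar> = \<bar>u t x - b x\<bar> * f x" using f(1)[of x] by (simp add: abs_mult)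
    also have "... <= (C * (T - t1) + 2 * K^2 / L * (1 + x^2)) * f x" by (intro mult_right_mono ub2 f)
    also have "... = (C * (T - t1) + 2 * K^2 / L) * f x + 2 * K^2 / L * (x^2 * f x)"
     by (simp add: algebra_simps add_divide_distrib)
    finally show "\<bar>u t x * f x - f x * b x\<bar> <= (C * (T - t1) + 2 * K^2 / L) * f x + 2 * K^2 / L * (x^2 * f x)" .
   qed (use iu ib f in auto)
   also have "... = C * (T - t1) + 2 * K^2 / L + 2 * K^2 / L * (LINT x|lborel. x^2 * f x)" using f by simp
   also have "... <= C * (T - t1) + 2 * K^2 / L + 2 * K^2 / L * M" using f L by (intro add_left_mono mult_left_mono) auto
   finally show ?thesis by (simp add: algebra_simps add_divide_distrib)
  qed
  have 1: "\<bar>(LINT x|lborel. u t x * m t x) - (LINT x|lborel. m t x * b x)\<bar> <= C * (T - t1) + 2 * K^2 / L * (1 + M1)"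
   using M1(2)[OF t(2)] by (intro est A.m_nonneg A.m_integrable integrable_products t) auto
  have 2: "\<bar>(LINT x|lborel. u t x * m' t x) - (LINT x|lborel. m' t x * b x)\<bar> <= C * (T - t1) + 2 * K^2 / L * (1 + M2)"
   using M2(2)[OF t(2)] by (intro est B.m_nonneg B.m_integrable integrable_products t) auto
  have 3: "\<bar>(LINT x|lborel. m t x * b x) - (LINT x|lborel. m' t x * b x)\<bar> < e / 4"
   using elim(1) A.integral_mu[OF t(2) bm] B.integral_mu[OF t(2) bm] by simp
  have "2 * K^2 / L * (1 + M1) + 2 * K^2 / L * (1 + M2) = Q / L" by (simp add: Q_def algebra_simps add_divide_distrib)
  then have "\<bar>(LINT x|lborel. u t x * m t x) - (LINT x|lborel. u t x * m' t x)\<bar> < e"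
   using 1 2 3 small QL e by linarith
  then show ?case by (simp add: dist_real_def)
 qed
qed

text \<open>The flux \<open>m u_x\<close> is bounded by \<open>Cn^2\<close> near \<open>T\<close>,
  whence a linear rate. A rate is wanted because in the transport argument the number of cells grows
  as \<open>t\<close> approaches \<open>T\<close>.\<close>

lemma mass_at_T:
 assumes t: "t \<in> {t0..<T}" and pq: "p <= q"
 shows "\<bar>integral {p..q} (m t) - measure (\<mu> T) {p..q}\<bar> <= 2 * Cn^2 * (T - t)"
proof -
 have t': "t \<in> {0<..<T}" using t t0 by auto
 have le: "\<bar>integral {p..q} (m t) - measure (\<mu> r) {p..q}\<bar> <= 2 * Cn^2 * (T - t)" if r: "t < r" "r < T" for r
 proof -
  have r': "r \<in> {0<..<T}" using r t' by auto
  have sub: "{t..r} \<subseteq> {0<..<T}" using r t' by auto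
  have fb: "\<bar>integral {t..r} (%ta. m ta x * dx u ta x)\<bar> <= Cn^2 * (r - t)" for x
  proof -
   have cf: "continuous_on {t..r} (%ta. m ta x * dx u ta x)"
    using continuous_on_fixed_space[OF A.m_continuous sub] continuous_on_fixed_space[OF C1_stripD(5)[OF A.u_C1] sub]
    by (intro continuous_intros)
   have "norm (integral {t..r} (%ta. m ta x * dx u ta x)) <= integral {t..r} (%ta. Cn^2)"
   proof (intro integral_norm_bound_integral integrable_continuous_interval cf)
    fix ta assume ta: "ta \<in> {t..r}"
    then have "ta \<in> {t0..<T}" "0 <= m ta x" using t r sub A.m_nonneg[of ta x] by auto
    then have "\<bar>m ta x\<bar> * \<bar>dx u ta x\<bar> <= Cn * Cn" using m_near[of ta x] ux_near[of ta x] by (intro mult_mono) auto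
    then show "norm (m ta x * dx u ta x) <= Cn^2" by (simp add: abs_mult power2_eq_square)
   qed simp
   then show ?thesis using r by (simp add: mult.commute)
  qed
  have "integral {p..q} (m r) - integral {p..q} (m t) = integral {t..r} (%ta. m ta q * dx u ta q) - integral {t..r} (%ta. m ta p * dx u ta p)"
   using t' r pq by (intro continuity_eq_integrated[OF A.ce A.m_continuous C1_stripD(5)[OF A.u_C1]]) auto
  then have "\<bar>integral {p..q} (m t) - integral {p..q} (m r)\<bar> <= 2 * (Cn^2 * (r - t))" using fb[of p] fb[of q] by linarith
  also have "Cn^2 * (r - t) <= Cn^2 * (T - t)" using r by (intro mult_left_mono) auto
  finally show ?thesis using A.measure_mu_interval[OF r'] by simp
 qed
 have "((%r. \<bar>integral {p..q} (m t) - measure (\<mu> r) {p..q}\<bar>) ---> \<bar>integral {p..q} (m t) - measure (\<mu> T) {p..q}\<bar>) (at_left T)"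
  by (intro tendsto_intros A.interval_mass_tendsto)
 moreover have "\<forall>\<^sub>F r in at_left T. \<bar>integral {p..q} (m t) - measure (\<mu> r) {p..q}\<bar> <= 2 * Cn^2 * (T - t)"
  using le t' by (auto simp: eventually_at_left_field)
 ultimately show ?thesis by (rule tendsto_upperbound) simp
qed

text \<open>The energy balance of one solution, with \<open>w = u'\<close> and its own stream
  function: the dissipation density is \<open>m' (u'_x^2 / 2 + m'^2)\<close>. Only its sign is used,
  so the retained interval is degenerate.\<close>

lemma u'_pairing_decreases:
 assumes st: "0 < s" "s <= t" "t < T"
 shows "(LINT x|lborel. u' t x * m' t x) <= (LINT x|lborel. u' s x * m' s x)"
proof -
 obtain K where K: "K \<ge> 0" "!!ta x. ta \<in> {s..t} ==> \<bar>u' ta x\<bar> <= K * (1 + \<bar>x\<bar>)" "!!ta x. ta \<in> {s..t} ==> \<bar>dx u' ta x\<bar> <= K"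
  using uniform_bounds[OF st] by blast
 obtain n' where n': "C1_strip {0<..<T} n' (%t x. m' t x * dx u' t x) m'" using B.potential by blast
 obtain B2 where B2: "!!t Q. t \<in> {0<..<T} ==> integral {- Q..Q} (%x. (1 + \<bar>x\<bar>) * m' t x) <= B2" using B.weighted_mass_bound by blast
 have sub: "{s..t} \<subseteq> {0<..<T}" using st by auto
 have "(LINT x|lborel. u' t x * m' t x) - (LINT x|lborel. u' s x * m' s x) <=
   - integral {s..t} (%ta. integral {- 0..0} (%x. dx u' ta x * (m' ta x * dx u' ta x) - dt u' ta x * m' ta x))"
 proof (rule pairing_inequality[OF B.u_C1 n' sub st(2) B.m_continuous])
  fix ta x assume ta: "ta \<in> {s..t}"
  then have ta': "ta \<in> {0<..<T}" using sub by auto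
  show mm: "0 <= m' ta x" using B.m_nonneg ta' by auto
  show "\<bar>u' ta x\<bar> <= K * (1 + \<bar>x\<bar>)" using K(2)[OF ta] .
  show "\<bar>m' ta x * dx u' ta x\<bar> <= K * m' ta x"
   using mult_left_mono[OF K(3)[OF ta] mm] mm by (simp add: abs_mult mult.commute)
  have "dx u' ta x * (m' ta x * dx u' ta x) - dt u' ta x * m' ta x = m' ta x * (1/2 * (dx u' ta x)^2 + (m' ta x)^2)"
   unfolding B.HJ[OF ta', of x] by (simp add: power2_eq_square algebra_simps)
  also have "0 <= ..." using mm by simp
  finally show "0 <= dx u' ta x * (m' ta x * dx u' ta x) - dt u' ta x * m' ta x" .
 next
  fix ta Q assume "ta \<in> {s..t}"
  then show "integral {- Q..Q} (%x. (1 + \<bar>x\<bar>) * m' ta x) <= B2" using B2 sub by auto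
 next
  show "((%q. integral {- q..q} (%x. u' s x * m' s x)) ---> (LINT x|lborel. u' s x * m' s x)) at_top"
   using st by (intro tendsto_integral_symmetric_interval integrable_products) auto
  show "((%q. integral {- q..q} (%x. u' t x * m' t x)) ---> (LINT x|lborel. u' t x * m' t x)) at_top"
   using st by (intro tendsto_integral_symmetric_interval integrable_products) auto
 qed simp
 then show ?thesis by simp
qed

text \<open>Outside \<open>{- N..N}\<close> the growth \<open>1 + |x|\<close> is at most
  \<open>2 x^2 / N\<close>, so the second moment pays for the tail.\<close>

lemma integral_tail_bound:
 assumes r: "r \<in> {0<..<T}" and N: "N \<ge> 1" and K: "K \<ge> 0" "!!x. \<bar>u' r x\<bar> <= K * (1 + \<bar>x\<bar>)"
  and M: "integrable lborel (%x. x^2 * m' r x)" "(LINT x|lborel. x^2 * m' r x) <= M"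
 shows "integral {- N..N} (%x. m' r x * u' r x) <= (LINT x|lborel. u' r x * m' r x) + 2 * K / N * M"
proof -
 have i: "integrable lborel (%x. u' r x * m' r x)" by (rule integrable_products(4)[OF r])
 have ii: "integrable lborel (%x. indicator {- N..N} x * (u' r x * m' r x))"
  using integrable_mult_indicator[OF _ i, of "{- N..N}"] by simp
 have "integral {- N..N} (%x. m' r x * u' r x) = (LINT x:{- N..N}|lborel. u' r x * m' r x)"
  by (subst set_borel_integral_eq_integral(2)) (use ii in \<open>auto simp: set_integrable_def mult.commute\<close>)
 also have "... = (LINT x|lborel. indicator {- N..N} x * (u' r x * m' r x))" by (simp add: set_lebesgue_integral_def)
 also have "... <= (LINT x|lborel. u' r x * m' r x + 2 * K / N * (x^2 * m' r x))"
 proof (rule integral_mono)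
  show "integrable lborel (%x. u' r x * m' r x + 2 * K / N * (x^2 * m' r x))" using i M(1) by simp
  fix x
  have mm: "0 <= m' r x" using B.m_nonneg[of r x] r by auto
  show "indicator {- N..N} x * (u' r x * m' r x) <= u' r x * m' r x + 2 * K / N * (x\<^sup>2 * m' r x)"
  proof (cases "x \<in> {- N..N}")
   case True then show ?thesis using mm K N by simp
  next
   case False
   then have x: "\<bar>x\<bar> > N" by auto
   have "N * (1 + \<bar>x\<bar>) <= \<bar>x\<bar> * (2 * \<bar>x\<bar>)" using x N by (intro mult_mono) auto
   then have "1 + \<bar>x\<bar> <= 2 / N * x^2" using N by (simp add: field_simps power2_eq_square)
   then have "K * (1 + \<bar>x\<bar>) <= K * (2 / N * x^2)" using K by (intro mult_left_mono)
   then have "- u' r x <= 2 * K / N * x\<^sup>2" using K(2)[of x] by (simp add: mult_ac)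
   from mult_right_mono[OF this mm] show ?thesis using False by (simp add: mult_ac)
  qed
 qed (rule ii)
 also have "... = (LINT x|lborel. u' r x * m' r x) + 2 * K / N * (LINT x|lborel. x^2 * m' r x)" using i M(1) by simp
 also have "... <= (LINT x|lborel. u' r x * m' r x) + 2 * K / N * M" using K N by (intro add_left_mono mult_left_mono M) auto
 finally show ?thesis .
qed

text \<open>No trace of \<open>u'\<close> at \<open>T\<close> is available, only its one-sided monotonicity along paths: the mass of
 \<open>m t\<close> is sent cell by cell onto that of \<open>m' r\<close> for some \<open>r\<close> much closer to \<open>T\<close> than \<open>t\<close>.\<close>

lemma u'_pairing_small:
 assumes e: "e > 0" and t1: "t1 < T"
 shows "\<exists>t. t1 < t \<and> t0 < t \<and> t < T \<and> (LINT x|lborel. u' t x * m t x) - (LINT x|lborel. u' t x * m' t x) <= e"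
proof -
 have T2: "T / 2 \<in> {0<..<T}" using A.T by auto
 obtain K where K: "K \<ge> 0" "!!t x. t \<in> {T/2..<T} ==> \<bar>u' t x\<bar> <= K * (1 + \<bar>x\<bar>)" using B.growth[OF T2] by blast
 obtain M2 where M2: "M2 > 0" "!!t. t \<in> {0<..T} ==> integrable lborel (%x. x^2 * m' t x) \<and> (LINT x|lborel. x^2 * m' t x) <= M2"
  using B.moment by blast
 obtain Ca where Ca: "Ca > 0" "!!t N. t \<in> {0<..<T} ==> integral {- N..N} (%x. m t x ^ 3) <= Ca / t" using A.cube by blast
 obtain Cb where Cb: "Cb > 0" "!!t N. t \<in> {0<..<T} ==> integral {- N..N} (%x. m' t x ^ 3) <= Cb / t" using B.cube by blast
 define C3 where "C3 = (Ca + Cb) / (T / 2)"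
 have C3: "C3 \<ge> 0" "!!t N. t \<in> {T/2..<T} ==> integral {- N..N} (%x. m t x ^ 3) <= C3"
  "!!t N. t \<in> {T/2..<T} ==> integral {- N..N} (%x. m' t x ^ 3) <= C3"
 proof -
  show "C3 \<ge> 0" using Ca Cb A.T by (simp add: C3_def)
  fix t N assume t: "t \<in> {T/2..<T}"
  then have tt: "t \<in> {0<..<T}" using A.T by auto
  have "Ca / t <= C3" unfolding C3_def using t Ca Cb A.T by (intro frac_le) auto
  then show "integral {- N..N} (%x. m t x ^ 3) <= C3" using Ca(2)[OF tt, of N] by simp
  have "Cb / t <= C3" unfolding C3_def using t Ca Cb A.T by (intro frac_le) auto
  then show "integral {- N..N} (%x. m' t x ^ 3) <= C3" using Cb(2)[OF tt, of N] by simp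
 qed
 \<comment> \<open>Beyond the support of \<open>m t\<close>, and large enough for the tail of
   \<open>m' r\<close> to cost at most \<open>e / 2\<close>.\<close>
 define N where "N = \<bar>N0\<bar> + 1 + 4 * K * M2 / e"
 have q: "0 <= 4 * K * M2 / e" using K M2 e by simp
 have N: "N \<ge> 1" "N \<ge> N0" using q by (auto simp: N_def)
 have tail: "2 * K / N * M2 <= e / 2"
 proof -
  have "4 * K * M2 = e * (4 * K * M2 / e)" using e by simp
  also have "... <= e * N" using e by (intro mult_left_mono) (auto simp: N_def)
  finally show ?thesis using N(1) by (simp add: field_simps)
 qed
 define c where "c = 4 * N^2 + 4 * C3 + K * (1 + N) * (2 * Cn^2 + 1)"
 have c0: "c \<ge> 0" using C3(1) K N by (simp add: c_def)
 define tt where "tt = max (max t0 t1) (T / 2)"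
 have tt: "tt < T" using t0 t1 A.T by (simp add: tt_def)
 obtain k :: nat where k: "real k > max (1 / (T - tt)) (2 * c / e) + 1" using reals_Archimedean2 by blast
 have k1: "real k > 1 / (T - tt)" "real k > 2 * c / e" using k by auto
 moreover have "0 <= 2 * c / e" using c0 e by simp
 ultimately have k1: "real k \<ge> 1" "real k > 1 / (T - tt)" "real k > 2 * c / e"
  using max.cobounded2[of "2 * c / e" "1 / (T - tt)"] k by linarith+
 define d where "d = 1 / real k ^ 4"
 have d0: "d > 0" using k1 by (simp add: d_def)
 have dk: "d <= 1 / real k"
  unfolding d_def using k1 power_increasing[of 1 4 "real k"] by (intro divide_left_mono) auto
 have dT: "d < T - tt"
 proof -
  have "1 / real k < T - tt" using k1(1,2) tt by (simp add: field_simps)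
  then show ?thesis using dk by simp
 qed
 define t where "t = T - d"
 have t: "tt < t" "t < T" using dT d0 by (auto simp: t_def)
 have t': "t \<in> {0<..<T}" "t \<in> {t0..<T}" "t \<in> {T/2..<T}" using t t0 by (auto simp: tt_def)
 define n where "n = k ^ 3"
 have n: "n > 0" "real n = real k ^ 3" using k1 by (auto simp: n_def)
 define p where "p j = - N + real j * (2 * N / real n)" for j :: nat
 have pmono: "p j <= p (Suc j)" for j
 proof -
  have "real j * (2 * N / real n) <= real (Suc j) * (2 * N / real n)" using N by (intro mult_right_mono) auto
  then show ?thesis by (simp only: p_def add_left_mono)
 qed
 have muT: "\<mu>' T = \<mu> T" using A.mu_T B.mu_T by simp
 \<comment> \<open>The cell masses of \<open>m' r\<close> converge without a rate. Hence
   \<open>r\<close> is chosen after \<open>k\<close>, late enough for all \<open>n\<close> cells at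
   once; the condition \<open>t + d / 2 < r\<close> keeps the kinetic cost under control.\<close>
 have "\<forall>\<^sub>F r in at_left T. \<forall>j\<in>{..<n}. dist (measure (\<mu>' r) {p j..p (Suc j)}) (measure (\<mu>' T) {p j..p (Suc j)}) < d"
  by (intro eventually_ball_finite ballI tendstoD[OF B.interval_mass_tendsto d0]) simp
 moreover have "\<forall>\<^sub>F r in at_left T. t + d / 2 < r \<and> r < T"
  using d0 by (auto simp: eventually_at_left_field t_def intro!: exI[of _ "T - d / 2"])
 ultimately have "\<forall>\<^sub>F r in at_left T. (\<forall>j\<in>{..<n}. dist (measure (\<mu>' r) {p j..p (Suc j)}) (measure (\<mu>' T) {p j..p (Suc j)}) < d) \<and> t + d / 2 < r \<and> r < T"
  by eventually_elim simp
 from eventually_happens'[OF _ this] obtain r where r: "!!j. j < n ==> dist (measure (\<mu>' r) {p j..p (Suc j)}) (measure (\<mu>' T) {p j..p (Suc j)}) < d"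
  "t + d / 2 < r" "r < T"
  by auto
 have r': "r \<in> {0<..<T}" "r \<in> {T/2..<T}" "t < r" using r(2,3) t' d0 by auto
 have cm: "continuous_on UNIV (m t)" "continuous_on UNIV (m' r)"
  using continuous_on_fixed_time[OF A.m_continuous t'(1)] continuous_on_fixed_time[OF B.m_continuous r'(1)] by auto
 have main: "integral {- N..N} (%x. m t x * u' t x) - integral {- N..N} (%x. m' r x * u' r x) <=
   (2 * N / real n)^2 / (2 * (r - t)) + 4 * C3 * (r - t) + K * (1 + N) * real n * ((2 * Cn^2 + 1) * d)"
 proof (rule transport_estimate[OF B.u_C1 B.HJ B.m_continuous _ _ r'(3) r(3) _ n(1) cm(1) _ cm(2)])
  show "0 < N" using N by simp
  show "!!x. 0 <= m t x" "!!x. 0 <= m' r x" using A.m_nonneg B.m_nonneg t' r' by auto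
  show "!!x. \<bar>u' t x\<bar> <= K * (1 + \<bar>x\<bar>)" "!!x. \<bar>u' r x\<bar> <= K * (1 + \<bar>x\<bar>)" using K t' r' by auto
  show "integral {- N..N} (%x. m t x ^ 3) <= C3" "integral {- N..N} (%x. m' r x ^ 3) <= C3" using C3 t' r' by auto
  show "!!s. s \<in> {t..r} ==> integral {- N..N} (%x. m' s x ^ 3) <= C3" using t' r' by (intro C3) auto
  interpret mu: real_distribution "\<mu> t" using t' by (intro A.mu_real_distribution) auto
  show "integral {- N..N} (m t) <= 1" using A.measure_mu_interval[OF t'(1), of "- N" N] mu.prob_le_1 by metis
  fix j assume j: "j < n"
  have 1: "\<bar>integral {p j..p (Suc j)} (m t) - measure (\<mu> T) {p j..p (Suc j)}\<bar> <= 2 * Cn^2 * d"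
   using mass_at_T[OF t'(2) pmono] by (simp add: t_def)
  have 2: "\<bar>integral {p j..p (Suc j)} (m' r) - measure (\<mu> T) {p j..p (Suc j)}\<bar> <= d"
   using r(1)[OF j] B.measure_mu_interval[OF r'(1)] muT by (simp add: dist_real_def)
  have "\<bar>integral {p j..p (Suc j)} (m t) - integral {p j..p (Suc j)} (m' r)\<bar> <= (2 * Cn^2 + 1) * d"
   using 1 2 by (simp add: algebra_simps)
  then show "\<bar>integral {- N + real j * (2 * N / real n)..- N + real (Suc j) * (2 * N / real n)} (m t) -
     integral {- N + real j * (2 * N / real n)..- N + real (Suc j) * (2 * N / real n)} (m' r)\<bar> <= (2 * Cn\<^sup>2 + 1) * d"
   by (simp only: p_def)
 qed (use t' B.m_nonneg in auto)
 also have "... <= c / real k"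
 proof -
  have kk: "real k > 0" using k1 by simp
  have "(2 * N / real n)^2 / (2 * (r - t)) <= (2 * N / real n)^2 / d"
   using r(2) d0 by (intro divide_left_mono) (auto intro!: mult_pos_pos)
  also have "... = 4 * N^2 / real k ^ 2"
   using kk by (simp add: n(2) d_def power_divide field_simps flip: power_mult power_add)
  also have "... <= 4 * N^2 / real k"
   using kk k1 power_increasing[of 1 2 "real k"] by (intro divide_left_mono) auto
  finally have a: "(2 * N / real n)^2 / (2 * (r - t)) <= 4 * N^2 / real k" .
  have "4 * C3 * (r - t) <= 4 * C3 * (1 / real k)"
   using r(3) dk C3(1) by (intro mult_left_mono) (auto simp: t_def)
  then have b: "4 * C3 * (r - t) <= 4 * C3 / real k" by simp
  have "real n * d = 1 / real k" using kk by (simp add: n(2) d_def field_simps power3_eq_cube power4_eq_xxxx)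
  then have cc: "K * (1 + N) * real n * ((2 * Cn^2 + 1) * d) = K * (1 + N) * (2 * Cn^2 + 1) / real k"
  proof -
   have "K * (1 + N) * real n * ((2 * Cn^2 + 1) * d) = K * (1 + N) * (2 * Cn^2 + 1) * (real n * d)" by (simp add: mult_ac)
   then show ?thesis using \<open>real n * d = 1 / real k\<close> by simp
  qed
  show ?thesis unfolding cc using a b by (simp add: c_def add_divide_distrib)
 qed
 also have "... <= e / 2" using k1 e c0 by (simp add: field_simps)
 finally have f1: "integral {- N..N} (%x. m t x * u' t x) - integral {- N..N} (%x. m' r x * u' r x) <= e / 2" .
 have f2: "(LINT x|lborel. u' t x * m t x) = integral {- N..N} (%x. m t x * u' t x)"
 proof -
  have "m t x = 0" if "x \<notin> {- N..N}" for x using m_support[OF t'(2), of x] that N by auto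
  then show ?thesis using integral_vanishing_outside[OF integrable_products(3)[OF t'(1)], of "- N" N] by (simp add: mult.commute)
 qed
 have f3: "integral {- N..N} (%x. m' r x * u' r x) <= (LINT x|lborel. u' r x * m' r x) + 2 * K / N * M2"
  using M2(2)[of r] r' K by (intro integral_tail_bound N) auto
 have f4: "(LINT x|lborel. u' r x * m' r x) <= (LINT x|lborel. u' t x * m' t x)"
  using t' r' by (intro u'_pairing_decreases) auto
 have "(LINT x|lborel. u' t x * m t x) - (LINT x|lborel. u' t x * m' t x) <= e" using f1 f2 f3 f4 tail by linarith
 then show ?thesis using t by (intro exI[of _ t]) (auto simp: tt_def)
qed

text \<open>A lower bound at some times arbitrarily close to \<open>T\<close> is enough, because
  \<open>J\<close> is monotone.\<close>

lemma J_near_T: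
 assumes e: "e > 0" and t1: "t1 < T"
 shows "\<exists>t. t1 < t \<and> t < T \<and> - e <= J t"
proof -
 have "\<forall>\<^sub>F t in at_left T. dist ((LINT x|lborel. u t x * m t x) - (LINT x|lborel. u t x * m' t x)) 0 < e / 2"
  using e by (intro tendstoD[OF u_pairing_tendsto_0]) auto
 then obtain t2 where t2: "t2 < T" "!!t. t2 < t ==> t < T ==> \<bar>(LINT x|lborel. u t x * m t x) - (LINT x|lborel. u t x * m' t x)\<bar> < e / 2"
  by (auto simp: eventually_at_left_field dist_real_def)
 obtain t where t: "max t1 t2 < t" "t0 < t" "t < T" "(LINT x|lborel. u' t x * m t x) - (LINT x|lborel. u' t x * m' t x) <= e / 2"
  using u'_pairing_small[of "e / 2" "max t1 t2"] e t1 t2 by auto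
 have "t \<in> {0<..<T}" using t t0 by auto
 moreover have "\<bar>(LINT x|lborel. u t x * m t x) - (LINT x|lborel. u t x * m' t x)\<bar> < e / 2" using t by (intro t2(2)) auto
 ultimately have "- e <= J t" using J_eq(2)[of t] t(4) unfolding abs_less_iff by linarith
 then show ?thesis using t by auto
qed

text \<open>Dissipation \<open>e > 0\<close> on a compact piece would lower \<open>J\<close> by at
  least \<open>e\<close> between a time where it is below \<open>e / 4\<close> and a time where it
  is at least \<open>- e / 4\<close>.\<close>

lemma E_eq_0:
 assumes t: "t \<in> {0<..<T}"
 shows "E t x = 0"
proof -
 have cE: "continuous_on ({0<..<T} \<times> UNIV) (%(t, x). E t x)"
  unfolding E_def case_prod_beta'
  using A.m_continuous B.m_continuous C1_stripD(5)[OF A.u_C1] C1_stripD(5)[OF B.u_C1]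
  unfolding case_prod_beta' by (intro continuous_intros)
 have E0: "0 <= E ta y" if "ta \<in> {0<..<T}" for ta y
  using A.m_nonneg[of ta y] B.m_nonneg[of ta y] that by (auto simp: E_def)
 define q where "q = \<bar>x\<bar> + 1"
 define F where "F ta = integral {- q..q} (E ta)" for ta
 have cF: "continuous_on {0<..<T} F" unfolding F_def by (rule continuous_on_integral_space[OF cE])
 have F0: "0 <= F ta" if "ta \<in> {0<..<T}" for ta
  unfolding F_def using that E0
  by (intro hk_nonneg integrable_continuous_interval continuous_on_fixed_time[OF cE]) auto
 define s1 where "s1 = t / 2"
 define t2 where "t2 = (t + T) / 2"
 have st: "0 < s1" "s1 < t" "t < t2" "t2 < T" using t by (auto simp: s1_def t2_def)
 have sub: "{s1..t2} \<subseteq> {0<..<T}" using st by auto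
 define e where "e = integral {s1..t2} F"
 have "e \<ge> 0" unfolding e_def using F0 sub
  by (intro hk_nonneg integrable_continuous_interval continuous_on_subset[OF cF]) auto
 have "e <= 0"
 proof (rule ccontr)
  assume "\<not> e <= 0"
  then have e: "e > 0" by simp
  have "\<forall>\<^sub>F s in at_right 0. dist (J s) 0 < e / 4" using e by (intro tendstoD[OF J_tendsto_0]) auto
  moreover have "\<forall>\<^sub>F s in at_right 0. 0 < s \<and> s < s1" using st by (auto simp: eventually_at_right_field)
  ultimately have "\<forall>\<^sub>F s in at_right 0. dist (J s) 0 < e / 4 \<and> 0 < s \<and> s < s1" by eventually_elim simp
  from eventually_happens'[OF _ this] obtain s where s: "dist (J s) 0 < e / 4" "0 < s" "s < s1" by auto
  obtain r where r: "t2 < r" "r < T" "- (e / 4) <= J r" using J_near_T[of "e / 4" t2] e st by auto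
  have "J r - J s <= - integral {s..r} F"
   unfolding F_def using s st r by (intro J_decreases) (auto simp: q_def)
  moreover have "e <= integral {s..r} F"
   unfolding e_def using s st r F0
   by (intro integral_subset_le integrable_continuous_interval continuous_on_subset[OF cF]) auto
  ultimately show False using s(1) r(3) e by (simp add: dist_real_def abs_less_iff)
 qed
 with \<open>e \<ge> 0\<close> have "integral {s1..t2} F = 0" by (simp add: e_def)
 then have "F t = 0"
  using st sub F0 by (intro integral_eq_0_continuous_nonneg[of s1 t2 F] continuous_on_subset[OF cF]) auto
 then show ?thesis
  unfolding F_def using E0[OF t]
  by (intro integral_eq_0_continuous_nonneg[of "- q" q "E t"] continuous_on_fixed_time[OF cE t]) (auto simp: q_def)
qed

theorem solutions_agree:
 "(\<forall>t\<in>{0..T}. \<mu>' t = \<mu> t) \<and> (\<forall>t\<in>{0<..<T}. \<forall>x. m' t x = m t x \<and> (m t x > 0 \<longrightarrow> dx u' t x = dx u t x))"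
proof -
 have eq: "m' t x = m t x \<and> (m t x > 0 \<longrightarrow> dx u' t x = dx u t x)" if t: "t \<in> {0<..<T}" for t x
 proof -
  have nn: "0 <= m t x" "0 <= m' t x" using A.m_nonneg B.m_nonneg t by auto
  have 1: "0 <= (m t x - m' t x)^2 * (m t x + m' t x)" using nn by simp
  have 2: "0 <= 1/2 * (m t x + m' t x) * (dx u t x - dx u' t x)^2" using nn by simp
  have "(m t x - m' t x)^2 * (m t x + m' t x) = 0" "1/2 * (m t x + m' t x) * (dx u t x - dx u' t x)^2 = 0"
   using E_eq_0[OF t, of x] 1 2 unfolding E_def by linarith+
  then show ?thesis using nn by force
 qed
 have "\<mu>' t = \<mu> t" if "t \<in> {0..T}" for t
 proof -
  consider "t = 0" | "t = T" | "t \<in> {0<..<T}" using \<open>t \<in> {0..T}\<close> by force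
  then show ?thesis
  proof cases
   case 3
   then have "m' t = m t" using eq by auto
   then show ?thesis using A.mu_density[of t] B.mu_density[of t] 3 by auto
  qed (use A.mu_0 B.mu_0 A.mu_T B.mu_T in auto)
 qed
 with eq show ?thesis by blast
qed

end

section \<open>The Cauchy transform of the terminal density\<close>

lemma integral_strict_less:
 fixes f g :: "real => real"
 assumes "continuous_on {a..b} f" "continuous_on {a..b} g" "!!x. x \<in> {a..b} ==> f x <= g x"
  "x \<in> {a..b}" "f x < g x" "a < b"
 shows "integral {a..b} f < integral {a..b} g"
proof -
 have le: "integral {a..b} f <= integral {a..b} g"
  using assms by (intro integral_le integrable_continuous_interval) auto
 have "integral {a..b} (%x. g x - f x) = integral {a..b} g - integral {a..b} f"
  using assms by (intro hk_diff integrable_continuous_interval) auto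
 moreover have "integral {a..b} (%x. g x - f x) \<noteq> 0"
  using integral_eq_0_continuous_nonneg[of a b "%x. g x - f x" x] assms by (auto intro!: continuous_intros)
 ultimately show ?thesis using le by linarith
qed

lemma has_integral_inverse_sqrt_right:
 assumes "bt <= u" "u <= v"
 shows "((%y. 1 / sqrt (y - bt)) has_integral 2 * (sqrt (v - bt) - sqrt (u - bt))) {u..v}"
proof -
 have "((%y. 1 / sqrt (y - bt)) has_integral 2 * sqrt (v - bt) - 2 * sqrt (u - bt)) {u..v}"
 proof (rule fundamental_theorem_of_calculus_interior[OF assms(2)])
  show "continuous_on {u..v} (%y. 2 * sqrt (y - bt))" by (intro continuous_intros)
  fix y assume "y \<in> {u<..<v}"
  then have "y - bt > 0" using assms by auto
  then show "((%y. 2 * sqrt (y - bt)) has_vector_derivative 1 / sqrt (y - bt)) (at y)"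
   unfolding has_real_derivative_iff_has_vector_derivative[symmetric]
   by (auto intro!: derivative_eq_intros simp: divide_simps)
 qed
 then show ?thesis by (simp add: right_diff_distrib)
qed

lemma has_integral_inverse_sqrt_left:
 assumes "v <= bt" "u <= v"
 shows "((%y. 1 / sqrt (bt - y)) has_integral 2 * (sqrt (bt - u) - sqrt (bt - v))) {u..v}"
 using has_integral_inverse_sqrt_right[of "- bt" "- v" "- u"] assms
 by (subst has_integral_reflect_real[symmetric]) (simp add: algebra_simps)

text \<open>Chosen with \<open>kap * pi = sqrt 2\<close>: the boundary value of \<open>Im G\<close>
  from above is \<open>- pi p\<close>, so \<open>Im W\<close> becomes \<open>sqrt 2 p\<close>, and
  the total change \<open>pi\<close> of \<open>Im Lf\<close> along the real line corresponds to mass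
  one.\<close>

definition kap :: real where "kap = sqrt 2 / pi"

lemma kap_pos: "kap > 0" by (simp add: kap_def)

text \<open>A branch of the logarithm whose cut is the negative imaginary axis, so that it is continuous up to
 the real axis from above.\<close>

definition lg :: "complex => complex" where
 "lg z = Ln (- \<i> * z) + \<i> * of_real pi / 2"

lemma lg_has_derivative:
 assumes "0 < Im z \<or> Re z \<noteq> 0"
 shows "(lg has_field_derivative 1 / z) (at z)"
proof -
 have "- \<i> * z \<notin> \<real>\<^sub>\<le>\<^sub>0" using assms by (auto simp: complex_nonpos_Reals_iff)
 moreover have "z \<noteq> 0" using assms by auto
 ultimately show ?thesis unfolding lg_def
  by (auto intro!: derivative_eq_intros simp: field_simps)
qed

lemma lg_of_real_pos: "s > 0 ==> lg (of_real s) = of_real (ln s)"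
proof -
 assume s: "s > 0"
 have "Ln (of_real s * (- \<i>)) = Ln (of_real s) + Ln (- \<i>)"
  using s by (intro Ln_times_of_real) auto
 then show ?thesis using s by (simp add: lg_def mult.commute Ln_of_real)
qed

lemma lg_of_real_neg: "s < 0 ==> lg (of_real s) = of_real (ln (- s)) + \<i> * pi"
proof -
 assume s: "s < 0"
 have "Ln (of_real (- s) * \<i>) = Ln (of_real (- s)) + Ln \<i>"
  using s by (intro Ln_times_of_real) auto
 moreover have "Ln (of_real (- s)) = of_real (ln (- s))" using s by (intro Ln_of_real) auto
 moreover have "- \<i> * of_real s = of_real (- s) * \<i>" by simp
 ultimately show ?thesis using s by (simp only: lg_def) simp
qed

lemma Im_lg_bounds:
 assumes "0 <= Im z" "z \<noteq> 0"
 shows "0 <= Im (lg z)" "Im (lg z) <= pi"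
proof -
 have "\<bar>Im (Ln (- \<i> * z))\<bar> <= pi / 2"
  using assms Re_Ln_pos_le[of "- \<i> * z"] by auto
 then show "0 <= Im (lg z)" "Im (lg z) <= pi" by (auto simp: lg_def abs_le_iff)
qed

text \<open>The exponent \<open>1/2\<close> acts on both sides. The upper estimate makes
  \<open>p y / |x - y|\<close> integrable at an end point of the support and tames the singular
  integral inside; the lower one drives \<open>Nf\<close> to infinity at every point of the support,
  end points included.\<close>

locale density_data =
 fixes p :: "real => real" and a b cl C :: real
 assumes ab: "a < b" and p_nonneg: "!!x. 0 <= p x" and p_outside: "!!x. x \<notin> {a..b} ==> p x = 0"
  and p_Holder: "!!x y. \<bar>p x - p y\<bar> <= C * sqrt \<bar>x - y\<bar>"
  and p_lower: "!!x. x \<in> {a..b} ==> cl * sqrt (min (x - a) (b - x)) <= p x"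
  and cl: "cl > 0" and p_mass: "integral {a..b} p = 1"
begin

lemma C_nonneg: "C \<ge> 0"
 using order_trans[OF abs_ge_zero p_Holder[of 1 0]] by simp

lemma p_continuous: "continuous_on A p"
proof -
 have "isCont p x" for x
 proof -
  have "((%y. p y - p x) ---> 0) (at x)"
  proof (rule Lim_null_comparison)
   show "\<forall>\<^sub>F y in at x. norm (p y - p x) <= C * sqrt \<bar>y - x\<bar>" using p_Holder by simp
   have "((%y. C * sqrt \<bar>y - x\<bar>) ---> C * sqrt \<bar>x - x\<bar>) (at x)" by (intro tendsto_intros)
   then show "((%y. C * sqrt \<bar>y - x\<bar>) ---> 0) (at x)" by simp
  qed
  then show ?thesis by (simp add: isCont_def LIM_zero_iff)
 qed
 then show ?thesis by (intro continuous_at_imp_continuous_on) auto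
qed

lemma p_le_sqrt:
 assumes "x \<notin> {a<..<b}"
 shows "p y <= C * sqrt \<bar>y - x\<bar>"
proof -
 have "p x = 0"
 proof (cases "x = a \<or> x = b")
  case True
  have "p x <= C * sqrt e" if "e > 0" for e
  proof -
   define x' where "x' = (if x = a then a - e else b + e)"
   have "p x' = 0" using that ab by (intro p_outside) (auto simp: x'_def)
   moreover have "\<bar>x - x'\<bar> = e" using True that by (auto simp: x'_def)
   ultimately show ?thesis using p_Holder[of x x'] by auto
  qed
  then have "p x <= C * r" if "r > 0" for r using that by (metis real_sqrt_abs abs_of_pos zero_less_power)
  then have "p x <= 0 + r" if "r > 0" for r
  proof -
   have "p x <= C * (r / (C + 1))" using that C_nonneg by (intro \<open>!!r. r > 0 ==> p x <= C * r\<close> divide_pos_pos) auto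
   also have "... <= r" using that C_nonneg by (simp add: field_simps)
   finally show ?thesis by simp
  qed
  then show ?thesis using p_nonneg[of x] field_le_epsilon[of "p x" 0] by (metis order_antisym)
 qed (use assms p_outside in auto)
 then show ?thesis using p_Holder[of y x] by auto
qed

text \<open>Besides the open upper half plane it contains the half planes on either side of the
  support. A real foot in the exterior is thus an interior point at which \<open>G\<close> is
  holomorphic.\<close>

definition upper_dom :: "complex set" where
 "upper_dom = {z. 0 < Im z \<or> Re z < a \<or> b < Re z}"

definition G :: "complex => complex" where
 "G z = integral {a..b} (%y. of_real (p y) / (z - of_real y))"

definition G1 :: "complex => complex" where
 "G1 z = integral {a..b} (%y. - of_real (p y) / (z - of_real y)^2)"

text \<open>The quotient \<open>- Im G / Im z\<close>, extended to the real exterior, where it is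
  \<open>- G'\<close>. The non-real feet of one time form a level curve of it.\<close>

definition Nf :: "complex => real" where
 "Nf z = integral {a..b} (%y. p y / (cmod (z - of_real y))^2)"

text \<open>The logarithmic potential, an antiderivative of \<open>G\<close>. With the branch
  \<open>lg\<close> its imaginary part at a real point is \<open>pi\<close> times the mass to the
  right of that point.\<close>

definition Lf :: "complex => complex" where
 "Lf z = integral {a..b} (%y. of_real (p y) * lg (z - of_real y))"

section \<open>Derivatives of the transforms and the level function\<close>

lemma open_upper_dom: "open upper_dom"
 unfolding upper_dom_def by (intro open_Collect_disj open_Collect_less continuous_intros)

lemma upper_domD:
 assumes "z \<in> upper_dom" "y \<in> {a..b}"
 shows "z - of_real y \<noteq> 0" "0 < Im (z - of_real y) \<or> Re (z - of_real y) \<noteq> 0" "z \<noteq> of_real y"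
 using assms by (auto simp: upper_dom_def)

lemma kernel_continuous:
 "z \<in> upper_dom ==> continuous_on {a..b} (%y. of_real (p y) / (z - of_real y))"
 "z \<in> upper_dom ==> continuous_on {a..b} (%y. p y / (cmod (z - of_real y))^2)"
 by (intro continuous_intros p_continuous; use upper_domD(1,3) in auto)+

lemma G_has_derivative:
 assumes z: "z \<in> upper_dom"
 shows "(G has_field_derivative G1 z) (at z)"
proof -
 obtain r where r: "r > 0" "ball z r \<subseteq> upper_dom" using open_upper_dom z open_contains_ball by blast
 have "((%z. integral (cbox a b) (%y. of_real (p y) / (z - of_real y))) has_field_derivative
   integral (cbox a b) (%y. - of_real (p y) / (z - of_real y)^2)) (at z within ball z r)"
 proof (rule leibniz_rule_field_derivative)
  fix w y assume "w \<in> ball z r" "y \<in> cbox a b"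
  then have "w - of_real y \<noteq> 0" using r upper_domD(1)[of w y] by auto
  then show "((%w. of_real (p y) / (w - of_real y)) has_field_derivative - of_real (p y) / (w - of_real y)^2) (at w within ball z r)"
   by (auto intro!: derivative_eq_intros simp: power2_eq_square)
 next
  fix w assume "w \<in> ball z r"
  then have "w \<in> upper_dom" using r by blast
  from integrable_continuous_interval[OF kernel_continuous(1)[OF this]]
  show "(%y. of_real (p y) / (w - of_real y)) integrable_on cbox a b" by simp
 next
  have "continuous_on (ball z r \<times> cbox a b) (%x. p (snd x))"
   by (rule continuous_on_compose2[OF p_continuous[of UNIV]]) (auto intro!: continuous_intros)
  then show "continuous_on (ball z r \<times> cbox a b) (%(w, y). - of_real (p y) / (w - of_real y)^2)"
   unfolding case_prod_beta'
   by (intro continuous_intros) (use r upper_domD(1) in fastforce)+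
 qed (use r in auto)
 moreover have "at z within ball z r = at z" using r by (intro at_within_open) auto
 ultimately show ?thesis by (simp add: G_def[abs_def] G1_def)
qed

lemma Lf_has_derivative:
 assumes z: "z \<in> upper_dom"
 shows "(Lf has_field_derivative G z) (at z)"
proof -
 obtain r where r: "r > 0" "ball z r \<subseteq> upper_dom" using open_upper_dom z open_contains_ball by blast
 have cp: "continuous_on (ball z r \<times> cbox a b) (%x. p (snd x))"
  by (rule continuous_on_compose2[OF p_continuous[of UNIV]]) (auto intro!: continuous_intros)
 have "((%z. integral (cbox a b) (%y. of_real (p y) * lg (z - of_real y))) has_field_derivative
   integral (cbox a b) (%y. of_real (p y) / (z - of_real y))) (at z within ball z r)"
 proof (rule leibniz_rule_field_derivative)
  fix w y assume "w \<in> ball z r" "y \<in> cbox a b"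
  then have "0 < Im (w - of_real y) \<or> Re (w - of_real y) \<noteq> 0" using r upper_domD(2)[of w y] by auto
  note lgd = lg_has_derivative[OF this]
  have "((%w. w - of_real y) has_field_derivative 1) (at w)" by (auto intro!: derivative_eq_intros)
  from DERIV_chain2[where f=lg and g="%w. w - of_real y" and x=w and s=UNIV, OF lgd this]
  have "((%w. lg (w - of_real y)) has_field_derivative 1 / (w - of_real y)) (at w)" by simp
  from DERIV_cmult[OF this, of "of_real (p y)"]
  show "((%w. of_real (p y) * lg (w - of_real y)) has_field_derivative of_real (p y) / (w - of_real y)) (at w within ball z r)"
   by (auto intro: has_field_derivative_at_within)
 next
  fix w assume w: "w \<in> ball z r"
  then have wd: "w \<in> upper_dom" using r by blast
  have "continuous_on {a..b} (%y. lg (w - of_real y))"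
  proof (rule continuous_at_imp_continuous_on, safe)
   fix y assume "y \<in> {a..b}"
   then have "isCont lg (w - of_real y)" by (rule DERIV_isCont[OF lg_has_derivative[OF upper_domD(2)[OF wd]]])
   moreover have "isCont (%y. w - of_real y) y" by (intro continuous_intros)
   ultimately show "isCont (%y. lg (w - of_real y)) y" by (rule isCont_o2[rotated])
  qed
  then show "(%y. of_real (p y) * lg (w - of_real y)) integrable_on cbox a b"
   by (auto intro!: integrable_continuous_interval continuous_intros p_continuous)
 next
  show "continuous_on (ball z r \<times> cbox a b) (%(w, y). of_real (p y) / (w - of_real y))"
   unfolding case_prod_beta' using cp
   by (intro continuous_intros) (use r upper_domD(1) in fastforce)+
 qed (use r in auto)
 moreover have "at z within ball z r = at z" using r by (intro at_within_open) auto
 ultimately show ?thesis by (simp add: G_def Lf_def[abs_def])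
qed

lemma Nf_continuous: "continuous_on upper_dom Nf"
proof -
 have "continuous_on (upper_dom \<times> cbox a b) (%(z, y). p y / (cmod (z - of_real y))^2)"
 proof -
  have "continuous_on (upper_dom \<times> cbox a b) (%x. p (snd x))"
   by (rule continuous_on_compose2[OF p_continuous[of UNIV]]) (auto intro!: continuous_intros)
  then show ?thesis unfolding case_prod_beta' by (intro continuous_intros) (use upper_domD(1) in fastforce)+
 qed
 from integral_continuous_on_param[OF this] show ?thesis by (simp add: Nf_def[abs_def])
qed

lemma Im_G: "z \<in> upper_dom ==> Im (G z) = - Im z * Nf z"
 and Re_G: "z \<in> upper_dom ==> Re (G z) = integral {a..b} (%y. p y * (Re z - y) / (cmod (z - of_real y))^2)"
proof -
 assume z: "z \<in> upper_dom"
 have i: "(%y. of_real (p y) / (z - of_real y)) integrable_on {a..b}"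
  by (intro integrable_continuous_interval kernel_continuous z)
 have "Im (G z) = integral {a..b} (Im \<circ> (%y. of_real (p y) / (z - of_real y)))"
  unfolding G_def by (rule integral_linear[OF i bounded_linear_Im, symmetric])
 also have "... = integral {a..b} (%y. - Im z * (p y / (cmod (z - of_real y))^2))"
  by (intro integral_cong) (simp add: Im_divide cmod_power2)
 also have "... = - Im z * Nf z" unfolding Nf_def by (rule integral_mult_right)
 finally show "Im (G z) = - Im z * Nf z" .
 have "Re (G z) = integral {a..b} (Re \<circ> (%y. of_real (p y) / (z - of_real y)))"
  unfolding G_def by (rule integral_linear[OF i bounded_linear_Re, symmetric])
 also have "... = integral {a..b} (%y. p y * (Re z - y) / (cmod (z - of_real y))^2)"
  by (intro integral_cong) (simp add: Re_divide cmod_power2)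
 finally show "Re (G z) = integral {a..b} (%y. p y * (Re z - y) / (cmod (z - of_real y))^2)" .
qed

lemma p_mid: "0 < p ((a + b) / 2)"
proof -
 have "0 < cl * sqrt (min ((a + b) / 2 - a) (b - (a + b) / 2))" using cl ab by auto
 also have "... <= p ((a + b) / 2)" using ab by (intro p_lower) auto
 finally show ?thesis .
qed

lemma Nf_strict_mono:
 assumes "z \<in> upper_dom" "w \<in> upper_dom" "!!y. y \<in> {a..b} ==> cmod (z - of_real y) < cmod (w - of_real y)"
 shows "Nf w < Nf z"
 unfolding Nf_def
proof (rule integral_strict_less)
 fix y assume y: "y \<in> {a..b}"
 have "0 < cmod (z - of_real y)" using upper_domD(1)[OF assms(1) y] by simp
 then show "p y / (cmod (w - of_real y))^2 <= p y / (cmod (z - of_real y))^2"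
  using assms(3)[OF y] p_nonneg by (intro divide_left_mono power_mono) (auto intro!: mult_pos_pos)
next
 let ?y = "(a + b) / 2"
 show y: "?y \<in> {a..b}" using ab by simp
 have "0 < cmod (z - of_real ?y)" using upper_domD(1)[OF assms(1) y] by simp
 then have "(cmod (z - of_real ?y))^2 < (cmod (w - of_real ?y))^2" "0 < (cmod (z - of_real ?y))^2"
  using assms(3)[OF y] by (auto intro: power_strict_mono)
 moreover from this have "0 < (cmod (w - of_real ?y))^2" by linarith
 ultimately show "p ?y / (cmod (w - of_real ?y))^2 < p ?y / (cmod (z - of_real ?y))^2"
  using p_mid by (intro divide_strict_left_mono) (auto intro!: mult_pos_pos)
qed (use assms ab in \<open>auto intro: kernel_continuous\<close>)

lemma Nf_le:
 assumes "z \<in> upper_dom" "d > 0" "!!y. y \<in> {a..b} ==> d <= cmod (z - of_real y)"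
 shows "Nf z <= 1 / d^2"
proof -
 have "Nf z <= integral {a..b} (%y. p y / d^2)"
  unfolding Nf_def using assms p_nonneg
  by (intro integral_le integrable_continuous_interval kernel_continuous continuous_intros p_continuous divide_left_mono power_mono)
   (auto intro!: mult_pos_pos dest: upper_domD(1))
 then show ?thesis by (simp add: p_mass divide_inverse)
qed

lemma Nf_ge:
 assumes "z \<in> upper_dom" "!!y. y \<in> {a..b} ==> cmod (z - of_real y) <= d"
 shows "1 / d^2 <= Nf z"
proof -
 have d: "d > 0"
  using upper_domD(1)[OF assms(1), of a] assms(2)[of a] ab by (auto intro: less_le_trans[of 0 "cmod (z - of_real a)"])
 have "integral {a..b} (%y. p y / d^2) <= Nf z"
  unfolding Nf_def using assms p_nonneg d
  by (intro integral_le integrable_continuous_interval kernel_continuous continuous_intros p_continuous divide_left_mono power_mono)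
   (auto intro!: mult_pos_pos dest: upper_domD(1))
 then show ?thesis by (simp add: p_mass divide_inverse)
qed

lemma Nf_pos: "z \<in> upper_dom ==> 0 < Nf z"
proof -
 assume z: "z \<in> upper_dom"
 define d where "d = cmod z + \<bar>a\<bar> + \<bar>b\<bar> + 1"
 have d: "d > 0" by (simp add: d_def add_nonneg_pos)
 have "1 / d^2 <= Nf z"
 proof (rule Nf_ge[OF z])
  fix y assume "y \<in> {a..b}"
  then have "\<bar>y\<bar> <= \<bar>a\<bar> + \<bar>b\<bar>" by auto
  then show "cmod (z - of_real y) <= d" using norm_triangle_ineq4[of z "of_real y"] by (simp add: d_def)
 qed
 then show ?thesis using d by (meson less_le_trans zero_less_divide_1_iff zero_less_power)
qed

text \<open>Cauchy--Schwarz for the probability density \<open>p\<close>, in pointwise form: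
  \<open>1/s <= l/2 + 1/(2 l s^2)\<close> with the optimal weight
  \<open>l = sqrt (Nf z)\<close>.\<close>

lemma norm_G_le: "z \<in> upper_dom ==> cmod (G z) <= sqrt (Nf z)"
proof -
 assume z: "z \<in> upper_dom"
 define l where "l = sqrt (Nf z)"
 have l: "l > 0" "l * l = Nf z" using Nf_pos[OF z] by (auto simp: l_def)
 have "cmod (G z) <= integral {a..b} (%y. l / 2 * p y + 1 / (2 * l) * (p y / (cmod (z - of_real y))^2))"
  unfolding G_def
 proof (intro integral_norm_bound_integral integrable_continuous_interval kernel_continuous z continuous_intros p_continuous)
  fix y assume y: "y \<in> {a..b}"
  define s where "s = cmod (z - of_real y)"
  have s: "s > 0" using upper_domD(1)[OF z y] by (simp add: s_def)
  have "0 <= (l - 1 / s)^2" by simp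
  then have "2 * l * (1 / s) <= l * l + 1 / s^2" by (simp add: power2_eq_square algebra_simps)
  then have "(2 * l * (1 / s)) / (2 * l) <= (l * l + 1 / s^2) / (2 * l)" using l by (intro divide_right_mono) auto
  then have "1 / s <= l / 2 + 1 / (2 * l) * (1 / s^2)" using l(1) by (simp add: add_divide_distrib mult_ac)
  then have "p y * (1 / s) <= p y * (l / 2 + 1 / (2 * l) * (1 / s^2))" by (intro mult_left_mono p_nonneg)
  then show "norm (of_real (p y) / (z - of_real y)) <= l / 2 * p y + 1 / (2 * l) * (p y / (cmod (z - of_real y))^2)"
   using p_nonneg[of y] by (simp add: norm_divide s_def[symmetric] algebra_simps)
 qed
 also have "... = l / 2 + 1 / (2 * l) * Nf z"
 proof -
  have "(p has_integral 1) {a..b}"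
   unfolding p_mass[symmetric] by (intro integrable_integral integrable_continuous_interval p_continuous)
  moreover have "((%y. p y / (cmod (z - of_real y))^2) has_integral Nf z) {a..b}"
   unfolding Nf_def by (intro integrable_integral integrable_continuous_interval kernel_continuous z)
  ultimately have "((%y. l / 2 * p y + 1 / (2 * l) * (p y / (cmod (z - of_real y))^2)) has_integral l / 2 * 1 + 1 / (2 * l) * Nf z) {a..b}"
   by (intro has_integral_add has_integral_mult_right)
  from integral_unique[OF this] show ?thesis by simp
 qed
 also have "... = l" using l by (simp add: field_simps)
 finally show ?thesis by (simp add: l_def)
qed

text \<open>For \<open>z\<close> within \<open>de\<close> of a support point \<open>x\<close>, take
  the window of points at distance \<open>de\<close> to \<open>2 de\<close> from \<open>x\<close>,
  on the side of the farther end point. There \<open>p\<close> is at least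
  \<open>cl * sqrt de\<close> and \<open>z\<close> is at most \<open>4 de\<close> away, so the
  window alone contributes \<open>cl / (16 * sqrt de)\<close>.\<close>

lemma Nf_large_near_support:
 "\<exists>de>0. \<forall>z\<in>upper_dom. (\<exists>x\<in>{a..b}. cmod (z - of_real x) < de) \<longrightarrow> K < Nf z"
proof -
 define q where "q = (b - a) / 4"
 have q: "q > 0" using ab by (simp add: q_def)
 define k where "k = cl / (16 * (\<bar>K\<bar> + 1))"
 have k: "k > 0" using cl by (simp add: k_def)
 define de where "de = min (q / 2) (k^2)"
 have de: "de > 0" "2 * de <= q" "sqrt de <= k"
  using q k by (auto simp: de_def min_def intro: real_le_lsqrt)
 have big: "K < cl / (16 * sqrt de)"
 proof -
  have "K < \<bar>K\<bar> + 1" by simp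
  also have "... = cl / (16 * k)" using cl by (simp add: k_def)
  also have "... <= cl / (16 * sqrt de)" using de cl k by (intro divide_left_mono mult_left_mono mult_pos_pos) auto
  finally show ?thesis .
 qed
 have main: "cl / (16 * sqrt de) <= Nf z"
  if z: "z \<in> upper_dom" and x: "x \<in> {a..b}" "cmod (z - of_real x) < de" and uv: "v = u + de"
   and s: "!!y. y \<in> {u..v} ==> de <= \<bar>y - x\<bar> \<and> \<bar>y - x\<bar> <= 2 * de \<and> \<bar>y - x\<bar> <= y - a \<and> \<bar>y - x\<bar> <= b - y" for z x u v
 proof -
  have sub: "{u..v} \<subseteq> {a..b}" using s de by force
  have lower: "cl * sqrt de / (16 * de^2) <= p y / (cmod (z - of_real y))^2" if y: "y \<in> {u..v}" for y
  proof -
   have "cl * sqrt de <= cl * sqrt (min (y - a) (b - y))" using s[OF y] cl by (intro mult_left_mono) auto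
   also have "... <= p y" using y sub by (intro p_lower) auto
   finally have 1: "cl * sqrt de <= p y" .
   have "cmod (z - of_real y) <= cmod (z - of_real x) + \<bar>y - x\<bar>"
    using norm_triangle_ineq[of "z - of_real x" "of_real (x - y)"] norm_of_real[of "x - y", where 'a=complex]
    by (simp add: abs_minus_commute)
   also have "... <= 4 * de" using x s[OF y] by linarith
   finally have "(cmod (z - of_real y))^2 <= (4 * de)^2" by (intro power_mono) auto
   moreover have "0 < (cmod (z - of_real y))^2" using upper_domD(3)[OF z, of y] y sub by auto
   ultimately have "cl * sqrt de / (16 * de^2) <= p y / (cmod (z - of_real y))^2"
    using 1 cl de p_nonneg by (intro frac_le) (auto simp: power_mult_distrib)
   then show ?thesis .
  qed
  have "cl / (16 * sqrt de) = integral {u..v} (%y. cl * sqrt de / (16 * de^2))"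
  proof -
   have "sqrt de * sqrt de = de" using de by simp
   then have "cl * sqrt de / (16 * de^2) * de = cl / (16 * sqrt de)"
    using de by (simp add: power2_eq_square field_simps)
   moreover have "integral {u..v} (%y. c) = c * de" for c :: real using uv de by simp
   from this[of "cl * sqrt de / (16 * de^2)"] have "integral {u..v} (%y. cl * sqrt de / (16 * de^2)) = cl * sqrt de / (16 * de^2) * de" .
   ultimately show ?thesis by metis
  qed
  also have "... <= integral {u..v} (%y. p y / (cmod (z - of_real y))^2)"
   by (intro integral_le integrable_continuous_interval lower continuous_on_subset[OF kernel_continuous(2)[OF z] sub]) auto
  also have "... <= Nf z"
   unfolding Nf_def using sub p_nonneg
   by (intro integral_subset_le integrable_continuous_interval continuous_on_subset[OF kernel_continuous(2)[OF z] sub] kernel_continuous(2)[OF z]) auto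
  finally show ?thesis .
 qed
 show ?thesis
 proof (intro exI[of _ de] conjI de ballI impI)
  fix z assume z: "z \<in> upper_dom" and "\<exists>x\<in>{a..b}. cmod (z - of_real x) < de"
  then obtain x where x: "x \<in> {a..b}" "cmod (z - of_real x) < de" by blast
  have "cl / (16 * sqrt de) <= Nf z"
  proof (cases "x <= (a + b) / 2")
   case True
   then have "2 * de <= b - (x + 2 * de)" using de(2) by (simp add: q_def field_simps)
   then show ?thesis using x(1) de by (intro main[OF z x, of "x + 2 * de" "x + de"]) auto
  next
   case False
   then have "2 * de <= (x - 2 * de) - a" using de(2) by (simp add: q_def field_simps)
   then show ?thesis using x(1) de by (intro main[OF z x, of "x - de" "x - 2 * de"]) auto
  qed
  then show "K < Nf z" using big by simp
 qed
qed

text \<open>The quotient is \<open>1 - k I\<close> with \<open>I\<close> the integral of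
  \<open>p A B\<close>. Expanding \<open>|A - cnj B|^2\<close> and using that both points are on the
  level curve, its integral is \<open>2/k - 2 Re I\<close>. It is positive, since
  \<open>A = cnj B\<close> at the midpoint would make \<open>z\<close> and \<open>w\<close>
  conjugate, against \<open>Im z > 0\<close> and \<open>Im w >= 0\<close>.\<close>

lemma subordination_monotone:
 assumes z: "0 < Im z" "0 <= Im w" "w \<in> upper_dom" "z \<noteq> w" and N: "Nf z = 1 / k" "Nf w = 1 / k" and k: "k > 0"
 shows "0 < Re (((z + of_real k * G z) - (w + of_real k * G w)) / (z - w))"
proof -
 have zw: "z \<in> upper_dom" "w \<in> upper_dom" using z by (auto simp: upper_dom_def)
 define A where "A y = 1 / (z - of_real y)" for y :: real
 define B where "B y = 1 / (w - of_real y)" for y :: real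
 have nz: "z - of_real y \<noteq> 0" "w - of_real y \<noteq> 0" if "y \<in> {a..b}" for y using upper_domD(1) zw that by auto
 have cAB: "continuous_on {a..b} A" "continuous_on {a..b} B"
  unfolding A_def B_def using nz by (auto intro!: continuous_intros)
 have iG: "(%y. of_real (p y) / (z - of_real y)) integrable_on {a..b}" "(%y. of_real (p y) / (w - of_real y)) integrable_on {a..b}"
  by (intro integrable_continuous_interval kernel_continuous zw)+
 define I where "I = integral {a..b} (%y. of_real (p y) * (A y * B y))"
 have "G z - G w = integral {a..b} (%y. of_real (p y) / (z - of_real y) - of_real (p y) / (w - of_real y))"
  unfolding G_def by (rule hk_diff[OF iG, symmetric])
 also have "... = integral {a..b} (%y. (w - z) * (of_real (p y) * (A y * B y)))"
  by (intro integral_cong) (use nz in \<open>simp add: A_def B_def field_simps\<close>)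
 also have "... = (w - z) * I" by (simp add: I_def)
 finally have e: "G z - G w = (w - z) * I" .
 have "(z + of_real k * G z) - (w + of_real k * G w) = (z - w) + of_real k * (G z - G w)" by (simp add: algebra_simps)
 also have "... = (z - w) * (1 - of_real k * I)" unfolding e by (simp add: algebra_simps)
 finally have quot: "((z + of_real k * G z) - (w + of_real k * G w)) / (z - w) = 1 - of_real k * I" using z(4) by simp
 define Q where "Q y = Re (A y * B y)" for y
 have cQ: "continuous_on {a..b} Q" unfolding Q_def by (intro continuous_intros cAB)
 have "Re I = integral {a..b} (Re \<circ> (%y. of_real (p y) * (A y * B y)))"
  unfolding I_def by (rule integral_linear[OF _ bounded_linear_Re, symmetric])
   (auto intro!: integrable_continuous_interval continuous_intros cAB p_continuous)
 also have "... = integral {a..b} (%y. p y * Q y)"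
  by (rule integral_cong) (unfold o_def Q_def scaleR_conv_of_real[symmetric] scaleR_complex.sel, simp)
 finally have 1: "integral {a..b} (%y. p y * Q y) = Re I" by simp
 have 2: "integral {a..b} (%y. p y * (cmod (A y))^2) = 1 / k" "integral {a..b} (%y. p y * (cmod (B y))^2) = 1 / k"
  using N by (simp_all add: Nf_def A_def B_def norm_divide power_divide)
 have id: "p y * (cmod (A y - cnj (B y)))^2 = p y * (cmod (A y))^2 + p y * (cmod (B y))^2 - 2 * (p y * Q y)" for y
  unfolding cmod_power2 Q_def by (simp add: power2_eq_square algebra_simps)
 have int: "integral {a..b} (%y. p y * (cmod (A y - cnj (B y)))^2) = 1 / k + 1 / k - 2 * Re I"
 proof -
  have h: "(f has_integral integral {a..b} f) {a..b}" if "continuous_on {a..b} f" for f :: "real => real"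
   using that by (intro integrable_integral integrable_continuous_interval)
  have "((%y. p y * (cmod (A y))^2) has_integral 1 / k) {a..b}"
   unfolding 2(1)[symmetric] by (intro h continuous_intros cAB p_continuous)
  moreover have "((%y. p y * (cmod (B y))^2) has_integral 1 / k) {a..b}"
   unfolding 2(2)[symmetric] by (intro h continuous_intros cAB p_continuous)
  moreover have "((%y. p y * Q y) has_integral Re I) {a..b}"
   unfolding 1[symmetric] by (intro h continuous_intros cQ p_continuous)
  ultimately show ?thesis
   unfolding id by (intro integral_unique has_integral_diff has_integral_add has_integral_mult_right)
 qed
 have c: "continuous_on {a..b} (%y. p y * (cmod (A y - cnj (B y)))^2)"
  by (intro continuous_intros cAB p_continuous)
 have "0 <= integral {a..b} (%y. p y * (cmod (A y - cnj (B y)))^2)"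
  using p_nonneg by (intro hk_nonneg integrable_continuous_interval c) auto
 moreover have "integral {a..b} (%y. p y * (cmod (A y - cnj (B y)))^2) \<noteq> 0"
 proof
  assume int0: "integral {a..b} (%y. p y * (cmod (A y - cnj (B y)))^2) = 0"
  have "p ((a + b) / 2) * (cmod (A ((a + b) / 2) - cnj (B ((a + b) / 2))))^2 = 0"
  proof (rule integral_eq_0_continuous_nonneg[OF c _ int0])
   show "(a + b) / 2 \<in> {a..b}" using ab by simp
  qed (use ab p_nonneg in auto)
  then have AB: "A ((a + b) / 2) = cnj (B ((a + b) / 2))" using p_mid by simp
  have inv: "1 / A y = z - of_real y" "1 / B y = w - of_real y" for y by (simp_all add: A_def B_def)
  have "z - of_real ((a + b) / 2) = cnj (w - of_real ((a + b) / 2))"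
   unfolding inv[symmetric] AB by simp
  then have "Im (z - of_real ((a + b) / 2)) = Im (cnj (w - of_real ((a + b) / 2)))" by (rule arg_cong)
  then have "Im z = - Im w" by simp
  then show False using z by simp
 qed
 ultimately have "Re I < 1 / k" using int by linarith
 then have "k * Re I < 1" using k by (simp add: field_simps)
 then show ?thesis unfolding quot by simp
qed

section \<open>Bounds for the Cauchy transform up to the real axis\<close>

definition GB :: real where "GB = 4 * C * sqrt (b - a) + C * sqrt (b - a) * pi"

lemma p_le: "p y <= C * sqrt (b - a)"
proof (cases "y \<in> {a..b}")
 case True
 have "p y <= C * sqrt \<bar>y - a\<bar>" by (rule p_le_sqrt) auto
 also have "... <= C * sqrt (b - a)" using True C_nonneg by (intro mult_left_mono) auto
 finally show ?thesis .
qed (use p_outside C_nonneg ab in auto)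

text \<open>\<open>Im z\<close> times the kernel of \<open>Nf\<close> is a Poisson kernel, whose
  integral over an interval is at most \<open>pi\<close>; the other factor is the sup of
  \<open>p\<close>.\<close>

lemma Im_G_bound:
 assumes "0 <= Im z" "z \<in> upper_dom"
 shows "\<bar>Im (G z)\<bar> <= C * sqrt (b - a) * pi"
proof (cases "Im z = 0")
 case False
 then have et: "Im z > 0" using assms by simp
 define bt et where "bt = Re z" and "et = Im z"
 have e0: "et > 0" using et by (simp add: et_def)
 have cm: "(cmod (z - of_real y))^2 = (y - bt)^2 + et^2" for y by (simp add: cmod_power2 bt_def et_def power2_commute)
 have nn: "0 < (y - bt)^2 + et^2" for y using e0 by (simp add: add_nonneg_pos)
 have P: "((%y. et / ((y - bt)^2 + et^2)) has_integral arctan ((b - bt) / et) - arctan ((a - bt) / et)) {a..b}"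
 proof (rule fundamental_theorem_of_calculus)
  fix y assume "y \<in> {a..b}"
  have "((%y. arctan ((y - bt) / et)) has_real_derivative inverse (1 + ((y - bt) / et)^2) * (1 / et)) (at y)"
   by (rule DERIV_chain2[OF DERIV_arctan]) (use e0 in \<open>auto intro!: derivative_eq_intros\<close>)
  also have "inverse (1 + ((y - bt) / et)^2) * (1 / et) = et / ((y - bt)^2 + et^2)"
   using e0 nn[of y] by (simp add: field_simps power2_eq_square)
  finally show "((%y. arctan ((y - bt) / et)) has_vector_derivative et / ((y - bt)^2 + et^2)) (at y within {a..b})"
   by (simp add: has_real_derivative_iff_has_vector_derivative has_vector_derivative_at_within)
 qed (use ab in simp)
 have "\<bar>Im (G z)\<bar> = et * Nf z"
  using e0 Nf_pos[OF assms(2)] by (simp add: Im_G[OF assms(2)] abs_mult et_def[symmetric])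
 also have "... = integral {a..b} (%y. et * (p y / (cmod (z - of_real y))^2))"
  unfolding Nf_def by (rule integral_mult_right[symmetric])
 also have "... <= integral {a..b} (%y. C * sqrt (b - a) * (et / ((y - bt)^2 + et^2)))"
 proof (intro integral_le integrable_continuous_interval continuous_intros kernel_continuous assms)
  fix y
  have "p y * (et / ((y - bt)^2 + et^2)) <= C * sqrt (b - a) * (et / ((y - bt)^2 + et^2))"
   using e0 nn[of y] by (intro mult_right_mono p_le) auto
  then show "et * (p y / (cmod (z - of_real y))^2) <= C * sqrt (b - a) * (et / ((y - bt)^2 + et^2))" by (simp add: cm mult.commute)
 qed (use e0 upper_domD(3)[OF assms(2)] p_continuous in auto)
 also have "... = C * sqrt (b - a) * (arctan ((b - bt) / et) - arctan ((a - bt) / et))"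
  by (rule integral_unique[OF has_integral_mult_right[OF P]])
 also have "... <= C * sqrt (b - a) * pi"
  using C_nonneg ab arctan_ubound[of "(b - bt) / et"] arctan_lbound[of "(a - bt) / et"] by (intro mult_left_mono) auto
 finally show ?thesis .
qed (use Im_G[OF assms(2)] C_nonneg ab in auto)

text \<open>A principal value estimate with majorant \<open>C / sqrt |bt - y|\<close>. Left and
  right of the support \<open>p\<close> itself has the required Hoelder bound, because it vanishes
  at the nearer end point; above the support the value \<open>p bt\<close> is subtracted.\<close>

lemma Re_G_bound:
 assumes "0 <= Im z" "z \<in> upper_dom"
 shows "\<bar>Re (G z)\<bar> <= 4 * C * sqrt (b - a)"
proof -
 define bt et where "bt = Re z" and "et = Im z"
 define D where "D = b - a"
 have D: "D > 0" using ab by (simp add: D_def)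
 have cm: "(cmod (z - of_real y))^2 = (bt - y)^2 + et^2" for y by (simp add: cmod_power2 bt_def et_def)
 have RG: "Re (G z) = integral {a..b} (%y. p y * (bt - y) / ((bt - y)^2 + et^2))"
  using Re_G[OF assms(2)] by (simp add: cm bt_def[symmetric])
 have kern: "\<bar>k * (bt - y) / ((bt - y)^2 + et^2)\<bar> <= C * (1 / sqrt \<bar>bt - y\<bar>)" if "\<bar>k\<bar> <= C * sqrt \<bar>bt - y\<bar>" for k y
 proof (cases "bt = y")
  case True then show ?thesis by simp
 next
  case False
  define s where "s = \<bar>bt - y\<bar>"
  have s: "s > 0" using False by (simp add: s_def)
  have "\<bar>k * (bt - y) / ((bt - y)^2 + et^2)\<bar> = \<bar>k\<bar> * s / (s^2 + et^2)" by (simp add: abs_mult s_def)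
  also have "... <= C * sqrt s * s / s^2"
   using that s C_nonneg by (intro frac_le mult_right_mono) (auto simp: s_def[symmetric])
  also have "... = C * (1 / sqrt s)" using s by (simp add: power2_eq_square field_simps)
  finally show ?thesis by (simp add: s_def)
 qed
 have c1: "continuous_on A (%y. k y * (bt - y) / ((bt - y)^2 + et^2))" if "continuous_on A k" "!!y. y \<in> A ==> bt \<noteq> y \<or> et \<noteq> 0" for A and k :: "real => real"
  using that by (intro continuous_intros) (auto simp: sum_power2_eq_zero_iff)
 consider "bt < a" | "bt > b" | "bt \<in> {a..b}" by fastforce
 then show ?thesis
 proof cases
  case 1
  have "\<bar>Re (G z)\<bar> <= integral {a..b} (%y. C * (1 / sqrt (y - bt)))"
   unfolding RG real_norm_def[symmetric]
  proof (intro integral_norm_bound_integral integrable_continuous_interval c1 p_continuous)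
   show "continuous_on {a..b} (%y. C * (1 / sqrt (y - bt)))" using 1 by (intro continuous_intros) auto
   fix y assume y: "y \<in> {a..b}"
   have "\<bar>p y\<bar> <= C * sqrt \<bar>bt - y\<bar>" using p_le_sqrt[of bt y] p_nonneg[of y] 1 by (auto simp: abs_minus_commute)
   from kern[OF this] show "norm (p y * (bt - y) / ((bt - y)^2 + et^2)) <= C * (1 / sqrt (y - bt))" using 1 y by simp
  qed (use 1 in auto)
  also have "... = C * (2 * (sqrt (b - bt) - sqrt (a - bt)))"
   by (rule integral_unique[OF has_integral_mult_right[OF has_integral_inverse_sqrt_right]]) (use 1 ab in auto)
  also have "sqrt (b - bt) - sqrt (a - bt) <= sqrt D" using sqrt_add_le_add_sqrt[of D "a - bt"] D 1 by (simp add: D_def)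
  finally show ?thesis using C_nonneg D by (simp add: D_def mult_left_mono)
 next
  case 2
  have "\<bar>Re (G z)\<bar> <= integral {a..b} (%y. C * (1 / sqrt (bt - y)))"
   unfolding RG real_norm_def[symmetric]
  proof (intro integral_norm_bound_integral integrable_continuous_interval c1 p_continuous)
   show "continuous_on {a..b} (%y. C * (1 / sqrt (bt - y)))" using 2 by (intro continuous_intros) auto
   fix y assume y: "y \<in> {a..b}"
   have "\<bar>p y\<bar> <= C * sqrt \<bar>bt - y\<bar>" using p_le_sqrt[of bt y] p_nonneg[of y] 2 by (auto simp: abs_minus_commute)
   from kern[OF this] show "norm (p y * (bt - y) / ((bt - y)^2 + et^2)) <= C * (1 / sqrt (bt - y))" using 2 y by simp
  qed (use 2 in auto)
  also have "... = C * (2 * (sqrt (bt - a) - sqrt (bt - b)))"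
   by (rule integral_unique[OF has_integral_mult_right[OF has_integral_inverse_sqrt_left]]) (use 2 ab in auto)
  also have "sqrt (bt - a) - sqrt (bt - b) <= sqrt D" using sqrt_add_le_add_sqrt[of D "bt - b"] D 2 by (simp add: D_def)
  finally show ?thesis using C_nonneg D by (simp add: D_def mult_left_mono)
 next
  case 3
  then have e0: "et > 0" using assms(2) by (auto simp: upper_dom_def bt_def et_def)
  have e0': "0 < (bt - y)^2 + et^2" for y using e0 by (simp add: add_nonneg_pos)
  let ?k = "%y. (bt - y) / ((bt - y)^2 + et^2)"
  \<comment> \<open>The larger interval is symmetric about \<open>bt\<close>, where the kernel is
    odd. Subtracting the constant \<open>p bt\<close> is therefore free and leaves the Hoelder
    quotient.\<close>
  have sub: "{a..b} \<subseteq> {bt - D..bt + D}" using 3 by (auto simp: D_def)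
  have odd: "(?k has_integral 0) {bt - D..bt + D}"
  proof -
   have "(?k has_integral (- ln ((bt - (bt + D))\<^sup>2 + et\<^sup>2) / 2) - (- ln ((bt - (bt - D))\<^sup>2 + et\<^sup>2) / 2)) {bt - D..bt + D}"
   proof (rule fundamental_theorem_of_calculus)
    fix y assume "y \<in> {bt - D..bt + D}"
    have "((%y. - ln ((bt - y)^2 + et^2) / 2) has_real_derivative ?k y) (at y)"
    proof -
     have "((%y. (bt - y)^2 + et^2) has_real_derivative - 2 * (bt - y)) (at y)"
      by (auto intro!: derivative_eq_intros)
     from DERIV_chain2[OF DERIV_ln_divide[OF e0'] this]
     have lnd: "((%y. ln ((bt - y)\<^sup>2 + et\<^sup>2)) has_real_derivative 1 / ((bt - y)\<^sup>2 + et\<^sup>2) * (- 2 * (bt - y))) (at y)" .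
     have "- (1 / Q * (- 2 * c)) / 2 = c / Q" for Q c :: real by simp
     then show ?thesis by (rule DERIV_cong[OF DERIV_cdivide[OF DERIV_minus[OF lnd]]])
    qed
    then show "((%y. - ln ((bt - y)^2 + et^2) / 2) has_vector_derivative ?k y) (at y within {bt - D..bt + D})"
     by (simp add: has_real_derivative_iff_has_vector_derivative has_vector_derivative_at_within)
   qed (use D in simp)
   then show ?thesis by simp
  qed
  have i0: "((%y. p y * (bt - y) / ((bt - y)^2 + et^2)) has_integral Re (G z)) {a..b}"
   unfolding RG by (intro integrable_integral integrable_continuous_interval c1 p_continuous) (use e0 in auto)
  have i1: "((%y. p y * (bt - y) / ((bt - y)^2 + et^2)) has_integral Re (G z)) {bt - D..bt + D}"
   using sub by (intro has_integral_on_superset[OF i0]) (auto simp: p_outside)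
  have i2: "((%y. (p y - p bt) * (bt - y) / ((bt - y)^2 + et^2)) has_integral Re (G z)) {bt - D..bt + D}"
  proof -
   have eq: "(u - v) * c / Q = u * c / Q - v * (c / Q)" for u v c Q :: real
    by (simp add: left_diff_distrib diff_divide_distrib)
   show ?thesis unfolding eq using has_integral_diff[OF i1 has_integral_mult_right[OF odd, of "p bt"]] by (simp only: mult_zero_right diff_zero)
  qed
  have r1: "((%y. 1 / sqrt (y - bt)) has_integral 2 * sqrt D) {bt..bt + D}"
   using has_integral_inverse_sqrt_right[of bt bt "bt + D"] D by simp
  have l1: "((%y. 1 / sqrt (bt - y)) has_integral 2 * sqrt D) {bt - D..bt}"
   using has_integral_inverse_sqrt_left[of bt bt "bt - D"] D by simp
  have r2: "((%y. 1 / sqrt \<bar>bt - y\<bar>) has_integral 2 * sqrt D) {bt..bt + D}"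
   by (rule has_integral_eq[OF _ r1]) auto
  have l2: "((%y. 1 / sqrt \<bar>bt - y\<bar>) has_integral 2 * sqrt D) {bt - D..bt}"
   by (rule has_integral_eq[OF _ l1]) auto
  have "((%y. 1 / sqrt \<bar>bt - y\<bar>) has_integral 2 * sqrt D + 2 * sqrt D) {bt - D..bt + D}"
   by (rule has_integral_combine[OF _ _ l2 r2]) (use D in auto)
  from has_integral_mult_right[OF this, of C]
  have ib: "((%y. C * (1 / sqrt \<bar>bt - y\<bar>)) has_integral 4 * C * sqrt D) {bt - D..bt + D}" by (simp add: algebra_simps)
  have "\<bar>Re (G z)\<bar> = norm (integral {bt - D..bt + D} (%y. (p y - p bt) * (bt - y) / ((bt - y)^2 + et^2)))"
   using i2 by (simp add: integral_unique)
  also have "... <= integral {bt - D..bt + D} (%y. C * (1 / sqrt \<bar>bt - y\<bar>))"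
  proof (rule integral_norm_bound_integral)
   fix y
   have "\<bar>p y - p bt\<bar> <= C * sqrt \<bar>bt - y\<bar>" using p_Holder[of y bt] by (simp add: abs_minus_commute)
   from kern[OF this] show "norm ((p y - p bt) * (bt - y) / ((bt - y)^2 + et^2)) <= C * (1 / sqrt \<bar>bt - y\<bar>)" by simp
  qed (use i2 ib in auto)
  also have "... = 4 * C * sqrt D" using ib by (rule integral_unique)
  finally show ?thesis by (simp add: D_def)
 qed
qed

lemma G_bounded: "0 <= Im z ==> z \<in> upper_dom ==> cmod (G z) <= GB"
 using cmod_le[of "G z"] Im_G_bound[of z] Re_G_bound[of z] by (simp add: GB_def)

end

section \<open>Characteristics outside the support\<close>

lemma abs_ln_le:
 fixes s :: real
 assumes "s > 0"
 shows "\<bar>ln s\<bar> <= 2 * (1 / sqrt s) + s"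
proof (cases "s \<ge> 1")
 case True
 then have "ln s <= s" "0 <= ln s" using ln_le_minus_one[of s] by auto
 then show ?thesis using assms by (simp add: add_increasing)
next
 case False
 have "ln (1 / sqrt s) <= 1 / sqrt s - 1" using assms by (intro ln_le_minus_one) auto
 moreover have "ln (1 / sqrt s) = - ln s / 2" using assms by (simp add: ln_div ln_sqrt)
 ultimately have "- ln s <= 2 * (1 / sqrt s)" by simp
 moreover have "ln s <= 0" using False assms by simp
 ultimately show ?thesis using assms by linarith
qed

text \<open>Reaches the end point \<open>bt = b\<close>, where the kernels are singular:
  integrability there comes from dominated convergence along \<open>bt + 1 / (n + 1)\<close>. The
  majorant may depend on an upper bound \<open>M\<close> for \<open>bt\<close>, as the logarithm is
  unbounded at infinity.\<close>

lemma continuous_on_integral_dominated: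
 fixes k :: "real => real => real"
 assumes int: "!!bt. b < bt ==> k bt integrable_on {a..b}"
  and bound: "!!bt M y. b <= bt ==> bt <= M ==> y \<in> {a..b} ==> \<bar>k bt y\<bar> <= h M y"
  and h: "!!M. h M integrable_on {a..b}"
  and cont: "!!y. y \<in> {a..b} ==> continuous_on {b..} (%bt. k bt y)"
 shows "!!bt. b <= bt ==> k bt integrable_on {a..b}" "continuous_on {b..} (%bt. integral {a..b} (k bt))"
proof -
 have lim: "k bt integrable_on {a..b} \<and> (%n. integral {a..b} (k (x n))) ----> integral {a..b} (k bt)"
  if x: "!!n. k (x n) integrable_on {a..b}" "!!n. b <= x n" "x ----> bt" "b <= bt" for x :: "nat => real" and bt
 proof -
  obtain M where M: "!!n. \<bar>x n\<bar> <= M" using convergent_imp_Bseq[of x] x(3) by (auto simp: convergent_def Bseq_def)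
  have cv: "(%n. k (x n) y) ----> k bt y" if "y \<in> {a..b}" for y
   using x by (intro continuous_on_tendsto_compose[OF cont[OF that]]) auto
  have bd: "norm (k (x n) y) <= h M y" if "y \<in> {a..b}" for n y
   using bound[OF x(2) _ that, of n M] M[of n] by auto
  show ?thesis using dominated_convergence[OF x(1) h bd cv] by auto
 qed
 show i: "k bt integrable_on {a..b}" if "b <= bt" for bt
 proof -
  have 1: "(%n. bt + inverse (real (Suc n))) ----> bt" using LIMSEQ_inverse_real_of_nat_add by simp
  have 2: "b < bt + inverse (real (Suc n))" for n
   using that by (intro le_less_trans[OF that]) simp
  have "b <= bt + inverse (real (Suc n))" for n using 2[of n] by (rule less_imp_le)
  from lim[OF int[OF 2] this 1 that] show ?thesis by (rule conjunct1)
 qed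
 show "continuous_on {b..} (%bt. integral {a..b} (k bt))"
  unfolding continuous_on_sequentially comp_def
  by (intro allI ballI impI lim[THEN conjunct2]) (auto intro: i)
qed

context density_data
begin

lemma real_in_upper_dom: "b < bt ==> of_real bt \<in> upper_dom" "bt < a ==> of_real bt \<in> upper_dom"
 by (auto simp: upper_dom_def)

definition gr :: "real => real" where "gr bt = integral {a..b} (%y. p y / (bt - y))"
definition lr :: "real => real" where "lr bt = integral {a..b} (%y. p y * ln (bt - y))"

lemma p_b: "p b = 0" using p_le_sqrt[of b b] p_nonneg[of b] by simp

lemma inverse_sqrt_integrable: "(%y. 1 / sqrt (b - y)) integrable_on {a..b}"
 using has_integral_inverse_sqrt_left[of b b a] ab by auto

lemma gr_props: "b <= bt ==> (%y. p y / (bt - y)) integrable_on {a..b}" "continuous_on {b..} gr"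
proof -
 have bd: "\<bar>p y / (bt - y)\<bar> <= C * (1 / sqrt (b - y))" if "b <= bt" "y \<in> {a..b}" for bt y
 proof (cases "y = b")
  case False
  then have y: "b - y > 0" using that by simp
  have "\<bar>p y / (bt - y)\<bar> = p y / (bt - y)" using p_nonneg[of y] y that by simp
  also have "... <= C * sqrt (b - y) / (b - y)"
   using p_le_sqrt[of b y] p_nonneg[of y] y that C_nonneg by (intro frac_le) (auto simp: abs_minus_commute)
  also have "... = C * (sqrt (b - y) / (b - y))" by simp
  also have "sqrt (b - y) / (b - y) = 1 / sqrt (b - y)"
  proof -
   have "sqrt s / s = 1 / sqrt s" if "s > 0" for s :: real
    using that real_sqrt_mult_self[of s] by (simp add: field_simps)
   from this[OF y] show ?thesis .
  qed
  finally show ?thesis .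
 qed (use p_b in simp)
 have ct: "continuous_on {b..} (%bt. p y / (bt - y))" if "y \<in> {a..b}" for y
 proof (cases "y = b")
  case False
  then show ?thesis using that by (intro continuous_intros) auto
 qed (use p_b in simp)
 have int: "(%y. p y / (bt - y)) integrable_on {a..b}" if "b < bt" for bt
  using that by (intro integrable_continuous_interval continuous_intros p_continuous) auto
 have h: "(%y. C * (1 / sqrt (b - y))) integrable_on {a..b}"
  using inverse_sqrt_integrable by (rule integrable_on_mult_right)
 note D = continuous_on_integral_dominated[where k="%bt y. p y / (bt - y)" and h="%M y. C * (1 / sqrt (b - y))", OF int bd h ct]
 show "b <= bt ==> (%y. p y / (bt - y)) integrable_on {a..b}" using D(1) by blast
 show "continuous_on {b..} gr" unfolding gr_def[abs_def] using D(2) by blast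
qed

lemma lr_props: "b <= bt ==> (%y. p y * ln (bt - y)) integrable_on {a..b}" "continuous_on {b..} lr"
proof -
 define P where "P = C * sqrt (b - a)"
 have P: "0 <= P" using C_nonneg ab by (simp add: P_def)
 have bd: "\<bar>p y * ln (bt - y)\<bar> <= P * 2 * (1 / sqrt (b - y)) + P * (M - a)" if "b <= bt" "bt <= M" "y \<in> {a..b}" for bt y M
 proof (cases "y = b")
  case False
  then have y: "b - y > 0" using that by simp
  have "\<bar>p y * ln (bt - y)\<bar> = p y * \<bar>ln (bt - y)\<bar>" using p_nonneg[of y] by (simp add: abs_mult)
  also have "... <= P * (2 * (1 / sqrt (bt - y)) + (bt - y))"
   using p_le[of y] P y that unfolding P_def[symmetric] by (intro mult_mono abs_ln_le) auto
  also have "... <= P * (2 * (1 / sqrt (b - y)) + (M - a))"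
   using P y that by (intro mult_left_mono add_mono) (auto intro!: divide_left_mono mult_pos_pos)
  finally show ?thesis by (simp add: algebra_simps)
 qed (use p_b P that ab in simp)
 have ct: "continuous_on {b..} (%bt. p y * ln (bt - y))" if "y \<in> {a..b}" for y
 proof (cases "y = b")
  case False
  then show ?thesis using that by (intro continuous_intros) auto
 qed (use p_b in simp)
 have int: "(%y. p y * ln (bt - y)) integrable_on {a..b}" if "b < bt" for bt
  using that by (intro integrable_continuous_interval continuous_intros p_continuous) auto
 have h: "(%y. P * 2 * (1 / sqrt (b - y)) + P * (M - a)) integrable_on {a..b}" for M
  using inverse_sqrt_integrable by (intro integrable_add integrable_on_mult_right) auto
 note D = continuous_on_integral_dominated[where k="%bt y. p y * ln (bt - y)" and h="%M y. P * 2 * (1 / sqrt (b - y)) + P * (M - a)", OF int bd h ct]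
 show "b <= bt ==> (%y. p y * ln (bt - y)) integrable_on {a..b}" using D(1) by blast
 show "continuous_on {b..} lr" unfolding lr_def[abs_def] using D(2) by blast
qed

lemma G_real: "b <= bt ==> G (of_real bt) = of_real (gr bt)"
proof -
 assume "b <= bt"
 from integral_linear[OF gr_props(1)[OF this] bounded_linear_of_real[where 'a=complex]]
 show ?thesis by (simp add: G_def gr_def o_def)
qed

lemma Lf_real: "b <= bt ==> Lf (of_real bt) = of_real (lr bt)"
proof -
 assume b: "b <= bt"
 have "Lf (of_real bt) = integral {a..b} (%y. of_real (p y * ln (bt - y)))"
  unfolding Lf_def
 proof (rule integral_cong)
  fix y assume y: "y \<in> {a..b}"
  show "of_real (p y) * lg (of_real bt - of_real y) = (of_real (p y * ln (bt - y)) :: complex)"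
  proof (cases "y < bt")
   case True
   then show ?thesis using lg_of_real_pos[of "bt - y"] by simp
  next
   case False
   then have "y = b" using y b by auto
   then show ?thesis by (simp add: p_b)
  qed
 qed
 also have "... = of_real (lr bt)"
  using integral_linear[OF lr_props(1)[OF b] bounded_linear_of_real[where 'a=complex]] by (simp add: lr_def o_def)
 finally show ?thesis .
qed

lemma gr_DERIV: "b < bt ==> (gr has_real_derivative - Nf (of_real bt)) (at bt)"
proof -
 assume b: "b < bt"
 have pc: "continuous_on ({b<..} \<times> cbox a b) (%z. p (snd z))"
  by (rule continuous_on_compose2[OF p_continuous[of UNIV]]) (auto intro!: continuous_intros)
 have "((%x. integral (cbox a b) (%y. p y / (x - y))) has_field_derivative integral (cbox a b) (%y. - p y / (bt - y)^2)) (at bt within {b<..})"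
 proof (rule leibniz_rule_field_derivative)
  fix x y assume xy: "x \<in> {b<..}" "y \<in> cbox a b"
  then show "((%x. p y / (x - y)) has_field_derivative - p y / (x - y)^2) (at x within {b<..})"
   by (auto intro!: derivative_eq_intros simp: power2_eq_square)
 next
  fix x assume "x \<in> {b<..}" then show "(%y. p y / (x - y)) integrable_on cbox a b" using gr_props(1)[of x] by simp
 next
  show "continuous_on ({b<..} \<times> cbox a b) (%(x, y). - p y / (x - y)^2)"
   unfolding case_prod_beta' by (intro continuous_intros pc) auto
 qed (use b in auto)
 moreover have "integral (cbox a b) (%y. - p y / (bt - y)\<^sup>2) = - Nf (of_real bt)"
  unfolding Nf_def integral_neg[symmetric]
  by (simp flip: of_real_diff)
 moreover have "at bt within {b<..} = at bt" using b by (intro at_within_open) auto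
 ultimately show ?thesis by (simp add: gr_def[abs_def])
qed

lemma lr_DERIV: "b < bt ==> (lr has_real_derivative gr bt) (at bt)"
proof -
 assume b: "b < bt"
 have pc: "continuous_on ({b<..} \<times> cbox a b) (%z. p (snd z))"
  by (rule continuous_on_compose2[OF p_continuous[of UNIV]]) (auto intro!: continuous_intros)
 have "((%x. integral (cbox a b) (%y. p y * ln (x - y))) has_field_derivative integral (cbox a b) (%y. p y / (bt - y))) (at bt within {b<..})"
 proof (rule leibniz_rule_field_derivative)
  fix x y assume xy: "x \<in> {b<..}" "y \<in> cbox a b"
  then show "((%x. p y * ln (x - y)) has_field_derivative p y / (x - y)) (at x within {b<..})"
   by (auto intro!: derivative_eq_intros)
 next
  fix x assume "x \<in> {b<..}" then show "(%y. p y * ln (x - y)) integrable_on cbox a b" using lr_props(1)[of x] by simp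
 next
  show "continuous_on ({b<..} \<times> cbox a b) (%(x, y). p y / (x - y))"
   unfolding case_prod_beta' by (intro continuous_intros pc) auto
 qed (use b in auto)
 moreover have "at bt within {b<..} = at bt" using b by (intro at_within_open) auto
 ultimately show ?thesis by (simp add: lr_def[abs_def] gr_def)
qed

lemma Nf_real_antimono: "b < bt ==> bt < bt' ==> Nf (of_real bt') < Nf (of_real bt)"
proof (rule Nf_strict_mono)
 fix y assume "b < bt" "bt < bt'" "y \<in> {a..b}"
 then show "cmod (of_real bt - of_real y) < cmod (of_real bt' - of_real y)"
  by (simp only: of_real_diff[symmetric] norm_of_real) auto
qed (use real_in_upper_dom in auto)

lemma Nf_real_le: "b < bt ==> Nf (of_real bt) <= 1 / (bt - b)^2"
proof (rule Nf_le)
 fix y assume "b < bt" "y \<in> {a..b}"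
 then show "bt - b <= cmod (of_real bt - of_real y)"
  by (simp only: of_real_diff[symmetric] norm_of_real) auto
qed (use real_in_upper_dom in auto)

lemma edge_exists: "k > 0 ==> \<exists>bt>b. Nf (of_real bt) = k"
proof -
 assume k: "k > 0"
 obtain de where de: "de > 0" "!!z. z \<in> upper_dom ==> (\<exists>x\<in>{a..b}. cmod (z - of_real x) < de) ==> k < Nf z"
  using Nf_large_near_support[of k] by blast
 define l where "l = b + de / 2"
 define r where "r = b + 1 / sqrt k + de"
 have lr: "b < l" "l < r" "b + 1 / sqrt k <= r" using de k by (auto simp: l_def r_def intro: less_le_trans)
 have 1: "k <= Nf (of_real l)"
 proof -
  have "cmod (of_real l - of_real b) < de" using de(1) by (simp only: of_real_diff[symmetric] norm_of_real) (simp add: l_def)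
  then have "\<exists>x\<in>{a..b}. cmod (of_real l - of_real x) < de" using ab by (intro bexI[of _ b]) auto
  from de(2)[OF real_in_upper_dom(1)[OF lr(1)] this] show ?thesis by simp
 qed
 have 2: "Nf (of_real r) <= k"
 proof -
  have "Nf (of_real r) <= 1 / (r - b)^2" using lr by (intro Nf_real_le) auto
  also have "... <= 1 / (1 / sqrt k)^2" using lr k by (intro divide_left_mono power_mono) auto
  also have "... = k" using k by (simp add: power_divide)
  finally show ?thesis .
 qed
 have "continuous_on {l..r} (%bt. Nf (of_real bt))"
  using lr real_in_upper_dom by (intro continuous_on_compose2[OF Nf_continuous] continuous_intros) auto
 then obtain bt where "l <= bt" "bt <= r" "Nf (of_real bt) = k"
  using IVT2'[of "%bt. Nf (of_real bt)" r k l] 1 2 lr by auto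
 then show ?thesis using lr by (intro exI[of _ bt]) auto
qed

end

section \<open>Characteristics with a real foot to the right of the support\<close>

locale planning_data = density_data +
 fixes T :: real
 assumes T_pos: "T > 0"
begin

definition W :: "complex => complex" where "W z = z / of_real T - of_real kap * G z"
text \<open>This is \<open>z - (T - t) * W z\<close>, rewritten with
  \<open>z = T * W z + kap * T * G z\<close>: affine in \<open>t\<close> with velocity
  \<open>W z\<close>, and equal to \<open>kap * T * G z\<close> at time \<open>0\<close>.\<close>

definition X :: "real => complex => complex" where "X t z = of_real t * W z + of_real (kap * T) * G z"
text \<open>The value of \<open>Nf\<close> at which \<open>Im (X t z)\<close> vanishes for non-real
  \<open>z\<close>. It increases from \<open>0\<close> to infinity on the time interval: the level
  curve comes in from infinity and closes up on the support.\<close>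

definition thr :: "real => real" where "thr t = t / (kap * T * (T - t))"

lemma X_eq: "X t z = of_real (t / T) * z + of_real (kap * (T - t)) * G z"
 using T_pos by (simp add: X_def W_def algebra_simps)

lemma thr_pos: "t \<in> {0<..<T} ==> 0 < thr t"
 using kap_pos T_pos by (simp add: thr_def)

lemma thr_eq: "t \<in> {0<..<T} ==> t / T = kap * (T - t) * thr t"
 using kap_pos T_pos by (simp add: thr_def)

lemma thr_continuous: "continuous_on {0<..<T} thr"
 unfolding thr_def using kap_pos T_pos by (intro continuous_intros) auto

lemma Im_X: "z \<in> upper_dom ==> Im (X t z) = Im z * (t / T - kap * (T - t) * Nf z)"
 using Im_G[of z] by (simp add: X_eq algebra_simps del: of_real_divide of_real_mult)

lemma X_real: "b <= bt ==> X t (of_real bt) = of_real (t / T * bt + kap * (T - t) * gr bt)"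
 by (simp add: X_eq G_real)

text \<open>The right end point, on the real axis, of the level curve for time \<open>t\<close>. The
  choice is unambiguous because \<open>Nf\<close> decreases strictly to the right of
  \<open>b\<close>.\<close>

definition edge :: "real => real" where "edge t = (SOME bt. bt > b \<and> Nf (of_real bt) = thr t)"

lemma edge: assumes "t \<in> {0<..<T}" shows "b < edge t" "Nf (of_real (edge t)) = thr t"
 using someI_ex[OF edge_exists[OF thr_pos[OF assms], simplified Bex_def]] by (auto simp: edge_def)

lemma edge_iff: "t \<in> {0<..<T} ==> b < bt ==> thr t <= Nf (of_real bt) \<longleftrightarrow> bt <= edge t"
 using edge[of t] Nf_real_antimono[of bt "edge t"] Nf_real_antimono[of "edge t" bt] by (cases "bt = edge t") force+

definition Xr :: "real => real => real" where "Xr t bt = t / T * bt + kap * (T - t) * gr bt"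

lemma Xr: "b <= bt ==> X t (of_real bt) = of_real (Xr t bt)"
 by (simp add: X_real Xr_def)

lemma Xr_continuous: "continuous_on ({0<..<T} \<times> {b..}) (%z. Xr (fst z) (snd z))"
 unfolding Xr_def
 by (intro continuous_intros continuous_on_compose2[OF gr_props(2)]) (use T_pos in auto)

text \<open>Between \<open>b\<close> and \<open>edge t\<close> the level function exceeds
  \<open>thr t\<close>, so \<open>Xr t\<close> has negative derivative: orientation is reversed, and
  as the foot returns from \<open>edge t\<close> to \<open>b\<close> the point reached moves away to
  the right.\<close>

lemma Xr_strict: "t \<in> {0<..<T} ==> b <= bt ==> bt < bt' ==> bt' <= edge t ==> Xr t bt' < Xr t bt"
proof -
 assume A: "t \<in> {0<..<T}" "b <= bt" "bt < bt'" "bt' <= edge t"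
 show "Xr t bt' < Xr t bt"
 proof (rule DERIV_neg_imp_decreasing_open[OF A(3)])
  fix x assume x: "bt < x" "x < bt'"
  have "(Xr t has_real_derivative t / T + kap * (T - t) * (- Nf (of_real x))) (at x)"
   unfolding Xr_def[abs_def] using gr_DERIV[of x] x A by (auto intro!: derivative_eq_intros)
  moreover have "thr t < Nf (of_real x)"
   using Nf_real_antimono[of x "edge t"] edge[OF A(1)] x A by simp
  then have "t / T + kap * (T - t) * (- Nf (of_real x)) < 0"
   using kap_pos A(1) by (simp add: thr_eq[OF A(1)])
  ultimately show "\<exists>y. (Xr t has_real_derivative y) (at x) \<and> y < 0" by blast
 next
  show "continuous_on {bt..bt'} (Xr t)"
   unfolding Xr_def[abs_def] using A by (intro continuous_intros continuous_on_subset[OF gr_props(2)]) auto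
 qed
qed

text \<open>\<open>ZR\<close>: the foot \<open>z\<close> of the characteristic through \<open>(t, x)\<close> is real and to the right of the
 support. Beyond the image of the end point \<open>b\<close> the foot is frozen at \<open>b\<close>.\<close>

definition ZR :: "real => real => complex => bool" where
 "ZR t x z \<longleftrightarrow> Im z = 0 \<and> b <= Re z \<and> (b < Re z \<longrightarrow> thr t <= Nf z) \<and>
   (Re (X t z) = x \<or> Re z = b \<and> Re (X t z) <= x)"

lemma ZR_iff:
 assumes t: "t \<in> {0<..<T}"
 shows "ZR t x z \<longleftrightarrow> (\<exists>bt. z = of_real bt \<and> b <= bt \<and> bt <= edge t \<and> (Xr t bt = x \<or> bt = b \<and> Xr t b <= x))"
proof
 assume Z: "ZR t x z"
 then have z: "z = of_real (Re z)" by (auto simp: ZR_def complex_eq_iff)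
 define bt where "bt = Re z"
 have b: "b <= bt" using Z by (simp add: ZR_def bt_def)
 have "bt <= edge t"
 proof (cases "b < bt")
  case True
  then show ?thesis using Z edge_iff[OF t True] z by (auto simp: ZR_def bt_def)
 qed (use edge(1)[OF t] in simp)
 moreover have "Xr t bt = x \<or> bt = b \<and> Xr t b <= x"
  using Z Xr[OF b, of t] z by (auto simp: ZR_def bt_def)
 ultimately show "\<exists>bt. z = of_real bt \<and> b <= bt \<and> bt <= edge t \<and> (Xr t bt = x \<or> bt = b \<and> Xr t b <= x)"
  using z b by (auto simp: bt_def)
next
 assume "\<exists>bt. z = of_real bt \<and> b <= bt \<and> bt <= edge t \<and> (Xr t bt = x \<or> bt = b \<and> Xr t b <= x)"
 then obtain bt where bt: "z = of_real bt" "b <= bt" "bt <= edge t" "Xr t bt = x \<or> bt = b \<and> Xr t b <= x" by blast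
 then show "ZR t x z" using Xr[OF bt(2), of t] edge_iff[OF t, of bt] by (auto simp: ZR_def)
qed

lemma ZR_unique: "t \<in> {0<..<T} ==> ZR t x z ==> ZR t x w ==> z = w"
proof -
 assume t: "t \<in> {0<..<T}" and "ZR t x z" "ZR t x w"
 then obtain bt bt' where B: "z = of_real bt" "b <= bt" "bt <= edge t" "Xr t bt = x \<or> bt = b \<and> Xr t b <= x"
  "w = of_real bt'" "b <= bt'" "bt' <= edge t" "Xr t bt' = x \<or> bt' = b \<and> Xr t b <= x" by (auto simp: ZR_iff)
 have False if "bt < bt'" using Xr_strict[OF t B(2) that B(7)] B that by auto
 moreover have False if "bt' < bt" using Xr_strict[OF t B(6) that B(3)] B that by auto
 ultimately show "z = w" using B by (metis linorder_neqE)
qed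

lemma ZR_exists: "t \<in> {0<..<T} ==> (\<exists>z. ZR t x z) \<longleftrightarrow> Xr t (edge t) <= x"
proof
 assume t: "t \<in> {0<..<T}" and "\<exists>z. ZR t x z"
 then obtain bt where B: "b <= bt" "bt <= edge t" "Xr t bt = x \<or> bt = b \<and> Xr t b <= x" by (auto simp: ZR_iff)
 then have "Xr t (edge t) <= Xr t bt" using Xr_strict[OF t, of bt "edge t"] by (cases "bt = edge t") auto
 then show "Xr t (edge t) <= x" using B by auto
next
 assume t: "t \<in> {0<..<T}" and x: "Xr t (edge t) <= x"
 show "\<exists>z. ZR t x z"
 proof (cases "Xr t b <= x")
  case True
  then have "ZR t x (of_real b)" using edge(1)[OF t] by (subst ZR_iff[OF t]) (intro exI[of _ b], auto)
  then show ?thesis by blast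
 next
  case False
  have "continuous_on {b..edge t} (Xr t)"
   unfolding Xr_def[abs_def] by (intro continuous_intros continuous_on_subset[OF gr_props(2)]) auto
  then obtain bt where "b <= bt" "bt <= edge t" "Xr t bt = x"
   using IVT2'[of "Xr t" "edge t" x b] x False edge(1)[OF t] by auto
  then have "ZR t x (of_real bt)" by (subst ZR_iff[OF t]) blast
  then show ?thesis by blast
 qed
qed

lemma ZR_closed:
 assumes lim: "tn ----> t" "xn ----> x" "zn ----> z" and t: "t \<in> {0<..<T}" "!!n. tn n \<in> {0<..<T}"
  and Z: "!!n. ZR (tn n) (xn n) (zn n)"
 shows "ZR t x z"
proof -
 define bt where "bt n = Re (zn n)" for n
 have zn: "zn n = of_real (bt n)" "b <= bt n" for n using Z[of n] by (auto simp: ZR_def bt_def complex_eq_iff)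
 have lb: "bt ----> Re z" unfolding bt_def by (intro tendsto_Re lim)
 have "(%n. Im (zn n)) ----> Im z" by (intro tendsto_Im lim)
 moreover have "Im (zn n) = 0" for n using Z[of n] by (simp add: ZR_def)
 ultimately have Imz: "Im z = 0" by (simp add: LIMSEQ_unique tendsto_const)
 have z: "z = of_real (Re z)" using Imz by (simp add: complex_eq_iff)
 have bz: "b <= Re z" by (rule LIMSEQ_le_const[OF lb]) (use zn in auto)
 have X1: "(%n. Xr (tn n) (bt n)) ----> Xr t (Re z)"
  using continuous_on_tendsto_compose[OF Xr_continuous, of "%n. (tn n, bt n)" "(t, Re z)"] lim lb t zn bz
  by (auto intro!: tendsto_Pair)
 have Xb: "(%n. Xr (tn n) b) ----> Xr t b"
 proof -
  have "(%n. (tn n, b)) ----> (t, b)" by (intro tendsto_Pair lim(1) tendsto_const)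
  from continuous_on_tendsto_compose[OF Xr_continuous this] show ?thesis using t by auto
 qed
 have XrZ: "Xr (tn n) (bt n) = xn n \<or> bt n = b \<and> Xr (tn n) b <= xn n" for n
  using Z[of n] Xr[OF zn(2)[of n], of "tn n"] zn(1)[of n] unfolding ZR_def by auto
 have ge: "Xr (tn n) (bt n) <= xn n" for n using XrZ[of n] by auto
 have le: "Xr t (Re z) <= x" by (rule LIMSEQ_le[OF X1 lim(2)]) (use ge in auto)
 have thrl: "thr t <= Nf z" "Xr t (Re z) = x" if b: "b < Re z"
 proof -
  have ev: "\<forall>\<^sub>F n in sequentially. b < bt n" using lb b by (rule order_tendstoD(1))
  have zd: "z \<in> upper_dom" using b by (auto simp: upper_dom_def)
  have ev2: "\<forall>\<^sub>F n in sequentially. zn n \<in> upper_dom" using ev by eventually_elim (auto simp: zn upper_dom_def)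
  have "(%n. Nf (zn n)) ----> Nf z"
   by (rule continuous_on_tendsto_compose[OF Nf_continuous lim(3) zd ev2])
  moreover have "(%n. thr (tn n)) ----> thr t"
   by (rule continuous_on_tendsto_compose[OF thr_continuous lim(1) t(1)]) (use t(2) in auto)
  moreover have "\<forall>\<^sub>F n in sequentially. thr (tn n) <= Nf (zn n)"
   using ev by eventually_elim (use Z in \<open>auto simp: ZR_def bt_def\<close>)
  ultimately show "thr t <= Nf z" using tendsto_le[OF sequentially_bot] by blast
  have "\<forall>\<^sub>F n in sequentially. Xr (tn n) (bt n) = xn n" using ev by eventually_elim (use XrZ in force)
  from Lim_transform_eventually[OF X1 this] show "Xr t (Re z) = x" using lim(2) LIMSEQ_unique by blast
 qed
 show ?thesis
  unfolding ZR_def using Imz bz thrl le Xr[OF bz, of t] z by (cases "b < Re z") auto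
qed

text \<open>All statements about the exterior on the left come from this symmetry; the mirrored data
  satisfy the same assumptions with the same constants.\<close>

lemma reflected: "planning_data (%x. p (- x)) (- b) (- a) cl C T"
proof
 show "- b < - a" using ab by simp
 show "0 <= p (- x)" for x by (rule p_nonneg)
 show "x \<notin> {- b..- a} ==> p (- x) = 0" for x by (rule p_outside) auto
 show "\<bar>p (- x) - p (- y)\<bar> <= C * sqrt \<bar>x - y\<bar>" for x y using p_Holder[of "- x" "- y"] by (simp add: abs_minus_commute)
 show "cl * sqrt (min (x - - b) (- a - x)) <= p (- x)" if "x \<in> {- b..- a}" for x
 proof -
  have "min (x - - b) (- a - x) = min (- x - a) (b - - x)" by (auto simp: min_def)
  then show ?thesis using p_lower[of "- x"] that by (simp only:) simp
 qed
 show "integral {- b..- a} (%x. p (- x)) = 1"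
  using hk_reflect_real[of b a p] p_mass by simp
qed (use cl T_pos in auto)

end

section \<open>The characteristic through a given point\<close>

lemma connected_subset_or_disjoint:
 fixes S :: "'a::topological_space set"
 assumes "connected I" "open S" "!!x. x \<in> closure S ==> x \<in> I ==> x \<in> S"
 shows "I \<inter> S = {} \<or> I \<subseteq> S"
proof -
 have "S \<inter> I = {} \<or> (- closure S) \<inter> I = {}"
  using closure_subset[of S] assms by (intro connectedD) auto
 then show ?thesis using assms(3) by auto
qed

context planning_data
begin

definition edgeR :: "real => real" where "edgeR t = Xr t (edge t)"

lemma ZR_edge: "t \<in> {0<..<T} ==> ZR t (edgeR t) (of_real (edge t))"
 using edge(1)[of t] by (subst ZR_iff) (auto simp: edgeR_def intro!: exI[of _ "edge t"])

definition A0 :: real where "A0 = \<bar>a\<bar> + \<bar>b\<bar>"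

lemma abs_le_A0: "y \<in> {a..b} ==> \<bar>y\<bar> <= A0" by (auto simp: A0_def)

lemma edge_le: "t \<in> {0<..<T} ==> edge t <= b + 1 / sqrt (thr t)"
proof -
 assume t: "t \<in> {0<..<T}"
 have th: "thr t > 0" by (rule thr_pos[OF t])
 have e: "edge t - b > 0" using edge(1)[OF t] by simp
 have "thr t <= 1 / (edge t - b)^2" using Nf_real_le[OF edge(1)[OF t]] edge(2)[OF t] by simp
 then have "thr t * (edge t - b)^2 <= 1" using e by (simp add: le_divide_eq)
 then have "sqrt (thr t * (edge t - b)^2) <= sqrt 1" by (rule real_sqrt_le_mono)
 then have "sqrt (thr t) * (edge t - b) <= 1" using e by (simp add: real_sqrt_mult)
 then have "edge t - b <= 1 / sqrt (thr t)" using th by (simp add: pos_le_divide_eq mult.commute)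
 then show ?thesis by simp
qed

lemma ZR_norm_le:
 assumes t: "t \<in> {0<..<T}" and z: "ZR t x z"
 shows "cmod z <= A0 + 1 / sqrt (thr t)"
proof -
 obtain bt where bt: "z = of_real bt" "b <= bt" "bt <= edge t" using z by (auto simp: ZR_iff[OF t])
 have "0 < 1 / sqrt (thr t)" using thr_pos[OF t] by simp
 then have "\<bar>bt\<bar> <= A0 + 1 / sqrt (thr t)" using bt edge_le[OF t] by (auto simp: A0_def abs_le_iff)
 then show ?thesis using bt by simp
qed

end

context planning_data
begin

interpretation refl: planning_data "%x. p (- x)" "- b" "- a" cl C T by (rule reflected)

section \<open>The mirror image, and the three kinds of feet\<close>

lemma refl_G: "refl.G z = - G (- z)"
proof -
 have "refl.G z = integral {- b..- a} (%y. (%y. of_real (p y) / (z + of_real y)) (- y))"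
  by (simp add: refl.G_def)
 also have "... = integral {a..b} (%y. of_real (p y) / (z + of_real y))"
  by (rule hk_reflect_real)
 also have "... = integral {a..b} (%y. - (of_real (p y) / (- z - of_real y)))"
 proof (rule integral_cong)
  fix y
  have "- z - of_real y = - (z + of_real y)" by simp
  then show "of_real (p y) / (z + of_real y) = - (of_real (p y) / (- z - of_real y))" by (simp only: divide_minus_right minus_minus)
 qed
 also have "... = - G (- z)" unfolding G_def by (rule integral_neg)
 finally show ?thesis .
qed

lemma refl_Nf: "refl.Nf z = Nf (- z)"
proof -
 have "refl.Nf z = integral {- b..- a} (%y. (%y. p y / (cmod (z + of_real y))\<^sup>2) (- y))"
  by (simp add: refl.Nf_def)
 also have "... = integral {a..b} (%y. p y / (cmod (z + of_real y))^2)"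
  by (rule hk_reflect_real)
 also have "... = Nf (- z)"
  unfolding Nf_def
 proof (rule integral_cong)
  fix y
  have "- z - of_real y = - (z + of_real y)" by simp
  then show "p y / (cmod (z + of_real y))\<^sup>2 = p y / (cmod (- z - of_real y))\<^sup>2" by (simp only: norm_minus_cancel)
 qed
 finally show ?thesis .
qed

lemma refl_W: "refl.W z = - W (- z)"
 by (simp add: refl.W_def W_def refl_G)

lemma refl_X: "refl.X t z = - X t (- z)"
 by (simp add: refl.X_def X_def refl_W refl_G)

lemma Lf_left: "- a <= bt ==> Lf (- of_real bt) = of_real (refl.lr bt) + \<i> * pi"
proof -
 assume b: "- a <= bt"
 have "Lf (- of_real bt) = integral {a..b} (%y. of_real (p y * ln (bt + y)) + of_real (p y) * (\<i> * pi))"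
  unfolding Lf_def
 proof (rule integral_cong)
  fix y assume y: "y \<in> {a..b}"
  show "of_real (p y) * lg (- of_real bt - of_real y) = of_real (p y * ln (bt + y)) + of_real (p y) * (\<i> * pi)"
  proof (cases "- bt < y")
   case True
   then show ?thesis using lg_of_real_neg[of "- bt - y"] by (simp add: algebra_simps)
  next
   case False
   then have "- y = - a" using y b by auto
   then show ?thesis using refl.p_b by simp
  qed
 qed
 also have "... = integral {- b..- a} (%y. of_real (p (- y) * ln (bt - y)) + of_real (p (- y)) * (\<i> * pi))"
  using hk_reflect_real[of b a "%y. of_real (p y * ln (bt + y)) + of_real (p y) * (\<i> * pi)"] by simp
 also have "... = of_real (refl.lr bt) + of_real 1 * (\<i> * pi)"
 proof (intro integral_unique has_integral_add)
  have "((%y. p (- y) * ln (bt - y)) has_integral refl.lr bt) {- b..- a}"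
   unfolding refl.lr_def by (rule integrable_integral[OF refl.lr_props(1)[OF b]])
  from has_integral_linear[OF this bounded_linear_of_real[where 'a=complex]]
  show "((%y. of_real (p (- y) * ln (bt - y))) has_integral complex_of_real (refl.lr bt)) {- b..- a}" by (simp add: o_def)
  have "((%y. p (- y)) has_integral 1) {- b..- a}"
   unfolding refl.p_mass[symmetric] by (intro integrable_integral integrable_continuous_interval refl.p_continuous)
  from has_integral_linear[OF this bounded_linear_of_real[where 'a=complex]]
  have "((%y. of_real (p (- y))) has_integral complex_of_real 1) {- b..- a}" by (simp add: o_def)
  then show "((%y. of_real (p (- y)) * (\<i> * pi)) has_integral complex_of_real 1 * (\<i> * pi)) {- b..- a}" by (rule has_integral_mult_left)
 qed
 finally show ?thesis by simp
qed

definition ZL :: "real => real => complex => bool" where "ZL t x z \<longleftrightarrow> refl.ZR t (- x) (- z)"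

text \<open>The closed version of a non-real foot. The level condition is stated explicitly, because
  on the real axis it no longer follows from \<open>X t z = x\<close>; there it leaves only the two
  end points of the level curve.\<close>

definition Zin :: "real => real => complex => bool" where
 "Zin t x z \<longleftrightarrow> 0 <= Im z \<and> z \<in> upper_dom \<and> Nf z = thr t \<and> X t z = of_real x"

definition ZZ :: "real => real => complex => bool" where
 "ZZ t x z \<longleftrightarrow> 0 < Im z \<and> X t z = of_real x \<or> ZR t x z \<or> ZL t x z"

definition edgeL :: "real => real" where "edgeL t = - refl.Xr t (refl.edge t)"

lemma Zin_of_Im_pos:
 assumes t: "t \<in> {0<..<T}" and z: "0 < Im z" "X t z = of_real x"
 shows "Zin t x z"
proof -
 have zd: "z \<in> upper_dom" using z by (simp add: upper_dom_def)
 have "Im z * (t / T - kap * (T - t) * Nf z) = 0" using Im_X[OF zd, of t] z by simp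
 then have "kap * (T - t) * thr t = kap * (T - t) * Nf z" using z thr_eq[OF t] by simp
 then have "Nf z = thr t" using kap_pos t by simp
 then show ?thesis using z zd by (simp add: Zin_def)
qed

lemma Zin_real:
 assumes t: "t \<in> {0<..<T}" and z: "Zin t x z" "Im z = 0"
 shows "b < Re z \<and> z = of_real (edge t) \<and> x = edgeR t \<or> Re z < a \<and> z = - of_real (refl.edge t) \<and> x = edgeL t"
proof -
 have zr: "z = of_real (Re z)" using z by (simp add: complex_eq_iff)
 have "b < Re z \<or> Re z < a" using z by (auto simp: Zin_def upper_dom_def)
 then show ?thesis
 proof
  assume b: "b < Re z"
  have N: "Nf (of_real (Re z)) = thr t" using z(1) unfolding Zin_def zr[symmetric] by simp
  have "Re z = edge t"
  proof (rule linorder_cases[of "Re z" "edge t"])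
   assume "Re z < edge t" from Nf_real_antimono[OF b this] show ?thesis unfolding N edge(2)[OF t] by simp
  next
   assume "edge t < Re z" from Nf_real_antimono[OF edge(1)[OF t] this] show ?thesis unfolding N edge(2)[OF t] by simp
  qed simp
  moreover have "of_real x = X t (of_real (Re z))" using z(1) unfolding Zin_def zr[symmetric] by simp
  ultimately have "of_real x = (of_real (Xr t (edge t)) :: complex)" using Xr[of "edge t" t] edge(1)[OF t] by simp
  then have "x = edgeR t" by (simp add: edgeR_def)
  then show ?thesis using b zr \<open>Re z = edge t\<close> by simp
 next
  assume a: "Re z < a"
  define bt where "bt = - Re z"
  have bt: "- a < bt" "z = - of_real bt" using a zr by (auto simp: bt_def)
  have N: "refl.Nf (of_real bt) = thr t" using z bt by (simp add: Zin_def refl_Nf)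
  have t': "t \<in> {0<..<T}" by (rule t)
  have e: "- a < refl.edge t" "refl.Nf (of_real (refl.edge t)) = thr t"
   using refl.edge[OF t] by blast+
  have "bt = refl.edge t"
  proof (rule linorder_cases[of bt "refl.edge t"])
   assume "bt < refl.edge t" from refl.Nf_real_antimono[OF bt(1) this] show ?thesis unfolding N e(2) by simp
  next
   assume "refl.edge t < bt" from refl.Nf_real_antimono[OF e(1) this] show ?thesis unfolding N e(2) by simp
  qed simp
  moreover have "of_real (- x) = refl.X t (of_real bt)" using z bt by (simp add: Zin_def refl_X)
  ultimately have "of_real (- x) = (of_real (refl.Xr t (refl.edge t)) :: complex)"
   using refl.Xr[of "refl.edge t" t] refl.edge(1)[OF t] by (simp only: less_imp_le)
  then have "- x = - edgeL t" by (simp only: of_real_eq_iff edgeL_def minus_minus)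
  then show ?thesis using a bt \<open>bt = refl.edge t\<close> by simp
 qed
qed

lemma Zin_imp_ZZ:
 assumes t: "t \<in> {0<..<T}" and z: "Zin t x z"
 shows "ZZ t x z"
proof (cases "Im z = 0")
 case True
 from Zin_real[OF t z True] show ?thesis
  using ZR_edge[OF t] refl.ZR_edge[OF t] by (auto simp: ZZ_def ZL_def edgeL_def refl.edgeR_def)
qed (use z in \<open>auto simp: ZZ_def Zin_def\<close>)

text \<open>Seen from far away the mass sits at the origin up to \<open>A0\<close>, so
  \<open>Nf z = thr t\<close> determines \<open>|z|\<close> up to \<open>A0\<close>. The upper bound
  gives compactness of the feet, and both together give their asymptotics at time
  \<open>0\<close>.\<close>

lemma Zin_norm_le:
 assumes t: "t \<in> {0<..<T}" and z: "Zin t x z"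
 shows "cmod z <= A0 + 1 / sqrt (thr t)" "1 / sqrt (thr t) <= cmod z + A0"
proof -
 have th: "thr t > 0" by (rule thr_pos[OF t])
 have zd: "z \<in> upper_dom" and N: "Nf z = thr t" using z by (auto simp: Zin_def)
 show "cmod z <= A0 + 1 / sqrt (thr t)"
 proof (rule ccontr)
  assume "\<not> ?thesis"
  then have d: "cmod z - A0 > 1 / sqrt (thr t)" by simp
  moreover have q: "1 / sqrt (thr t) > 0" using th by simp
  ultimately have d0: "cmod z - A0 > 0" by linarith
  have "Nf z <= 1 / (cmod z - A0)^2"
  proof (rule Nf_le[OF zd d0])
   fix y assume "y \<in> {a..b}"
   then show "cmod z - A0 <= cmod (z - of_real y)"
    using norm_triangle_ineq2[of z "of_real y"] abs_le_A0[of y] by simp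
  qed
  also have "... < 1 / (1 / sqrt (thr t))^2"
   using d q d0 by (intro divide_strict_left_mono power_strict_mono) auto
  also have "... = thr t" using th by (simp add: power_divide)
  finally show False using N by simp
 qed
 have "1 / (cmod z + A0)^2 <= Nf z"
 proof (rule Nf_ge[OF zd])
  fix y assume "y \<in> {a..b}"
  then show "cmod (z - of_real y) <= cmod z + A0"
   using norm_triangle_ineq4[of z "of_real y"] abs_le_A0[of y] by simp
 qed
 then have le: "1 / (cmod z + A0)^2 <= thr t" using N by simp
 have A0p: "0 < A0" using ab by (simp add: A0_def)
 have s0: "0 < cmod z + A0" using A0p by (simp add: add_nonneg_pos)
 have "1 <= thr t * (cmod z + A0)^2" using le s0 by (simp add: divide_le_eq)
 then have "sqrt 1 <= sqrt (thr t * (cmod z + A0)^2)" by (rule real_sqrt_le_mono)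
 then have "1 <= sqrt (thr t) * (cmod z + A0)" using s0 by (simp add: real_sqrt_mult)
 then show "1 / sqrt (thr t) <= cmod z + A0" using th by (simp add: divide_le_eq mult.commute)
qed

lemma ZZ_norm_le:
 assumes t: "t \<in> {0<..<T}" and z: "ZZ t x z"
 shows "cmod z <= A0 + 1 / sqrt (thr t)"
proof -
 have "refl.A0 = A0" by (simp add: refl.A0_def A0_def)
 then show ?thesis
  using z Zin_norm_le(1)[OF t Zin_of_Im_pos[OF t]] ZR_norm_le[OF t] refl.ZR_norm_le[OF t, of "- x" "- z"]
  by (auto simp: ZZ_def ZL_def)
qed

lemma Zin_x_le:
 assumes t: "t \<in> {0<..<T}" and z: "Zin t x z"
 shows "\<bar>x\<bar> <= t / T * (A0 + 1 / sqrt (thr t)) + kap * (T - t) * sqrt (thr t)"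
proof -
 have "\<bar>x\<bar> = cmod (X t z)" using z by (simp add: Zin_def)
 also have "... <= cmod (of_real (t / T) * z) + cmod (of_real (kap * (T - t)) * G z)"
  unfolding X_eq by (rule norm_triangle_ineq)
 also have "... = t / T * cmod z + kap * (T - t) * cmod (G z)"
  using t T_pos kap_pos by (simp only: norm_mult norm_of_real) simp
 also have "... <= t / T * (A0 + 1 / sqrt (thr t)) + kap * (T - t) * sqrt (thr t)"
  using t T_pos kap_pos Zin_norm_le(1)[OF t z] norm_G_le[of z] z by (intro add_mono mult_left_mono) (auto simp: Zin_def)
 finally show ?thesis .
qed

lemma X_has_derivative: "z \<in> upper_dom ==> (X t has_field_derivative of_real (t / T) + of_real (kap * (T - t)) * G1 z) (at z)"
 unfolding X_eq[abs_def] using T_pos by (auto intro!: derivative_eq_intros G_has_derivative)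

text \<open>The only danger is a limit in the support, where \<open>upper_dom\<close> ends; it is
  excluded because \<open>Nf\<close> would have to become large while it equals the convergent
  \<open>thr\<close>.\<close>

lemma Zin_closed:
 assumes lim: "tn ----> t" "xn ----> x" "zn ----> z" and t: "t \<in> {0<..<T}" "!!n. tn n \<in> {0<..<T}"
  and Z: "!!n. Zin (tn n) (xn n) (zn n)"
 shows "Zin t x z"
proof -
 have thl: "(%n. thr (tn n)) ----> thr t"
  by (rule continuous_on_tendsto_compose[OF thr_continuous lim(1) t(1)]) (use t(2) in auto)
 obtain de where de: "de > 0" "!!z. z \<in> upper_dom ==> (\<exists>x\<in>{a..b}. cmod (z - of_real x) < de) ==> thr t + 1 < Nf z"
  using Nf_large_near_support[of "thr t + 1"] by blast
 have Imz: "0 <= Im z" by (rule LIMSEQ_le_const[OF tendsto_Im[OF lim(3)]]) (use Z in \<open>auto simp: Zin_def\<close>)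
 have far: "de <= cmod (z - of_real y)" if y: "y \<in> {a..b}" for y
 proof (rule tendsto_lowerbound)
  show "(%n. cmod (zn n - of_real y)) ----> cmod (z - of_real y)" by (intro tendsto_intros lim)
  have "\<forall>\<^sub>F n in sequentially. thr (tn n) < thr t + 1" using thl by (rule order_tendstoD(2)) simp
  then show "\<forall>\<^sub>F n in sequentially. de <= cmod (zn n - of_real y)"
  proof eventually_elim
   case (elim n)
   show ?case
   proof (rule ccontr)
    assume "\<not> ?case"
    then have "\<exists>x\<in>{a..b}. cmod (zn n - of_real x) < de" using y by (intro bexI[of _ y]) auto
    from de(2)[OF _ this] show False using Z[of n] elim by (auto simp: Zin_def)
   qed
  qed
 qed simp
 have zd: "z \<in> upper_dom"
 proof (rule ccontr)
  assume "z \<notin> upper_dom"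
  then have "Im z = 0" "Re z \<in> {a..b}" using Imz by (auto simp: upper_dom_def)
  then have "z = of_real (Re z)" by (simp add: complex_eq_iff)
  then have "cmod (z - of_real (Re z)) = 0" by simp
  with far[OF \<open>Re z \<in> {a..b}\<close>] de(1) show False by simp
 qed
 have "(%n. Nf (zn n)) ----> Nf z"
  by (rule continuous_on_tendsto_compose[OF Nf_continuous lim(3) zd]) (use Z in \<open>auto simp: Zin_def\<close>)
 moreover have "(%n. Nf (zn n)) = (%n. thr (tn n))" using Z by (auto simp: Zin_def)
 ultimately have N: "Nf z = thr t" using thl LIMSEQ_unique by metis
 have Gl: "(%n. G (zn n)) ----> G z" by (rule isCont_tendsto_compose[OF DERIV_isCont[OF G_has_derivative[OF zd]] lim(3)])
 have "(%n. X (tn n) (zn n)) ----> X t z" unfolding X_def W_def using T_pos by (intro tendsto_intros lim Gl) auto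
 moreover have "(%n. X (tn n) (zn n)) = (%n. of_real (xn n))" using Z by (auto simp: Zin_def)
 moreover have "(%n. complex_of_real (xn n)) ----> of_real x" by (intro tendsto_intros lim)
 ultimately have "X t z = of_real x" using LIMSEQ_unique by metis
 then show ?thesis using Imz zd N by (simp add: Zin_def)
qed

section \<open>The interval reached by characteristics with a non-real foot\<close>

definition inner :: "real => real set" where "inner t = {x. \<exists>z. 0 < Im z \<and> X t z = of_real x}"

lemma level_point: "k > 0 ==> \<exists>h>0. Nf (Complex ((a + b) / 2) h) = k"
proof -
 assume k: "k > 0"
 define M where "M = (a + b) / 2"
 have M: "M \<in> {a..b}" using ab by (auto simp: M_def)
 obtain de where de: "de > 0" "!!z. z \<in> upper_dom ==> (\<exists>x\<in>{a..b}. cmod (z - of_real x) < de) ==> k < Nf z"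
  using Nf_large_near_support[of k] by blast
 define r where "r = de + 1 / sqrt k"
 have r: "de / 2 <= r" "1 / sqrt k <= r" "0 < r" using de k by (auto simp: r_def add_pos_pos)
 have dom: "h > 0 ==> Complex M h \<in> upper_dom" for h by (simp add: upper_dom_def)
 have "cmod (Complex M (de / 2) - of_real M) < de" using de(1) by (simp add: cmod_def)
 then have "\<exists>x\<in>{a..b}. cmod (Complex M (de / 2) - of_real x) < de" using M by blast
 then have 1: "k <= Nf (Complex M (de / 2))" using de(2)[OF dom] de(1) by (simp add: less_imp_le)
 have "Nf (Complex M r) <= 1 / r^2"
 proof (rule Nf_le[OF dom[OF r(3)] r(3)])
  fix y show "r <= cmod (Complex M r - of_real y)"
   using abs_Im_le_cmod[of "Complex M r - of_real y"] r by simp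
 qed
 also have "... <= 1 / (1 / sqrt k)^2" using r k by (intro divide_left_mono power_mono) auto
 also have "... = k" using k by (simp add: power_divide)
 finally have 2: "Nf (Complex M r) <= k" .
 have "continuous_on {de / 2..r} (%h. Nf (Complex M h))"
 proof (rule continuous_on_compose2[OF Nf_continuous])
  show "continuous_on {de / 2..r} (Complex M)"
   unfolding complex_eq[of "Complex M _", simplified] Complex_eq by (intro continuous_intros)
  show "Complex M ` {de / 2..r} \<subseteq> upper_dom" using de dom by auto
 qed
 then obtain h where "de / 2 <= h" "h <= r" "Nf (Complex M h) = k"
  using IVT2'[of "%h. Nf (Complex M h)" r k "de / 2"] 1 2 r by auto
 then show ?thesis using de by (intro exI[of _ h]) (auto simp: M_def)
qed

text \<open>Openness is the open mapping theorem for \<open>X t\<close> on the upper half plane.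
  That map is not constant: its imaginary part is zero at a point of the level curve and positive at
  twice the height.\<close>

lemma inner_open_nonempty:
 assumes t: "t \<in> {0<..<T}"
 shows "open (inner t)" "inner t \<noteq> {}"
proof -
 obtain h where h: "h > 0" "Nf (Complex ((a + b) / 2) h) = thr t" using level_point[OF thr_pos[OF t]] by blast
 let ?z = "Complex ((a + b) / 2) h" and ?w = "Complex ((a + b) / 2) (2 * h)"
 have zd: "?z \<in> upper_dom" "?w \<in> upper_dom" using h by (auto simp: upper_dom_def)
 have z0: "Im (X t ?z) = 0" unfolding Im_X[OF zd(1)] using h thr_eq[OF t] by simp
 have "Nf ?w < Nf ?z"
 proof (rule Nf_strict_mono[OF zd])
  fix y :: real
  have "h^2 < (2 * h)^2" using h by (intro power_strict_mono) auto
  then show "cmod (?z - of_real y) < cmod (?w - of_real y)" by (simp add: cmod_def)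
 qed
 then have "kap * (T - t) * Nf ?w < kap * (T - t) * thr t" using h kap_pos t by simp
 then have w0: "Im (X t ?w) > 0" unfolding Im_X[OF zd(2)] using h thr_eq[OF t] by simp
 have "X t ?z = of_real (Re (X t ?z))" using z0 by (simp add: complex_eq_iff)
 then show "inner t \<noteq> {}" using h by (auto simp: inner_def intro!: exI[of _ "Re (X t ?z)"] exI[of _ ?z])
 let ?H = "{z. 0 < Im z}"
 have H: "open ?H" "connected ?H" "?H \<subseteq> upper_dom"
  using open_halfspace_Im_gt[of 0] convex_halfspace_Im_gt[of 0] convex_connected by (auto simp: upper_dom_def)
 have "open (X t ` ?H)"
 proof (rule open_mapping_thm[OF _ H(1,2,1)])
  show "X t holomorphic_on ?H"
   unfolding holomorphic_on_open[OF H(1)] using X_has_derivative H(3) by blast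
  show "\<not> X t constant_on ?H"
  proof
   assume "X t constant_on ?H"
   then have "X t ?z = X t ?w" using h unfolding constant_on_def by force
   then show False using z0 w0 by simp
  qed
 qed auto
 then have "open (complex_of_real -` (X t ` ?H))" by (intro open_vimage continuous_intros)
 moreover have "complex_of_real -` (X t ` ?H) = inner t" by (force simp: inner_def)
 ultimately show "open (inner t)" by simp
qed

lemma inner_closure:
 assumes t: "t \<in> {0<..<T}" and x: "x \<in> closure (inner t)"
 shows "x \<in> inner t \<or> x = edgeR t \<or> x = edgeL t"
proof -
 obtain xn where xn: "!!n. xn n \<in> inner t" "xn ----> x" using x unfolding closure_sequential by blast
 then have "\<forall>n. \<exists>z. Zin t (xn n) z" using Zin_of_Im_pos[OF t] by (fastforce simp: inner_def)
 then obtain zn where zn: "!!n. Zin t (xn n) (zn n)" by metis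
 have "\<forall>n. zn n \<in> cball 0 (A0 + 1 / sqrt (thr t))" using Zin_norm_le(1)[OF t zn] by simp
 then obtain z r where z: "strict_mono r" "(zn \<circ> r) ----> z"
  using compact_cball[of 0 "A0 + 1 / sqrt (thr t)"] unfolding compact_def by metis
 have "(%n. xn (r n)) ----> x" using LIMSEQ_subseq_LIMSEQ[OF xn(2) z(1)] by (simp add: o_def)
 moreover have "(%n. zn (r n)) ----> z" using z(2) by (simp add: o_def)
 ultimately have Z: "Zin t x z" using zn t by (intro Zin_closed[of "%n. t" t "%n. xn (r n)" x "%n. zn (r n)" z]) auto
 show ?thesis
 proof (cases "Im z = 0")
  case True
  from Zin_real[OF t Z this] show ?thesis by auto
 next
  case False
  then show ?thesis using Z by (auto simp: Zin_def inner_def)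
 qed
qed

text \<open>\<open>subordination_monotone\<close> with one of the two points real: both images are
  then real as well, and the positive real part of the quotient says that image and foot lie on the
  same side.\<close>

lemma edge_diff_sign:
 assumes t: "t \<in> {0<..<T}" and z: "0 < Im z" "X t z = of_real x"
  and w: "of_real e \<in> upper_dom" "Nf (of_real e) = thr t" "X t (of_real e) = of_real y"
 shows "0 < (x - y) * (Re z - e)"
proof -
 define k where "k = 1 / thr t"
 have k: "k > 0" "1 / k = thr t" using thr_pos[OF t] by (auto simp: k_def)
 have Zz: "Nf z = 1 / k" using Zin_of_Im_pos[OF t z] k by (simp add: Zin_def)
 have ne: "z \<noteq> of_real e" using z by auto
 have tk: "kap * (T - t) = t / T * k" using thr_eq[OF t] thr_pos[OF t] by (simp add: k_def)
 have X': "X t v = of_real (t / T) * (v + of_real k * G v)" for v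
  unfolding X_eq tk by (simp add: algebra_simps)
 have "0 < Re (((z + of_real k * G z) - (of_real e + of_real k * G (of_real e))) / (z - of_real e))"
  using z w ne Zz k by (intro subordination_monotone) auto
 then have "0 < t / T * Re (((z + of_real k * G z) - (of_real e + of_real k * G (of_real e))) / (z - of_real e))"
  using t T_pos by (intro mult_pos_pos) auto
 also have "... = Re (of_real (t / T) * (((z + of_real k * G z) - (of_real e + of_real k * G (of_real e))) / (z - of_real e)))"
  by (simp only: scaleR_conv_of_real[symmetric] scaleR_complex.sel)
 also have "of_real (t / T) * (((z + of_real k * G z) - (of_real e + of_real k * G (of_real e))) / (z - of_real e)) =
   (X t z - X t (of_real e)) / (z - of_real e)"
  unfolding X' by (simp only: right_diff_distrib times_divide_eq_right)
 also have "... = of_real (x - y) / (z - of_real e)" using z w by simp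
 also have "Re ... = (x - y) * (Re z - e) / (cmod (z - of_real e))^2"
  by (simp add: Re_divide cmod_power2)
 finally show ?thesis using ne by (simp add: zero_less_divide_iff)
qed

text \<open>A foot with \<open>Re z\<close> at or beyond \<open>edge t\<close> would be farther than
  \<open>edge t\<close> from every point of the support and so have smaller \<open>Nf\<close>, but
  both are on the level curve. The order of the feet is then carried over to the images.\<close>

lemma inner_subset:
 assumes t: "t \<in> {0<..<T}" and z: "0 < Im z" "X t z = of_real x"
 shows "x < edgeR t" "edgeL t < x"
proof -
 have zd: "z \<in> upper_dom" and Nz: "Nf z = thr t" using Zin_of_Im_pos[OF t z] by (auto simp: Zin_def)
 have e: "b < edge t" "Nf (of_real (edge t)) = thr t" using edge[OF t] by auto
 have ed: "of_real (edge t) \<in> upper_dom" using real_in_upper_dom e by simp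
 have closer: "(s - y)^2 < (Re z - y)^2 + (Im z)^2" if "\<bar>s - y\<bar> <= \<bar>Re z - y\<bar>" for s y :: real
 proof -
  have "(s - y)^2 <= (Re z - y)^2" using that by (simp add: abs_le_square_iff)
  moreover have "0 < (Im z)^2" using z by simp
  ultimately show ?thesis by linarith
 qed
 have cm: "cmod (of_real s - of_real y) < cmod (z - of_real y)" if "\<bar>s - y\<bar> <= \<bar>Re z - y\<bar>" for s y :: real
 proof (rule power2_less_imp_less)
  show "(cmod (of_real s - of_real y))^2 < (cmod (z - of_real y))^2"
   using closer[OF that] by (simp add: cmod_power2)
 qed simp
 have "Re z < edge t"
 proof (rule ccontr)
  assume "\<not> Re z < edge t"
  then have "Nf z < Nf (of_real (edge t))" using e by (intro Nf_strict_mono[OF ed zd] cm) auto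
  then show False using Nz e by simp
 qed
 then show "x < edgeR t"
  using edge_diff_sign[OF t z ed e(2), of "edgeR t"] Xr[of "edge t" t] e(1) by (simp add: edgeR_def zero_less_mult_iff)
 define l where "l = - refl.edge t"
 have l: "l < a" "Nf (of_real l) = thr t"
  using refl.edge[OF t] by (auto simp: l_def refl_Nf)
 have ld: "of_real l \<in> upper_dom" using real_in_upper_dom l by simp
 have Xl: "X t (of_real l) = of_real (edgeL t)"
 proof -
  have "- X t (of_real l) = of_real (refl.Xr t (refl.edge t))"
   using refl.Xr[of "refl.edge t" t] refl.edge(1)[OF t] by (simp add: l_def refl_X)
  then have "- (- X t (of_real l)) = - of_real (refl.Xr t (refl.edge t))" by (rule arg_cong)
  then show ?thesis by (simp only: minus_minus edgeL_def of_real_minus)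
 qed
 have "l < Re z"
 proof (rule ccontr)
  assume "\<not> l < Re z"
  then have "Nf z < Nf (of_real l)" using l by (intro Nf_strict_mono[OF ld zd] cm) auto
  then show False using Nz l by simp
 qed
 then show "edgeL t < x" using edge_diff_sign[OF t z ld l(2) Xl] by (simp add: zero_less_mult_iff)
qed

text \<open>\<open>inner t\<close> is open, nonempty and contained in the interval, and its closure
  adds at most the two end points; connectedness of the interval gives equality.\<close>

lemma inner_eq:
 assumes t: "t \<in> {0<..<T}"
 shows "inner t = {edgeL t<..<edgeR t}" "edgeL t < edgeR t"
proof -
 note O = inner_open_nonempty[OF t]
 have sub: "inner t \<subseteq> {edgeL t<..<edgeR t}" using inner_subset[OF t] by (auto simp: inner_def)
 then show "edgeL t < edgeR t" using O(2) by force
 have "{edgeL t<..<edgeR t} \<inter> inner t = {} \<or> {edgeL t<..<edgeR t} \<subseteq> inner t"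
  using inner_closure[OF t] by (intro connected_subset_or_disjoint O) (auto simp: connected_Ioo)
 then show "inner t = {edgeL t<..<edgeR t}" using sub O(2) by auto
qed

lemma ZL_exists: "t \<in> {0<..<T} ==> (\<exists>z. ZL t x z) \<longleftrightarrow> x <= edgeL t"
proof -
 assume t: "t \<in> {0<..<T}"
 have "(\<exists>z. ZL t x z) \<longleftrightarrow> (\<exists>z. refl.ZR t (- x) z)" unfolding ZL_def by (metis minus_minus)
 then show ?thesis using refl.ZR_exists[OF t, of "- x"] by (auto simp: edgeL_def)
qed

lemma ZZ_exists: "t \<in> {0<..<T} ==> \<exists>z. ZZ t x z"
proof -
 assume t: "t \<in> {0<..<T}"
 consider "x \<in> inner t" | "edgeR t <= x" | "x <= edgeL t" using inner_eq[OF t] by fastforce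
 then show ?thesis
  using ZR_exists[OF t, of x] ZL_exists[OF t, of x] by cases (auto simp: ZZ_def inner_def edgeR_def)
qed

lemma ZZ_cases:
 assumes t: "t \<in> {0<..<T}" and z: "ZZ t x z"
 shows "0 < Im z \<and> X t z = of_real x \<and> x \<in> inner t \<or> ZR t x z \<and> edgeR t <= x \<or> ZL t x z \<and> x <= edgeL t"
 using z ZR_exists[OF t, of x] ZL_exists[OF t, of x] by (auto simp: ZZ_def inner_def edgeR_def)

text \<open>Two different non-real feet of one point would make the difference quotient of
  \<open>subordination_monotone\<close> zero. For real feet uniqueness is the strict monotonicity of
  \<open>Xr\<close>, and the three ranges of \<open>x\<close> are disjoint.\<close>

lemma ZZ_unique:
 assumes t: "t \<in> {0<..<T}" and zw: "ZZ t x z" "ZZ t x w"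
 shows "z = w"
proof -
 note E = inner_eq[OF t]
 consider "x \<in> inner t" | "edgeR t <= x" | "x <= edgeL t" using E by fastforce
 then show ?thesis
 proof cases
  case 1
  then have zw': "0 < Im z" "X t z = of_real x" "0 < Im w" "X t w = of_real x"
   using ZZ_cases[OF t zw(1)] ZZ_cases[OF t zw(2)] E by auto
  show ?thesis
  proof (rule ccontr)
   assume ne: "z \<noteq> w"
   define k where "k = 1 / thr t"
   have k: "k > 0" "1 / k = thr t" using thr_pos[OF t] by (auto simp: k_def)
   have tk: "kap * (T - t) = t / T * k" using thr_eq[OF t] thr_pos[OF t] by (simp add: k_def)
   have X': "X t v = of_real (t / T) * (v + of_real k * G v)" for v
    unfolding X_eq tk by (simp add: algebra_simps)
   have "of_real (t / T) * (z + of_real k * G z) = of_real (t / T) * (w + of_real k * G w)"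
    using zw' X'[of z] X'[of w] by metis
   moreover have "complex_of_real (t / T) \<noteq> 0" using t T_pos by simp
   ultimately have eq: "z + of_real k * G z = w + of_real k * G w" by (metis mult_cancel_left)
   have "0 < Re (((z + of_real k * G z) - (w + of_real k * G w)) / (z - w))"
    using Zin_of_Im_pos[OF t zw'(1,2)] Zin_of_Im_pos[OF t zw'(3,4)] zw' ne k
    by (intro subordination_monotone) (auto simp: Zin_def)
   then show False by (simp add: eq)
  qed
 next
  case 2
  then have "ZR t x z" "ZR t x w" using ZZ_cases[OF t zw(1)] ZZ_cases[OF t zw(2)] E by auto
  then show ?thesis by (rule ZR_unique[OF t])
 next
  case 3
  then have "ZL t x z" "ZL t x w" using ZZ_cases[OF t zw(1)] ZZ_cases[OF t zw(2)] E by auto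
  then show ?thesis using refl.ZR_unique[OF t, of "- x" "- z" "- w"] by (simp add: ZL_def)
 qed
qed

section \<open>The foot as a continuous function of time and space\<close>

definition zz :: "real => real => complex" where "zz t x = (SOME z. ZZ t x z)"

lemma zz: "t \<in> {0<..<T} ==> ZZ t x (zz t x)"
 unfolding zz_def by (rule someI_ex[OF ZZ_exists])

lemma zz_eq: "t \<in> {0<..<T} ==> ZZ t x z ==> zz t x = z"
 using ZZ_unique zz by blast

lemma ZZ_closed:
 assumes lim: "tn ----> t" "xn ----> x" "zn ----> z" and t: "t \<in> {0<..<T}" "!!n. tn n \<in> {0<..<T}"
  and Z: "!!n. ZZ (tn n) (xn n) (zn n)"
 shows "ZZ t x z"
proof -
 have three: "Zin (tn n) (xn n) (zn n) \<or> ZR (tn n) (xn n) (zn n) \<or> ZL (tn n) (xn n) (zn n)" for n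
  using Z[of n] Zin_of_Im_pos[OF t(2)] by (auto simp: ZZ_def)
 have sub: "\<exists>r :: nat => nat. strict_mono r \<and> (\<forall>n. P (r n))" if "infinite {n. P n}" for P :: "nat => bool"
  using infinite_enumerate[OF that] by auto
 have inf: "infinite {n. Zin (tn n) (xn n) (zn n)} \<or> infinite {n. ZR (tn n) (xn n) (zn n)} \<or> infinite {n. ZL (tn n) (xn n) (zn n)}"
 proof (rule ccontr)
  assume "\<not> ?thesis"
  then have "finite ({n. Zin (tn n) (xn n) (zn n)} \<union> {n. ZR (tn n) (xn n) (zn n)} \<union> {n. ZL (tn n) (xn n) (zn n)})" by simp
  moreover have "{n. Zin (tn n) (xn n) (zn n)} \<union> {n. ZR (tn n) (xn n) (zn n)} \<union> {n. ZL (tn n) (xn n) (zn n)} = UNIV" using three by auto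
  ultimately show False by simp
 qed
 have lims: "(%n. tn (r n)) ----> t" "(%n. xn (r n)) ----> x" "(%n. zn (r n)) ----> z" if "strict_mono r" for r :: "nat => nat"
  using LIMSEQ_subseq_LIMSEQ[OF lim(1) that] LIMSEQ_subseq_LIMSEQ[OF lim(2) that] LIMSEQ_subseq_LIMSEQ[OF lim(3) that]
  by (auto simp: o_def)
 from inf show ?thesis
 proof (elim disjE)
  assume "infinite {n. Zin (tn n) (xn n) (zn n)}"
  from sub[OF this] obtain r :: "nat => nat" where r: "strict_mono r" "!!n. Zin (tn (r n)) (xn (r n)) (zn (r n))" by blast
  have "Zin t x z" by (rule Zin_closed[OF lims[OF r(1)] t(1) _ r(2)]) (rule t(2))
  then show ?thesis by (rule Zin_imp_ZZ[OF t(1)])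
 next
  assume "infinite {n. ZR (tn n) (xn n) (zn n)}"
  from sub[OF this] obtain r :: "nat => nat" where r: "strict_mono r" "!!n. ZR (tn (r n)) (xn (r n)) (zn (r n))" by blast
  have "ZR t x z" by (rule ZR_closed[OF lims[OF r(1)] t(1) _ r(2)]) (rule t(2))
  then show ?thesis by (simp add: ZZ_def)
 next
  assume "infinite {n. ZL (tn n) (xn n) (zn n)}"
  from sub[OF this] obtain r :: "nat => nat" where r: "strict_mono r" "!!n. ZL (tn (r n)) (xn (r n)) (zn (r n))" by blast
  have "refl.ZR t (- x) (- z)"
   by (rule refl.ZR_closed[OF lims(1)[OF r(1)] tendsto_minus[OF lims(2)[OF r(1)]] tendsto_minus[OF lims(3)[OF r(1)]] t(1)])
    (use t(2) r(2) in \<open>auto simp: ZL_def\<close>)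
  then show ?thesis by (simp add: ZZ_def ZL_def)
 qed
qed

text \<open>Compactness and uniqueness: feet stay bounded for times near \<open>t\<close>, every
  subsequential limit is a foot of the limiting point, and there is only one.\<close>

lemma zz_tendsto:
 assumes lim: "tn ----> t" "xn ----> x" and t: "t \<in> {0<..<T}" "!!n. tn n \<in> {0<..<T}"
 shows "(%n. zz (tn n) (xn n)) ----> zz t x"
proof (rule ccontr)
 assume "\<not> ?thesis"
 then obtain e where e: "e > 0" "\<not> (\<forall>\<^sub>F n in sequentially. dist (zz (tn n) (xn n)) (zz t x) < e)"
  unfolding tendsto_iff by blast
 from not_eventually_sequentiallyD[OF e(2)]
 obtain r :: "nat => nat" where r: "strict_mono r" "!!n. \<not> dist (zz (tn (r n)) (xn (r n))) (zz t x) < e" by blast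
 have thl: "(%n. thr (tn n)) ----> thr t"
  by (rule continuous_on_tendsto_compose[OF thr_continuous lim(1) t(1)]) (use t(2) in auto)
 have lm: "(%n. A0 + 1 / sqrt (thr (tn n))) ----> A0 + 1 / sqrt (thr t)"
  using thr_pos[OF t(1)] by (intro tendsto_intros thl) auto
 have "Bseq (%n. A0 + 1 / sqrt (thr (tn n)))" by (rule convergent_imp_Bseq[OF convergentI[OF lm]])
 then obtain M where "\<forall>n. norm (A0 + 1 / sqrt (thr (tn n))) <= M" by (rule BseqE)
 then have M: "\<bar>A0 + 1 / sqrt (thr (tn n))\<bar> <= M" for n by (simp add: real_norm_def)
 have "cmod (zz (tn n) (xn n)) <= M" for n
  using ZZ_norm_le[OF t(2)[of n] zz[OF t(2)[of n]], of "xn n"] M[of n] by linarith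
 then have bd: "bounded (range (%n. zz (tn (r n)) (xn (r n))))" by (auto simp: bounded_iff)
 have "\<exists>l q. strict_mono q \<and> ((%n. zz (tn (r n)) (xn (r n))) \<circ> q) ----> l"
  by (rule bounded_imp_convergent_subsequence[OF bd])
 then obtain z q where z: "strict_mono q" "((%n. zz (tn (r n)) (xn (r n))) \<circ> q) ----> z" by blast
 have zl: "(%n. zz (tn (r (q n))) (xn (r (q n)))) ----> z" using z(2) by (simp add: o_def)
 have rq: "strict_mono (%n. r (q n))" using strict_mono_o[OF r(1) z(1)] by (simp add: o_def)
 have "ZZ t x z"
 proof (rule ZZ_closed[OF _ _ zl t(1)])
  show "(%n. tn (r (q n))) ----> t" using LIMSEQ_subseq_LIMSEQ[OF lim(1) rq] by (simp add: o_def)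
  show "(%n. xn (r (q n))) ----> x" using LIMSEQ_subseq_LIMSEQ[OF lim(2) rq] by (simp add: o_def)
 qed (use t(2) zz in auto)
 then have "z = zz t x" using zz_eq[OF t(1)] by simp
 then have "\<forall>\<^sub>F n in sequentially. dist (zz (tn (r (q n))) (xn (r (q n)))) (zz t x) < e"
  using tendstoD[OF zl e(1)] by simp
 then show False using r(2) by (simp add: eventually_sequentially)
qed

lemma zz_continuous: "continuous_on ({0<..<T} \<times> UNIV) (%(t, x). zz t x)"
 unfolding continuous_on_sequentially comp_def
proof (intro allI ballI impI)
 fix xs :: "nat => real \<times> real" and l assume l: "l \<in> {0<..<T} \<times> UNIV" and xs: "(\<forall>n. xs n \<in> {0<..<T} \<times> UNIV) \<and> xs ----> l"
 have "(%n. zz (fst (xs n)) (snd (xs n))) ----> zz (fst l) (snd l)"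
  using xs l by (intro zz_tendsto tendsto_fst tendsto_snd) (auto simp: mem_Times_iff)
 then show "(%n. case xs n of (t, x) => zz t x) ----> (case l of (t, x) => zz t x)" by (simp add: case_prod_beta')
qed

end

section \<open>The complex potential\<close>

text \<open>Near a zero of order \<open>n\<close> the modulus is comparable with
  \<open>|w - z0|^n\<close>. This replaces a lower bound on the derivative, which fails for
  \<open>X t\<close> at the end points of the level curve, where the foot has a square root
  singularity.\<close>

lemma holomorphic_zero_comparable:
 assumes f: "f holomorphic_on ball z0 r" and r: "r > 0" and z0: "f z0 = 0" and nc: "\<not> f constant_on ball z0 r"
 shows "\<exists>r'>0. \<exists>K\<ge>0. \<forall>w v. cmod (w - z0) < r' \<longrightarrow> cmod (v - z0) <= cmod (w - z0) \<longrightarrow> cmod (f v) <= K * cmod (f w)"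
proof -
 obtain g s n where g: "0 < s" "g holomorphic_on ball z0 s" "!!w. w \<in> ball z0 s ==> f w = (w - z0) ^ n * g w" "!!w. w \<in> ball z0 s ==> g w \<noteq> 0"
  by (rule holomorphic_factor_zero_nonconstant[OF f open_ball _ _ z0 nc]) (use r in \<open>auto simp: convex_connected\<close>)
 define r' where "r' = s / 2"
 have r': "r' > 0" "cball z0 r' \<subseteq> ball z0 s" using g(1) by (auto simp: r'_def)
 have cg: "continuous_on (cball z0 r') (%w. cmod (g w))"
  by (intro continuous_on_norm continuous_on_subset[OF holomorphic_on_imp_continuous_on[OF g(2)] r'(2)])
 have ne: "cball z0 r' \<noteq> {}" using r'(1) by simp
 obtain wm where wm: "wm \<in> cball z0 r'" "!!w. w \<in> cball z0 r' ==> cmod (g wm) <= cmod (g w)"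
  using continuous_attains_inf[OF compact_cball ne cg] by blast
 obtain wM where wM: "wM \<in> cball z0 r'" "!!w. w \<in> cball z0 r' ==> cmod (g w) <= cmod (g wM)"
  using continuous_attains_sup[OF compact_cball ne cg] by blast
 define c where "c = cmod (g wm)"
 define M where "M = cmod (g wM)"
 have c: "c > 0" using g(4)[of wm] wm(1) r'(2) by (auto simp: c_def)
 have M: "M \<ge> 0" by (simp add: M_def)
 have "cmod (f v) <= M / c * cmod (f w)" if w: "cmod (w - z0) < r'" and v: "cmod (v - z0) <= cmod (w - z0)" for w v
 proof -
  have wv: "w \<in> cball z0 r'" "v \<in> cball z0 r'" using w v by (auto simp: dist_norm norm_minus_commute)
  then have fw: "f w = (w - z0) ^ n * g w" "f v = (v - z0) ^ n * g v" using g(3) r'(2) by blast+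
  have "cmod (f v) = cmod (v - z0) ^ n * cmod (g v)" by (simp add: fw norm_mult norm_power)
  also have "... <= cmod (w - z0) ^ n * M" using wM(2)[OF wv(2)] v by (intro mult_mono power_mono) (auto simp: M_def)
  also have "... = M / c * (cmod (w - z0) ^ n * c)" using c by simp
  also have "... <= M / c * (cmod (w - z0) ^ n * cmod (g w))"
   using wm(2)[OF wv(1)] c M by (intro mult_left_mono) (auto simp: c_def)
  also have "... = M / c * cmod (f w)" by (simp add: fw norm_mult norm_power)
  finally show ?thesis .
 qed
 then show ?thesis using r'(1) c M by (intro exI[of _ r'] conjI exI[of _ "M / c"]) auto
qed

context planning_data
begin

text \<open>The complex potential: at a foot \<open>z\<close> of the characteristic through \<open>(t, x)\<close> it is stationary in
 \<open>z\<close>, so that its partial derivatives there are \<open>(W z)\<^sup>2 / 2\<close> in \<open>t\<close> and \<open>- W z\<close> in \<open>x\<close>.\<close>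

definition FF :: "real => real => complex => complex" where
 "FF t x z = - W z * of_real x + (W z)\<^sup>2 * of_real t / 2 + of_real kap * Lf z - of_real (kap\<^sup>2 * T) * (G z)\<^sup>2 / 2"

definition W1 :: "complex => complex" where "W1 z = 1 / of_real T - of_real kap * G1 z"

lemma W_has_derivative: "z \<in> upper_dom ==> (W has_field_derivative W1 z) (at z)"
 unfolding W_def[abs_def] W1_def using T_pos by (auto intro!: derivative_eq_intros G_has_derivative)

lemma FF_has_derivative:
 assumes z: "z \<in> upper_dom"
 shows "(FF t x has_field_derivative W1 z * (X t z - of_real x)) (at z)"
proof -
 have "(FF t x has_field_derivative - W1 z * of_real x + 2 * W z * W1 z * of_real t / 2 + of_real kap * G z
   - of_real (kap^2 * T) * (2 * G z * G1 z) / 2) (at z)"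
  unfolding FF_def[abs_def]
  by (auto intro!: derivative_eq_intros W_has_derivative G_has_derivative Lf_has_derivative z)
 also have "- W1 z * of_real x + 2 * W z * W1 z * of_real t / 2 + of_real kap * G z
   - of_real (kap^2 * T) * (2 * G z * G1 z) / 2 = W1 z * (X t z - of_real x)"
 proof -
  have "of_real (kap * T) * G z * W1 z = of_real kap * G z - of_real (kap^2 * T) * (G z * G1 z)"
   using T_pos by (simp add: W1_def power2_eq_square algebra_simps)
  then show ?thesis by (simp add: X_def algebra_simps)
 qed
 finally show ?thesis .
qed

lemma FF_affine: "FF t' x' z - FF t x z = (W z)^2 / 2 * of_real (t' - t) - W z * of_real (x' - x)"
 by (simp add: FF_def algebra_simps) (simp add: field_simps)

lemma X_affine: "X t' z - X t z = of_real (t' - t) * W z"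
 by (simp add: X_def algebra_simps)

definition wr :: "real => real" where "wr bt = bt / T - kap * gr bt"

lemma W_real: "b <= bt ==> W (of_real bt) = of_real (wr bt)"
 by (simp add: W_def wr_def G_real)

lemma wr_continuous: "continuous_on {b..} wr"
 unfolding wr_def[abs_def] using T_pos by (intro continuous_intros gr_props(2)) auto

lemma wr_DERIV: "b < bt ==> (wr has_real_derivative 1 / T + kap * Nf (of_real bt)) (at bt)"
 unfolding wr_def[abs_def] using T_pos by (auto intro!: derivative_eq_intros gr_DERIV)

definition RF :: "real => real => real => real" where
 "RF t x bt = - wr bt * x + (wr bt)\<^sup>2 * t / 2 + kap * lr bt - kap\<^sup>2 * T * (gr bt)\<^sup>2 / 2"

lemma FF_real: "b <= bt ==> FF t x (of_real bt) = of_real (RF t x bt)"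
 by (simp add: FF_def RF_def W_real G_real Lf_real)

lemma Xr_wr: "Xr t bt = t * wr bt + kap * T * gr bt"
 using T_pos by (simp add: Xr_def wr_def field_simps)

text \<open>At \<open>b\<close> there is no derivative to work with, so the Cauchy mean value
  theorem is used: \<open>RF\<close> and \<open>wr\<close> have derivatives in the ratio
  \<open>Xr t' s - x'\<close>, hence increments in the same ratio at some \<open>s\<close>.
  Monotonicity places \<open>Xr t' s\<close> between \<open>x'\<close> and the image of
  \<open>b\<close>, which at the base point does not exceed \<open>x\<close>.\<close>

lemma frozen_estimate:
 assumes t: "t' \<in> {0<..<T}" and Zb: "ZR t x (of_real b)" and Z': "ZR t' x' z'"
 shows "cmod (FF t' x' z' - FF t' x' (of_real b)) <= \<bar>wr (Re z') - wr b\<bar> * ((\<bar>wr b\<bar> + 1) * (\<bar>t' - t\<bar> + \<bar>x' - x\<bar>))"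
proof -
 obtain bt where bt: "z' = of_real bt" "b <= bt" "bt <= edge t'" "Xr t' bt = x' \<or> bt = b \<and> Xr t' b <= x'"
  using Z' by (auto simp: ZR_iff[OF t])
 show ?thesis
 proof (cases "bt = b")
  case True
  then show ?thesis using bt by simp
 next
  case False
  then have bb: "b < bt" and Xbt: "Xr t' bt = x'" using bt by auto
  have cr: "continuous_on {b..bt} gr" "continuous_on {b..bt} lr" "continuous_on {b..bt} wr"
   using continuous_on_subset[OF gr_props(2)] continuous_on_subset[OF lr_props(2)] continuous_on_subset[OF wr_continuous] by auto
  have cRF: "continuous_on {b..bt} (RF t' x')" unfolding RF_def[abs_def] by (intro continuous_intros cr) auto
  have dRF: "(RF t' x' has_real_derivative (1 / T + kap * Nf (of_real s)) * (Xr t' s - x')) (at s)" if s: "b < s" for s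
  proof -
   obtain K where K: "1 / T + kap * Nf (of_real s) = K" by blast
   have "(RF t' x' has_real_derivative - K * x' + 2 * wr s * K * t' / 2
     + kap * gr s - kap\<^sup>2 * T * (2 * gr s * (- Nf (of_real s))) / 2) (at s)"
    unfolding RF_def[abs_def]
    by (auto intro!: derivative_eq_intros wr_DERIV[OF s, unfolded K] gr_DERIV lr_DERIV s)
   also have "- K * x' + 2 * wr s * K * t' / 2
     + kap * gr s - kap\<^sup>2 * T * (2 * gr s * (- Nf (of_real s))) / 2 = K * (Xr t' s - x')"
   proof -
    have "kap * T * gr s * K = kap * gr s + kap^2 * T * (gr s * Nf (of_real s))"
     unfolding K[symmetric] using T_pos by (simp add: power2_eq_square field_simps)
    then show ?thesis unfolding Xr_wr by (simp add: algebra_simps)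
   qed
   also have "K * (Xr t' s - x') = (1 / T + kap * Nf (of_real s)) * (Xr t' s - x')" unfolding K ..
   finally show ?thesis .
  qed
  \<comment> \<open>The auxiliary function of the Cauchy mean value theorem; it takes the same value
    at \<open>b\<close> and \<open>bt\<close>.\<close>
  define h where "h s = (RF t' x' bt - RF t' x' b) * wr s - (wr bt - wr b) * RF t' x' s" for s
  have "continuous_on {b..bt} h" unfolding h_def[abs_def] by (intro continuous_intros cr cRF)
  moreover have "(h has_derivative (*) ((RF t' x' bt - RF t' x' b) * (1 / T + kap * Nf (of_real s)) -
    (wr bt - wr b) * ((1 / T + kap * Nf (of_real s)) * (Xr t' s - x')))) (at s)" if s: "b < s" for s
   unfolding h_def[abs_def] has_field_derivative_def[symmetric]
   by (intro DERIV_diff DERIV_cmult wr_DERIV dRF s)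
  ultimately obtain s where s: "b < s" "s < bt" and hs: "h bt - h b = ((RF t' x' bt - RF t' x' b) * (1 / T + kap * Nf (of_real s)) -
    (wr bt - wr b) * ((1 / T + kap * Nf (of_real s)) * (Xr t' s - x'))) * (bt - b)"
   using mvt[OF bb, of h "%s. (*) ((RF t' x' bt - RF t' x' b) * (1 / T + kap * Nf (of_real s)) -
    (wr bt - wr b) * ((1 / T + kap * Nf (of_real s)) * (Xr t' s - x')))"] by blast
  have "h bt - h b = 0" by (simp add: h_def algebra_simps)
  with hs bb have GM: "(RF t' x' bt - RF t' x' b) * (1 / T + kap * Nf (of_real s)) =
    (wr bt - wr b) * ((1 / T + kap * Nf (of_real s)) * (Xr t' s - x'))" by simp
  define k where "k = 1 / T + kap * Nf (of_real s)"
  have k: "k > 0" using T_pos kap_pos Nf_pos[OF real_in_upper_dom(1)[OF s(1)]] by (simp add: k_def add_pos_pos)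
  have "(RF t' x' bt - RF t' x' b) * k = ((wr bt - wr b) * (Xr t' s - x')) * k" using GM by (simp add: k_def mult_ac)
  then have eq: "RF t' x' bt - RF t' x' b = (wr bt - wr b) * (Xr t' s - x')" using k by simp
  have "x' < Xr t' s" using Xr_strict[OF t, of s bt] s Xbt bt(3) by simp
  moreover have "Xr t' s < Xr t' b" using Xr_strict[OF t, of b s] s bt(3) by simp
  moreover have "Xr t b <= x" using Zb Xr[of b t] by (auto simp: ZR_def)
  moreover have "Xr t' b - Xr t b = (t' - t) * wr b" by (simp add: Xr_wr algebra_simps)
  moreover have "(t' - t) * wr b <= \<bar>t' - t\<bar> * \<bar>wr b\<bar>" by (metis abs_ge_self abs_mult)
  ultimately have "\<bar>Xr t' s - x'\<bar> <= \<bar>t' - t\<bar> * \<bar>wr b\<bar> + \<bar>x' - x\<bar>" by linarith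
  also have "... <= (\<bar>wr b\<bar> + 1) * (\<bar>t' - t\<bar> + \<bar>x' - x\<bar>)" by (simp add: algebra_simps)
  finally have le: "\<bar>Xr t' s - x'\<bar> <= (\<bar>wr b\<bar> + 1) * (\<bar>t' - t\<bar> + \<bar>x' - x\<bar>)" .
  have "cmod (FF t' x' z' - FF t' x' (of_real b)) = \<bar>RF t' x' bt - RF t' x' b\<bar>"
   using bt(1,2) by (simp add: FF_real flip: of_real_diff)
  also have "... = \<bar>wr bt - wr b\<bar> * \<bar>Xr t' s - x'\<bar>" unfolding eq by (rule abs_mult)
  also have "... <= \<bar>wr bt - wr b\<bar> * ((\<bar>wr b\<bar> + 1) * (\<bar>t' - t\<bar> + \<bar>x' - x\<bar>))" by (intro mult_left_mono le) auto
  finally show ?thesis using bt(1) by simp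
 qed
qed

end

context planning_data
begin

interpretation refl: planning_data "%x. p (- x)" "- b" "- a" cl C T by (rule reflected)

lemma ZZ_X:
 assumes z: "ZZ t x z" "z \<in> upper_dom"
 shows "X t z = of_real x" "0 <= Im z"
proof -
 have L: "X t z = of_real x" if zl: "refl.ZR t (- x) (- z)" "Re z < a"
 proof -
  obtain bt where bt: "bt = - Re z" by blast
  have zr: "- z = of_real bt" using zl(1) by (simp add: refl.ZR_def complex_eq_iff bt)
  have "Re (refl.X t (- z)) = - x" using zl by (auto simp: refl.ZR_def)
  moreover have "refl.X t (- z) = of_real (refl.Xr t bt)" unfolding zr by (rule refl.Xr) (use zl(2) bt in simp)
  ultimately have "refl.X t (- z) = of_real (- x)" by simp
  then show ?thesis by (simp add: refl_X)
 qed
 have R: "X t z = of_real x" if zl: "ZR t x z" "b < Re z"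
 proof -
  obtain bt where bt: "bt = Re z" by blast
  have zr: "z = of_real bt" using zl(1) by (simp add: ZR_def complex_eq_iff bt)
  have "Re (X t z) = x" using zl by (auto simp: ZR_def)
  moreover have "X t z = of_real (Xr t bt)" unfolding zr by (rule Xr) (use zl(2) bt in simp)
  ultimately show ?thesis by simp
 qed
 consider "0 < Im z \<and> X t z = of_real x" | "ZR t x z" | "refl.ZR t (- x) (- z)" using z(1) unfolding ZZ_def ZL_def by blast
 then show "X t z = of_real x"
 proof cases
  case 2
  then have "b < Re z" using z(2) ab unfolding ZR_def upper_dom_def by force
  then show ?thesis using R 2 by blast
 next
  case 3
  then have "Re z < a" using z(2) ab unfolding refl.ZR_def upper_dom_def by force
  then show ?thesis using L 3 by blast
 qed blast
 show "0 <= Im z" using z by (auto simp: ZZ_def ZL_def ZR_def refl.ZR_def)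
qed

section \<open>Differentiability of the complex potential\<close>

definition U :: "real => real => complex" where "U t x = FF t x (zz t x)"

text \<open>For a fixed foot \<open>FF\<close> is affine in time and space, with exactly the claimed
  slopes. What remains is the effect of moving the foot, and that has to be of smaller order than
  the displacement.\<close>

lemma U_has_derivative_criterion:
 assumes t: "t \<in> {0<..<T}"
  and et: "((%q. et q) ---> 0) (at (t, x))"
  and le: "\<forall>\<^sub>F q in at (t, x). cmod (FF (fst q) (snd q) (zz (fst q) (snd q)) - FF (fst q) (snd q) (zz t x)) <= et q * norm (q - (t, x))"
 shows "((%(t, x). U t x) has_derivative (%(s, y). (W (zz t x))^2 / 2 * of_real s - W (zz t x) * of_real y)) (at (t, x))"
proof (rule has_derivativeI)
 show "bounded_linear (%(s, y). (W (zz t x))^2 / 2 * of_real s - W (zz t x) * of_real y)"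
  unfolding case_prod_beta'
  by (intro bounded_linear_sub bounded_linear_const_mult bounded_linear_of_real[THEN bounded_linear_compose] bounded_linear_fst bounded_linear_snd)
 show "((%q. (((case q of (t, x) => U t x) - (case (t, x) of (t, x) => U t x))
   - (case q - (t, x) of (s, y) => (W (zz t x))^2 / 2 * of_real s - W (zz t x) * of_real y)) /\<^sub>R norm (q - (t, x))) ---> 0) (at (t, x))"
 proof (rule Lim_null_comparison[OF _ et])
  have ne: "\<forall>\<^sub>F q in at (t, x). q \<noteq> (t, x)" by (simp add: eventually_at_filter)
  from le ne show "\<forall>\<^sub>F q in at (t, x). norm ((((case q of (t, x) => U t x) - (case (t, x) of (t, x) => U t x))
   - (case q - (t, x) of (s, y) => (W (zz t x))^2 / 2 * of_real s - W (zz t x) * of_real y)) /\<^sub>R norm (q - (t, x))) <= et q"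
  proof eventually_elim
   case (elim q)
   have "((case q of (t, x) => U t x) - (case (t, x) of (t, x) => U t x))
    - (case q - (t, x) of (s, y) => (W (zz t x))^2 / 2 * of_real s - W (zz t x) * of_real y)
    = FF (fst q) (snd q) (zz (fst q) (snd q)) - FF (fst q) (snd q) (zz t x)"
    using FF_affine[of "fst q" "snd q" "zz t x" t x] by (simp add: U_def case_prod_beta' algebra_simps)
   moreover have "norm (q - (t, x)) > 0" using elim by simp
   ultimately show ?case using elim(1) by (simp add: divide_simps mult.commute)
  qed
 qed
qed

lemma abs_fst_snd_le: "\<bar>fst q - t\<bar> + \<bar>snd q - x\<bar> <= 2 * norm (q - (t, x))" for q :: "real \<times> real"
proof -
 have e: "(fst q - t, snd q - x) = q - (t, x)" by (simp add: prod_eq_iff)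
 have "norm (fst q - t) <= norm (q - (t, x))" "norm (snd q - x) <= norm (q - (t, x))"
  unfolding e[symmetric] by (rule norm_fst_le norm_snd_le)+
 then show ?thesis by simp
qed

lemma zz_tendsto_at:
 assumes t: "t \<in> {0<..<T}"
 shows "((%q. zz (fst q) (snd q)) ---> zz t x) (at (t, x))" "\<forall>\<^sub>F q in at (t, x). fst q \<in> {0<..<T}"
proof -
 have o: "open ({0<..<T} \<times> (UNIV :: real set))" by (intro open_Times) auto
 have "isCont (%(t, x). zz t x) (t, x)" using zz_continuous t by (simp add: continuous_on_eq_continuous_at[OF o])
 then show "((%q. zz (fst q) (snd q)) ---> zz t x) (at (t, x))" by (simp add: isCont_def case_prod_beta')
 have "\<forall>\<^sub>F q in at (t, x). q \<in> {0<..<T} \<times> (UNIV :: real set)" using t by (intro eventually_at_in_open' o) auto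
 then show "\<forall>\<^sub>F q in at (t, x). fst q \<in> {0<..<T}" by eventually_elim (auto simp: mem_Times_iff)
qed

text \<open>Moving the foot from \<open>z0\<close> to \<open>z'\<close> costs at most the length of
  the segment times the size of \<open>X t' - x'\<close> on it. The length tends to zero by
  continuity of \<open>zz\<close>, and the second factor is of the order of the displacement, even
  where \<open>X t\<close> is critical.\<close>

lemma U_has_derivative_regular:
 assumes t: "t \<in> {0<..<T}" and zd: "zz t x \<in> upper_dom"
 shows "((%(t, x). U t x) has_derivative (%(s, y). (W (zz t x))^2 / 2 * of_real s - W (zz t x) * of_real y)) (at (t, x))"
proof -
 define z0 where "z0 = zz t x"
 have Z0: "X t z0 = of_real x" "0 <= Im z0" using ZZ_X[OF zz[OF t, of x] zd] by (auto simp: z0_def)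
 obtain r0 where r0: "r0 > 0" "cball z0 r0 \<subseteq> upper_dom" using open_upper_dom zd open_contains_cball unfolding z0_def by blast
 define f where "f z = X t z - of_real x" for z
 have bs: "ball z0 r0 \<subseteq> upper_dom" using r0 by (meson ball_subset_cball subset_trans)
 have hf: "f holomorphic_on ball z0 r0"
  unfolding holomorphic_on_open[OF open_ball] f_def using X_has_derivative bs by (auto intro!: exI derivative_eq_intros)
 \<comment> \<open>Were \<open>X t\<close> constant near \<open>z0\<close>, two points vertically
   above \<open>z0\<close> would both lie on the level curve, but \<open>Nf\<close> strictly
   decreases upwards.\<close>
 have nc: "\<not> f constant_on ball z0 r0"
 proof
  assume "f constant_on ball z0 r0"
  moreover have "f z0 = 0" using Z0 by (simp add: f_def)
  ultimately have f0: "f z = 0" if "z \<in> ball z0 r0" for z using that r0(1) unfolding constant_on_def by (metis centre_in_ball)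
  define z1 where "z1 = z0 + \<i> * of_real (r0 / 4)"
  define z2 where "z2 = z0 + \<i> * of_real (r0 / 2)"
  have in1: "z1 \<in> ball z0 r0" "z2 \<in> ball z0 r0" using r0(1) by (auto simp: z1_def z2_def dist_norm norm_mult)
  have im: "0 < Im z1" "0 < Im z2" using Z0 r0(1) by (auto simp: z1_def z2_def)
  have "X t z1 = of_real x" "X t z2 = of_real x" using f0[OF in1(1)] f0[OF in1(2)] by (auto simp: f_def)
  then have "Nf z1 = thr t" "Nf z2 = thr t" using Zin_of_Im_pos[OF t im(1)] Zin_of_Im_pos[OF t im(2)] by (auto simp: Zin_def)
  moreover have "Nf z2 < Nf z1"
  proof (rule Nf_strict_mono)
   show "z1 \<in> upper_dom" "z2 \<in> upper_dom" using in1 bs by auto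
   fix y
   have "(Im z0 + r0 / 4)^2 < (Im z0 + r0 / 2)^2" using Z0 r0(1) by (intro power_strict_mono) auto
   then show "cmod (z1 - of_real y) < cmod (z2 - of_real y)" by (simp add: cmod_def z1_def z2_def)
  qed
  ultimately show False by simp
 qed
 have "f z0 = 0" using Z0 by (simp add: f_def)
 from holomorphic_zero_comparable[OF hf r0(1) this nc]
 obtain r1 K where r1: "r1 > 0" "K \<ge> 0" "!!w v. cmod (w - z0) < r1 ==> cmod (v - z0) <= cmod (w - z0) ==> cmod (f v) <= K * cmod (f w)"
  by blast
 have W1_cont: "continuous_on (cball z0 r0) W1"
 proof -
  have "W holomorphic_on upper_dom" unfolding holomorphic_on_open[OF open_upper_dom] using W_has_derivative by blast
  then have "deriv W holomorphic_on upper_dom" by (rule holomorphic_deriv[OF _ open_upper_dom])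
  then have "continuous_on (cball z0 r0) (deriv W)" using holomorphic_on_imp_continuous_on continuous_on_subset r0(2) by blast
  then show ?thesis by (rule continuous_on_eq) (use W_has_derivative r0(2) in \<open>auto intro!: DERIV_imp_deriv\<close>)
 qed
 have W_cont: "continuous_on (cball z0 r0) W"
  using W_has_derivative r0(2) by (intro continuous_at_imp_continuous_on ballI DERIV_isCont) blast
 obtain B where B: "!!z. z \<in> cball z0 r0 ==> cmod (W z) <= B"
  using compact_imp_bounded[OF compact_continuous_image[OF W_cont compact_cball]] unfolding bounded_iff by blast
 obtain B' where B': "!!z. z \<in> cball z0 r0 ==> cmod (W1 z) <= B'"
  using compact_imp_bounded[OF compact_continuous_image[OF W1_cont compact_cball]] unfolding bounded_iff by blast
 have z0c: "z0 \<in> cball z0 r0" using r0(1) by simp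
 have Bnn: "0 <= B" "0 <= B'" using B[OF z0c] B'[OF z0c] norm_ge_zero order_trans by blast+
 define Q where "Q = B' * ((K + 1) * (B + 1)) * 2"
 show ?thesis
 proof (rule U_has_derivative_criterion[OF t])
  have "((%q. Q * cmod (zz (fst q) (snd q) - zz t x)) ---> Q * cmod (zz t x - zz t x)) (at (t, x))"
   by (intro tendsto_intros zz_tendsto_at[OF t])
  then show "((%q. Q * cmod (zz (fst q) (snd q) - zz t x)) ---> 0) (at (t, x))" by simp
  have "\<forall>\<^sub>F q in at (t, x). dist (zz (fst q) (snd q)) (zz t x) < min r0 r1"
   using r0 r1 by (intro tendstoD zz_tendsto_at[OF t]) auto
  with zz_tendsto_at(2)[OF t]
  show "\<forall>\<^sub>F q in at (t, x). cmod (FF (fst q) (snd q) (zz (fst q) (snd q)) - FF (fst q) (snd q) (zz t x)) <=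
   Q * cmod (zz (fst q) (snd q) - zz t x) * norm (q - (t, x))"
  proof eventually_elim
   case (elim q)
   define t' x' z' where "t' = fst q" and "x' = snd q" and "z' = zz t' x'"
   define d where "d = \<bar>t' - t\<bar> + \<bar>x' - x\<bar>"
   have t': "t' \<in> {0<..<T}" using elim by (simp add: t'_def)
   have z': "cmod (z' - z0) < r0" "cmod (z' - z0) < r1" using elim by (auto simp: z'_def z0_def t'_def x'_def dist_norm)
   have z'c: "z' \<in> cball z0 r0" using z' by (simp add: dist_norm norm_minus_commute)
   have X': "X t' z' = of_real x'" using ZZ_X(1)[OF zz[OF t', of x']] z'c r0(2) by (auto simp: z'_def)
   \<comment> \<open>\<open>z'\<close> is an exact foot for \<open>(t', x')\<close>, so
     \<open>f z'\<close> is a mere displacement. Comparability carries this bound from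
     \<open>z'\<close> to the whole segment.\<close>
   have fz': "cmod (f z') <= (B + 1) * d"
   proof -
    have "f z' = of_real (x' - x) - of_real (t' - t) * W z'"
     using X_affine[of t' z' t] X' by (simp add: f_def algebra_simps)
    then have "cmod (f z') <= cmod (of_real (x' - x)) + cmod (of_real (t' - t) * W z')" by (metis norm_triangle_ineq4)
    also have "... <= \<bar>x' - x\<bar> + \<bar>t' - t\<bar> * B" using B[OF z'c] by (simp only: norm_mult norm_of_real) (simp add: mult_left_mono)
    also have "... <= (B + 1) * d" using Bnn by (simp add: d_def algebra_simps)
    finally show ?thesis .
   qed
   have "cmod (FF t' x' z' - FF t' x' z0) <= B' * ((K + 1) * (B + 1) * d) * cmod (z' - z0)"
   proof (rule field_differentiable_bound[where S="closed_segment z0 z'" and f'="%z. W1 z * (X t' z - of_real x')"])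
    fix v assume v: "v \<in> closed_segment z0 z'"
    have vd: "cmod (v - z0) <= cmod (z' - z0)" using segment_bound(1)[OF v] by (simp add: norm_minus_commute)
    have vc: "v \<in> cball z0 r0" using vd z' by (simp add: dist_norm norm_minus_commute)
    show "(FF t' x' has_field_derivative W1 v * (X t' v - of_real x')) (at v within closed_segment z0 z')"
     by (rule has_field_derivative_at_within, rule FF_has_derivative) (rule subsetD[OF r0(2) vc])
    have "X t' v - of_real x' = f v + (of_real (t' - t) * W v - of_real (x' - x))"
     using X_affine[of t' v t] by (simp add: f_def algebra_simps)
    then have "cmod (X t' v - of_real x') <= cmod (f v) + cmod (of_real (t' - t) * W v - of_real (x' - x))"
     by (metis norm_triangle_ineq)
    also have "cmod (of_real (t' - t) * W v - of_real (x' - x)) <= cmod (of_real (t' - t) * W v) + cmod (complex_of_real (x' - x))"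
     by (rule norm_triangle_ineq4)
    also have "... <= \<bar>t' - t\<bar> * B + \<bar>x' - x\<bar>" using B[OF vc] by (simp only: norm_mult norm_of_real) (simp add: mult_left_mono)
    also have "... <= (B + 1) * d" using Bnn by (simp add: d_def algebra_simps)
    also have "cmod (f v) <= K * ((B + 1) * d)"
     using r1(3)[OF z'(2) vd] mult_left_mono[OF fz' r1(2)] by linarith
    finally have "cmod (X t' v - of_real x') <= (K + 1) * (B + 1) * d" by (simp add: algebra_simps)
    then show "cmod (W1 v * (X t' v - of_real x')) <= B' * ((K + 1) * (B + 1) * d)"
     unfolding norm_mult using B'[OF vc] Bnn by (intro mult_mono) auto
   qed auto
   also have "... = B' * ((K + 1) * (B + 1)) * cmod (z' - z0) * d" by (simp add: mult_ac)
   also have "... <= B' * ((K + 1) * (B + 1)) * cmod (z' - z0) * (2 * norm (q - (t, x)))"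
    using abs_fst_snd_le[of q t x] Bnn r1(2) by (intro mult_left_mono) (auto simp: d_def t'_def x'_def)
   finally show ?case by (simp only: Q_def z0_def z'_def t'_def x'_def mult_ac)
  qed
 qed
qed

lemma FF_left:
 assumes "- a <= bt"
 shows "FF t x (- of_real bt) = refl.FF t (- x) (of_real bt) + of_real kap * (\<i> * pi)"
 using Lf_left[OF assms] refl.Lf_real[OF assms]
 by (simp add: FF_def refl.FF_def refl_W refl_G algebra_simps)

lemma zz_not_upper_dom:
 assumes t: "t \<in> {0<..<T}" and "zz t x \<notin> upper_dom"
 shows "ZR t x (of_real b) \<and> zz t x = of_real b \<or> refl.ZR t (- x) (of_real (- a)) \<and> zz t x = of_real a"
proof -
 have "\<not> 0 < Im (zz t x)" and re: "a <= Re (zz t x)" "Re (zz t x) <= b" using assms(2) by (auto simp: upper_dom_def)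
 then consider "ZR t x (zz t x)" | "ZL t x (zz t x)" using zz[OF t, of x] by (auto simp: ZZ_def)
 then show ?thesis
 proof cases
  case 1
  then have "zz t x = of_real b" using re by (auto simp: ZR_def complex_eq_iff)
  then show ?thesis using 1 by simp
 next
  case 2
  then have "zz t x = of_real a" using re by (auto simp: ZL_def refl.ZR_def complex_eq_iff)
  then show ?thesis using 2 by (simp add: ZL_def)
 qed
qed

text \<open>Close to the support \<open>Nf\<close> exceeds all thresholds of nearby times, so no
  non-real foot can be close to a frozen one.\<close>

lemma zz_frozen_nearby:
 assumes t: "t \<in> {0<..<T}" and y: "zz t x = of_real y" "y \<in> {a..b}"
 shows "\<forall>\<^sub>F q in at (t, x). fst q \<in> {0<..<T} \<and> cmod (zz (fst q) (snd q) - of_real y) < b - a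
  \<and> (ZR (fst q) (snd q) (zz (fst q) (snd q)) \<or> ZL (fst q) (snd q) (zz (fst q) (snd q)))"
proof -
 obtain d where d: "d > 0" "!!z. z \<in> upper_dom ==> \<exists>x\<in>{a..b}. cmod (z - of_real x) < d ==> thr t + 1 < Nf z"
  using Nf_large_near_support[of "thr t + 1"] by blast
 have "isCont thr t" using thr_continuous t by (simp add: continuous_on_eq_continuous_at)
 moreover have "(fst ---> t) (at (t, x))" using tendsto_fst[OF tendsto_ident_at, of "(t, x)" UNIV] by simp
 ultimately have "((%q. thr (fst q)) ---> thr t) (at (t, x))" by (rule isCont_tendsto_compose)
 then have e1: "\<forall>\<^sub>F q in at (t, x). thr (fst q) < thr t + 1" by (rule order_tendstoD) simp
 have e2: "\<forall>\<^sub>F q in at (t, x). dist (zz (fst q) (snd q)) (zz t x) < min d (b - a)"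
  using d ab by (intro tendstoD zz_tendsto_at[OF t]) auto
 from zz_tendsto_at(2)[OF t, of x] e1 e2 show ?thesis
 proof eventually_elim
  case (elim q)
  let ?z = "zz (fst q) (snd q)"
  have n: "cmod (?z - of_real y) < d" "cmod (?z - of_real y) < b - a" using elim(3) y by (auto simp: dist_norm)
  have "\<not> (0 < Im ?z \<and> X (fst q) ?z = of_real (snd q))"
  proof
   assume "0 < Im ?z \<and> X (fst q) ?z = of_real (snd q)"
   then have "Zin (fst q) (snd q) ?z" using Zin_of_Im_pos[OF elim(1)] by blast
   then have zi: "?z \<in> upper_dom" "Nf ?z = thr (fst q)" by (auto simp: Zin_def)
   have "\<exists>x\<in>{a..b}. cmod (?z - of_real x) < d" using n(1) y(2) by blast
   from d(2)[OF zi(1) this] show False using zi(2) elim(2) by linarith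
  qed
  then show ?case using zz[OF elim(1), of "snd q"] n elim(1) by (auto simp: ZZ_def)
 qed
qed

lemma wr_clamped_tendsto:
 assumes "(f ---> b) F"
 shows "((%q. \<bar>wr (max b (f q)) - wr b\<bar> * ((\<bar>wr b\<bar> + 1) * 2)) ---> 0) F"
proof -
 have "continuous_on UNIV (%s. wr (max b s))"
  by (rule continuous_on_compose2[OF wr_continuous]) (auto intro!: continuous_intros)
 then have "isCont (%s. wr (max b s)) b" by (simp add: continuous_on_eq_continuous_at)
 then have "((%q. wr (max b (f q))) ---> wr (max b b)) F" using isCont_tendsto_compose assms by blast
 then have "((%q. \<bar>wr (max b (f q)) - wr b\<bar> * ((\<bar>wr b\<bar> + 1) * 2)) ---> \<bar>wr (max b b) - wr b\<bar> * ((\<bar>wr b\<bar> + 1) * 2)) F"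
  by (intro tendsto_intros)
 then show ?thesis by simp
qed

end

context planning_data
begin

interpretation refl: planning_data "%x. p (- x)" "- b" "- a" cl C T by (rule reflected)

definition w :: "real => real => complex" where "w t x = W (zz t x)"

lemma U_has_derivative:
 assumes t: "t \<in> {0<..<T}"
 shows "((%(t, x). U t x) has_derivative (%(s, y). (w t x)^2 / 2 * of_real s - w t x * of_real y)) (at (t, x))"
proof (cases "zz t x \<in> upper_dom")
 case True
 then show ?thesis using U_has_derivative_regular[OF t] by (simp add: w_def)
next
 case False
 have re: "((%q. Re (zz (fst q) (snd q))) ---> Re (zz t x)) (at (t, x))" by (intro tendsto_Re zz_tendsto_at t)
 from zz_not_upper_dom[OF t False] show ?thesis
 proof
  assume z: "ZR t x (of_real b) \<and> zz t x = of_real b"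
  have yb: "zz t x = of_real b" "b \<in> {a..b}" using z ab by auto
  have "((%(t, x). U t x) has_derivative (%(s, y). (W (zz t x))^2 / 2 * of_real s - W (zz t x) * of_real y)) (at (t, x))"
  proof (rule U_has_derivative_criterion[OF t])
   show "((%q. \<bar>wr (max b (Re (zz (fst q) (snd q)))) - wr b\<bar> * ((\<bar>wr b\<bar> + 1) * 2)) ---> 0) (at (t, x))"
    using re z by (intro wr_clamped_tendsto) simp
   from zz_frozen_nearby[OF t yb]
   show "\<forall>\<^sub>F q in at (t, x). cmod (FF (fst q) (snd q) (zz (fst q) (snd q)) - FF (fst q) (snd q) (zz t x)) <=
    \<bar>wr (max b (Re (zz (fst q) (snd q)))) - wr b\<bar> * ((\<bar>wr b\<bar> + 1) * 2) * norm (q - (t, x))"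
   proof eventually_elim
    case (elim q)
    let ?z = "zz (fst q) (snd q)"
    have "\<bar>Re ?z - b\<bar> < b - a" using elim abs_Re_le_cmod[of "?z - of_real b"] by simp
    then have "\<not> ZL (fst q) (snd q) ?z" by (auto simp: ZL_def refl.ZR_def)
    then have ZRq: "ZR (fst q) (snd q) ?z" using elim by blast
    then have mx: "max b (Re ?z) = Re ?z" by (auto simp: ZR_def)
    have l1: "cmod (FF (fst q) (snd q) ?z - FF (fst q) (snd q) (of_real b))
     <= \<bar>wr (Re ?z) - wr b\<bar> * ((\<bar>wr b\<bar> + 1) * (\<bar>fst q - t\<bar> + \<bar>snd q - x\<bar>))"
     using frozen_estimate[of "fst q" t x "snd q" ?z] ZRq z elim by blast
    have l2: "\<bar>wr (Re ?z) - wr b\<bar> * ((\<bar>wr b\<bar> + 1) * (\<bar>fst q - t\<bar> + \<bar>snd q - x\<bar>)) <= \<bar>wr (Re ?z) - wr b\<bar> * ((\<bar>wr b\<bar> + 1) * (2 * norm (q - (t, x))))"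
     by (intro mult_left_mono abs_fst_snd_le) auto
    show ?case unfolding yb(1) mx using order_trans[OF l1 l2] by (simp only: mult.assoc)
   qed
  qed
  then show ?thesis by (simp add: w_def)
 next
  assume z: "refl.ZR t (- x) (of_real (- a)) \<and> zz t x = of_real a"
  have ya: "zz t x = of_real a" "a \<in> {a..b}" using z ab by auto
  have "((%(t, x). U t x) has_derivative (%(s, y). (W (zz t x))^2 / 2 * of_real s - W (zz t x) * of_real y)) (at (t, x))"
  proof (rule U_has_derivative_criterion[OF t])
   have "((%q. - Re (zz (fst q) (snd q))) ---> - a) (at (t, x))" using tendsto_minus[OF re] z by simp
   then show "((%q. \<bar>refl.wr (max (- a) (- Re (zz (fst q) (snd q)))) - refl.wr (- a)\<bar> * ((\<bar>refl.wr (- a)\<bar> + 1) * 2)) ---> 0) (at (t, x))"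
    by (rule refl.wr_clamped_tendsto)
   from zz_frozen_nearby[OF t ya]
   show "\<forall>\<^sub>F q in at (t, x). cmod (FF (fst q) (snd q) (zz (fst q) (snd q)) - FF (fst q) (snd q) (zz t x)) <=
    \<bar>refl.wr (max (- a) (- Re (zz (fst q) (snd q)))) - refl.wr (- a)\<bar> * ((\<bar>refl.wr (- a)\<bar> + 1) * 2) * norm (q - (t, x))"
   proof eventually_elim
    case (elim q)
    let ?z = "zz (fst q) (snd q)"
    have "\<bar>Re ?z - a\<bar> < b - a" using elim abs_Re_le_cmod[of "?z - of_real a"] by simp
    then have "\<not> ZR (fst q) (snd q) ?z" by (auto simp: ZR_def)
    then have ZRq: "refl.ZR (fst q) (- snd q) (- ?z)" using elim by (auto simp: ZL_def)
    then have mx: "max (- a) (- Re ?z) = - Re ?z" and zr: "?z = - of_real (- Re ?z)" "- a <= - Re ?z"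
     by (auto simp: refl.ZR_def complex_eq_iff)
    have zm: "- ?z = of_real (- Re ?z)" using zr(1) by (metis add.inverse_inverse)
    \<comment> \<open>The two potentials differ by the constant jump of \<open>Lf\<close> across the
      support, which cancels in the difference.\<close>
    have d1: "FF (fst q) (snd q) ?z = refl.FF (fst q) (- snd q) (- ?z) + of_real kap * (\<i> * pi)"
     using FF_left[OF zr(2), of "fst q" "snd q"] unfolding zm[symmetric] by simp
    have d2: "FF (fst q) (snd q) (of_real a) = refl.FF (fst q) (- snd q) (of_real (- a)) + of_real kap * (\<i> * pi)"
     using FF_left[of "- a" "fst q" "snd q"] by simp
    have l1: "cmod (refl.FF (fst q) (- snd q) (- ?z) - refl.FF (fst q) (- snd q) (of_real (- a)))
     <= \<bar>refl.wr (Re (- ?z)) - refl.wr (- a)\<bar> * ((\<bar>refl.wr (- a)\<bar> + 1) * (\<bar>fst q - t\<bar> + \<bar>- snd q - - x\<bar>))"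
     using refl.frozen_estimate[of "fst q" t "- x" "- snd q" "- ?z"] ZRq z elim by blast
    have l2: "\<bar>refl.wr (Re (- ?z)) - refl.wr (- a)\<bar> * ((\<bar>refl.wr (- a)\<bar> + 1) * (\<bar>fst q - t\<bar> + \<bar>- snd q - - x\<bar>))
     <= \<bar>refl.wr (Re (- ?z)) - refl.wr (- a)\<bar> * ((\<bar>refl.wr (- a)\<bar> + 1) * (2 * norm (q - (t, x))))"
     using abs_fst_snd_le[of q t x] by (intro mult_left_mono) auto
    show ?case unfolding ya(1) d1 d2 mx using order_trans[OF l1 l2]
     by (simp only: add_diff_cancel_right uminus_complex.simps mult.assoc)
   qed
  qed
  then show ?thesis by (simp add: w_def)
 qed
qed

end

section \<open>The solution and its distribution function\<close>

lemma real_distribution_of_antiderivative: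
 fixes f F :: "real => real"
 assumes f: "!!x. 0 <= f x" "continuous_on UNIV f" "!!x. (F has_real_derivative f x) (at x)"
  and l: "!!x. x <= l ==> F x = 0" and r: "!!x. r <= x ==> F x = 1"
  and z: "!!x. x < l ==> f x = 0" "!!x. r < x ==> f x = 0"
 shows "real_distribution (ldens f)" "cdf (ldens f) x = F x"
proof -
 have bm: "f \<in> borel_measurable borel" using f(2) by (rule borel_measurable_continuous_onI)
 have em: "emeasure (ldens f) {..x} = ennreal (F x)" for x
 proof -
  define l0 where "l0 = min l x"
  have "emeasure (ldens f) {..x} = (\<integral>\<^sup>+y. ennreal (f y) * indicator {..x} y \<partial>lborel)"
   using bm by (intro emeasure_density) auto
  also have "... = (\<integral>\<^sup>+y. ennreal (f y) * indicator {l0..x} y \<partial>lborel)"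
   by (intro nn_integral_cong) (auto simp: indicator_def l0_def z)
  also have "... = ennreal (F x - F l0)"
  proof (rule nn_integral_FTC_Icc)
   show "l0 <= x" by (simp add: l0_def)
  qed (use f bm in auto)
  also have "F l0 = 0" by (rule l) (simp add: l0_def)
  finally show ?thesis by simp
 qed
 have "emeasure (ldens f) UNIV = (\<integral>\<^sup>+y. ennreal (f y) * indicator UNIV y \<partial>lborel)"
  using bm by (intro emeasure_density) auto
 also have "... = (\<integral>\<^sup>+y. ennreal (f y) * indicator {..r} y \<partial>lborel)"
  by (intro nn_integral_cong) (auto simp: indicator_def z not_le)
 also have "... = emeasure (ldens f) {..r}" using bm by (intro emeasure_density[symmetric]) auto
 also have "... = 1" using em[of r] r[of r] by simp
 finally have tot: "emeasure (ldens f) UNIV = 1" .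
 show "real_distribution (ldens f)"
  by (intro real_distribution.intro prob_spaceI real_distribution_axioms.intro) (use tot in auto)
 have "F (min l x) <= F x" by (rule DERIV_nonneg_imp_nondecreasing) (use f in auto)
 then have "0 <= F x" using l[of "min l x"] by simp
 then show "cdf (ldens f) x = F x" by (simp add: cdf_def measure_def em)
qed

lemma C1_strip_imp_Ck_on_1:
 assumes C: "C1_strip I f ft fx" and I: "open I"
 shows "Ck_on 1 (I \<times> UNIV) (%(t, x). f t x)"
proof -
 have D: "((%(t, x). f t x) has_derivative (%(c, d). ft (fst q) (snd q) * c + fx (fst q) (snd q) * d)) (at q)" if "q \<in> I \<times> UNIV" for q
  using C1_strip_has_derivative[OF C I, of "fst q" "snd q"] that by auto
 have "continuous_on (I \<times> UNIV) (%q. frechet_derivative (%(t, x). f t x) (at q) v)" for v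
 proof -
  have "continuous_on (I \<times> UNIV) (%q. (%(t, x). ft t x) q * fst v + (%(t, x). fx t x) q * snd v)"
   by (intro continuous_intros C1_stripD(4,5)[OF C])
  then show ?thesis
   by (rule continuous_on_eq) (use frechet_derivative_at[OF D, symmetric] in \<open>auto simp: case_prod_beta'\<close>)
 qed
 moreover have "(%(t, x). f t x) differentiable (at q)" if "q \<in> I \<times> UNIV" for q
  using D[OF that] unfolding differentiable_def by blast
 ultimately show ?thesis unfolding One_nat_def Ck_on.simps by blast
qed

text \<open>The stream function is paired with the test function on a rectangle around its support,
  where all boundary terms vanish. No derivative of \<open>m\<close> is ever formed.\<close>

lemma continuity_eq_of_potential:
 assumes N: "C1_strip {0<..<T} N (%t x. m t x * dx u t x) m"
 shows "continuity_eq T u m"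
 unfolding continuity_eq_def
proof (intro allI impI, elim conjE exE)
 fix ps :: "real => real => real" and K
 assume sm: "smooth_on UNIV (%(t, x). ps t x)" and K: "compact K" "K \<subseteq> {0<..<T} \<times> UNIV" "\<forall>t x. (t, x) \<notin> K \<longrightarrow> ps t x = 0"
 let ?J = "{0<..<T}"
 let ?g = "%(t, x). - m t x * dt ps t x + m t x * dx u t x * dx ps t x"
 have "Ck_on 1 (?J \<times> UNIV) (%(t, x). ps t x)"
 proof -
  have C: "Ck_on 1 UNIV (%(t, x). ps t x)" using sm by (auto simp: smooth_on_def)
  then show ?thesis unfolding One_nat_def Ck_on.simps using continuous_on_subset[OF _ subset_UNIV] by blast
 qed
 then have P: "C1_strip ?J ps (dt ps) (dx ps)" by (rule Ck_on_1_imp_C1_strip) simp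
 have oK: "open (- K)" using K(1) by (simp add: compact_imp_closed open_Compl)
 have zt: "dt ps t x = 0" and zx: "dx ps t x = 0" if q: "(t, x) \<notin> K" for t x
 proof -
  have o: "open ((%s. (s, x)) -` (- K))" "open ((%y. (t, y)) -` (- K))"
   by (intro open_vimage oK continuous_intros)+
  have "\<forall>\<^sub>F s in nhds t. s \<in> (%s. (s, x)) -` (- K)" "\<forall>\<^sub>F y in nhds x. y \<in> (%y. (t, y)) -` (- K)"
   using eventually_nhds_in_open[OF o(1), of t] eventually_nhds_in_open[OF o(2), of x] q by auto
  then have "\<forall>\<^sub>F s in nhds t. ps s x = 0" "\<forall>\<^sub>F y in nhds x. ps t y = 0"
   using K(3) by (auto elim!: eventually_mono)
  then show "dt ps t x = 0" "dx ps t x = 0"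
   using deriv_cong_ev[of "%s. ps s x" "%_. 0" t t] deriv_cong_ev[of "ps t" "%_. 0" x x] by (auto simp: dt_def dx_def)
 qed
 have gK: "?g q = 0" if "q \<notin> K" for q using zt zx that by (cases q) auto
 have cg: "continuous_on (?J \<times> UNIV) ?g"
  using continuous_on_add[OF continuous_on_mult[OF continuous_on_minus[OF C1_stripD(5)[OF N]] C1_stripD(4)[OF P]]
    continuous_on_mult[OF C1_stripD(4)[OF N] C1_stripD(5)[OF P]]] by (simp add: case_prod_beta')
 show "(LINT (t, x) : ?J \<times> UNIV | lborel. - m t x * dt ps t x + m t x * dx u t x * dx ps t x) = 0"
 proof (cases "K = {}")
  case True
  then have "(%(t, x). - m t x * dt ps t x + m t x * dx u t x * dx ps t x) = (%_. 0)" using gK by auto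
  then show ?thesis by simp
 next
  case False
  have c1: "compact (fst ` K)" "compact (snd ` K)" by (intro compact_continuous_image continuous_intros K(1))+
  obtain tm where tm: "tm \<in> fst ` K" "!!t. t \<in> fst ` K ==> tm <= t" using compact_attains_inf[OF c1(1)] False by auto
  obtain tM where tM: "tM \<in> fst ` K" "!!t. t \<in> fst ` K ==> t <= tM" using compact_attains_sup[OF c1(1)] False by auto
  obtain B where B: "!!x. x \<in> snd ` K ==> \<bar>x\<bar> <= B" using compact_imp_bounded[OF c1(2)] unfolding bounded_iff real_norm_def by blast
  have tmp: "0 < tm" "tM < T" "tm <= tM" using tm tM K(2) by force+
  define s r q where "s = tm / 2" and "r = (tM + T) / 2" and "q = \<bar>B\<bar> + 1"
  have sr: "0 < s" "s < tm" "tM < r" "r < T" "s <= r" "- q <= q" using tmp by (auto simp: s_def r_def q_def)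
  have out: "(t, x) \<notin> K" if "t <= s \<or> r <= t \<or> x <= - q \<or> q <= x" for t x
  proof
   assume k: "(t, x) \<in> K"
   then have "t \<in> fst ` K" "x \<in> snd ` K" by force+
   then have "tm <= t" "t <= tM" "\<bar>x\<bar> <= B" using tm tM B by auto
   then show False using that sr by (auto simp: q_def)
  qed
  have sub: "{s..r} \<subseteq> ?J" using sr by auto
  have box: "cbox (s, - q) (r, q) \<subseteq> ?J \<times> UNIV" "cbox (s, - q) (r, q) = {s..r} \<times> {- q..q}" using sub by (auto simp: cbox_Pair_eq)
  have cb: "continuous_on (cbox (s, - q) (r, q)) ?g" by (rule continuous_on_subset[OF cg box(1)])
  have KB: "(t, x) \<in> {s..r} \<times> {- q..q}" if "(t, x) \<in> K" for t x using out[of t x] that by force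
  have "(LINT z : ?J \<times> UNIV | lborel. ?g z) = (LINT z : cbox (s, - q) (r, q) | lborel. ?g z)"
   unfolding set_lebesgue_integral_def
  proof (intro Bochner_Integration.integral_cong refl)
   fix z :: "real \<times> real"
   show "indicat_real (?J \<times> UNIV) z *\<^sub>R ?g z = indicat_real (cbox (s, - q) (r, q)) z *\<^sub>R ?g z"
    using gK[of z] KB[of "fst z" "snd z"] box K(2) by (cases "z \<in> K") (auto simp: indicator_def)
  qed
  also have "... = integral (cbox (s, - q) (r, q)) ?g"
   using borel_integrable_compact[OF compact_cbox cb] by (intro set_borel_integral_eq_integral) (simp only: set_integrable_def)
  also have "... = integral {s..r} (%t. integral {- q..q} (%x. - m t x * dt ps t x + m t x * dx u t x * dx ps t x))"
   using integral_prod_continuous[OF cb] by (simp add: cbox_interval)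
  also have "... = - integral {s..r} (%ta. integral {- q..q} (%x. dt ps ta x * m ta x - dx ps ta x * (m ta x * dx u ta x))
    + ps ta q * (m ta q * dx u ta q) - ps ta (- q) * (m ta (- q) * dx u ta (- q)))"
  proof -
   have b0: "ps ta q = 0" "ps ta (- q) = 0" for ta using out K(3) by auto
   have e: "integral {- q..q} (%x. - m t x * dt ps t x + m t x * dx u t x * dx ps t x)
     = - integral {- q..q} (%x. dt ps t x * m t x - dx ps t x * (m t x * dx u t x))" for t
    unfolding integral_neg[symmetric] by (rule arg_cong[where f="integral _"]) (auto simp: algebra_simps)
   show ?thesis unfolding e integral_neg b0 by simp
  qed
  also have "... = - (integral {- q..q} (%x. ps r x * m r x) - integral {- q..q} (%x. ps s x * m s x))"
   using pairing_identity[OF P N sub sr(5) sr(6)] by simp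
  also have "... = 0"
  proof -
   have "ps r x = 0" "ps s x = 0" for x using out K(3) by auto
   then show ?thesis by simp
  qed
  finally show ?thesis .
 qed
qed

text \<open>The hypotheses are real and imaginary part of \<open>X t z = x\<close>; the second one
  trades \<open>k T Ig\<close> for \<open>- t Iw\<close>.\<close>

lemma Im_potential_identity:
 fixes Rw Iw Rg Ig t T k x :: real
 assumes "x = t * Rw + k * T * Rg" "0 = t * Iw + k * T * Ig"
 shows "- (Iw * x) + Rw * Iw * t - k\<^sup>2 * T * (Rg * Ig) = - k * (((T - t) * Iw) * Rg)"
proof -
 have "k^2 * T * (Rg * Ig) = k * Rg * (k * T * Ig)" by (simp add: power2_eq_square)
 also have "k * T * Ig = - (t * Iw)" using assms(2) by linarith
 finally have "k\<^sup>2 * T * (Rg * Ig) = - (k * Rg * t * Iw)" by simp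
 then show ?thesis unfolding assms(1) by (simp add: algebra_simps)
qed

context planning_data
begin

interpretation refl: planning_data "%x. p (- x)" "- b" "- a" cl C T by (rule reflected)

text \<open>Projection of \<open>x\<close> to the interval that characteristics reach. With it,
  \<open>(T - t) w = zz - clampx\<close> holds everywhere, so continuity of \<open>w\<close> follows
  from that of \<open>zz\<close>, without any continuity of \<open>G\<close> at the end points of
  the support.\<close>

definition clampx :: "real => real => real" where
 "clampx t x = max (- refl.Xr t (- a)) (min (Xr t b) x)"

definition uu :: "real => real => real" where "uu t x = Re (U t x)"
definition MM :: "real => real => real" where "MM t x = 1 - Im (U t x) / sqrt 2"
definition dens :: "real => real => real" where "dens t x = (if t < T then Im (w t x) / sqrt 2 else p x)"
text \<open>Radius of a centred interval containing the support at time \<open>t\<close>: the share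
  \<open>A0 t / T\<close> of the terminal support plus the semicircle radius
  \<open>2 sqrt (kap t)\<close>.\<close>

definition rad :: "real => real" where "rad t = A0 * t / T + 2 * sqrt (kap * t)"

section \<open>Sign, support, continuity and size of the solution\<close>

lemma zz_cases:
 assumes t: "t \<in> {0<..<T}"
 obtains (inside) "0 < Im (zz t x)" "Zin t x (zz t x)" "edgeL t < x" "x < edgeR t"
 | (right) bt where "zz t x = of_real bt" "b <= bt" "bt <= edge t" "Xr t bt = x \<or> bt = b \<and> Xr t b <= x" "edgeR t <= x"
 | (left) bt where "zz t x = - of_real bt" "- a <= bt" "bt <= refl.edge t" "refl.Xr t bt = - x \<or> bt = - a \<and> refl.Xr t (- a) <= - x" "x <= edgeL t"
proof -
 from ZZ_cases[OF t zz[OF t, of x]] consider "0 < Im (zz t x) \<and> X t (zz t x) = of_real x \<and> x \<in> inner t"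
  | "ZR t x (zz t x) \<and> edgeR t <= x" | "ZL t x (zz t x) \<and> x <= edgeL t" by blast
 then show thesis
 proof cases
  case 1
  then show ?thesis using inside Zin_of_Im_pos[OF t] inner_eq(1)[OF t] by auto
 next
  case 2
  then show ?thesis using right ZR_iff[OF t] by blast
 next
  case 3
  then obtain bt where bt: "- zz t x = of_real bt" "- a <= bt" "bt <= refl.edge t" "refl.Xr t bt = - x \<or> bt = - a \<and> refl.Xr t (- a) <= - x"
   unfolding ZL_def using refl.ZR_iff[OF t] by blast
  have "zz t x = - of_real bt" using bt(1) by (metis add.inverse_inverse)
  then show ?thesis using left bt 3 by blast
 qed
qed

lemma edge_order:
 assumes t: "t \<in> {0<..<T}"
 shows "- refl.Xr t (- a) < edgeL t" "edgeR t < Xr t b"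
 using Xr_strict[OF t _ edge(1)[OF t]] refl.Xr_strict[OF t _ refl.edge(1)[OF t]] by (auto simp: edgeL_def edgeR_def)

lemma W_X: "of_real (T - t) * W z = z - X t z"
 using T_pos by (simp add: W_def X_def field_simps)

lemma w_clamp:
 assumes t: "t \<in> {0<..<T}"
 shows "of_real (T - t) * w t x = zz t x - of_real (clampx t x)"
proof -
 note e = edge_order[OF t] inner_eq(2)[OF t]
 have "X t (zz t x) = of_real (clampx t x)"
 proof (rule zz_cases[OF t, of x])
  assume "Zin t x (zz t x)" "edgeL t < x" "x < edgeR t"
  then show ?thesis using e by (auto simp: Zin_def clampx_def)
 next
  fix bt assume bt: "zz t x = of_real bt" "b <= bt" "bt <= edge t" "Xr t bt = x \<or> bt = b \<and> Xr t b <= x" "edgeR t <= x"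
  have "Xr t bt <= Xr t b" using Xr_strict[OF t, of b bt] bt by (cases "b = bt") auto
  then have "clampx t x = Xr t bt" using bt(4,5) e by (auto simp: clampx_def)
  then show ?thesis using bt Xr by simp
 next
  fix bt assume bt: "zz t x = - of_real bt" "- a <= bt" "bt <= refl.edge t" "refl.Xr t bt = - x \<or> bt = - a \<and> refl.Xr t (- a) <= - x" "x <= edgeL t"
  have "refl.Xr t bt <= refl.Xr t (- a)" using refl.Xr_strict[OF t, of "- a" bt] bt by (cases "- a = bt") auto
  then have "clampx t x = - refl.Xr t bt" using bt(4,5) e by (auto simp: clampx_def)
  moreover have "X t (- of_real bt) = - of_real (refl.Xr t bt)" using refl.Xr[OF bt(2), of t] refl_X[of t "of_real bt"] by (metis add.inverse_inverse)
  ultimately show ?thesis using bt(1) by simp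
 qed
 then show ?thesis using W_X[of t "zz t x"] by (simp add: w_def)
qed

lemma Im_w: "t \<in> {0<..<T} ==> (T - t) * Im (w t x) = Im (zz t x)"
 using arg_cong[OF w_clamp[of t x], of Im] by simp

lemma Im_zz_nonneg: "t \<in> {0<..<T} ==> 0 <= Im (zz t x)"
 by (erule zz_cases[of t x]) auto

lemma Im_w_nonneg: "t \<in> {0<..<T} ==> 0 <= Im (w t x)"
 using Im_w[of t x] Im_zz_nonneg[of t x] by (metis diff_gt_0_iff_gt greaterThanLessThan_iff zero_le_mult_iff not_less)

lemma Im_w_outside:
 assumes t: "t \<in> {0<..<T}" and x: "x <= edgeL t \<or> edgeR t <= x"
 shows "Im (w t x) = 0"
proof -
 have "Im (zz t x) = 0" by (rule zz_cases[OF t, of x]) (use x in auto)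
 then show ?thesis using Im_w[OF t, of x] t by auto
qed

lemma w_continuous: "continuous_on ({0<..<T} \<times> UNIV) (%(t, x). w t x)"
proof -
 have "continuous_on ({0<..<T} \<times> UNIV) (%q. ((%(t, x). zz t x) q - of_real (clampx (fst q) (snd q))) / of_real (T - fst q))"
  unfolding clampx_def Xr_def refl.Xr_def using T_pos by (intro continuous_intros zz_continuous) auto
 then show ?thesis
 proof (rule continuous_on_eq)
  fix q assume q: "q \<in> {0<..<T} \<times> (UNIV :: real set)"
  have "of_real (T - fst q) * w (fst q) (snd q) = zz (fst q) (snd q) - of_real (clampx (fst q) (snd q))"
   using q by (intro w_clamp) auto
  moreover have "complex_of_real (T - fst q) \<noteq> 0" using q by (auto simp del: of_real_diff)
  ultimately show "((%(t, x). zz t x) q - of_real (clampx (fst q) (snd q))) / of_real (T - fst q) = (case q of (t, x) => w t x)"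
   by (simp add: case_prod_beta' field_simps)
 qed
qed

lemma U_partial:
 assumes t: "t \<in> {0<..<T}"
 shows "((%s. U s x) has_derivative (%h. (w t x)^2 / 2 * of_real h)) (at t)"
  "(U t has_derivative (%h. - w t x * of_real h)) (at x)"
proof -
 have "((%s. (s, x)) has_derivative (%h. (h, 0))) (at t)" by (intro has_derivative_Pair derivative_intros)
 from has_derivative_compose[OF this U_has_derivative[OF t]]
 show "((%s. U s x) has_derivative (%h. (w t x)^2 / 2 * of_real h)) (at t)" by simp
 have "((%y. (t, y)) has_derivative (%h. (0, h))) (at x)" by (intro has_derivative_Pair derivative_intros)
 from has_derivative_compose[OF this U_has_derivative[OF t]]
 show "(U t has_derivative (%h. - w t x * of_real h)) (at x)" by simp
qed

lemma uu_strip: "C1_strip {0<..<T} uu (%t x. Re ((w t x)^2) / 2) (%t x. - Re (w t x))"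
proof (rule C1_stripI)
 fix t x assume t: "t \<in> {0<..<T}"
 show "((%s. uu s x) has_real_derivative Re ((w t x)^2) / 2) (at t)"
  unfolding has_field_derivative_def uu_def
  by (rule has_derivative_eq_rhs[OF bounded_linear.has_derivative[OF bounded_linear_Re U_partial(1)[OF t]]]) auto
 show "(uu t has_real_derivative - Re (w t x)) (at x)"
  unfolding has_field_derivative_def uu_def[abs_def]
  by (rule has_derivative_eq_rhs[OF bounded_linear.has_derivative[OF bounded_linear_Re U_partial(2)[OF t]]]) auto
next
 have "continuous_on ({0<..<T} \<times> UNIV) (%q. Re (((%(t, x). w t x) q)^2) / 2)"
  "continuous_on ({0<..<T} \<times> UNIV) (%q. - Re ((%(t, x). w t x) q))"
  by (intro continuous_intros w_continuous; simp)+
 then show "continuous_on ({0<..<T} \<times> UNIV) (%(t, x). Re ((w t x)^2) / 2)"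
  "continuous_on ({0<..<T} \<times> UNIV) (%(t, x). - Re (w t x))" by (simp_all add: case_prod_beta')
qed simp

lemma MM_strip: "C1_strip {0<..<T} MM (%t x. Im (w t x) / sqrt 2 * (- Re (w t x))) (%t x. Im (w t x) / sqrt 2)"
proof (rule C1_stripI)
 fix t x assume t: "t \<in> {0<..<T}"
 have "((%s. Im (U s x)) has_real_derivative Im ((w t x)^2) / 2) (at t)"
  unfolding has_field_derivative_def
  by (rule has_derivative_eq_rhs[OF bounded_linear.has_derivative[OF bounded_linear_Im U_partial(1)[OF t]]]) auto
 from DERIV_diff[OF DERIV_const[of 1] DERIV_cdivide[OF this, of "sqrt 2"]]
 show "((%s. MM s x) has_real_derivative Im (w t x) / sqrt 2 * (- Re (w t x))) (at t)"
  unfolding MM_def by (simp add: Im_power2 mult_ac)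
 have "((%y. Im (U t y)) has_real_derivative - Im (w t x)) (at x)"
  unfolding has_field_derivative_def
  by (rule has_derivative_eq_rhs[OF bounded_linear.has_derivative[OF bounded_linear_Im U_partial(2)[OF t]]]) auto
 from DERIV_diff[OF DERIV_const[of 1] DERIV_cdivide[OF this, of "sqrt 2"]]
 show "(MM t has_real_derivative Im (w t x) / sqrt 2) (at x)"
  unfolding MM_def[abs_def] by simp
next
 have "continuous_on ({0<..<T} \<times> UNIV) (%q. Im ((%(t, x). w t x) q) / sqrt 2 * (- Re ((%(t, x). w t x) q)))"
  "continuous_on ({0<..<T} \<times> UNIV) (%q. Im ((%(t, x). w t x) q) / sqrt 2)"
  by (intro continuous_intros w_continuous; simp)+
 then show "continuous_on ({0<..<T} \<times> UNIV) (%(t, x). Im (w t x) / sqrt 2 * (- Re (w t x)))"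
  "continuous_on ({0<..<T} \<times> UNIV) (%(t, x). Im (w t x) / sqrt 2)" by (simp_all add: case_prod_beta')
qed simp

lemma du: "t \<in> {0<..<T} ==> dx uu t x = - Re (w t x)" "t \<in> {0<..<T} ==> dt uu t x = Re ((w t x)\<^sup>2) / 2"
 unfolding dx_def dt_def by (rule DERIV_imp_deriv, rule C1_stripD(2,1)[OF uu_strip], assumption)+

text \<open>Here \<open>x\<close>, \<open>t\<close> and \<open>W\<close> are eliminated. Both
  remaining terms have limits when the foot approaches a real point inside the support, which is how
  the terminal condition is reached.\<close>

lemma Im_U:
 assumes t: "t \<in> {0<..<T}"
 shows "Im (U t x) = kap * (Im (Lf (zz t x)) - Im (zz t x) * Re (G (zz t x)))"
proof (rule zz_cases[OF t, of x])
 assume z: "0 < Im (zz t x)" "Zin t x (zz t x)"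
 define z where "z = zz t x"
 have X: "of_real t * W z + of_real (kap * T) * G z = of_real x" using z by (simp add: Zin_def z_def X_def)
 have X1: "x = t * Re (W z) + kap * T * Re (G z)" "0 = t * Im (W z) + kap * T * Im (G z)"
  using arg_cong[OF X, of Re] arg_cong[OF X, of Im] by simp_all
 have "Im (U t x) = - (Im (W z) * x) + Re (W z) * Im (W z) * t - kap\<^sup>2 * T * (Re (G z) * Im (G z)) + kap * Im (Lf z)"
  by (simp add: U_def FF_def z_def Im_power2 flip: of_real_power)
 also have "... = kap * Im (Lf z) - kap * (((T - t) * Im (W z)) * Re (G z))"
  using Im_potential_identity[OF X1] by simp
 also have "(T - t) * Im (W z) = Im z" using Im_w[OF t, of x] by (simp add: w_def z_def)
 finally show ?thesis by (simp add: z_def algebra_simps)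
next
 fix bt assume "zz t x = of_real bt" "b <= bt"
 then show ?thesis using FF_real Lf_real by (simp add: U_def)
next
 fix bt assume "zz t x = - of_real bt" "- a <= bt"
 then show ?thesis using FF_left refl.FF_real Lf_left by (simp add: U_def)
qed

lemma MM_right:
 assumes t: "t \<in> {0<..<T}" and x: "edgeR t <= x"
 shows "MM t x = 1"
proof (rule zz_cases[OF t, of x])
 fix bt assume "zz t x = of_real bt" "b <= bt"
 then show ?thesis using FF_real by (simp add: MM_def U_def)
qed (use x inner_eq(2)[OF t] in auto)

lemma MM_left:
 assumes t: "t \<in> {0<..<T}" and x: "x <= edgeL t"
 shows "MM t x = 0"
proof (rule zz_cases[OF t, of x])
 fix bt assume "zz t x = - of_real bt" "- a <= bt"
 then show ?thesis using FF_left refl.FF_real by (simp add: MM_def U_def kap_def)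
qed (use x inner_eq(2)[OF t] in auto)

lemma inv_sqrt_thr_le:
 assumes t: "t \<in> {0<..<T}"
 shows "1 / sqrt (thr t) <= sqrt kap * T / sqrt t"
proof -
 have "t / (kap * T * T) <= thr t"
  unfolding thr_def using t T_pos kap_pos by (intro divide_left_mono mult_left_mono mult_pos_pos) auto
 then have "sqrt (t / (kap * T * T)) <= sqrt (thr t)" by simp
 moreover have "sqrt (t / (kap * T * T)) = sqrt t / (sqrt kap * T)" using T_pos by (simp add: real_sqrt_divide real_sqrt_mult)
 ultimately have "sqrt t / (sqrt kap * T) <= sqrt (thr t)" by simp
 moreover have "0 < sqrt t / (sqrt kap * T)" using t T_pos kap_pos by simp
 ultimately have "1 / sqrt (thr t) <= 1 / (sqrt t / (sqrt kap * T))" by (intro divide_left_mono mult_pos_pos) (use thr_pos[OF t] in auto)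
 then show ?thesis by simp
qed

lemma inside_le_rad:
 assumes t: "t \<in> {0<..<T}" and x: "Zin t x z"
 shows "\<bar>x\<bar> <= rad t"
proof -
 define k where "k = kap * (T - t)"
 have k: "k > 0" using t kap_pos by (simp add: k_def)
 have th: "thr t > 0" by (rule thr_pos[OF t])
 have kt: "t / T = k * thr t" using thr_eq[OF t] by (simp add: k_def)
 have "\<bar>x\<bar> <= t / T * (A0 + 1 / sqrt (thr t)) + k * sqrt (thr t)" using Zin_x_le[OF t x] by (simp add: k_def)
 also have "... = A0 * t / T + t / T / sqrt (thr t) + k * sqrt (thr t)"
  unfolding distrib_left by (simp add: mult_ac)
 also have "t / T / sqrt (thr t) = k * (thr t / sqrt (thr t))" unfolding kt by simp
 also have "thr t / sqrt (thr t) = sqrt (thr t)" using th by (simp add: real_div_sqrt)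
 finally have le: "\<bar>x\<bar> <= A0 * t / T + 2 * (k * sqrt (thr t))" by simp
 have "(k * sqrt (thr t))^2 = k * (k * thr t)" using th by (simp add: power_mult_distrib) (simp add: power2_eq_square)
 also have "... = kap * ((T - t) * t / T)" unfolding kt[symmetric] by (simp add: k_def)
 also have "... <= kap * t" using t T_pos kap_pos by (intro mult_left_mono) (auto simp: field_simps)
 finally have "k * sqrt (thr t) <= sqrt (kap * t)" by (rule real_le_rsqrt)
 then show ?thesis using le by (simp add: rad_def)
qed

lemma edges_le_rad:
 assumes t: "t \<in> {0<..<T}"
 shows "- rad t <= edgeL t" "edgeR t <= rad t"
proof -
 have in1: "\<bar>x\<bar> <= rad t" if "edgeL t < x" "x < edgeR t" for x
 proof -
  have "x \<in> inner t" using inner_eq(1)[OF t] that by simp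
  then obtain z where "0 < Im z" "X t z = of_real x" by (auto simp: inner_def)
  then show ?thesis using inside_le_rad[OF t Zin_of_Im_pos[OF t]] by blast
 qed
 show "edgeR t <= rad t"
 proof (rule ccontr)
  assume "\<not> edgeR t <= rad t"
  then obtain x where "max (edgeL t) (rad t) < x" "x < edgeR t" using inner_eq(2)[OF t] dense[of "max (edgeL t) (rad t)" "edgeR t"] by auto
  then show False using in1[of x] by auto
 qed
 show "- rad t <= edgeL t"
 proof (rule ccontr)
  assume "\<not> - rad t <= edgeL t"
  then obtain x where "edgeL t < x" "x < min (edgeR t) (- rad t)" using inner_eq(2)[OF t] dense[of "edgeL t" "min (edgeR t) (- rad t)"] by auto
  then show False using in1[of x] by auto
 qed
qed

text \<open>The feet grow only like \<open>1 / sqrt (thr t)\<close>, hence like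
  \<open>t^(-1/2)\<close>, and \<open>G\<close> is bounded on all of them. There is no loss at
  \<open>T\<close>, which makes the solution regular enough for the comparison.\<close>

lemma w_bound: "\<exists>K>0. \<forall>t\<in>{0<..<T}. \<forall>x. cmod (w t x) <= K / sqrt t"
proof -
 define GM where "GM = max GB (max \<bar>gr b\<bar> \<bar>refl.gr (- a)\<bar>)"
 define K1 where "K1 = A0 / T + kap * GM"
 have GM: "0 <= GM" by (simp add: GM_def)
 have K1: "0 <= K1" using T_pos kap_pos GM by (auto simp: K1_def A0_def intro!: add_nonneg_nonneg mult_nonneg_nonneg divide_nonneg_pos)
 have Gz: "cmod (G (zz t x)) <= GM" if t: "t \<in> {0<..<T}" for t x
 proof (cases "zz t x \<in> upper_dom")
  case True
  then show ?thesis using G_bounded[OF Im_zz_nonneg[OF t] True] by (simp add: GM_def)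
 next
  case False
  have "G (of_real a) = - refl.G (of_real (- a))" using refl_G[of "of_real (- a)"] by simp
  then have "G (of_real a) = - of_real (refl.gr (- a))" using refl.G_real[of "- a"] by simp
  then show ?thesis using zz_not_upper_dom[OF t False] G_real[of b] by (auto simp: GM_def)
 qed
 have "cmod (w t x) <= (K1 * sqrt T + sqrt kap) / sqrt t" if t: "t \<in> {0<..<T}" for t x
 proof -
  have "cmod (w t x) <= cmod (zz t x / of_real T) + cmod (of_real kap * G (zz t x))"
   unfolding w_def W_def by (rule norm_triangle_ineq4)
  also have "... <= (A0 + sqrt kap * T / sqrt t) / T + kap * GM"
  proof (intro add_mono)
   have "cmod (zz t x) <= A0 + sqrt kap * T / sqrt t" using ZZ_norm_le[OF t zz[OF t, of x]] inv_sqrt_thr_le[OF t] by linarith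
   then show "cmod (zz t x / of_real T) <= (A0 + sqrt kap * T / sqrt t) / T" using T_pos by (simp add: norm_divide divide_right_mono)
   show "cmod (of_real kap * G (zz t x)) <= kap * GM" using Gz[OF t, of x] kap_pos by (simp add: norm_mult mult_left_mono)
  qed
  also have "... = K1 + sqrt kap / sqrt t" using T_pos t by (simp add: K1_def field_simps)
  also have "... <= K1 * (sqrt T / sqrt t) + sqrt kap / sqrt t"
  proof -
   have "1 <= sqrt T / sqrt t" using t by simp
   then show ?thesis using mult_left_mono[of 1 "sqrt T / sqrt t" K1] K1 by simp
  qed
  also have "... = (K1 * sqrt T + sqrt kap) / sqrt t" by (simp add: add_divide_distrib)
  finally show ?thesis .
 qed
 moreover have "0 < K1 * sqrt T + sqrt kap" using K1 T_pos kap_pos by (intro add_nonneg_pos mult_nonneg_nonneg) auto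
 ultimately show ?thesis by blast
qed

end

section \<open>The curve of measures\<close>

text \<open>Outside the interval the values are squeezed by monotonicity between those just inside
  and the trivial bounds \<open>0\<close> and \<open>1\<close>, and \<open>F\<close> is continuous
  at both ends.\<close>

lemma cdf_tendsto_from_interior:
 fixes Fn :: "'i => real => real"
 assumes Fn: "\<forall>\<^sub>F i in L. mono (Fn i) \<and> (\<forall>x. 0 <= Fn i x \<and> Fn i x <= 1)"
  and conv: "!!x. x \<in> {a<..<b} ==> ((%i. Fn i x) ---> F x) L"
  and F: "isCont F a" "isCont F b" "!!x. x <= a ==> F x = 0" "!!x. b <= x ==> F x = 1" and ab: "a < b"
 shows "((%i. Fn i x) ---> F x) L"
proof -
 consider "x \<in> {a<..<b}" | "b <= x" | "x <= a" by fastforce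
 then show ?thesis
 proof cases
  case 2
  show ?thesis
  proof (rule tendstoI)
   fix e :: real assume e: "e > 0"
   have "(F ---> F b) (at_left b)" using F(2) by (simp add: isCont_def filterlim_at_split)
   then have "\<forall>\<^sub>F y in at_left b. 1 - e < F y" by (rule order_tendstoD) (use F(4)[of b] e in simp)
   moreover have "\<forall>\<^sub>F y in at_left b. y \<in> {a<..<b}" by (rule eventually_at_left_real[OF ab])
   ultimately have "\<exists>y. 1 - e < F y \<and> y \<in> {a<..<b}"
    using eventually_happens[OF eventually_conj] trivial_limit_at_left_real by blast
   then obtain y where y: "1 - e < F y" "y \<in> {a<..<b}" by blast
   have "\<forall>\<^sub>F i in L. 1 - e < Fn i y" by (rule order_tendstoD(1)[OF conv[OF y(2)] y(1)])
   with Fn show "\<forall>\<^sub>F i in L. dist (Fn i x) (F x) < e"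
   proof eventually_elim
    case (elim i)
    then have "Fn i y <= Fn i x" using y(2) 2 by (auto simp: mono_def)
    moreover have "Fn i x <= 1" using elim by blast
    ultimately show ?case using elim F(4)[OF 2] e by (auto simp: dist_real_def)
   qed
  qed
 next
  case 3
  show ?thesis
  proof (rule tendstoI)
   fix e :: real assume e: "e > 0"
   have "(F ---> F a) (at_right a)" using F(1) by (simp add: isCont_def filterlim_at_split)
   then have "\<forall>\<^sub>F y in at_right a. F y < e" by (rule order_tendstoD) (use F(3)[of a] e in simp)
   moreover have "\<forall>\<^sub>F y in at_right a. y \<in> {a<..<b}" by (rule eventually_at_right_real[OF ab])
   ultimately have "\<exists>y. F y < e \<and> y \<in> {a<..<b}"
    using eventually_happens[OF eventually_conj] trivial_limit_at_right_real by blast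
   then obtain y where y: "F y < e" "y \<in> {a<..<b}" by blast
   have "\<forall>\<^sub>F i in L. Fn i y < e" by (rule order_tendstoD(2)[OF conv[OF y(2)] y(1)])
   with Fn show "\<forall>\<^sub>F i in L. dist (Fn i x) (F x) < e"
   proof eventually_elim
    case (elim i)
    then have "Fn i x <= Fn i y" using y(2) 3 by (auto simp: mono_def)
    moreover have "0 <= Fn i x" using elim by blast
    ultimately show ?case using elim F(3)[OF 3] e by (auto simp: dist_real_def)
   qed
  qed
 qed (use conv in blast)
qed

lemma weakly_continuous_on_of_cdf:
 assumes rd: "!!t. t \<in> I ==> real_distribution (\<mu> t)"
  and c: "!!t x. t \<in> I ==> isCont (cdf (\<mu> t)) x ==> ((%s. cdf (\<mu> s) x) ---> cdf (\<mu> t) x) (at t within I)"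
 shows "weakly_continuous_on I \<mu>"
 unfolding weakly_continuous_on_def
proof (intro allI impI)
 fix f :: "real => real" assume f0: "continuous_on UNIV f \<and> bounded (range f)"
 show "continuous_on I (%t. integral\<^sup>L (\<mu> t) f)"
 unfolding continuous_on_sequentially comp_def
proof (intro allI ballI impI)
 fix ts :: "nat => real" and t
 assume t: "t \<in> I" and ts0: "(\<forall>n. ts n \<in> I) \<and> ts ----> t"
 have f: "continuous_on UNIV f" "bounded (range f)" and ts: "\<forall>n. ts n \<in> I" "ts ----> t" using f0 ts0 by auto
 obtain B where B: "!!x. norm (f x) <= B" using f(2) unfolding bounded_iff by blast
 have "weak_conv_m (%n. \<mu> (ts n)) (\<mu> t)"
  unfolding weak_conv_m_def weak_conv_def
 proof (intro allI impI)
  fix x assume x: "isCont (cdf (\<mu> t)) x"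
  have "continuous (at t within I) (%s. cdf (\<mu> s) x)" using c[OF t x] by (simp add: continuous_within)
  then show "(%n. cdf (\<mu> (ts n)) x) ----> cdf (\<mu> t) x"
   using ts by (intro continuous_within_tendsto_compose'[where f="%s. cdf (\<mu> s) x"]) auto
 qed
 moreover have "isCont f x" for x using f(1) by (simp add: continuous_on_eq_continuous_at)
 ultimately show "(%n. integral\<^sup>L (\<mu> (ts n)) f) ----> integral\<^sup>L (\<mu> t) f"
  using rd t ts(1) B by (intro weak_conv_imp_integral_bdd_continuous_conv) auto
qed
qed

context density_data
begin

lemma p_integrable: "integrable lborel p" and p_LINT: "(LINT y|lborel. p y) = 1"
proof -
 have e: "(%y. indicator {a..b} y *\<^sub>R p y) = p" by (rule ext) (use p_outside in \<open>auto simp: indicator_def\<close>)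
 have i: "integrable lborel (%y. indicator {a..b} y *\<^sub>R p y)" by (intro borel_integrable_compact p_continuous) auto
 then show "integrable lborel p" by (simp only: e)
 have "(LINT y:{a..b}|lborel. p y) = integral {a..b} p" using i by (intro set_borel_integral_eq_integral) (simp only: set_integrable_def)
 then show "(LINT y|lborel. p y) = 1" using p_mass unfolding set_lebesgue_integral_def by (simp only: e)
qed

lemma p_measurable: "p \<in> borel_measurable borel"
 by (rule borel_measurable_continuous_onI[OF p_continuous])

lemma p_distribution: "real_distribution (ldens p)"
proof -
 have "emeasure (ldens p) UNIV = (\<integral>\<^sup>+y. ennreal (p y) \<partial>lborel)"
  using p_measurable by (subst emeasure_density) auto
 also have "... = 1" using p_integrable p_LINT p_nonneg by (simp add: nn_integral_eq_integral)
 finally show ?thesis by (intro real_distribution.intro prob_spaceI real_distribution_axioms.intro) auto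
qed

definition Fp :: "real => real" where "Fp = cdf (ldens p)"

lemma Fp_eq: "Fp x = (LINT y|lborel. p y * indicator {..x} y)"
proof -
 have "Fp x = integral\<^sup>L (ldens p) (indicator {..x})"
  unfolding Fp_def cdf_def by simp
 also have "... = (LINT y|lborel. p y *\<^sub>R indicator {..x} y)"
  using p_measurable p_nonneg by (intro integral_density) auto
 finally show ?thesis by simp
qed

lemma p_ends: "p a = 0" "p b = 0"
 using p_le_sqrt[of a a] p_le_sqrt[of b b] p_nonneg[of a] p_nonneg[of b] by auto

lemma Fp_left: "x <= a ==> Fp x = 0"
proof -
 assume x: "x <= a"
 have e: "p y * indicator {..x} y = 0" for y
  using x p_outside[of y] p_ends by (cases "y = a") (auto simp: indicator_def)
 show ?thesis unfolding Fp_eq e by simp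
qed

lemma Fp_right: "b <= x ==> Fp x = 1"
proof -
 assume x: "b <= x"
 have e: "p y * indicator {..x} y = p y" for y
  using x p_outside[of y] by (auto simp: indicator_def)
 show ?thesis unfolding Fp_eq e by (rule p_LINT)
qed

lemma Fp_isCont: "isCont Fp x"
proof -
 interpret real_distribution "ldens p" by (rule p_distribution)
 have "emeasure (ldens p) {x} = 0"
  using p_measurable by (subst emeasure_density) auto
 then show ?thesis unfolding Fp_def by (simp add: isCont_cdf measure_def)
qed

lemma Lf_integrand:
 assumes z: "z \<in> upper_dom"
 shows "(%y. p y * Im (lg (z - of_real y))) \<in> borel_measurable borel" "Im (Lf z) = (LINT y|lborel. p y * Im (lg (z - of_real y)))"
proof -
 let ?f = "%y. complex_of_real (p y) * lg (z - of_real y)"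
 have "continuous_on {a..b} ?f"
 proof (intro continuous_at_imp_continuous_on ballI continuous_mult)
  fix y assume y: "y \<in> {a..b}"
  have "isCont p y" using p_continuous[of UNIV] by (simp add: continuous_on_eq_continuous_at)
  then show "isCont (%y. complex_of_real (p y)) y" by (rule isCont_of_real)
  have "isCont lg (z - of_real y)" using lg_has_derivative[OF upper_domD(2)[OF z y]] by (rule DERIV_isCont)
  then show "isCont (%y. lg (z - of_real y)) y" by (intro isCont_o2[where g=lg and f="%y. z - of_real y"] continuous_intros)
 qed
 then have i: "integrable lborel (%y. indicator {a..b} y *\<^sub>R ?f y)" by (intro borel_integrable_compact) auto
 have e: "Im (indicator {a..b} y *\<^sub>R ?f y) = p y * Im (lg (z - of_real y))" for y using p_outside[of y] by (auto simp: indicator_def)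
 have "(%y. Im (indicator {a..b} y *\<^sub>R ?f y)) \<in> borel_measurable lborel" using borel_measurable_integrable[OF i] by measurable
 then show "(%y. p y * Im (lg (z - of_real y))) \<in> borel_measurable borel" unfolding e by simp
 have "Lf z = (LINT y:{a..b}|lborel. ?f y)"
  unfolding Lf_def using i by (intro set_borel_integral_eq_integral(2)[symmetric]) (simp only: set_integrable_def)
 then have "Im (Lf z) = (LINT y|lborel. Im (indicator {a..b} y *\<^sub>R ?f y))"
  unfolding set_lebesgue_integral_def using integral_bounded_linear[OF bounded_linear_Im i] by simp
 then show "Im (Lf z) = (LINT y|lborel. p y * Im (lg (z - of_real y)))" unfolding e .
qed

text \<open>\<open>Im lg\<close> is an argument in \<open>[0, pi]\<close>, so dominated convergence
  applies; its limit is \<open>0\<close> for \<open>y < x\<close> and \<open>pi\<close> for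
  \<open>y > x\<close>.\<close>

lemma Im_Lf_boundary:
 assumes z: "zn ----> of_real x" "\<forall>\<^sub>F n in sequentially. 0 < Im (zn n)"
 shows "(%n. Im (Lf (zn n))) ----> pi * (1 - Fp x)"
proof -
 \<comment> \<open>The value \<open>0\<close> before \<open>zn\<close> has entered the upper half
   plane keeps measurability and the majorant valid for every index.\<close>
 define g where "g n y = (if 0 < Im (zn n) then p y * Im (lg (zn n - of_real y)) else 0)" for n y
 define g0 where "g0 y = p y * (if y < x then 0 else pi)" for y
 have up: "0 < Im (zn n) ==> zn n \<in> upper_dom" for n by (simp add: upper_dom_def)
 have lim: "(%n. LINT y|lborel. g n y) ----> (LINT y|lborel. g0 y)"
 proof (rule integral_dominated_convergence[where w="%y. p y * pi"])
  show "g0 \<in> borel_measurable lborel" unfolding g0_def[abs_def] using p_measurable by measurable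
  show "g n \<in> borel_measurable lborel" for n
   unfolding g_def[abs_def] using Lf_integrand(1)[OF up[of n]] by (cases "0 < Im (zn n)") auto
  show "integrable lborel (%y. p y * pi)" using p_integrable by simp
  show "AE y in lborel. norm (g n y) <= p y * pi" for n
  proof (rule AE_I2)
   fix y show "norm (g n y) <= p y * pi"
   proof (cases "0 < Im (zn n)")
    case True
    have "zn n - of_real y \<noteq> 0" "0 <= Im (zn n - of_real y)" using True by (auto simp: complex_eq_iff)
    then show ?thesis using Im_lg_bounds[of "zn n - of_real y"] p_nonneg[of y] True by (simp add: g_def abs_mult mult_left_mono)
   qed (use p_nonneg[of y] in \<open>simp add: g_def\<close>)
  qed
  have "AE y in lborel. y \<noteq> x" by (rule AE_lborel_singleton)
  then show "AE y in lborel. (%n. g n y) ----> g0 y"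
  proof eventually_elim
   case (elim y)
   have "isCont lg (of_real (x - y))" by (rule DERIV_isCont[OF lg_has_derivative]) (use elim in simp)
   moreover have "(%n. zn n - of_real y) ----> of_real (x - y)" using tendsto_diff[OF z(1) tendsto_const[of "of_real y"]] by simp
   ultimately have "(%n. lg (zn n - of_real y)) ----> lg (of_real (x - y))" by (rule isCont_tendsto_compose)
   then have "(%n. p y * Im (lg (zn n - of_real y))) ----> p y * Im (lg (of_real (x - y)))" by (intro tendsto_intros)
   moreover have "p y * Im (lg (of_real (x - y))) = g0 y"
   proof (cases "y < x")
    case True
    then show ?thesis using lg_of_real_pos[of "x - y"] by (simp add: g0_def)
   next
    case False
    then have "lg (of_real (x - y)) = of_real (ln (- (x - y))) + \<i> * pi" using elim by (intro lg_of_real_neg) simp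
    then show ?thesis using False by (simp add: g0_def)
   qed
   ultimately have "(%n. p y * Im (lg (zn n - of_real y))) ----> g0 y" by simp
   then show ?case by (rule Lim_transform_eventually) (use z(2) in \<open>auto simp: g_def elim: eventually_mono\<close>)
  qed
 qed
 have g0: "(LINT y|lborel. g0 y) = pi * (1 - Fp x)"
 proof -
  have ind: "integrable lborel (%y. p y * indicator {..x} y)"
   using integrable_mult_indicator[OF _ p_integrable, of "{..x}"] by (simp add: mult.commute)
  have "(LINT y|lborel. g0 y) = (LINT y|lborel. pi * (p y - p y * indicator {..x} y))"
  proof (rule integral_cong_AE)
   have "AE y in lborel. y \<noteq> x" by (rule AE_lborel_singleton)
   then show "AE y in lborel. g0 y = pi * (p y - p y * indicator {..x} y)"
    by eventually_elim (auto simp: g0_def indicator_def)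
  qed (use p_measurable in \<open>measurable, auto simp: g0_def\<close>)
  also have "... = pi * (1 - Fp x)" using ind p_integrable by (simp add: p_LINT Fp_eq)
  finally show ?thesis .
 qed
 have ev: "\<forall>\<^sub>F n in sequentially. (LINT y|lborel. g n y) = Im (Lf (zn n))"
  using z(2) by eventually_elim (simp add: g_def Lf_integrand(2)[OF up])
 show ?thesis using Lim_transform_eventually[OF lim ev] unfolding g0 .
qed

end

context planning_data
begin

interpretation refl: planning_data "%x. p (- x)" "- b" "- a" cl C T by (rule reflected)

definition mu :: "real => real measure" where
 "mu t = (if t = 0 then return borel 0 else ldens (dens t))"

lemma dens_continuous: "continuous_on ({0<..<T} \<times> UNIV) (%(t, x). dens t x)"
proof -
 have "continuous_on ({0<..<T} \<times> UNIV) (%q. Im ((%(t, x). w t x) q) / sqrt 2)"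
  by (intro continuous_intros w_continuous) simp
 then show ?thesis by (rule continuous_on_eq) (auto simp: dens_def)
qed

lemma dens_measurable: "t \<in> {0<..T} ==> dens t \<in> borel_measurable borel"
proof (cases "t = T")
 case True
 then show ?thesis using p_measurable by (simp add: dens_def[abs_def])
qed (use continuous_on_fixed_time[OF dens_continuous, of t UNIV] in \<open>auto intro: borel_measurable_continuous_onI\<close>)

lemma dens_nonneg: "t \<in> {0<..T} ==> 0 <= dens t x"
 using Im_w_nonneg[of t x] p_nonneg by (auto simp: dens_def)

lemma mu_T: "mu T = ldens p"
 using T_pos by (simp add: mu_def dens_def)

lemma mu_interior:
 assumes t: "t \<in> {0<..<T}"
 shows "real_distribution (mu t)" "cdf (mu t) x = MM t x"
proof -
 have m: "mu t = ldens (dens t)" using t by (simp add: mu_def)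
 note A = real_distribution_of_antiderivative[of "dens t" "MM t" "edgeL t" "edgeR t"]
 have c: "continuous_on UNIV (dens t)" by (rule continuous_on_fixed_time[OF dens_continuous t])
 have d: "(MM t has_real_derivative dens t x) (at x)" for x using C1_stripD(2)[OF MM_strip t, of x] t by (simp add: dens_def)
 have n: "0 <= dens t x" for x using t by (intro dens_nonneg) auto
 have z: "dens t x = 0" if "x < edgeL t \<or> edgeR t < x" for x using Im_w_outside[OF t, of x] that t by (auto simp: dens_def)
 show "real_distribution (mu t)" "cdf (mu t) x = MM t x"
  unfolding m using A[OF n c d MM_left[OF t] MM_right[OF t]] z by auto
qed

lemma mu_distribution: "t \<in> {0..T} ==> real_distribution (mu t)"
proof -
 assume t: "t \<in> {0..T}"
 consider "t = 0" | "t = T" | "t \<in> {0<..<T}" using t by force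
 then show ?thesis
 proof cases
  case 1
  then show ?thesis
   by (simp add: mu_def real_distribution_def real_distribution_axioms_def prob_space_return)
 qed (use mu_T p_distribution mu_interior(1) in auto)
qed

lemma MM_cdf_like: "t \<in> {0<..<T} ==> mono (MM t) \<and> (\<forall>x. 0 <= MM t x \<and> MM t x <= 1)"
proof -
 assume t: "t \<in> {0<..<T}"
 interpret real_distribution "mu t" by (rule mu_interior(1)[OF t])
 have e: "MM t x = cdf (mu t) x" for x using mu_interior(2)[OF t] by simp
 show ?thesis unfolding mono_def e using cdf_nondecreasing cdf_nonneg cdf_bounded_prob by auto
qed

text \<open>\<open>(T - t) w\<close> vanishes in the limit because \<open>w\<close> stays bounded,
  so the foot tends to the projected point, which at \<open>T\<close> is \<open>x\<close>. A foot
  whose real part is strictly inside the support cannot be of a real kind.\<close>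

lemma zz_terminal:
 assumes S: "!!n. S n \<in> {0<..<T}" "S ----> T" and x: "x \<in> {a<..<b}"
 shows "(%n. zz (S n) x) ----> of_real x" "\<forall>\<^sub>F n in sequentially. 0 < Im (zz (S n) x)"
proof -
 obtain K where K: "K > 0" "!!t x. t \<in> {0<..<T} ==> cmod (w t x) <= K / sqrt t" using w_bound by blast
 have "(%n. (T - S n) * (K / sqrt (S n))) ----> (T - T) * (K / sqrt T)" using T_pos by (intro tendsto_intros S(2)) auto
 then have l0: "(%n. (T - S n) * (K / sqrt (S n))) ----> 0" by simp
 have d: "(%n. of_real (T - S n) * w (S n) x) ----> 0"
 proof (rule Lim_null_comparison[OF _ l0], rule always_eventually, rule allI)
  fix n
  have "0 <= T - S n" using S(1)[of n] by simp
  then show "norm (of_real (T - S n) * w (S n) x) <= (T - S n) * (K / sqrt (S n))"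
   using mult_left_mono[OF K(2)[OF S(1)[of n], of x], of "T - S n"] unfolding norm_mult norm_of_real by simp
 qed
 have c: "(%n. clampx (S n) x) ----> clampx T x"
  unfolding clampx_def Xr_def refl.Xr_def using T_pos by (intro tendsto_intros S(2)) auto
 have "clampx T x = x" using x T_pos by (auto simp: clampx_def Xr_def refl.Xr_def)
 then have "(%n. of_real (T - S n) * w (S n) x + of_real (clampx (S n) x)) ----> 0 + of_real x"
  using c by (intro tendsto_add d tendsto_of_real) simp
 then show z: "(%n. zz (S n) x) ----> of_real x" using w_clamp[OF S(1), of _ x] by simp
 have re: "(%n. Re (zz (S n) x)) ----> x" using tendsto_Re[OF z] by simp
 have "\<forall>\<^sub>F n in sequentially. a < Re (zz (S n) x)" "\<forall>\<^sub>F n in sequentially. Re (zz (S n) x) < b"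
  using order_tendstoD[OF re] x by auto
 then show "\<forall>\<^sub>F n in sequentially. 0 < Im (zz (S n) x)"
 proof eventually_elim
  case (elim n)
  show ?case by (rule zz_cases[OF S(1)[of n], of x]) (use elim in auto)
 qed
qed

lemma MM_terminal:
 assumes S: "!!n. S n \<in> {0<..<T}" "S ----> T" and x: "x \<in> {a<..<b}"
 shows "(%n. MM (S n) x) ----> Fp x"
proof -
 note z = zz_terminal[OF S x]
 have l1: "(%n. Im (Lf (zz (S n) x))) ----> pi * (1 - Fp x)" by (rule Im_Lf_boundary[OF z])
 have im: "(%n. Im (zz (S n) x) * (4 * C * sqrt (b - a))) ----> 0" using tendsto_mult_left_zero[OF tendsto_Im[OF z(1), simplified]] by simp
 have l2: "(%n. Im (zz (S n) x) * Re (G (zz (S n) x))) ----> 0"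
 proof (rule Lim_null_comparison[OF _ im])
  from z(2) show "\<forall>\<^sub>F n in sequentially. norm (Im (zz (S n) x) * Re (G (zz (S n) x))) <= Im (zz (S n) x) * (4 * C * sqrt (b - a))"
  proof eventually_elim
   case (elim n)
   have "\<bar>Re (G (zz (S n) x))\<bar> <= 4 * C * sqrt (b - a)" using elim by (intro Re_G_bound) (auto simp: upper_dom_def)
   then show ?case using elim by (simp add: abs_mult mult_left_mono)
  qed
 qed
 have "(%n. 1 - kap * (Im (Lf (zz (S n) x)) - Im (zz (S n) x) * Re (G (zz (S n) x))) / sqrt 2)
   ----> 1 - kap * (pi * (1 - Fp x) - 0) / sqrt 2"
  by (intro tendsto_intros l1 l2) simp
 then show ?thesis unfolding MM_def Im_U[OF S(1)] by (simp add: kap_def)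
qed

text \<open>At \<open>0\<close> the support shrinks to the origin; at \<open>T\<close> the
  distribution functions converge inside the support; in between \<open>MM\<close> is jointly
  continuous.\<close>

lemma mu_weakly_continuous: "weakly_continuous_on {0..T} mu"
proof (rule weakly_continuous_on_of_cdf[OF mu_distribution])
 fix t x assume t: "t \<in> {0..T}" and x: "isCont (cdf (mu t)) x"
 consider "t = 0" | "t = T" | "t \<in> {0<..<T}" using t by force
 then show "((%s. cdf (mu s) x) ---> cdf (mu t) x) (at t within {0..T})"
 proof cases
  case 1
  interpret real_distribution "mu t" by (rule mu_distribution[OF t])
  have c0: "cdf (mu t) y = indicator {0..} y" for y using 1 by (auto simp: cdf_def mu_def measure_return indicator_def)
  have "x \<noteq> 0"
  proof
   assume "x = 0"
   then have "measure (mu t) {0} = 0" using x by (simp add: isCont_cdf)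
   then show False using 1 by (simp add: mu_def measure_return)
  qed
  have "((%s. rad s) ---> rad 0) (at_right 0)" unfolding rad_def using T_pos by (intro tendsto_intros) auto
  then have r: "\<forall>\<^sub>F s in at_right 0. rad s < \<bar>x\<bar>" by (rule order_tendstoD) (use \<open>x \<noteq> 0\<close> in \<open>simp add: rad_def\<close>)
  have s: "\<forall>\<^sub>F s in at_right 0. s \<in> {0<..<T}" by (rule eventually_at_right_real[OF T_pos])
  from r s have "\<forall>\<^sub>F s in at_right 0. cdf (mu t) x = cdf (mu s) x"
  proof eventually_elim
   case (elim s)
   then show ?case using edges_le_rad[OF elim(2)] MM_left[OF elim(2), of x] MM_right[OF elim(2), of x] mu_interior(2)[OF elim(2), of x] c0[of x]
    by (cases "x > 0") (auto simp: indicator_def)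
  qed
  then have "((%s. cdf (mu s) x) ---> cdf (mu t) x) (at_right 0)" by (rule Lim_transform_eventually[OF tendsto_const])
  then show ?thesis using 1 T_pos by (simp add: at_within_Icc_at_right)
 next
  case 2
  have e: "cdf (mu t) = Fp" using 2 mu_T by (simp add: Fp_def)
  have s: "\<forall>\<^sub>F s in at_left T. s \<in> {0<..<T}" by (rule eventually_at_left_real[OF T_pos])
  have "((%s. MM s x) ---> Fp x) (at_left T)"
  proof (rule cdf_tendsto_from_interior[OF _ _ Fp_isCont Fp_isCont Fp_left Fp_right ab])
   show "\<forall>\<^sub>F s in at_left T. mono (MM s) \<and> (\<forall>x. 0 <= MM s x \<and> MM s x <= 1)"
    using s by eventually_elim (rule MM_cdf_like)
   show "((%s. MM s y) ---> Fp y) (at_left T)" if "y \<in> {a<..<b}" for y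
    by (rule tendsto_at_left_sequentially[OF T_pos]) (use MM_terminal that in auto)
  qed
  moreover have "\<forall>\<^sub>F s in at_left T. MM s x = cdf (mu s) x" using s by eventually_elim (simp add: mu_interior(2))
  ultimately have "((%s. cdf (mu s) x) ---> Fp x) (at_left T)" by (rule Lim_transform_eventually)
  then show ?thesis using 2 T_pos e by (simp add: at_within_Icc_at_left)
 next
  case 3
  have "continuous_on {0<..<T} (%s. (%(t, x). MM t x) (s, x))"
   by (intro continuous_on_compose2[OF C1_stripD(3)[OF MM_strip]] continuous_intros) auto
  then have "isCont (%s. MM s x) t" using 3 by (simp add: continuous_on_eq_continuous_at)
  then have l: "((%s. MM s x) ---> MM t x) (at t)" by (simp add: isCont_def)
  have "\<forall>\<^sub>F s in at t. s \<in> {0<..<T}" using 3 by (intro eventually_at_in_open') auto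
  then have "\<forall>\<^sub>F s in at t. MM s x = cdf (mu s) x" by eventually_elim (simp add: mu_interior(2))
  from Lim_transform_eventually[OF l this] have "((%s. cdf (mu s) x) ---> cdf (mu t) x) (at t)" using mu_interior(2)[OF 3] by simp
  then show ?thesis by (rule tendsto_within_subset) simp
 qed
qed

end

section \<open>A priori bounds\<close>

lemma powr_alpha:
 assumes "t > 0"
 shows "t powr alpha 2 = sqrt t" "t powr (alpha 2 - 1) = 1 / sqrt t" "t powr (- alpha 2 * 2) = 1 / t"
proof -
 have e: "alpha 2 = 1 / 2" "alpha 2 - 1 = - (1 / 2)" "- alpha 2 * 2 = - 1" by (simp_all add: alpha_def)
 show "t powr alpha 2 = sqrt t" "t powr (alpha 2 - 1) = 1 / sqrt t" "t powr (- alpha 2 * 2) = 1 / t"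
  unfolding e using assms by (simp_all add: powr_minus_divide powr_half_sqrt)
qed

context planning_data
begin

lemma dens_bound: "\<exists>B>0. \<forall>t\<in>{0<..T}. \<forall>x. dens t x <= B / sqrt t"
proof -
 obtain K where K: "K > 0" "!!t x. t \<in> {0<..<T} ==> cmod (w t x) <= K / sqrt t" using w_bound by blast
 define B where "B = max K (C * sqrt (b - a) * sqrt T)"
 have "dens t x <= B / sqrt t" if t: "t \<in> {0<..T}" for t x
 proof (cases "t = T")
  case True
  have "p x * sqrt T <= C * sqrt (b - a) * sqrt T" using T_pos by (intro mult_right_mono p_le) simp
  then have "p x * sqrt T <= B" unfolding B_def by (rule max.coboundedI2)
  then show ?thesis using True T_pos by (simp add: dens_def pos_le_divide_eq)
 next
  case False
  then have t': "t \<in> {0<..<T}" using t by auto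
  have "dens t x <= Im (w t x)" using t' Im_w_nonneg[OF t', of x] by (auto simp: dens_def divide_le_eq intro: mult_le_cancel_left1[THEN iffD2])
  also have "... <= cmod (w t x)" by (rule abs_le_D1[OF abs_Im_le_cmod])
  also have "... <= K / sqrt t" by (rule K(2)[OF t'])
  also have "... <= B / sqrt t" using t by (intro divide_right_mono) (auto simp: B_def)
  finally show ?thesis .
 qed
 moreover have "B > 0" using K(1) by (simp add: B_def)
 ultimately show ?thesis by blast
qed

lemma mu_density: "t \<in> {0<..T} ==> mu t = ldens (dens t)"
 by (simp add: mu_def)

lemma dens_mass: "t \<in> {0<..T} ==> (\<integral>\<^sup>+x. ennreal (dens t x) \<partial>lborel) = 1"
proof -
 assume t: "t \<in> {0<..T}"
 interpret real_distribution "mu t" by (rule mu_distribution) (use t in auto)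
 have "(\<integral>\<^sup>+x. ennreal (dens t x) \<partial>lborel) = emeasure (mu t) UNIV"
  unfolding mu_density[OF t] using dens_measurable[OF t] by (subst emeasure_density) auto
 then show ?thesis using emeasure_space_1 by simp
qed

lemma rad_mono: "0 <= s ==> s <= t ==> rad s <= rad t"
 unfolding rad_def using T_pos kap_pos by (intro add_mono divide_right_mono mult_left_mono) (auto simp: A0_def)

lemma dens_outside:
 assumes t: "t \<in> {0<..<T}" and x: "rad t < \<bar>x\<bar>"
 shows "dens t x = 0"
proof -
 have "x <= edgeL t \<or> edgeR t <= x" using edges_le_rad[OF t] x by linarith
 then show ?thesis using Im_w_outside[OF t, of x] t by (simp add: dens_def)
qed

lemma dens_support: "t \<in> {0<..T} ==> rad T < \<bar>x\<bar> ==> dens t x = 0"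
proof (cases "t = T")
 case True
 assume "rad T < \<bar>x\<bar>"
 moreover have "A0 <= rad T" using T_pos kap_pos by (simp add: rad_def)
 ultimately have "x \<notin> {a..b}" using abs_le_A0[of x] by auto
 then show ?thesis using True p_outside by (simp add: dens_def)
next
 case False
 assume "t \<in> {0<..T}" "rad T < \<bar>x\<bar>"
 then show ?thesis using False dens_outside[of t x] rad_mono[of t T] by auto
qed

text \<open>The cubic norm is the square of the sup bound \<open>B / sqrt t\<close> times the unit
  mass; the second moment is bounded by the common support.\<close>

lemma dens_m_bounds: "m_bounds 2 T dens"
proof -
 obtain B where B: "B > 0" "!!t x. t \<in> {0<..T} ==> dens t x <= B / sqrt t" using dens_bound by blast
 have cube: "(\<integral>\<^sup>+ x. ennreal (\<bar>dens t x\<bar> powr 3) \<partial>lborel) <= ennreal (B^2 / t)" if t: "t \<in> {0<..T}" for t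
 proof -
  have "(\<integral>\<^sup>+ x. ennreal (\<bar>dens t x\<bar> powr 3) \<partial>lborel) <= (\<integral>\<^sup>+ x. ennreal (B^2 / t) * ennreal (dens t x) \<partial>lborel)"
  proof (rule nn_integral_mono)
   fix x
   have n: "0 <= dens t x" by (rule dens_nonneg[OF t])
   have "\<bar>dens t x\<bar> powr 3 = (dens t x)^2 * dens t x" using n by (cases "dens t x = 0") (auto simp: powr_numeral power2_eq_square power3_eq_cube)
   also have "... <= (B / sqrt t)^2 * dens t x" using B(2)[OF t, of x] n by (intro mult_right_mono power_mono) auto
   also have "(B / sqrt t)^2 = B^2 / t" using t by (simp add: power_divide)
   finally show "ennreal (\<bar>dens t x\<bar> powr 3) <= ennreal (B^2 / t) * ennreal (dens t x)"
    using n t by (simp add: ennreal_mult'[symmetric] ennreal_leI)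
  qed
  also have "... = ennreal (B^2 / t)" using dens_mass[OF t] dens_measurable[OF t] by (subst nn_integral_cmult) auto
  finally show ?thesis .
 qed
 have mom: "(\<integral>\<^sup>+ x. ennreal (\<bar>x\<bar>^2 * dens t x) \<partial>lborel) <= ennreal ((rad T)^2)" if t: "t \<in> {0<..T}" for t
 proof -
  have "(\<integral>\<^sup>+ x. ennreal (\<bar>x\<bar>^2 * dens t x) \<partial>lborel) <= (\<integral>\<^sup>+ x. ennreal ((rad T)^2) * ennreal (dens t x) \<partial>lborel)"
  proof (rule nn_integral_mono)
   fix x
   have n: "0 <= dens t x" by (rule dens_nonneg[OF t])
   have "\<bar>x\<bar>^2 * dens t x <= (rad T)^2 * dens t x"
   proof (cases "\<bar>x\<bar> <= rad T")
    case True
    show ?thesis by (intro mult_right_mono power_mono True abs_ge_zero n)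
   next
    case False
    then show ?thesis using dens_support[OF t, of x] by simp
   qed
   then show "ennreal (\<bar>x\<bar>^2 * dens t x) <= ennreal ((rad T)^2) * ennreal (dens t x)"
    using n by (simp add: ennreal_mult'[symmetric] ennreal_leI)
  qed
  also have "... = ennreal ((rad T)^2)" using dens_mass[OF t] dens_measurable[OF t] by (subst nn_integral_cmult) auto
  finally show ?thesis .
 qed
 show ?thesis unfolding m_bounds_def
 proof (intro exI[of _ "B^2 + (rad T)^2"] conjI ballI)
  show "0 < B^2 + (rad T)^2" using B(1) by (simp add: add_pos_nonneg)
  fix t assume t: "t \<in> {0<..T}"
  have "B\<^sup>2 / t <= (B\<^sup>2 + (rad T)\<^sup>2) * t powr (- alpha 2 * 2)"
   using powr_alpha(3)[of t] t by (simp add: divide_right_mono)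
  then show "(\<integral>\<^sup>+ x. ennreal (\<bar>dens t x\<bar> powr (2 + 1)) \<partial>lborel) <= ennreal ((B\<^sup>2 + (rad T)\<^sup>2) * t powr (- alpha 2 * 2))"
   using order_trans[OF cube[OF t] ennreal_leI] by simp
  show "(\<integral>\<^sup>+ x. ennreal (\<bar>x\<bar>^2 * dens t x) \<partial>lborel) <= ennreal (B^2 + (rad T)^2)"
   by (rule order_trans[OF mom[OF t] ennreal_leI]) simp
 qed
qed

lemma uu_ux_bound: "ux_bound 2 T uu"
proof -
 obtain K where K: "K > 0" "!!t x. t \<in> {0<..<T} ==> cmod (w t x) <= K / sqrt t" using w_bound by blast
 show ?thesis unfolding ux_bound_def
 proof (intro ballI exI[of _ K] conjI K(1))
  fix de t assume "de \<in> {0<..<T}" "t \<in> {0<..T - de}"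
  then have t: "t \<in> {0<..<T}" by auto
  show "esssup lborel (%x. ereal \<bar>dx uu t x\<bar>) <= ereal (K * t powr (alpha 2 - 1))"
  proof (rule esssup_I)
   have "continuous_on UNIV (w t)" by (rule continuous_on_fixed_time[OF w_continuous t])
   then have "(%x. \<bar>- Re (w t x)\<bar>) \<in> borel_measurable borel" by (intro borel_measurable_continuous_onI continuous_intros)
   then show "(%x. ereal \<bar>dx uu t x\<bar>) \<in> borel_measurable lborel" using du(1)[OF t] by simp
   have "\<bar>dx uu t x\<bar> <= K * t powr (alpha 2 - 1)" for x
   proof -
    have "\<bar>dx uu t x\<bar> <= cmod (w t x)" using du(1)[OF t] abs_Re_le_cmod by simp
    also have "... <= K / sqrt t" by (rule K(2)[OF t])
    also have "... = K * t powr (alpha 2 - 1)" using powr_alpha(2)[of t] t by simp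
    finally show ?thesis .
   qed
   then show "AE x in lborel. ereal \<bar>dx uu t x\<bar> <= ereal (K * t powr (alpha 2 - 1))" by simp
  qed
 qed
qed

lemma uu_growth: "u_growth T uu"
proof -
 obtain K where K: "K > 0" "!!t x. t \<in> {0<..<T} ==> cmod (w t x) <= K / sqrt t" using w_bound by blast
 show ?thesis unfolding u_growth_def
 proof (intro ballI)
  fix de assume de: "de \<in> {0<..<T}"
  define V where "V = K / sqrt de"
  have V: "V > 0" using K(1) de by (simp add: V_def)
  have wV: "cmod (w s x) <= V" if "s \<in> {de..<T}" for s x
  proof -
   have "cmod (w s x) <= K / sqrt s" using that de by (intro K(2)) auto
   also have "... <= V" unfolding V_def using that de K(1) by (intro divide_left_mono mult_pos_pos) auto
   finally show ?thesis .
  qed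
  define Q where "Q = \<bar>uu de 0\<bar> + V^2 * T + V"
  show "\<exists>Q. \<forall>t\<in>{de..<T}. \<forall>x. \<bar>uu t x / (1 + \<bar>x\<bar>)\<bar> <= Q"
  proof (intro exI[of _ Q] ballI allI)
   fix t x assume t: "t \<in> {de..<T}"
   have t': "t \<in> {0<..<T}" using t de by auto
   have x: "\<bar>uu t x - uu t 0\<bar> <= V * \<bar>x - 0\<bar>"
    unfolding real_norm_def[symmetric]
   proof (rule field_differentiable_bound[where S=UNIV and f'="%x. - Re (w t x)"])
    show "(uu t has_real_derivative - Re (w t z)) (at z within UNIV)" for z using C1_stripD(2)[OF uu_strip t'] by simp
    show "norm (- Re (w t z)) <= V" for z using wV[OF t, of z] abs_Re_le_cmod[of "w t z"] by simp
   qed auto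
   have s: "\<bar>uu t 0 - uu de 0\<bar> <= V^2 * \<bar>t - de\<bar>"
    unfolding real_norm_def[symmetric]
   proof (rule field_differentiable_bound[where S="{de..<T}" and f'="%s. Re ((w s 0)^2) / 2"])
    show "((%t. uu t 0) has_real_derivative Re ((w z 0)^2) / 2) (at z within {de..<T})" if "z \<in> {de..<T}" for z
     by (rule has_field_derivative_at_within, rule C1_stripD(1)[OF uu_strip]) (use that de in auto)
    show "norm (Re ((w z 0)^2) / 2) <= V^2" if "z \<in> {de..<T}" for z
    proof -
     have "\<bar>Re ((w z 0)^2)\<bar> <= (cmod (w z 0))^2" using abs_Re_le_cmod[of "(w z 0)^2"] by (simp add: norm_power)
     also have "... <= V^2" using wV[OF that, of 0] by (intro power_mono) auto
     finally show ?thesis by simp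
    qed
   qed (use t de in auto)
   have "V^2 * \<bar>t - de\<bar> <= V^2 * T" using t de by (intro mult_left_mono) auto
   then have "\<bar>uu t x\<bar> <= \<bar>uu de 0\<bar> + V^2 * T + V * \<bar>x\<bar>" using x s by simp
   also have "... <= Q * (1 + \<bar>x\<bar>)"
   proof -
    have "0 <= (\<bar>uu de 0\<bar> + V^2 * T) * \<bar>x\<bar>" using T_pos by simp
    then show ?thesis using V unfolding Q_def by (simp add: algebra_simps)
   qed
   finally show "\<bar>uu t x / (1 + \<bar>x\<bar>)\<bar> <= Q" by (simp add: abs_divide pos_divide_le_eq)
  qed
 qed
qed

lemma uu_energy: "energy_L1_loc T uu dens"
proof -
 obtain K where K: "K > 0" "!!t x. t \<in> {0<..<T} ==> cmod (w t x) <= K / sqrt t" using w_bound by blast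
 show ?thesis unfolding energy_L1_loc_def
 proof (intro allI impI, elim conjE)
  fix s r assume sr: "0 < s" "s <= r" "r < T"
  have inner: "(\<integral>\<^sup>+ x. ennreal (dens t x * (dx uu t x)^2) \<partial>lborel) <= ennreal (K^2 / s)" if t: "t \<in> {s..r}" for t
  proof -
   have t': "t \<in> {0<..<T}" "t \<in> {0<..T}" using t sr by auto
   have "(\<integral>\<^sup>+ x. ennreal (dens t x * (dx uu t x)^2) \<partial>lborel) <= (\<integral>\<^sup>+ x. ennreal (K^2 / s) * ennreal (dens t x) \<partial>lborel)"
   proof (rule nn_integral_mono)
    fix x
    have "\<bar>dx uu t x\<bar> <= cmod (w t x)" using du(1)[OF t'(1)] abs_Re_le_cmod by simp
    also have "... <= K / sqrt t" by (rule K(2)[OF t'(1)])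
    finally have "(dx uu t x)^2 <= (K / sqrt t)^2" by (metis abs_ge_zero power2_abs power_mono)
    also have "... = K^2 / t" using t' by (simp add: power_divide)
    also have "... <= K^2 / s" using t sr by (intro divide_left_mono) auto
    finally have "dens t x * (dx uu t x)^2 <= K^2 / s * dens t x" using dens_nonneg[OF t'(2), of x] by (subst mult.commute) (intro mult_right_mono)
    then show "ennreal (dens t x * (dx uu t x)^2) <= ennreal (K^2 / s) * ennreal (dens t x)"
     using dens_nonneg[OF t'(2), of x] sr by (simp add: ennreal_mult'[symmetric] ennreal_leI)
   qed
   also have "... = ennreal (K^2 / s)" using dens_mass[OF t'(2)] dens_measurable[OF t'(2)] by (subst nn_integral_cmult) auto
   finally show ?thesis .
  qed
  have "(\<integral>\<^sup>+ t\<in>{s..r}. (\<integral>\<^sup>+ x. ennreal (dens t x * (dx uu t x)^2) \<partial>lborel) \<partial>lborel) <= (\<integral>\<^sup>+ t\<in>{s..r}. ennreal (K^2 / s) \<partial>lborel)"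
   by (rule nn_integral_mono) (use inner in \<open>auto simp: indicator_def\<close>)
  also have "... = ennreal (K^2 / s) * emeasure lborel {s..r}" by (rule nn_integral_cmult_indicator) simp
  also have "... < \<infinity>" using sr by (simp add: ennreal_mult_less_top)
  finally show "(\<integral>\<^sup>+ t\<in>{s..r}. (\<integral>\<^sup>+ x. ennreal (dens t x * (dx uu t x)^2) \<partial>lborel) \<partial>lborel) < \<infinity>" .
 qed
qed

lemma uu_planning_solution: "planning_solution 2 T p uu mu dens"
 unfolding planning_solution_def
proof (intro conjI)
 show "Ck_on 1 ({0<..<T} \<times> UNIV) (%(t, x). uu t x)" by (rule C1_strip_imp_Ck_on_1[OF uu_strip]) simp
 show "\<forall>t\<in>{0<..T}. dens t \<in> borel_measurable borel \<and> (\<forall>x. 0 <= dens t x) \<and> mu t = ldens (dens t)"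
  using dens_measurable dens_nonneg mu_density by blast
 show "\<forall>t\<in>{0<..<T}. \<forall>x. - dt uu t x + 1/2 * (dx uu t x)^2 = dens t x powr 2"
 proof (intro ballI allI)
  fix t x assume t: "t \<in> {0<..<T}"
  have "dens t x powr 2 = (dens t x)^2" using dens_nonneg[of t x] t by (cases "dens t x = 0") (auto simp: powr_numeral)
  then show "- dt uu t x + 1/2 * (dx uu t x)\<^sup>2 = dens t x powr 2"
   using t by (simp add: du dens_def power_divide) (simp add: power2_eq_square field_simps)
 qed
 show "continuity_eq T uu dens"
 proof (rule continuity_eq_of_potential[where N=MM])
  show "C1_strip {0<..<T} MM (%t x. dens t x * dx uu t x) dens"
  proof (rule C1_stripI)
   fix t x assume t: "t \<in> {0<..<T}"
   show "((%s. MM s x) has_real_derivative dens t x * dx uu t x) (at t)"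
    using C1_stripD(1)[OF MM_strip t, of x] t by (simp add: dens_def du)
   show "(MM t has_real_derivative dens t x) (at x)" using C1_stripD(2)[OF MM_strip t, of x] t by (simp add: dens_def)
  next
   show "continuous_on ({0<..<T} \<times> UNIV) (%(t, x). dens t x * dx uu t x)"
    by (rule continuous_on_eq[OF C1_stripD(4)[OF MM_strip]]) (auto simp: dens_def du)
  qed (use dens_continuous in auto)
 qed
 show "mu 0 = return borel 0" by (simp add: mu_def)
qed (use mu_distribution mu_weakly_continuous dens_continuous mu_T in auto)

end

section \<open>The self-similar limit\<close>

text \<open>Skorohod's representation realises weak convergence by random variables converging
  pointwise; their joint laws are couplings, and uniform boundedness of the supports lets the cost
  converge to zero.\<close>

lemma wasserstein1_tendsto_0:
 fixes \<nu> :: "nat => real measure" and N :: "real measure"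
 assumes rd: "!!n. real_distribution (\<nu> n)" "real_distribution N" and wc: "weak_conv_m \<nu> N"
  and supp: "!!n. AE x in \<nu> n. \<bar>x\<bar> <= B" "AE x in N. \<bar>x\<bar> <= B"
 shows "(%n. wasserstein1 (\<nu> n) N) ----> 0"
proof -
 from Skorohod[OF rd wc] obtain \<Omega> :: "real measure" and Yn Y where
  P: "prob_space \<Omega>" and Yn: "!!n. Yn n \<in> measurable \<Omega> borel" "!!n. distr \<Omega> borel (Yn n) = \<nu> n"
  and Y: "Y \<in> measurable \<Omega> lborel" "distr \<Omega> borel Y = N"
  and lim: "!!x. x \<in> space \<Omega> ==> (%n. Yn n x) ----> Y x" by blast
 interpret prob_space \<Omega> by (rule P)
 have Yb: "Y \<in> measurable \<Omega> borel" using Y(1) by simp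
 define J where "J n = (\<integral>\<^sup>+\<omega>. ennreal \<bar>Yn n \<omega> - Y \<omega>\<bar> \<partial>\<Omega>)" for n
 have le: "wasserstein1 (\<nu> n) N <= J n" for n
 proof -
  define ga where "ga = distr \<Omega> borel (%\<omega>. (Yn n \<omega>, Y \<omega>))"
  have pm: "(%\<omega>. (Yn n \<omega>, Y \<omega>)) \<in> measurable \<Omega> borel"
   unfolding borel_prod[symmetric] using Yn(1)[of n] Yb by (rule measurable_Pair)
  have fm: "(fst :: real \<times> real => real) \<in> borel_measurable borel" "(snd :: real \<times> real => real) \<in> borel_measurable borel"
   by (intro borel_measurable_continuous_onI continuous_intros)+
  have "ga \<in> couplings (\<nu> n) N"
   unfolding couplings_def ga_def using distr_distr[OF fm(1) pm] distr_distr[OF fm(2) pm] Yn(2)[of n] Y(2) by (simp add: comp_def)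
  moreover have "(\<integral>\<^sup>+ q. ennreal \<bar>fst q - snd q\<bar> \<partial>ga) = J n"
   unfolding ga_def J_def using fm by (subst nn_integral_distr[OF pm]) auto
  ultimately show ?thesis unfolding wasserstein1_def using INF_lower[of ga "couplings (\<nu> n) N" "%ga. \<integral>\<^sup>+ q. ennreal \<bar>fst q - snd q\<bar> \<partial>ga"] by simp
 qed
 have bd: "AE \<omega> in \<Omega>. \<bar>Yn n \<omega>\<bar> <= B" for n using supp(1)[of n] unfolding Yn(2)[symmetric] by (rule AE_distrD[OF Yn(1)])
 have bY: "AE \<omega> in \<Omega>. \<bar>Y \<omega>\<bar> <= B" using supp(2) unfolding Y(2)[symmetric] by (rule AE_distrD[OF Yb])
 have "(%n. \<integral>\<^sup>+\<omega>. ennreal \<bar>Yn n \<omega> - Y \<omega>\<bar> \<partial>\<Omega>) ----> (\<integral>\<^sup>+\<omega>. 0 \<partial>\<Omega>)"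
 proof (rule nn_integral_dominated_convergence[where w="%_. ennreal (2 * B)"])
  show "(%\<omega>. ennreal \<bar>Yn n \<omega> - Y \<omega>\<bar>) \<in> borel_measurable \<Omega>" for n using Yn(1)[of n] Yb by measurable
  show "AE \<omega> in \<Omega>. ennreal \<bar>Yn n \<omega> - Y \<omega>\<bar> <= ennreal (2 * B)" for n
   using bd[of n] bY by eventually_elim (auto intro!: ennreal_leI)
  show "AE \<omega> in \<Omega>. (%n. ennreal \<bar>Yn n \<omega> - Y \<omega>\<bar>) ----> 0"
  proof (rule AE_I2)
   fix \<omega> assume "\<omega> \<in> space \<Omega>"
   then have "(%n. \<bar>Yn n \<omega> - Y \<omega>\<bar>) ----> \<bar>Y \<omega> - Y \<omega>\<bar>" by (intro tendsto_intros lim)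
   from tendsto_ennrealI[OF this] show "(%n. ennreal \<bar>Yn n \<omega> - Y \<omega>\<bar>) ----> 0" by simp
  qed
 qed (auto simp: emeasure_space_1)
 then have J: "J ----> 0" unfolding J_def[abs_def] by simp
 show ?thesis by (rule tendsto_sandwich[OF _ _ tendsto_const J]) (use le in auto)
qed

text \<open>Dilating the radius by \<open>c\<close> multiplies the profile by \<open>c\<close> and
  the length by \<open>c\<close>, hence the mass by \<open>c^2\<close>.\<close>

lemma phi_2_has_bochner_unique:
 assumes R: "R > 0" "has_bochner_integral lborel (phi 2 R) 1" and r: "r > 0" "has_bochner_integral lborel (phi 2 r) 1"
 shows "R = r"
proof -
 define c where "c = R / r"
 have c: "c > 0" "R = c * r" using R(1) r(1) by (auto simp: c_def)
 have "phi 2 R (0 + c * x) = c * phi 2 r x" for x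
 proof -
  have "max 0 (1/8 * (R^2 - (c * x)^2)) = c^2 * max 0 (1/8 * (r^2 - x^2))"
   using c by (simp add: max_mult_distrib_left power_mult_distrib algebra_simps)
  then show ?thesis using c(1) by (simp add: phi_2 real_sqrt_mult)
 qed
 then have "(LINT x|lborel. phi 2 R x) = \<bar>c\<bar> *\<^sub>R (LINT x|lborel. c * phi 2 r x)"
  using lborel_integral_real_affine[of c "phi 2 R" 0] c(1) by simp
 then have "1 = c * c" using R(2) r(2) c(1) by (simp add: has_bochner_integral_integral_eq)
 then have "c^2 = 1" by (simp add: power2_eq_square)
 then have "c = 1" using c(1) by (auto simp: power2_eq_1_iff)
 then show ?thesis using c(2) by simp
qed

context planning_data
begin

text \<open>The radius of the semicircle law of variance \<open>kap\<close>; the following results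
  show that \<open>phi 2 R0\<close> is its density.\<close>

definition R0 :: real where "R0 = 2 * sqrt kap"
definition dil :: "real => real => real" where "dil t xz = sqrt t * dens t (sqrt t * xz)"
definition q :: "real => real" where "q t = sqrt (kap * T * (T - t))"

lemma q_eq: "t \<in> {0<..<T} ==> sqrt t / sqrt (thr t) = q t"
 by (simp add: q_def thr_def real_sqrt_divide[symmetric])

lemma q_limit:
 assumes "S ----> 0"
 shows "(%n. q (S n)) ----> sqrt kap * T"
proof -
 have "(%n. q (S n)) ----> sqrt (kap * T * (T - 0))" unfolding q_def by (intro tendsto_intros assms)
 moreover have "sqrt (kap * T * (T - 0)) = sqrt kap * T" using T_pos by (simp add: real_sqrt_mult mult.assoc)
 ultimately show ?thesis by simp
qed

text \<open>All of the support lies within \<open>e - a\<close> of the edge \<open>e\<close>, so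
  \<open>Nf\<close> there is at least \<open>1 / (e - a)^2\<close> and \<open>gr e\<close> at least
  \<open>1 / (e - a)\<close>. After division by \<open>sqrt t\<close> the bound tends to
  \<open>R0\<close>.\<close>

lemma edgeR_lower:
 assumes t: "t \<in> {0<..<T}"
 shows "t / T * (a + 1 / sqrt (thr t)) + kap * (T - t) / (1 / sqrt (thr t) + (b - a)) <= edgeR t"
proof -
 define e where "e = edge t"
 have e: "b < e" "Nf (of_real e) = thr t" "e <= b + 1 / sqrt (thr t)" using edge[OF t] edge_le[OF t] by (auto simp: e_def)
 have up: "of_real e \<in> upper_dom" by (rule real_in_upper_dom(1)[OF e(1)])
 have ea: "0 < e - a" using e(1) ab by simp
 have "1 / (e - a)^2 <= Nf (of_real e)"
  by (rule Nf_ge[OF up]) (use e(1) in \<open>auto simp: norm_of_real simp flip: of_real_diff\<close>)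
 then have "sqrt (1 / (e - a)^2) <= sqrt (thr t)" using e(2) by simp
 then have "1 / (e - a) <= sqrt (thr t)" using ea by (simp add: real_sqrt_divide)
 then have l1: "1 / sqrt (thr t) <= e - a" using ea thr_pos[OF t] by (simp add: divide_le_eq mult.commute)
 have gre: "gr e = integral {a..b} (%y. p y * (e - y) / (cmod (of_real e - of_real y))^2)"
  using Re_G[OF up] G_real[of e] e(1) by simp
 have "integral {a..b} (%y. p y * (1 / (e - a))) <= gr e"
  unfolding gre
 proof (rule integral_le)
  show "(%y. p y * (1 / (e - a))) integrable_on {a..b}" by (intro integrable_continuous_real continuous_intros p_continuous)
  have "continuous_on {a..b} (%y. (p y / (cmod (of_real e - of_real y))^2) * (e - y))" by (intro continuous_intros kernel_continuous(2) up)
  then show "(%y. p y * (e - y) / (cmod (of_real e - of_real y))^2) integrable_on {a..b}" by (intro integrable_continuous_real) simp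
  fix y assume y: "y \<in> {a..b}"
  have ey: "0 < e - y" "e - y <= e - a" using y e(1) by auto
  have "(e - y) / (cmod (of_real e - of_real y))^2 = 1 / (e - y)"
   using ey by (simp add: power2_eq_square flip: of_real_diff)
  moreover have "1 / (e - a) <= 1 / (e - y)" using ey by (intro divide_left_mono) auto
  ultimately have "1 / (e - a) <= (e - y) / (cmod (of_real e - of_real y))^2" by linarith
  from mult_left_mono[OF this p_nonneg[of y]] show "p y * (1 / (e - a)) <= p y * (e - y) / (cmod (of_real e - of_real y))^2" by simp
 qed
 moreover have "integral {a..b} (%y. p y * (1 / (e - a))) = 1 / (e - a)"
  using p_mass by simp
 ultimately have l2: "1 / (e - a) <= gr e" by linarith
 have "1 / (1 / sqrt (thr t) + (b - a)) <= 1 / (e - a)" using e(3) ea by (intro divide_left_mono) auto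
 then have "kap * (T - t) * (1 / (1 / sqrt (thr t) + (b - a))) <= kap * (T - t) * gr e"
  using l2 kap_pos t by (intro mult_left_mono) auto
 moreover have "t / T * (a + 1 / sqrt (thr t)) <= t / T * e" using l1 t T_pos by (intro mult_left_mono) auto
 ultimately show ?thesis by (simp add: edgeR_def Xr_def e_def)
qed

lemma edgeR_eventually:
 assumes S: "!!n. S n \<in> {0<..<T}" "S ----> 0" and xz: "xz < R0"
 shows "\<forall>\<^sub>F n in sequentially. sqrt (S n) * xz < edgeR (S n)"
proof -
 define h where "h n = sqrt (S n) / T * a + q (S n) / T + kap * (T - S n) / (q (S n) + sqrt (S n) * (b - a))" for n
 have sq: "(%n. sqrt (S n)) ----> 0" using tendsto_real_sqrt[OF S(2)] by simp
 have kT: "sqrt kap * T \<noteq> 0" using kap_pos T_pos by simp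
 have "h ----> 0 / T * a + sqrt kap * T / T + kap * (T - 0) / (sqrt kap * T + 0 * (b - a))"
  unfolding h_def by (intro tendsto_intros sq q_limit S(2)) (use T_pos kT in auto)
 moreover have "0 / T * a + sqrt kap * T / T + kap * (T - 0) / (sqrt kap * T + 0 * (b - a)) = R0"
 proof -
  have "kap * T / (sqrt kap * T) = sqrt kap" using T_pos kap_pos by (simp add: real_div_sqrt)
  then show ?thesis using T_pos by (simp add: R0_def)
 qed
 ultimately have "h ----> R0" by simp
 then have "\<forall>\<^sub>F n in sequentially. xz < h n" using xz by (rule order_tendstoD)
 then show ?thesis
 proof eventually_elim
  case (elim n)
  define t c s where "t = S n" and "c = sqrt t" and "s = 1 / sqrt (thr t)"
  have t: "t \<in> {0<..<T}" using S(1) by (simp add: t_def)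
  have c: "c > 0" "t = c * c" using t by (auto simp: c_def)
  have s: "c * s = q t" "s > 0" using q_eq[OF t] thr_pos[OF t] by (auto simp: c_def s_def)
  have e1: "t / T * (a + s) = c * (c / T * a + q t / T)" unfolding s(1)[symmetric] using c(2) by (simp add: algebra_simps add_divide_distrib)
  have e2: "kap * (T - t) / (s + (b - a)) = c * (kap * (T - t) / (q t + c * (b - a)))"
  proof -
   have "q t + c * (b - a) = c * (s + (b - a))" using s(1) by (simp add: algebra_simps)
   then show ?thesis using c(1) by simp
  qed
  have "c * xz < c * h n" using elim c(1) by simp
  also have "... = t / T * (a + s) + kap * (T - t) / (s + (b - a))"
   unfolding e1 e2 by (simp add: h_def t_def c_def algebra_simps)
  also have "... <= edgeR t" using edgeR_lower[OF t] by (simp add: s_def)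
  finally show ?case by (simp add: c_def t_def)
 qed
qed

text \<open>On the level curve the two contributions to \<open>Re X\<close> have the same main part
  \<open>(t/T) Re z\<close>; the error is a mean of support points weighted by the kernel of
  \<open>Nf\<close>.\<close>

lemma Zin_Re:
 assumes t: "t \<in> {0<..<T}" and z: "Zin t x z"
 shows "\<bar>x - 2 * (t / T) * Re z\<bar> <= A0 * t / T"
proof -
 have zu: "z \<in> upper_dom" and N: "Nf z = thr t" and X: "X t z = of_real x" using z by (auto simp: Zin_def)
 define h where "h y = p y / (cmod (z - of_real y))^2" for y
 have ch: "continuous_on {a..b} h" unfolding h_def using kernel_continuous(2)[OF zu] .
 have "integral {a..b} (%y. Re z * h y - y * h y) = Re z * integral {a..b} h - integral {a..b} (%y. y * h y)"
  by (subst hk_diff) (auto intro!: integrable_continuous_real continuous_intros ch)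
 moreover have "Re (G z) = integral {a..b} (%y. Re z * h y - y * h y)"
  unfolding Re_G[OF zu] by (rule arg_cong[where f="integral _"]) (auto simp: h_def algebra_simps diff_divide_distrib)
 moreover have "integral {a..b} h = thr t" using N by (simp add: Nf_def h_def[abs_def])
 ultimately have G: "Re (G z) = Re z * thr t - integral {a..b} (%y. y * h y)" by simp
 have "norm (integral {a..b} (%y. y * h y)) <= integral {a..b} (%y. A0 * h y)"
 proof (rule integral_norm_bound_integral)
  fix y assume y: "y \<in> {a..b}"
  have "0 <= h y" using p_nonneg[of y] by (simp add: h_def)
  then show "norm (y * h y) <= A0 * h y" using abs_le_A0[OF y] by (simp add: abs_mult mult_right_mono)
 qed (intro integrable_continuous_real continuous_intros ch)+
 then have I: "\<bar>integral {a..b} (%y. y * h y)\<bar> <= A0 * thr t" using \<open>integral {a..b} h = thr t\<close> by simp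
 have "x = t / T * Re z + kap * (T - t) * Re (G z)" using arg_cong[OF X, of Re] by (simp add: X_eq)
 also have "... = t / T * Re z + (kap * (T - t) * thr t) * Re z - kap * (T - t) * integral {a..b} (%y. y * h y)"
  unfolding G by (simp add: algebra_simps)
 finally have "x - 2 * (t / T) * Re z = - (kap * (T - t) * integral {a..b} (%y. y * h y))"
  unfolding thr_eq[OF t, symmetric] by simp
 then have "\<bar>x - 2 * (t / T) * Re z\<bar> = kap * (T - t) * \<bar>integral {a..b} (%y. y * h y)\<bar>" using kap_pos t by (simp add: abs_mult)
 also have "... <= kap * (T - t) * (A0 * thr t)" using kap_pos t by (intro mult_left_mono I) auto
 also have "... = A0 * (kap * (T - t) * thr t)" by simp
 also have "... = A0 * t / T" unfolding thr_eq[OF t, symmetric] by simp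
 finally show ?thesis .
qed

end

context planning_data
begin

interpretation refl: planning_data "%x. p (- x)" "- b" "- a" cl C T by (rule reflected)

text \<open>The level condition gives the modulus of the rescaled foot and the equation
  \<open>X = x\<close> gives its real part. The density is its imaginary part, so the profile is a
  half circle by Pythagoras.\<close>

lemma dil_limit_inside:
 assumes S: "!!n. S n \<in> {0<..<T}" "S ----> 0" and xz: "\<bar>xz\<bar> < R0"
 shows "(%n. dil (S n) xz) ----> phi 2 R0 xz"
proof -
 define zs where "zs n = zz (S n) (sqrt (S n) * xz)" for n
 have sq: "(%n. sqrt (S n)) ----> 0" using tendsto_real_sqrt[OF S(2)] by simp
 have "\<forall>\<^sub>F n in sequentially. sqrt (S n) * xz < edgeR (S n)" using edgeR_eventually[OF S] xz by auto
 moreover have "\<forall>\<^sub>F n in sequentially. sqrt (S n) * (- xz) < refl.edgeR (S n)"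
  by (rule refl.edgeR_eventually[OF S]) (use xz in \<open>auto simp: refl.R0_def R0_def\<close>)
 ultimately have ins: "\<forall>\<^sub>F n in sequentially. 0 < Im (zs n) \<and> Zin (S n) (sqrt (S n) * xz) (zs n)"
 proof eventually_elim
  case (elim n)
  have "edgeL (S n) < sqrt (S n) * xz" using elim(2) by (simp add: edgeL_def refl.edgeR_def)
  then show ?case unfolding zs_def by (rule_tac zz_cases[OF S(1)[of n], of "sqrt (S n) * xz"]) (use elim(1) in auto)
 qed
 have absl: "(%n. sqrt (S n) * cmod (zs n)) ----> sqrt kap * T"
 proof (rule Lim_transform2[OF q_limit[OF S(2)]])
  have l: "(%n. sqrt (S n) * A0) ----> 0" using tendsto_mult_left_zero[OF sq] .
  show "(%n. q (S n) - sqrt (S n) * cmod (zs n)) ----> 0"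
  proof (rule Lim_null_comparison[OF _ l])
   from ins show "\<forall>\<^sub>F n in sequentially. norm (q (S n) - sqrt (S n) * cmod (zs n)) <= sqrt (S n) * A0"
   proof eventually_elim
    case (elim n)
    have "\<bar>1 / sqrt (thr (S n)) - cmod (zs n)\<bar> <= A0" using Zin_norm_le[OF S(1)[of n]] elim by (fastforce simp: abs_le_iff)
    moreover have "q (S n) - sqrt (S n) * cmod (zs n) = sqrt (S n) * (1 / sqrt (thr (S n)) - cmod (zs n))"
     unfolding q_eq[OF S(1)[of n], symmetric] by (simp add: right_diff_distrib)
    ultimately show ?case using S(1)[of n] by (simp add: abs_mult mult_left_mono)
   qed
  qed
 qed
 have rel: "(%n. sqrt (S n) * Re (zs n)) ----> xz * T / 2"
 proof (rule Lim_transform2[OF tendsto_const])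
  have l: "(%n. sqrt (S n) * (A0 / 2)) ----> 0" using tendsto_mult_left_zero[OF sq] .
  show "(%n. xz * T / 2 - sqrt (S n) * Re (zs n)) ----> 0"
  proof (rule Lim_null_comparison[OF _ l])
   from ins show "\<forall>\<^sub>F n in sequentially. norm (xz * T / 2 - sqrt (S n) * Re (zs n)) <= sqrt (S n) * (A0 / 2)"
   proof eventually_elim
    case (elim n)
    define c where "c = sqrt (S n)"
    have c: "c > 0" "S n = c * c" using S(1)[of n] by (auto simp: c_def)
    have le: "\<bar>c * xz - 2 * (c * c / T) * Re (zs n)\<bar> <= A0 * (c * c) / T"
     using Zin_Re[OF S(1)[of n] conjunct2[OF elim]] unfolding c_def[symmetric] c(2)[symmetric] by (simp add: c(2))
    define D where "D = xz * T / 2 - c * Re (zs n)"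
    have e: "c * xz - 2 * (c * c / T) * Re (zs n) = (2 * c / T) * D" using T_pos by (simp add: D_def field_simps)
    have cT: "0 < 2 * c / T" using c(1) T_pos by simp
    have "(2 * c / T) * \<bar>D\<bar> <= A0 * (c * c) / T" using le cT unfolding e abs_mult by (simp only: abs_of_pos)
    also have "... = (2 * c / T) * (c * (A0 / 2))" by simp
    finally have "\<bar>D\<bar> <= c * (A0 / 2)" by (rule mult_left_le_imp_le[OF _ cT])
    then have "\<bar>xz * T / 2 - c * Re (zs n)\<bar> <= c * (A0 / 2)" by (simp only: D_def)
    then show ?case by (simp add: c_def)
   qed
  qed
 qed
 have "(%n. sqrt ((sqrt (S n) * cmod (zs n))^2 - (sqrt (S n) * Re (zs n))^2) / ((T - S n) * sqrt 2))
   ----> sqrt ((sqrt kap * T)^2 - (xz * T / 2)^2) / ((T - 0) * sqrt 2)"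
  by (intro tendsto_intros absl rel S(2)) (use T_pos in auto)
 moreover have "sqrt ((sqrt kap * T)^2 - (xz * T / 2)^2) / ((T - 0) * sqrt 2) = phi 2 R0 xz"
 proof -
  define y where "y = 1/8 * (R0^2 - xz^2)"
  have A: "(sqrt kap * T)^2 - (xz * T / 2)^2 = T^2 * 2 * y"
   using kap_pos by (simp add: y_def R0_def power_mult_distrib power_divide algebra_simps)
  have y0: "0 <= y" using xz abs_le_square_iff[of xz R0] by (simp add: y_def)
  have "sqrt ((sqrt kap * T)^2 - (xz * T / 2)^2) / ((T - 0) * sqrt 2) = sqrt y"
   unfolding A real_sqrt_mult using T_pos by simp
  moreover have "phi 2 R0 xz = sqrt y" unfolding phi_2 y_def[symmetric] using y0 by simp
  ultimately show ?thesis by simp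
 qed
 ultimately have lim: "(%n. sqrt ((sqrt (S n) * cmod (zs n))^2 - (sqrt (S n) * Re (zs n))^2) / ((T - S n) * sqrt 2)) ----> phi 2 R0 xz"
  by simp
 have ev: "\<forall>\<^sub>F n in sequentially. sqrt ((sqrt (S n) * cmod (zs n))^2 - (sqrt (S n) * Re (zs n))^2) / ((T - S n) * sqrt 2) = dil (S n) xz"
  using ins
 proof eventually_elim
  case (elim n)
  have "(sqrt (S n) * cmod (zs n))^2 - (sqrt (S n) * Re (zs n))^2 = (sqrt (S n) * Im (zs n))^2"
   by (simp add: power_mult_distrib cmod_power2 algebra_simps)
  moreover have "0 <= sqrt (S n) * Im (zs n)" using elim S(1)[of n] by simp
  ultimately have e: "sqrt ((sqrt (S n) * cmod (zs n))^2 - (sqrt (S n) * Re (zs n))^2) = sqrt (S n) * Im (zs n)" by simp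
  have "Im (zs n) = (T - S n) * Im (w (S n) (sqrt (S n) * xz))" unfolding zs_def by (rule Im_w[OF S(1), symmetric])
  then show ?case unfolding e using S(1)[of n] by (simp add: dil_def dens_def)
 qed
 show ?thesis by (rule Lim_transform_eventually[OF lim ev])
qed

lemma dil_limit:
 assumes S: "!!n. S n \<in> {0<..<T}" "S ----> 0" and xz: "\<bar>xz\<bar> \<noteq> R0"
 shows "(%n. dil (S n) xz) ----> phi 2 R0 xz"
proof (cases "\<bar>xz\<bar> < R0")
 case True
 then show ?thesis by (rule dil_limit_inside[OF S])
next
 case False
 then have x: "R0 < \<bar>xz\<bar>" using xz by simp
 have sq: "(%n. sqrt (S n)) ----> 0" using tendsto_real_sqrt[OF S(2)] by simp
 have "(%n. A0 * sqrt (S n) / T + 2 * sqrt kap) ----> A0 * 0 / T + 2 * sqrt kap" by (intro tendsto_intros sq) (use T_pos in auto)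
 then have "(%n. A0 * sqrt (S n) / T + 2 * sqrt kap) ----> R0" by (simp add: R0_def)
 then have "\<forall>\<^sub>F n in sequentially. A0 * sqrt (S n) / T + 2 * sqrt kap < \<bar>xz\<bar>" using x by (rule order_tendstoD)
 then have "\<forall>\<^sub>F n in sequentially. 0 = dil (S n) xz"
 proof eventually_elim
  case (elim n)
  define c where "c = sqrt (S n)"
  have c: "c > 0" "S n = c * c" using S(1)[of n] by (auto simp: c_def)
  have "rad (S n) = c * (A0 * c / T + 2 * sqrt kap)" unfolding rad_def using c by (simp add: real_sqrt_mult algebra_simps)
  also have "... < c * \<bar>xz\<bar>" using elim c(1) by (simp add: c_def)
  also have "... = \<bar>c * xz\<bar>" using c(1) by (simp add: abs_mult)
  finally have "dens (S n) (c * xz) = 0" by (rule dens_outside[OF S(1)])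
  then show ?case by (simp add: dil_def c_def)
 qed
 moreover have "phi 2 R0 xz = 0" by (rule phi_2_outside) (use x kap_pos in \<open>simp add: R0_def\<close>)
 ultimately show ?thesis using Lim_transform_eventually[OF tendsto_const[of 0]] by simp
qed

definition Rb :: real where "Rb = rad T / sqrt T"

lemma Rb_eq: "Rb = A0 * sqrt T / T + 2 * sqrt kap"
proof -
 have "1 / sqrt T = sqrt T / T" by (subst frac_eq_eq) (use T_pos in auto)
 then have "A0 * (1 / sqrt T) = A0 * (sqrt T / T)" by (rule arg_cong)
 then show ?thesis using T_pos by (simp add: Rb_def rad_def real_sqrt_mult add_divide_distrib)
qed

lemma dil_outside:
 assumes t: "t \<in> {0<..<T}" and x: "Rb < \<bar>xz\<bar>"
 shows "dil t xz = 0"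
proof -
 have "rad t = sqrt t * (A0 * sqrt t / T + 2 * sqrt kap)" using t by (simp add: rad_def real_sqrt_mult algebra_simps)
 also have "... <= sqrt t * (A0 * sqrt T / T + 2 * sqrt kap)"
  using t by (intro mult_left_mono add_right_mono divide_right_mono) (auto simp: A0_def)
 also have "A0 * sqrt T / T + 2 * sqrt kap = Rb" by (rule Rb_eq[symmetric])
 also have "sqrt t * Rb < sqrt t * \<bar>xz\<bar>" using x t by simp
 also have "... = \<bar>sqrt t * xz\<bar>" using t by (simp add: abs_mult)
 finally show ?thesis using dens_outside[OF t] by (simp add: dil_def)
qed

lemma R0_le_Rb: "R0 <= Rb"
proof -
 show ?thesis using T_pos by (simp add: Rb_eq R0_def A0_def)
qed

lemma dil_measurable: "t \<in> {0<..<T} ==> dil t \<in> borel_measurable borel"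
 unfolding dil_def[abs_def] using dens_measurable[of t]
 by (intro borel_measurable_times borel_measurable_const measurable_compose[where g="dens t" and f="%xz. sqrt t * xz"]) auto

lemma dil_distribution:
 assumes t: "t \<in> {0<..<T}"
 shows "real_distribution (ldens (dil t))" "has_bochner_integral lborel (dil t) 1"
proof -
 have t': "t \<in> {0<..T}" using t by auto
 have n: "0 <= dil t x" for x using dens_nonneg[OF t'] t by (simp add: dil_def)
 have "(\<integral>\<^sup>+x. ennreal (dens t x) \<partial>lborel) = ennreal \<bar>sqrt t\<bar> * (\<integral>\<^sup>+x. ennreal (dens t (0 + sqrt t * x)) \<partial>lborel)"
  using t dens_measurable[OF t'] by (intro nn_integral_real_affine) auto
 also have "... = (\<integral>\<^sup>+x. ennreal \<bar>sqrt t\<bar> * ennreal (dens t (0 + sqrt t * x)) \<partial>lborel)"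
  using dens_measurable[OF t'] by (intro nn_integral_cmult[symmetric]) (auto intro!: measurable_compose[where g="dens t" and f="%xz. sqrt t * xz"])
 also have "... = (\<integral>\<^sup>+x. ennreal (dil t x) \<partial>lborel)"
  using t dens_nonneg[OF t'] by (intro nn_integral_cong) (simp add: dil_def ennreal_mult')
 finally have m: "(\<integral>\<^sup>+x. ennreal (dil t x) \<partial>lborel) = 1" using dens_mass[OF t'] by simp
 then show "has_bochner_integral lborel (dil t) 1"
  using n dil_measurable[OF t] by (intro has_bochner_integral_nn_integral) auto
 have "emeasure (ldens (dil t)) UNIV = 1"
  using m dil_measurable[OF t] by (subst emeasure_density) auto
 then show "real_distribution (ldens (dil t))"
  by (intro real_distribution.intro prob_spaceI real_distribution_axioms.intro) auto
qed

lemma dil_integral_limit: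
 assumes S: "!!n. S n \<in> {0<..<T}" "S ----> 0" and f: "f \<in> borel_measurable borel" "!!x. \<bar>f x\<bar> <= 1"
 shows "(%n. LINT x|lborel. dil (S n) x * f x) ----> (LINT x|lborel. phi 2 R0 x * f x)"
  "integrable lborel (%x. phi 2 R0 x * f x)"
proof -
 obtain B where B: "B > 0" "!!t x. t \<in> {0<..T} ==> dens t x <= B / sqrt t" using dens_bound by blast
 have pm: "phi 2 R0 \<in> borel_measurable borel" by (intro borel_measurable_continuous_onI phi_2_continuous)
 have ms: "(%x. phi 2 R0 x * f x) \<in> borel_measurable lborel" "(%x. dil (S n) x * f x) \<in> borel_measurable lborel" for n
  using pm f(1) dil_measurable[OF S(1)[of n]] by auto
 have w: "integrable lborel (%x. B * indicator {- Rb..Rb} x)"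
  using borel_integrable_compact[of "{- Rb..Rb}" "%_. B"] by (simp add: mult.commute)
 have lim: "AE x in lborel. (%n. dil (S n) x * f x) ----> phi 2 R0 x * f x"
  using AE_lborel_singleton[of R0] AE_lborel_singleton[of "- R0"]
  by eventually_elim (intro tendsto_mult tendsto_const dil_limit[OF S], auto simp: abs_if split: if_splits)
 have bd: "AE x in lborel. norm (dil (S n) x * f x) <= B * indicator {- Rb..Rb} x" for n
 proof (rule AE_I2)
  fix x
  have t: "S n \<in> {0<..T}" using S(1)[of n] by auto
  show "norm (dil (S n) x * f x) <= B * indicator {- Rb..Rb} x"
  proof (cases "\<bar>x\<bar> <= Rb")
   case True
   have "sqrt (S n) * dens (S n) (sqrt (S n) * x) <= sqrt (S n) * (B / sqrt (S n))" using t by (intro mult_left_mono B(2)) auto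
   then have "dil (S n) x <= B" using t by (simp add: dil_def)
   moreover have "0 <= dil (S n) x" using dens_nonneg[OF t] t by (simp add: dil_def)
   ultimately have "\<bar>dil (S n) x\<bar> * \<bar>f x\<bar> <= B * 1" using f(2)[of x] by (intro mult_mono) auto
   then show ?thesis using True by (auto simp: abs_mult indicator_def)
  qed (use dil_outside[OF S(1)] B(1) in \<open>auto simp: indicator_def\<close>)
 qed
 show "(%n. LINT x|lborel. dil (S n) x * f x) ----> (LINT x|lborel. phi 2 R0 x * f x)"
  by (rule integral_dominated_convergence[OF ms w lim bd])
 show "integrable lborel (%x. phi 2 R0 x * f x)"
  by (rule integrable_dominated_convergence[OF ms w lim bd])
qed

lemma R0_pos: "R0 > 0" using kap_pos by (simp add: R0_def)

text \<open>The mass is obtained as the limit of the masses of the rescaled densities, each equal to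
  one, so the integral of the semicircle is never computed. Together with
  \<open>phi_2_has_bochner_unique\<close> it identifies the given radius with
  \<open>R0\<close>.\<close>

lemma phi_mass: "has_bochner_integral lborel (phi 2 R0) 1"
proof -
 define S where "S n = T / real (n + 2)" for n :: nat
 have S: "S n \<in> {0<..<T}" for n using T_pos by (auto simp: S_def field_simps intro!: add_pos_nonneg)
 have Sl: "S ----> 0" unfolding S_def by (rule LIMSEQ_ignore_initial_segment[OF lim_const_over_n])
 have "(%n. LINT x|lborel. dil (S n) x * 1) ----> (LINT x|lborel. phi 2 R0 x * 1)" and i: "integrable lborel (%x. phi 2 R0 x * 1)"
  using dil_integral_limit[OF S Sl, of "%_. 1"] by auto
 moreover have "(LINT x|lborel. dil (S n) x * 1) = 1" for n using dil_distribution(2)[OF S] by (simp add: has_bochner_integral_integral_eq)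
 ultimately have "(LINT x|lborel. phi 2 R0 x) = 1" by (simp add: LIMSEQ_const_iff)
 then show ?thesis using i by (simp add: has_bochner_integral_iff)
qed

lemma dens_self_similar: "self_similar_limit 2 R0 dens"
proof -
 have pm: "phi 2 R0 \<in> borel_measurable borel" by (intro borel_measurable_continuous_onI phi_2_continuous)
 have pn: "0 <= phi 2 R0 x" for x by (simp add: phi_2)
 have "emeasure (ldens (phi 2 R0)) UNIV = (\<integral>\<^sup>+x. ennreal (phi 2 R0 x) \<partial>lborel)"
  using pm by (subst emeasure_density) auto
 also have "... = 1" using phi_mass pn by (simp add: nn_integral_eq_integral has_bochner_integral_iff)
 finally have N: "real_distribution (ldens (phi 2 R0))"
  by (intro real_distribution.intro prob_spaceI real_distribution_axioms.intro) auto
 have "((%t. wasserstein1 (ldens (dil t)) (ldens (phi 2 R0))) ---> 0) (at_right 0)"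
 proof (rule tendsto_at_right_sequentially[OF T_pos])
  fix S :: "nat => real" assume S0: "!!n. 0 < S n" "!!n. S n < T" "S ----> 0"
  have S: "S n \<in> {0<..<T}" for n using S0 by auto
  show "(%n. wasserstein1 (ldens (dil (S n))) (ldens (phi 2 R0))) ----> 0"
  proof (rule wasserstein1_tendsto_0[OF dil_distribution(1)[OF S] N])
   show "weak_conv_m (%n. ldens (dil (S n))) (ldens (phi 2 R0))"
   proof (rule integral_bdd_continuous_conv_imp_weak_conv[OF dil_distribution(1)[OF S] N])
    fix f :: "real => real" assume f: "!!x. isCont f x" "!!x. \<bar>f x\<bar> <= 1"
    have fm: "f \<in> borel_measurable borel" using f(1) by (intro borel_measurable_continuous_onI continuous_at_imp_continuous_on) auto
    have e1: "integral\<^sup>L (ldens (dil (S n))) f = (LINT x|lborel. dil (S n) x * f x)" for n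
    proof -
     have "S n \<in> {0<..T}" using S[of n] by auto
     then have "0 <= dil (S n) x" for x using dens_nonneg[of "S n"] by (simp add: dil_def)
     then show ?thesis using fm dil_measurable[OF S[of n]] by (subst integral_real_density) auto
    qed
    have e2: "integral\<^sup>L (ldens (phi 2 R0)) f = (LINT x|lborel. phi 2 R0 x * f x)"
     using fm pm pn by (subst integral_real_density) auto
    show "(%n. integral\<^sup>L (ldens (dil (S n))) f) ----> integral\<^sup>L (ldens (phi 2 R0)) f"
     unfolding e1 e2 by (rule dil_integral_limit(1)[OF S S0(3) fm f(2)])
   qed
   show "AE x in ldens (dil (S n)). \<bar>x\<bar> <= Rb" for n
   proof -
    have "\<bar>x\<bar> <= Rb" if "0 < ennreal (dil (S n) x)" for x
     using dil_outside[OF S[of n], of x] that by (cases "\<bar>x\<bar> <= Rb") auto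
    then show ?thesis using dil_measurable[OF S[of n]] by (subst AE_density) auto
   qed
   show "AE x in ldens (phi 2 R0). \<bar>x\<bar> <= Rb"
   proof -
    have "\<bar>x\<bar> <= Rb" if "0 < ennreal (phi 2 R0 x)" for x
     using phi_2_outside[of R0 x] R0_le_Rb R0_pos that by (cases "\<bar>x\<bar> <= Rb") auto
    then show ?thesis using pm by (subst AE_density) auto
   qed
  qed
 qed
 moreover have "\<forall>\<^sub>F t in at_right 0. wasserstein1 (ldens (dil t)) (ldens (phi 2 R0))
   = wasserstein1 (density lborel (%x. ennreal (t powr alpha 2 * dens t (t powr alpha 2 * x)))) (ldens (phi 2 R0))"
  using eventually_at_right_real[OF T_pos]
  by eventually_elim (simp add: powr_alpha(1) dil_def[abs_def])
 ultimately show ?thesis unfolding self_similar_limit_def by (rule Lim_transform_eventually)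
qed

theorem uu_admissible:
 assumes "R > 0" "has_bochner_integral lborel (phi 2 R) 1"
 shows "admissible_solution 2 T R p uu mu dens"
proof -
 have "R = R0" using phi_2_has_bochner_unique[OF assms R0_pos phi_mass] .
 then show ?thesis unfolding admissible_solution_def
  using uu_planning_solution uu_growth uu_energy uu_ux_bound dens_m_bounds dens_self_similar by simp
qed

end

section \<open>Existence and uniqueness\<close>

lemma infdist_endpoints:
 fixes a b x :: real
 assumes "x \<in> {a..b}"
 shows "infdist x {a, b} = min (x - a) (b - x)"
proof -
 have "infdist x {a, b} = min (infdist x {a}) (infdist x {b})" using infdist_Un_min[of "{a}" "{b}" x] by (simp add: insert_commute)
 then show ?thesis using assms by (simp add: dist_real_def)
qed

lemma abs_diff_le_sqrt_of_square:
 fixes u v L :: real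
 assumes "0 <= u" "0 <= v" "\<bar>u^2 - v^2\<bar> <= L"
 shows "\<bar>u - v\<bar> <= sqrt L"
proof -
 have "\<bar>u - v\<bar> * \<bar>u - v\<bar> <= \<bar>u - v\<bar> * \<bar>u + v\<bar>" using assms(1,2) by (intro mult_left_mono) auto
 also have "... = \<bar>u^2 - v^2\<bar>" by (simp add: abs_mult[symmetric] power2_eq_square algebra_simps)
 finally have "\<bar>u - v\<bar>^2 <= L" using assms(3) by (simp add: power2_eq_square)
 then show ?thesis by (rule real_le_rsqrt)
qed

text \<open>Inside the interval \<open>|u - v|^2 <= |u^2 - v^2|\<close>. If one of the points is
  outside or an end point, the function vanishes there and the edge bound controls the other
  value.\<close>

lemma Holder_of_square_Lipschitz:
 fixes f :: "real => real"
 assumes ab: "a < b" and f0: "!!x. 0 <= f x" "!!x. x \<notin> {a..b} ==> f x = 0"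
  and up: "!!x. x \<in> {a..b} ==> f x <= K * sqrt (min (x - a) (b - x))"
  and L: "!!x y. x \<in> {a<..<b} ==> y \<in> {a<..<b} ==> \<bar>(f x)^2 - (f y)^2\<bar> <= L * \<bar>x - y\<bar>" and KL: "0 <= K" "0 <= L"
 shows "\<bar>f x - f y\<bar> <= (K + sqrt L) * sqrt \<bar>x - y\<bar>"
proof -
 have out: "f u <= K * sqrt \<bar>u - v\<bar> \<and> f v = 0" if v: "v \<notin> {a<..<b}" for u v
 proof -
  have "f v = 0"
  proof (cases "v \<in> {a..b}")
   case True
   then have "v = a \<or> v = b" using v by auto
   then have "f v <= 0" using up[OF True] ab by (auto simp: min_def)
   then show ?thesis using f0(1)[of v] by linarith
  qed (use f0 in blast)
  moreover have "f u <= K * sqrt \<bar>u - v\<bar>"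
  proof (cases "u \<in> {a..b}")
   case True
   have "min (u - a) (b - u) <= \<bar>u - v\<bar>" using v True by auto
   then have "K * sqrt (min (u - a) (b - u)) <= K * sqrt \<bar>u - v\<bar>" using KL by (intro mult_left_mono) auto
   then show ?thesis using up[OF True] by linarith
  qed (use f0 KL in auto)
  ultimately show ?thesis by blast
 qed
 have le: "K * sqrt \<bar>x - y\<bar> <= (K + sqrt L) * sqrt \<bar>x - y\<bar>" "sqrt L * sqrt \<bar>x - y\<bar> <= (K + sqrt L) * sqrt \<bar>x - y\<bar>"
  using KL by (auto intro!: mult_right_mono)
 consider "x \<in> {a<..<b}" "y \<in> {a<..<b}" | "y \<notin> {a<..<b}" | "x \<notin> {a<..<b}" by blast
 then show ?thesis
 proof cases
  case 1
  have "\<bar>f x - f y\<bar> <= sqrt (L * \<bar>x - y\<bar>)" by (rule abs_diff_le_sqrt_of_square[OF f0(1) f0(1) L[OF 1]])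
  then show ?thesis using le by (simp add: real_sqrt_mult)
 next
  case 2
  then show ?thesis using out[OF 2, of x] le f0(1)[of x] by auto
 next
  case 3
  then show ?thesis using out[OF 3, of y] le f0(1)[of y] by (auto simp: abs_minus_commute)
 qed
qed

lemma C1_holder_on_Lipschitz:
 assumes H: "C1_holder_on \<sigma> {a<..<b} f"
 shows "\<exists>L\<ge>0. \<forall>x\<in>{a<..<b}. \<forall>y\<in>{a<..<b}. \<bar>f x - f y\<bar> <= L * \<bar>x - y\<bar>"
proof -
 have "bounded (deriv f ` {a<..<b})" using H by (simp add: C1_holder_on_def)
 then obtain L where "\<forall>y\<in>deriv f ` {a<..<b}. norm y <= L" unfolding bounded_iff by blast
 then have L: "\<bar>deriv f x\<bar> <= L" if "x \<in> {a<..<b}" for x using that by simp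
 have d: "(f has_real_derivative deriv f x) (at x)" if "x \<in> {a<..<b}" for x
  using H that by (auto simp: C1_holder_on_def DERIV_deriv_iff_real_differentiable)
 have "\<bar>f x - f y\<bar> <= \<bar>L\<bar> * \<bar>x - y\<bar>" if "x \<in> {a<..<b}" "y \<in> {a<..<b}" for x y
  unfolding real_norm_def[symmetric]
 proof (rule field_differentiable_bound[where S="{a<..<b}" and f'="deriv f"])
  show "(f has_real_derivative deriv f z) (at z within {a<..<b})" if "z \<in> {a<..<b}" for z
   using d[OF that] by (rule has_field_derivative_at_within)
  show "norm (deriv f z) <= norm L" if "z \<in> {a<..<b}" for z using L[OF that] by simp
 qed (use that in auto)
 then show ?thesis by (intro exI[of _ "\<bar>L\<bar>"]) auto
qed

context planning_data
begin

theorem existence_and_uniqueness: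
 assumes R: "R > 0" "has_bochner_integral lborel (phi 2 R) 1"
 shows "\<exists>u \<mu> m. admissible_solution 2 T R p u \<mu> m \<and>
      (\<forall>u' \<mu>' m'. admissible_solution 2 T R p u' \<mu>' m' \<longrightarrow>
       (\<forall>t\<in>{0..T}. \<mu>' t = \<mu> t) \<and>
       (\<forall>t\<in>{0<..<T}. \<forall>x. m' t x = m t x \<and> (m t x > 0 \<longrightarrow> dx u' t x = dx u t x)))"
proof -
 have adm: "admissible_solution 2 T R p uu mu dens" by (rule uu_admissible[OF R])
 have "(\<forall>t\<in>{0..T}. \<mu>' t = mu t) \<and> (\<forall>t\<in>{0<..<T}. \<forall>x. m' t x = dens t x \<and> (dens t x > 0 \<longrightarrow> dx u' t x = dx uu t x))"
  if adm': "admissible_solution 2 T R p u' \<mu>' m'" for u' \<mu>' m'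
 proof -
 obtain K where K: "K > 0" "!!t x. t \<in> {0<..<T} ==> cmod (w t x) <= K / sqrt t" using w_bound by blast
 obtain B where B: "B > 0" "!!t x. t \<in> {0<..T} ==> dens t x <= B / sqrt t" using dens_bound by blast
 have mono: "k / sqrt t <= k / sqrt (T / 2)" if "t \<in> {T/2..<T}" "k > 0" for t k
  using that T_pos by (intro divide_left_mono mult_pos_pos) auto
 \<comment> \<open>From \<open>T / 2\<close> on, the bounds of order \<open>t^(-1/2)\<close> for the
   field and the density become one constant, valid up to \<open>T\<close>.\<close>
 interpret two_solutions T R p uu mu dens u' \<mu>' m' "T / 2" "max K B / sqrt (T / 2)" "rad T"
 proof unfold_locales
  show "T > 0" by (rule T_pos)
  show "0 < T / 2" "T / 2 < T" using T_pos by auto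
  fix t x assume t: "t \<in> {T / 2..<T}"
  then have t': "t \<in> {0<..<T}" "t \<in> {0<..T}" using T_pos by auto
  have "\<bar>dx uu t x\<bar> <= cmod (w t x)" using du(1)[OF t'(1)] abs_Re_le_cmod by simp
  also have "... <= K / sqrt t" by (rule K(2)[OF t'(1)])
  also have "... <= K / sqrt (T / 2)" by (rule mono[OF t K(1)])
  also have "... <= max K B / sqrt (T / 2)" using T_pos by (intro divide_right_mono) auto
  finally show "\<bar>dx uu t x\<bar> <= max K B / sqrt (T / 2)" .
  have "dens t x <= B / sqrt t" by (rule B(2)[OF t'(2)])
  also have "... <= B / sqrt (T / 2)" by (rule mono[OF t B(1)])
  also have "... <= max K B / sqrt (T / 2)" using T_pos by (intro divide_right_mono) auto
  finally show "dens t x <= max K B / sqrt (T / 2)" .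
  show "dens t x = 0" if "rad T < \<bar>x\<bar>" by (rule dens_support[OF t'(2) that])
 qed (use adm adm' in auto)
 show ?thesis by (rule solutions_agree)
 qed
 with adm show ?thesis by blast
qed

end

theorem theorem3p6:
  fixes T \<theta> R a b \<sigma> C\<^sub>0 :: real and mT :: "real \<Rightarrow> real"
  assumes "T > 0"
    and "\<theta> = 2"
    and "R > 0" and "has_bochner_integral lborel (phi \<theta> R) 1"
    and "a < b"
    and "\<And>x. 0 \<le> mT x" and "has_bochner_integral lborel mT 1"
    and "\<And>x. x \<notin> {a..b} \<Longrightarrow> mT x = 0"
    and "smooth_on {a<..<b} mT"
    and "\<sigma> > 0" and "C1_holder_on \<sigma> {a<..<b} (\<lambda>x. mT x powr \<theta>)"
    and "C\<^sub>0 > 1"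
    and "\<And>x. x \<in> {a..b} \<Longrightarrow>
           inverse C\<^sub>0 * infdist x {a, b} powr (1 / \<theta>) \<le> mT x \<and>
           mT x \<le> C\<^sub>0 * infdist x {a, b} powr (1 / \<theta>)"
  shows "\<exists>u \<mu> m. admissible_solution \<theta> T R mT u \<mu> m \<and>
           (\<forall>u' \<mu>' m'. admissible_solution \<theta> T R mT u' \<mu>' m' \<longrightarrow>
              (\<forall>t\<in>{0..T}. \<mu>' t = \<mu> t) \<and>
              (\<forall>t\<in>{0<..<T}. \<forall>x. m' t x = m t x \<and>
                 (m t x > 0 \<longrightarrow> dx u' t x = dx u t x)))"
proof -
 have two: "\<theta> = 2" by fact
 have sq: "mT x powr 2 = (mT x)^2" for x using assms(6)[of x] by (cases "mT x = 0") (auto simp: powr_numeral)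
 have dist: "infdist x {a, b} powr (1 / 2) = sqrt (min (x - a) (b - x))" if "x \<in> {a..b}" for x
  unfolding infdist_endpoints[OF that] using that by (intro powr_half_sqrt) auto
 have bounds: "inverse C\<^sub>0 * sqrt (min (x - a) (b - x)) <= mT x" "mT x <= C\<^sub>0 * sqrt (min (x - a) (b - x))" if "x \<in> {a..b}" for x
  using assms(13)[OF that] dist[OF that] unfolding two by auto
 obtain L where L: "L \<ge> 0" "\<forall>x\<in>{a<..<b}. \<forall>y\<in>{a<..<b}. \<bar>mT x powr 2 - mT y powr 2\<bar> <= L * \<bar>x - y\<bar>"
  using C1_holder_on_Lipschitz assms(11) unfolding two by blast
 have Holder: "\<bar>mT x - mT y\<bar> <= (C\<^sub>0 + sqrt L) * sqrt \<bar>x - y\<bar>" for x y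
  by (rule Holder_of_square_Lipschitz[OF assms(5,6,8) bounds(2)]) (use L assms(12) sq in auto)
 have mass: "integral {a..b} mT = 1"
 proof -
  have e: "(%x. indicator {a..b} x *\<^sub>R mT x) = mT" by (rule ext) (use assms(8) in \<open>auto simp: indicator_def\<close>)
  have "set_integrable lborel {a..b} mT" unfolding set_integrable_def e using assms(7) by (simp add: has_bochner_integral_iff)
  then have "(LINT x:{a..b}|lborel. mT x) = integral {a..b} mT" by (rule set_borel_integral_eq_integral(2))
  then show ?thesis unfolding set_lebesgue_integral_def e using assms(7) by (simp add: has_bochner_integral_iff)
 qed
 interpret planning_data mT a b "inverse C\<^sub>0" "C\<^sub>0 + sqrt L" T
  by unfold_locales (use assms(1,5,6,8,12) Holder bounds(1) mass in auto)
 show ?thesis unfolding two using existence_and_uniqueness assms(3,4) unfolding two by blast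
qed

end
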